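(* Let $A \to B \to C$ be flat homomorphisms of commutative rings, with $A$ noetherian. Given an ideal $\mathfrak{a} \subseteq A$, let $\mathfrak{b} := B\cdot\mathfrak{a} \subseteq B$ and $\mathfrak{c} := C\cdot\mathfrak{a} \subseteq C$ be the induced ideals, and let $\widehat{B}$ and $\widehat{C}$ be the corresponding completions of $B$ and $C$ (the $\mathfrak{b}$-adic completion of $B$ and the $\mathfrak{c}$-adic completion of $C$). Define the ideal $\widehat{\mathfrak{b}} := \widehat{B}\cdot\mathfrak{b} \subseteq \widehat{B}$. Then $\widehat{C}$ is $\widehat{\mathfrak{b}}$-adically flat over $\widehat{B}$.
   Context: All rings are commutative. $\widehat{B}=\lim_{\leftarrow k}B/\mathfrak{b}^{k+1}$ and $\widehat{C}=\lim_{\leftarrow k}C/\mathfrak{c}^{k+1}$, with the induced ring homomorphism $\widehat{B}\to\widehat{C}$. Adic flatness: for a commutative ring $R$ with an ideal $\mathfrak{r}$, an $R$-module $N$ is $\mathfrak{r}$-torsion if every element of $N$ is annihilated by some power $\mathfrak{r}^i$, $i\ge 1$; an $R$-module $P$ is $\mathfrak{r}$-adically flat if $\operatorname{Tor}^R_i(P,N)=0$ for every $\mathfrak{r}$-torsion $R$-module $N$ and every $i>0$. *)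

theory Defs
  imports "HOL-Algebra.Module" "HOL-Algebra.Ideal_Product" "HOL-Algebra.Ring_Divisibility"
begin

section \<open>Modules\<close>

text \<open>
  The record type of modules extends that of rings, so every module carries two irrelevant fields
  for a multiplication and its unit; the constructions below leave them undefined.
\<close>

definition linear_maps ::
    "('r, 'x) ring_scheme \<Rightarrow> ('r, 'm, 'y) module_scheme \<Rightarrow> ('r, 'n, 'z) module_scheme \<Rightarrow> ('m \<Rightarrow> 'n) set"
  where "linear_maps R M N =
    {h. h \<in> carrier M \<rightarrow> carrier N \<and>
        (\<forall>x\<in>carrier M. \<forall>y\<in>carrier M. h (x \<oplus>\<^bsub>M\<^esub> y) = h x \<oplus>\<^bsub>N\<^esub> h y) \<and>
        (\<forall>r\<in>carrier R. \<forall>x\<in>carrier M. h (r \<odot>\<^bsub>M\<^esub> x) = r \<odot>\<^bsub>N\<^esub> h x)}"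

definition submodule_span ::
    "('r, 'x) ring_scheme \<Rightarrow> ('r, 'm, 'y) module_scheme \<Rightarrow> 'm set \<Rightarrow> 'm set"
  where "submodule_span R M S = \<Inter>{H. submodule H R M \<and> S \<subseteq> H}"

definition quotient_module :: "('r, 'm, 'y) module_scheme \<Rightarrow> 'm set \<Rightarrow> ('r, 'm set) module"
  where "quotient_module M H =
    \<lparr>carrier = a_rcosets\<^bsub>M\<^esub> H, monoid.mult = undefined, one = undefined,
     zero = H, add = set_add M, smult = (\<lambda>r X. \<Union>x\<in>X. H +>\<^bsub>M\<^esub> (r \<odot>\<^bsub>M\<^esub> x))\<rparr>"

text \<open>The ring \<open>S\<close> as a module over \<open>R\<close> via a ring homomorphism \<open>f\<close> from \<open>R\<close> to \<open>S\<close>.\<close>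

definition algebra_module :: "('r \<Rightarrow> 's) \<Rightarrow> ('s, 'x) ring_scheme \<Rightarrow> ('r, 's) module"
  where "algebra_module f S =
    \<lparr>carrier = carrier S, monoid.mult = monoid.mult S, one = one S, zero = zero S, add = add S,
     smult = (\<lambda>r s. f r \<otimes>\<^bsub>S\<^esub> s)\<rparr>"


subsection \<open>Free modules\<close>

text \<open>The free module on a set \<open>X\<close> consists of the finitely supported functions from \<open>X\<close> to \<open>R\<close>,
  extended by zero outside \<open>X\<close>.\<close>

definition free_module :: "('r, 'x) ring_scheme \<Rightarrow> 'g set \<Rightarrow> ('r, 'g \<Rightarrow> 'r) module"
  where "free_module R X =
    \<lparr>carrier = {u. range u \<subseteq> carrier R \<and> finite {x. u x \<noteq> \<zero>\<^bsub>R\<^esub>} \<and> {x. u x \<noteq> \<zero>\<^bsub>R\<^esub>} \<subseteq> X},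
     monoid.mult = undefined, one = undefined,
     zero = (\<lambda>x. \<zero>\<^bsub>R\<^esub>), add = (\<lambda>u v x. u x \<oplus>\<^bsub>R\<^esub> v x), smult = (\<lambda>r u x. r \<otimes>\<^bsub>R\<^esub> u x)\<rparr>"

definition basis_vec :: "('r, 'x) ring_scheme \<Rightarrow> 'g \<Rightarrow> 'g \<Rightarrow> 'r"
  where "basis_vec R x = (\<lambda>y. if y = x then \<one>\<^bsub>R\<^esub> else \<zero>\<^bsub>R\<^esub>)"

text \<open>The linear map from a free module to \<open>M\<close> sending the basis vector of \<open>x\<close> to \<open>h x\<close>.\<close>

definition linear_ext ::
    "('r, 'x) ring_scheme \<Rightarrow> ('r, 'm, 'y) module_scheme \<Rightarrow> ('g \<Rightarrow> 'm) \<Rightarrow> ('g \<Rightarrow> 'r) \<Rightarrow> 'm"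
  where "linear_ext R M h u = (\<Oplus>\<^bsub>M\<^esub>x\<in>{x. u x \<noteq> \<zero>\<^bsub>R\<^esub>}. u x \<odot>\<^bsub>M\<^esub> h x)"


subsection \<open>Tensor products\<close>

definition tensor_relations ::
    "('r, 'x) ring_scheme \<Rightarrow> ('r, 'm, 'y) module_scheme \<Rightarrow> ('r, 'n, 'z) module_scheme
     \<Rightarrow> ('m \<times> 'n \<Rightarrow> 'r) set"
  where "tensor_relations R M N =
    (let F = free_module R (carrier M \<times> carrier N); \<delta> = basis_vec R in
     submodule_span R F
      ({\<delta> (x \<oplus>\<^bsub>M\<^esub> x', y) \<ominus>\<^bsub>F\<^esub> (\<delta> (x, y) \<oplus>\<^bsub>F\<^esub> \<delta> (x', y)) | x x' y.
          x \<in> carrier M \<and> x' \<in> carrier M \<and> y \<in> carrier N} \<union>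
       {\<delta> (x, y \<oplus>\<^bsub>N\<^esub> y') \<ominus>\<^bsub>F\<^esub> (\<delta> (x, y) \<oplus>\<^bsub>F\<^esub> \<delta> (x, y')) | x y y'.
          x \<in> carrier M \<and> y \<in> carrier N \<and> y' \<in> carrier N} \<union>
       {\<delta> (r \<odot>\<^bsub>M\<^esub> x, y) \<ominus>\<^bsub>F\<^esub> (r \<odot>\<^bsub>F\<^esub> \<delta> (x, y)) | r x y.
          r \<in> carrier R \<and> x \<in> carrier M \<and> y \<in> carrier N} \<union>
       {\<delta> (x, r \<odot>\<^bsub>N\<^esub> y) \<ominus>\<^bsub>F\<^esub> (r \<odot>\<^bsub>F\<^esub> \<delta> (x, y)) | r x y.
          r \<in> carrier R \<and> x \<in> carrier M \<and> y \<in> carrier N}))"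

definition tensor_product ::
    "('r, 'x) ring_scheme \<Rightarrow> ('r, 'm, 'y) module_scheme \<Rightarrow> ('r, 'n, 'z) module_scheme
     \<Rightarrow> ('r, ('m \<times> 'n \<Rightarrow> 'r) set) module"
  where "tensor_product R M N =
    quotient_module (free_module R (carrier M \<times> carrier N)) (tensor_relations R M N)"

text \<open>
  The map induced by \<open>h\<close> and \<open>k\<close> with values in the tensor product of \<open>M'\<close> and \<open>N'\<close>. The
  elements of the source are cosets; the image of such a coset under the pushforward of formal
  combinations of pairs is contained in a unique coset, recovered by adding the relations.
\<close>

definition tensor_map ::
    "('r, 'x) ring_scheme \<Rightarrow> ('r, 'm1, 'y) module_scheme \<Rightarrow> ('r, 'n1, 'z) module_scheme
     \<Rightarrow> ('m \<Rightarrow> 'm1) \<Rightarrow> ('n \<Rightarrow> 'n1) \<Rightarrow> ('m \<times> 'n \<Rightarrow> 'r) set \<Rightarrow> ('m1 \<times> 'n1 \<Rightarrow> 'r) set"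
  where "tensor_map R M' N' h k X =
    (let F = free_module R (carrier M' \<times> carrier N') in
     tensor_relations R M' N' <+>\<^bsub>F\<^esub>
       linear_ext R F (\<lambda>(x, y). basis_vec R (h x, k y)) ` X)"


section \<open>Flatness\<close>

text \<open>
  The module \<open>P\<close> is flat if tensoring with it is exact. The test modules range over all modules
  whose elements have the type \<open>'r\<close> of elements of \<open>R\<close>. This is no restriction: it includes
  the sequences given by the inclusion of an ideal in \<open>R\<close>, and these already
  imply exactness for modules over arbitrary types.
\<close>

definition flat_module :: "('r, 'x) ring_scheme \<Rightarrow> ('r, 'p, 'y) module_scheme \<Rightarrow> bool"
  where "flat_module R P \<longleftrightarrow> module R P \<and>
    (\<forall>(L::('r, 'r) module) (M::('r, 'r) module) (N::('r, 'r) module). \<forall>h k.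
       module R L \<and> module R M \<and> module R N \<and> h \<in> linear_maps R L M \<and> k \<in> linear_maps R M N \<and>
       h ` carrier L = a_kernel M N k \<longrightarrow>
       tensor_map R P M (\<lambda>p. p) h ` carrier (tensor_product R P L) =
         a_kernel (tensor_product R P M) (tensor_product R P N) (tensor_map R P N (\<lambda>p. p) k))"

definition flat_hom :: "('r, 'x) ring_scheme \<Rightarrow> ('s, 'y) ring_scheme \<Rightarrow> ('r \<Rightarrow> 's) \<Rightarrow> bool"
  where "flat_hom R S f \<longleftrightarrow> ring_hom_cring R S f \<and> flat_module R (algebra_module f S)"


section \<open>Tor\<close>

text \<open>
  Tor is computed from a canonical free resolution of the first argument \<open>P\<close>. The free module in
  degree 0 has one generator \<open>Elem p\<close> for each element \<open>p\<close> of \<open>P\<close>. The free module in degree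
  \<open>n + 1\<close> has one generator \<open>Rel l\<close> for each list \<open>l\<close> of pairs (coefficient, generator of degree
  \<open>n\<close>) whose sum is a cycle, and this generator is mapped to that sum. The map from degree 0 to
  \<open>P\<close> is thus surjective, and every cycle is a boundary. The recursive datatype keeps the
  generators of all degrees in a single type.
\<close>

datatype ('r, 'p) res_gen =
    Elem (elem_of: 'p)
  | Rel (terms_of: "('r \<times> ('r, 'p) res_gen) list")

definition formal_sum :: "('r, 'x) ring_scheme \<Rightarrow> ('r \<times> 'g) list \<Rightarrow> 'g \<Rightarrow> 'r"
  where "formal_sum R l = (\<lambda>x. foldr (\<lambda>(r, y) s. if y = x then r \<oplus>\<^bsub>R\<^esub> s else s) l \<zero>\<^bsub>R\<^esub>)"

fun res_gens ::
    "('r, 'x) ring_scheme \<Rightarrow> ('r, 'p, 'y) module_scheme \<Rightarrow> nat \<Rightarrow> ('r, 'p) res_gen set"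
  where
    "res_gens R P 0 = Elem ` carrier P"
  | "res_gens R P (Suc 0) =
      {Rel l | l. set l \<subseteq> carrier R \<times> res_gens R P 0 \<and>
         linear_ext R P elem_of (formal_sum R l) = \<zero>\<^bsub>P\<^esub>}"
  | "res_gens R P (Suc (Suc n)) =
      (let F = free_module R (res_gens R P n) in
       {Rel l | l. set l \<subseteq> carrier R \<times> res_gens R P (Suc n) \<and>
          linear_ext R F (\<lambda>g. formal_sum R (terms_of g)) (formal_sum R l) = \<zero>\<^bsub>F\<^esub>})"

definition res_module ::
    "('r, 'x) ring_scheme \<Rightarrow> ('r, 'p, 'y) module_scheme \<Rightarrow> nat
     \<Rightarrow> ('r, ('r, 'p) res_gen \<Rightarrow> 'r) module"
  where "res_module R P n = free_module R (res_gens R P n)"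

definition res_aug ::
    "('r, 'x) ring_scheme \<Rightarrow> ('r, 'p, 'y) module_scheme \<Rightarrow> (('r, 'p) res_gen \<Rightarrow> 'r) \<Rightarrow> 'p"
  where "res_aug R P = linear_ext R P elem_of"

text \<open>The differential from degree \<open>n + 1\<close> to degree \<open>n\<close>.\<close>

definition res_diff ::
    "('r, 'x) ring_scheme \<Rightarrow> ('r, 'p, 'y) module_scheme \<Rightarrow> nat
     \<Rightarrow> (('r, 'p) res_gen \<Rightarrow> 'r) \<Rightarrow> ('r, 'p) res_gen \<Rightarrow> 'r"
  where "res_diff R P n = linear_ext R (res_module R P n) (\<lambda>g. formal_sum R (terms_of g))"

definition tor_module ::
    "('r, 'x) ring_scheme \<Rightarrow> ('r, 'p, 'y) module_scheme \<Rightarrow> ('r, 'n, 'z) module_scheme \<Rightarrow> nat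
     \<Rightarrow> ('r, ((('r, 'p) res_gen \<Rightarrow> 'r) \<times> 'n \<Rightarrow> 'r) set) module"
  where "tor_module R P N n = tensor_product R (res_module R P n) N"

definition tor_diff ::
    "('r, 'x) ring_scheme \<Rightarrow> ('r, 'p, 'y) module_scheme \<Rightarrow> ('r, 'n, 'z) module_scheme \<Rightarrow> nat
     \<Rightarrow> ((('r, 'p) res_gen \<Rightarrow> 'r) \<times> 'n \<Rightarrow> 'r) set \<Rightarrow> ((('r, 'p) res_gen \<Rightarrow> 'r) \<times> 'n \<Rightarrow> 'r) set"
  where "tor_diff R P N n = tensor_map R (res_module R P n) N (res_diff R P n) (\<lambda>y. y)"

fun tor_cycles ::
    "('r, 'x) ring_scheme \<Rightarrow> ('r, 'p, 'y) module_scheme \<Rightarrow> ('r, 'n, 'z) module_scheme \<Rightarrow> nat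
     \<Rightarrow> ((('r, 'p) res_gen \<Rightarrow> 'r) \<times> 'n \<Rightarrow> 'r) set set"
  where
    "tor_cycles R P N 0 = carrier (tor_module R P N 0)"
  | "tor_cycles R P N (Suc n) =
      a_kernel (tor_module R P N (Suc n)) (tor_module R P N n) (tor_diff R P N n)"

definition Tor ::
    "('r, 'x) ring_scheme \<Rightarrow> nat \<Rightarrow> ('r, 'p, 'y) module_scheme \<Rightarrow> ('r, 'n, 'z) module_scheme
     \<Rightarrow> ('r, ((('r, 'p) res_gen \<Rightarrow> 'r) \<times> 'n \<Rightarrow> 'r) set set) module"
  where "Tor R n P N =
    quotient_module (tor_module R P N n\<lparr>carrier := tor_cycles R P N n\<rparr>)
      (tor_diff R P N n ` carrier (tor_module R P N (Suc n)))"


section \<open>Adic flatness\<close>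

definition torsion_module ::
    "('r, 'x) ring_scheme \<Rightarrow> 'r set \<Rightarrow> ('r, 'n, 'z) module_scheme \<Rightarrow> bool"
  where "torsion_module R I N \<longleftrightarrow> module R N \<and>
    (\<forall>y\<in>carrier N. \<exists>i::nat. i \<ge> 1 \<and> (\<forall>r \<in> I [^]\<^bsub>ideals_set R\<^esub> i. r \<odot>\<^bsub>N\<^esub> y = \<zero>\<^bsub>N\<^esub>))"

text \<open>
  HOL cannot quantify over types inside a definition, so the element type \<open>'n\<close> of the torsion
  modules is a parameter; adic flatness in the usual sense is the statement for every \<open>'n\<close>.
\<close>

definition adically_flat ::
    "'n itself \<Rightarrow> ('r, 'x) ring_scheme \<Rightarrow> 'r set \<Rightarrow> ('r, 'p, 'y) module_scheme \<Rightarrow> bool"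
  where "adically_flat (_::'n itself) R I P \<longleftrightarrow> module R P \<and>
    (\<forall>N::('r, 'n) module. torsion_module R I N \<longrightarrow>
       (\<forall>i>0. carrier (Tor R i P N) = {\<zero>\<^bsub>Tor R i P N\<^esub>}))"


section \<open>Completion\<close>

text \<open>
  The inverse limit of the rings \<open>R / I^(k+1)\<close>. The transition map from \<open>R / I^(k+2)\<close> to
  \<open>R / I^(k+1)\<close> enlarges a coset by adding \<open>I^(k+1)\<close> to it.
\<close>

definition adic_completion :: "('r, 'x) ring_scheme \<Rightarrow> 'r set \<Rightarrow> (nat \<Rightarrow> 'r set) ring"
  where "adic_completion R I =
    (let J = (\<lambda>k. I [^]\<^bsub>ideals_set R\<^esub> Suc k); Q = (\<lambda>k. R Quot J k) in
     \<lparr>carrier = {x. (\<forall>k. x k \<in> carrier (Q k)) \<and> (\<forall>k. J k <+>\<^bsub>R\<^esub> x (Suc k) = x k)},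
      monoid.mult = (\<lambda>x y k. x k \<otimes>\<^bsub>Q k\<^esub> y k), one = (\<lambda>k. \<one>\<^bsub>Q k\<^esub>),
      zero = (\<lambda>k. \<zero>\<^bsub>Q k\<^esub>), add = (\<lambda>x y k. x k \<oplus>\<^bsub>Q k\<^esub> y k)\<rparr>)"

definition to_completion :: "('r, 'x) ring_scheme \<Rightarrow> 'r set \<Rightarrow> 'r \<Rightarrow> nat \<Rightarrow> 'r set"
  where "to_completion R I r = (\<lambda>k. (I [^]\<^bsub>ideals_set R\<^esub> Suc k) +>\<^bsub>R\<^esub> r)"

text \<open>The map from a completion to the \<open>J\<close>-adic completion of \<open>S\<close> induced by \<open>h\<close>: in degree \<open>k\<close>
  the coset \<open>x k\<close> is sent to the coset modulo \<open>J^(k+1)\<close> containing its image.\<close>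

definition completion_map ::
    "('s, 'y) ring_scheme \<Rightarrow> 's set \<Rightarrow> ('r \<Rightarrow> 's) \<Rightarrow> (nat \<Rightarrow> 'r set) \<Rightarrow> nat \<Rightarrow> 's set"
  where "completion_map S J h x = (\<lambda>k. (J [^]\<^bsub>ideals_set S\<^esub> Suc k) <+>\<^bsub>S\<^esub> h ` x k)"

end

theory Submission
  imports Defs
begin

text \<open>
  Write \<open>B'\<close>, \<open>C'\<close> for the completions, and let \<open>N\<close> be killed by the \<open>k\<close>-th power of \<open>\<aa>\<close>. Then
  \<open>Tor\<close> of \<open>C'\<close> and \<open>N\<close> over \<open>B'\<close> vanishes for two reasons. Both \<open>B'\<close> and \<open>C'\<close> are flat over the
  noetherian ring \<open>A\<close>, so that the derived tensor product of \<open>C'\<close> with \<open>B'/\<aa>\<^sup>kB'\<close> over \<open>B'\<close> equals that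
  of \<open>C'\<close> with \<open>A/\<aa>\<^sup>k\<close> over \<open>A\<close>, and this is the module \<open>C'/\<aa>\<^sup>kC'\<close> without higher homology. And
  \<open>C'/\<aa>\<^sup>kC' = C/\<aa>\<^sup>kC\<close> is flat over \<open>B'/\<aa>\<^sup>kB' = B/\<aa>\<^sup>kB\<close>, since \<open>C\<close> is flat over \<open>B\<close>. A general torsion module
  reduces to this case because a cycle in the tensor product of a free module with \<open>N\<close> involves only
  finitely many elements of \<open>N\<close>, and some power of \<open>\<aa>\<close> kills all of them.

  Flatness is used throughout in the form of the equational criterion: every linear relation between
  elements of the module is a consequence of linear relations in the ring (\<open>relation_flat\<close>, with
  theorem \<open>relation_flat_of_flat\<close> for the passage from exactness of the tensor product). One definition
  covers both kinds of flatness above: relations with coefficients in the image of \<open>A\<close>, and relations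
  with arbitrary coefficients that hold modulo a power of \<open>\<aa>\<close>. With this criterion the
  two reasons become statements about the canonical free resolution of \<open>C'\<close>. All its syzygies inherit
  both kinds of flatness (\<open>kernel_relation_flat\<close>, \<open>kernel_inter_scaled\<close>), and therefore
  the formal basis vectors in a cycle with coefficients killed by a power of \<open>\<aa>\<close> can be replaced by
  honest cycles of the resolution, which are boundaries (\<open>lift_cycle\<close>, \<open>Tor_vanishes\<close>).

  The noetherian hypothesis enters through a weak form of the Artin-Rees lemma
  (\<open>weak_artin_rees\<close>), which extends to matrices acting on a flat module (\<open>weak_artin_rees_matrix\<close>).
  It makes linear systems over \<open>A\<close> that are solvable modulo every power of \<open>\<aa>\<close> solvable in the
  completion (\<open>lift_to_completion\<close>). This yields both the flatness of the completions over
  \<open>A\<close> (\<open>completion_relation_flat\<close>) and the description of \<open>\<aa>\<^sup>kB'\<close> as the kernel of the projection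
  to \<open>B/\<aa>\<^sup>kB\<close> (\<open>cls_in_scaled_iff\<close>), on which the second kind of flatness rests
  (\<open>P_flat_mod_power\<close>).
\<close>

section \<open>Linear combinations, linear maps and quotients\<close>

definition lincomb ::
    "('r, 'm, 'y) module_scheme \<Rightarrow> 'i set \<Rightarrow> ('i \<Rightarrow> 'r) \<Rightarrow> ('i \<Rightarrow> 'm) \<Rightarrow> 'm"
  where "lincomb M I a m = (\<Oplus>\<^bsub>M\<^esub>i\<in>I. a i \<odot>\<^bsub>M\<^esub> m i)"

text \<open>
  The ring as a module over itself turns sums of products in the ring into linear combinations
  too.
\<close>

definition self_module :: "('r, 'x) ring_scheme \<Rightarrow> ('r, 'r) module"
  where "self_module R = algebra_module (\<lambda>r. r) R"

lemma algebra_module_simps [simp]: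
  "carrier (algebra_module f S) = carrier S" "zero (algebra_module f S) = zero S"
  "add (algebra_module f S) = add S" "smult (algebra_module f S) = (\<lambda>r s. f r \<otimes>\<^bsub>S\<^esub> s)"
  by (simp_all add: algebra_module_def)

lemma algebra_module_derived [simp]:
  "a_inv (algebra_module f S) = a_inv S" "a_minus (algebra_module f S) = a_minus S"
  "finsum (algebra_module f S) = finsum S"
  by (auto simp: a_inv_def a_minus_def finsum_def fun_eq_iff m_inv_def finprod_def)

lemma self_module_simps [simp]:
  "carrier (self_module R) = carrier R" "zero (self_module R) = zero R"
  "add (self_module R) = add R" "smult (self_module R) = monoid.mult R"
  "a_inv (self_module R) = a_inv R" "a_minus (self_module R) = a_minus R"
  "finsum (self_module R) = finsum R"
  by (simp_all add: self_module_def)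

lemma algebra_module_module:
  assumes "ring_hom_cring R S f"
  shows "module R (algebra_module f S)"
proof -
  interpret ring_hom_cring R S f by fact
  show ?thesis
  proof (rule moduleI)
    show "abelian_group (algebra_module f S)"
      by (rule abelian_groupI) (auto simp: S.a_assoc intro: S.a_comm S.l_neg S.a_inv_closed)
  qed (auto simp: R.is_cring S.l_distr S.r_distr S.m_assoc)
qed

lemma self_module_module: "cring R \<Longrightarrow> module R (self_module R)"
  unfolding self_module_def
  by (rule algebra_module_module) (auto simp: ring_hom_cring_def ring_hom_cring_axioms_def ring_hom_def)

lemma submoduleD:
  assumes "module R M" "submodule H R M"
  shows "H \<subseteq> carrier M" "\<zero>\<^bsub>M\<^esub> \<in> H" "\<And>x. x \<in> H \<Longrightarrow> x \<in> carrier M" "\<And>x. x \<in> H \<Longrightarrow> \<ominus>\<^bsub>M\<^esub> x \<in> H"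
    "\<And>x y. x \<in> H \<Longrightarrow> y \<in> H \<Longrightarrow> x \<oplus>\<^bsub>M\<^esub> y \<in> H" "\<And>x y. x \<in> H \<Longrightarrow> y \<in> H \<Longrightarrow> x \<ominus>\<^bsub>M\<^esub> y \<in> H"
    "\<And>r x. r \<in> carrier R \<Longrightarrow> x \<in> H \<Longrightarrow> r \<odot>\<^bsub>M\<^esub> x \<in> H"
proof -
  interpret module R M by fact
  note E = submoduleE[OF assms(2)]
  show "H \<subseteq> carrier M" "\<And>x. x \<in> H \<Longrightarrow> x \<in> carrier M" "\<And>x. x \<in> H \<Longrightarrow> \<ominus>\<^bsub>M\<^esub> x \<in> H"
    "\<And>x y. x \<in> H \<Longrightarrow> y \<in> H \<Longrightarrow> x \<oplus>\<^bsub>M\<^esub> y \<in> H" "\<And>x y. x \<in> H \<Longrightarrow> y \<in> H \<Longrightarrow> x \<ominus>\<^bsub>M\<^esub> y \<in> H"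
    "\<And>r x. r \<in> carrier R \<Longrightarrow> x \<in> H \<Longrightarrow> r \<odot>\<^bsub>M\<^esub> x \<in> H"
    using E by (auto simp: a_minus_def)
  show "\<zero>\<^bsub>M\<^esub> \<in> H"
    using assms(2) by (auto simp: submodule_def dest: subgroup.one_closed)
qed

context module
begin

lemma lincomb_closed [simp, intro]:
  "a \<in> I \<rightarrow> carrier R \<Longrightarrow> m \<in> I \<rightarrow> carrier M \<Longrightarrow> lincomb M I a m \<in> carrier M"
  unfolding lincomb_def by (auto intro!: M.finsum_closed)

lemma lincomb_empty [simp]: "lincomb M {} a m = \<zero>\<^bsub>M\<^esub>"
  by (simp add: lincomb_def)

lemma lincomb_insert:
  "finite I \<Longrightarrow> i \<notin> I \<Longrightarrow> a \<in> insert i I \<rightarrow> carrier R \<Longrightarrow> m \<in> insert i I \<rightarrow> carrier M \<Longrightarrow>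
   lincomb M (insert i I) a m = a i \<odot>\<^bsub>M\<^esub> m i \<oplus>\<^bsub>M\<^esub> lincomb M I a m"
  unfolding lincomb_def by (subst M.finsum_insert) auto

lemma lincomb_cong:
  "I = I' \<Longrightarrow> (\<And>i. i \<in> I' \<Longrightarrow> a i = a' i) \<Longrightarrow> (\<And>i. i \<in> I' \<Longrightarrow> m i = m' i) \<Longrightarrow>
   a' \<in> I' \<rightarrow> carrier R \<Longrightarrow> m' \<in> I' \<rightarrow> carrier M \<Longrightarrow> lincomb M I a m = lincomb M I' a' m'"
  unfolding lincomb_def by (rule M.finsum_cong') auto

lemma lincomb_in_submodule:
  assumes "submodule H R M" "a \<in> I \<rightarrow> carrier R" "m \<in> I \<rightarrow> H"
  shows "lincomb M I a m \<in> H"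
  using assms(2,3)
proof (induction I rule: infinite_finite_induct)
  case (infinite A)
  then show ?case using submoduleD[OF module_axioms assms(1)] by (simp add: lincomb_def)
next
  case empty
  then show ?case using submoduleD[OF module_axioms assms(1)] by simp
next
  case (insert i I)
  have "lincomb M (insert i I) a m = a i \<odot>\<^bsub>M\<^esub> m i \<oplus>\<^bsub>M\<^esub> lincomb M I a m"
    using insert submoduleD(3)[OF module_axioms assms(1)] by (intro lincomb_insert) auto
  then show ?case using insert submoduleD[OF module_axioms assms(1)] by auto
qed

lemma lincomb_add_right:
  "a \<in> I \<rightarrow> carrier R \<Longrightarrow> m \<in> I \<rightarrow> carrier M \<Longrightarrow> m' \<in> I \<rightarrow> carrier M \<Longrightarrow>
   lincomb M I a (\<lambda>i. m i \<oplus>\<^bsub>M\<^esub> m' i) = lincomb M I a m \<oplus>\<^bsub>M\<^esub> lincomb M I a m'"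
proof -
  assume "a \<in> I \<rightarrow> carrier R" "m \<in> I \<rightarrow> carrier M" "m' \<in> I \<rightarrow> carrier M"
  moreover from this have "lincomb M I a (\<lambda>i. m i \<oplus>\<^bsub>M\<^esub> m' i) =
      (\<Oplus>\<^bsub>M\<^esub>i\<in>I. a i \<odot>\<^bsub>M\<^esub> m i \<oplus>\<^bsub>M\<^esub> a i \<odot>\<^bsub>M\<^esub> m' i)"
    unfolding lincomb_def by (intro M.finsum_cong') (auto simp: smult_r_distr Pi_iff)
  ultimately show ?thesis
    unfolding lincomb_def by (simp add: M.finsum_addf Pi_iff)
qed

lemma lincomb_add_left:
  "a \<in> I \<rightarrow> carrier R \<Longrightarrow> a' \<in> I \<rightarrow> carrier R \<Longrightarrow> m \<in> I \<rightarrow> carrier M \<Longrightarrow>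
   lincomb M I (\<lambda>i. a i \<oplus> a' i) m = lincomb M I a m \<oplus>\<^bsub>M\<^esub> lincomb M I a' m"
proof -
  assume "a \<in> I \<rightarrow> carrier R" "a' \<in> I \<rightarrow> carrier R" "m \<in> I \<rightarrow> carrier M"
  moreover from this have "lincomb M I (\<lambda>i. a i \<oplus> a' i) m =
      (\<Oplus>\<^bsub>M\<^esub>i\<in>I. a i \<odot>\<^bsub>M\<^esub> m i \<oplus>\<^bsub>M\<^esub> a' i \<odot>\<^bsub>M\<^esub> m i)"
    unfolding lincomb_def by (intro M.finsum_cong') (auto simp: smult_l_distr Pi_iff)
  ultimately show ?thesis
    unfolding lincomb_def by (simp add: M.finsum_addf Pi_iff)
qed

lemma lincomb_zero_right: "a \<in> I \<rightarrow> carrier R \<Longrightarrow> lincomb M I a (\<lambda>i. \<zero>\<^bsub>M\<^esub>) = \<zero>\<^bsub>M\<^esub>"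
  unfolding lincomb_def by (rule M.add.finprod_one_eqI) (auto simp: Pi_iff)

lemma lincomb_minus_right:
  assumes "a \<in> I \<rightarrow> carrier R" "m \<in> I \<rightarrow> carrier M" "m' \<in> I \<rightarrow> carrier M"
  shows "lincomb M I a (\<lambda>i. m i \<ominus>\<^bsub>M\<^esub> m' i) = lincomb M I a m \<ominus>\<^bsub>M\<^esub> lincomb M I a m'"
proof -
  have "lincomb M I a (\<lambda>i. m i \<ominus>\<^bsub>M\<^esub> m' i) \<oplus>\<^bsub>M\<^esub> lincomb M I a m' = lincomb M I a m"
    using assms
    by (subst lincomb_add_right[symmetric])
      (auto intro!: lincomb_cong simp: a_minus_def M.a_assoc M.l_neg Pi_iff)
  moreover have "lincomb M I a (\<lambda>i. m i \<ominus>\<^bsub>M\<^esub> m' i) \<in> carrier M" "lincomb M I a m' \<in> carrier M"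
    using assms by (auto simp: Pi_iff)
  moreover have "x = (x \<oplus>\<^bsub>M\<^esub> y) \<ominus>\<^bsub>M\<^esub> y" if "x \<in> carrier M" "y \<in> carrier M" for x y
    using that by (simp add: a_minus_def M.a_assoc M.r_neg)
  ultimately show ?thesis by metis
qed

lemma smult_lincomb:
  assumes "r \<in> carrier R" "a \<in> I \<rightarrow> carrier R" "m \<in> I \<rightarrow> carrier M"
  shows "r \<odot>\<^bsub>M\<^esub> lincomb M I a m = lincomb M I (\<lambda>i. r \<otimes> a i) m"
    and "r \<odot>\<^bsub>M\<^esub> lincomb M I a m = lincomb M I a (\<lambda>i. r \<odot>\<^bsub>M\<^esub> m i)"
proof -
  have *: "finite I \<Longrightarrow> r \<odot>\<^bsub>M\<^esub> lincomb M I a m = (\<Oplus>\<^bsub>M\<^esub>i\<in>I. r \<odot>\<^bsub>M\<^esub> (a i \<odot>\<^bsub>M\<^esub> m i))"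
    unfolding lincomb_def using assms by (intro finsum_smult_ldistr) auto
  show "r \<odot>\<^bsub>M\<^esub> lincomb M I a m = lincomb M I (\<lambda>i. r \<otimes> a i) m"
  proof (cases "finite I")
    case True
    show ?thesis unfolding *[OF True] unfolding lincomb_def
      by (rule M.finsum_cong') (use assms in \<open>auto simp: smult_assoc1 Pi_iff\<close>)
  qed (use assms in \<open>auto simp: lincomb_def\<close>)
  show "r \<odot>\<^bsub>M\<^esub> lincomb M I a m = lincomb M I a (\<lambda>i. r \<odot>\<^bsub>M\<^esub> m i)"
  proof (cases "finite I")
    case True
    have "r \<odot>\<^bsub>M\<^esub> (a i \<odot>\<^bsub>M\<^esub> m i) = a i \<odot>\<^bsub>M\<^esub> (r \<odot>\<^bsub>M\<^esub> m i)" if "i \<in> I" for i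
    proof -
      have "a i \<in> carrier R" "m i \<in> carrier M" using assms that by auto
      then show ?thesis
        using assms(1) by (simp add: smult_assoc1[symmetric] R.m_comm)
    qed
    then show ?thesis unfolding *[OF True] unfolding lincomb_def
      by (intro M.finsum_cong') (use assms in \<open>auto simp: Pi_iff\<close>)
  qed (use assms in \<open>auto simp: lincomb_def\<close>)
qed

lemma lincomb_lincomb:
  assumes "finite I" "finite J" "a \<in> I \<rightarrow> carrier R" "S \<in> I \<rightarrow> J \<rightarrow> carrier R" "w \<in> J \<rightarrow> carrier M"
  shows "lincomb M I a (\<lambda>i. lincomb M J (S i) w) =
         lincomb M J (\<lambda>j. lincomb (self_module R) I a (\<lambda>i. S i j)) w"
  using assms(1,3,4)
proof (induction I rule: finite_induct)
  case empty
  have "lincomb M J (\<lambda>j. \<zero>) w = \<zero>\<^bsub>M\<^esub>"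
    unfolding lincomb_def using assms by (intro M.add.finprod_one_eqI) (auto simp: Pi_iff)
  then show ?case
    by (simp add: lincomb_def)
next
  case (insert i I)
  interpret S: module R "self_module R" by (intro self_module_module R.is_cring)
  have wit: "S i \<in> J \<rightarrow> carrier R" "a i \<in> carrier R" "a \<in> I \<rightarrow> carrier R" "S \<in> I \<rightarrow> J \<rightarrow> carrier R"
    using insert.prems by auto
  have cl: "lincomb (self_module R) I a (\<lambda>i. S i j) \<in> carrier R" if "j \<in> J" for j
    using wit that S.lincomb_closed[of a I "\<lambda>i. S i j"] by (force simp: Pi_iff)
  have "lincomb M (insert i I) a (\<lambda>i. lincomb M J (S i) w) =
        a i \<odot>\<^bsub>M\<^esub> lincomb M J (S i) w \<oplus>\<^bsub>M\<^esub> lincomb M I a (\<lambda>i. lincomb M J (S i) w)"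
    using insert assms(5) by (intro lincomb_insert) (auto intro!: lincomb_closed)
  also have "\<dots> = lincomb M J (\<lambda>j. a i \<otimes> S i j) w \<oplus>\<^bsub>M\<^esub>
                    lincomb M J (\<lambda>j. lincomb (self_module R) I a (\<lambda>i. S i j)) w"
    using insert.IH wit assms(5) by (simp add: smult_lincomb)
  also have "\<dots> = lincomb M J (\<lambda>j. a i \<otimes> S i j \<oplus> lincomb (self_module R) I a (\<lambda>i. S i j)) w"
    using wit cl assms(5) by (intro lincomb_add_left[symmetric]) auto
  also have "\<dots> = lincomb M J (\<lambda>j. lincomb (self_module R) (insert i I) a (\<lambda>i. S i j)) w"
  proof (rule lincomb_cong)
    fix j assume j: "j \<in> J"
    show "a i \<otimes> S i j \<oplus> lincomb (self_module R) I a (\<lambda>i. S i j) =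
          lincomb (self_module R) (insert i I) a (\<lambda>i. S i j)"
      using insert(1,2) wit j by (subst S.lincomb_insert) (auto simp: Pi_iff)
  next
    show "(\<lambda>j. lincomb (self_module R) (insert i I) a (\<lambda>i. S i j)) \<in> J \<rightarrow> carrier R"
    proof
      fix j assume "j \<in> J"
      then show "lincomb (self_module R) (insert i I) a (\<lambda>i. S i j) \<in> carrier R"
        using wit S.lincomb_closed[of a "insert i I" "\<lambda>i. S i j"] by (force simp: Pi_iff)
    qed
  qed (use assms in auto)
  finally show ?case .
qed

lemma lincomb_reindex:
  assumes "inj_on h I" "a \<in> h ` I \<rightarrow> carrier R" "m \<in> h ` I \<rightarrow> carrier M"
  shows "lincomb M (h ` I) a m = lincomb M I (\<lambda>i. a (h i)) (\<lambda>i. m (h i))"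
  unfolding lincomb_def using assms by (intro M.finsum_reindex) auto

end

text \<open>
  A relation modulo an ideal becomes a genuine relation once multiples of elements of the ideal
  are added as further terms; with families indexed by initial segments, adding terms is
  concatenation.
\<close>

definition cat :: "nat \<Rightarrow> (nat \<Rightarrow> 'v) \<Rightarrow> (nat \<Rightarrow> 'v) \<Rightarrow> nat \<Rightarrow> 'v"
  where "cat p u v = (\<lambda>j. if j < p then u j else v (j - p))"

lemma cat_less [simp]: "j < p \<Longrightarrow> cat p u v j = u j"
  and cat_plus [simp]: "cat p u v (p + j) = v j"
  by (auto simp: cat_def)

lemma cat_Pi: "u \<in> {..<p} \<rightarrow> S \<Longrightarrow> v \<in> {..<q} \<rightarrow> S \<Longrightarrow> cat p u v \<in> {..<p + q} \<rightarrow> S"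
  by (auto simp: cat_def Pi_iff)

lemma (in module) lincomb_cat:
  assumes "a \<in> {..<p} \<rightarrow> carrier R" "b \<in> {..<q} \<rightarrow> carrier R"
    and "m \<in> {..<p} \<rightarrow> carrier M" "n \<in> {..<q} \<rightarrow> carrier M"
  shows "lincomb M {..<p + q} (cat p a b) (cat p m n) = lincomb M {..<p} a m \<oplus>\<^bsub>M\<^esub> lincomb M {..<q} b n"
proof -
  have eq: "{..<p + q} = {..<p} \<union> (\<lambda>j. p + j) ` {..<q}"
  proof (intro equalityI subsetI)
    fix x assume "x \<in> {..<p + q}"
    then have "x < p \<or> x = p + (x - p) \<and> x - p < q" by auto
    then show "x \<in> {..<p} \<union> (\<lambda>j. p + j) ` {..<q}" by blast
  qed auto
  let ?f = "\<lambda>j. cat p a b j \<odot>\<^bsub>M\<^esub> cat p m n j"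
  have c: "?f \<in> {..<p} \<rightarrow> carrier M" "?f \<in> (\<lambda>j. p + j) ` {..<q} \<rightarrow> carrier M"
    using assms by (auto simp: Pi_iff)
  have "lincomb M {..<p + q} (cat p a b) (cat p m n) = finsum M ?f {..<p} \<oplus>\<^bsub>M\<^esub> finsum M ?f ((\<lambda>j. p + j) ` {..<q})"
    unfolding lincomb_def eq using c by (intro M.finsum_Un_disjoint) auto
  also have "finsum M ?f ((\<lambda>j. p + j) ` {..<q}) = lincomb M {..<q} b n"
    using c(2) assms by (subst M.finsum_reindex) (auto simp: lincomb_def intro!: M.finsum_cong')
  also have "finsum M ?f {..<p} = lincomb M {..<p} a m"
    unfolding lincomb_def using assms by (intro M.finsum_cong') auto
  finally show ?thesis .
qed

subsection \<open>Linear maps\<close>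

locale linear_map = M: module R M + N: module R N
  for R (structure) and M (structure) and N (structure) +
  fixes h
  assumes linear: "h \<in> linear_maps R M N"
begin

lemma hom_closed [simp, intro]: "x \<in> carrier M \<Longrightarrow> h x \<in> carrier N"
  using linear by (auto simp: linear_maps_def)

lemma hom_add: "x \<in> carrier M \<Longrightarrow> y \<in> carrier M \<Longrightarrow> h (x \<oplus>\<^bsub>M\<^esub> y) = h x \<oplus>\<^bsub>N\<^esub> h y"
  using linear by (auto simp: linear_maps_def)

lemma hom_smult: "r \<in> carrier R \<Longrightarrow> x \<in> carrier M \<Longrightarrow> h (r \<odot>\<^bsub>M\<^esub> x) = r \<odot>\<^bsub>N\<^esub> h x"
  using linear by (auto simp: linear_maps_def)

lemma hom_zero [simp]: "h \<zero>\<^bsub>M\<^esub> = \<zero>\<^bsub>N\<^esub>"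
  using hom_smult[of "\<zero>\<^bsub>R\<^esub>" "\<zero>\<^bsub>M\<^esub>"] by simp

lemma hom_neg: "x \<in> carrier M \<Longrightarrow> h (\<ominus>\<^bsub>M\<^esub> x) = \<ominus>\<^bsub>N\<^esub> h x"
  by (metis M.M.add.inv_closed M.M.r_neg N.M.add.inv_equality hom_add hom_closed hom_zero
      M.M.l_neg)

lemma hom_minus: "x \<in> carrier M \<Longrightarrow> y \<in> carrier M \<Longrightarrow> h (x \<ominus>\<^bsub>M\<^esub> y) = h x \<ominus>\<^bsub>N\<^esub> h y"
  by (simp add: a_minus_def hom_add hom_neg)

lemma hom_lincomb:
  assumes "a \<in> I \<rightarrow> carrier R" "m \<in> I \<rightarrow> carrier M"
  shows "h (lincomb M I a m) = lincomb N I a (\<lambda>i. h (m i))"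
  using assms
proof (induction I rule: infinite_finite_induct)
  case (insert i I)
  then show ?case
    by (simp add: M.lincomb_insert N.lincomb_insert hom_add hom_smult Pi_iff M.lincomb_closed)
qed (auto simp: lincomb_def)

lemma image_submodule:
  assumes "submodule H R M"
  shows "submodule (h ` H) R N"
proof (rule N.submoduleI)
  note H = submoduleD[OF M.module_axioms assms]
  show "h ` H \<subseteq> carrier N" using H by auto
  show "\<zero>\<^bsub>N\<^esub> \<in> h ` H" using H(2) hom_zero by force
  show "\<ominus>\<^bsub>N\<^esub> a \<in> h ` H" if "a \<in> h ` H" for a
    using that H by (auto simp: hom_neg[symmetric])
  show "a \<oplus>\<^bsub>N\<^esub> b \<in> h ` H" if "a \<in> h ` H" "b \<in> h ` H" for a b
    using that H by (auto simp: hom_add[symmetric])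
  show "a \<odot>\<^bsub>N\<^esub> x \<in> h ` H" if "a \<in> carrier R" "x \<in> h ` H" for a x
    using that H by (auto simp: hom_smult[symmetric])
qed

lemma preimage_submodule:
  assumes "submodule H R N"
  shows "submodule {x \<in> carrier M. h x \<in> H} R M"
proof (rule M.submoduleI)
  note H = submoduleD[OF N.module_axioms assms]
qed (use submoduleD[OF N.module_axioms assms] in \<open>auto simp: hom_neg hom_add hom_smult\<close>)

lemma kernel_submodule: "submodule (a_kernel M N h) R M"
proof -
  have "submodule {\<zero>\<^bsub>N\<^esub>} R N"
    by (rule N.submoduleI) auto
  from preimage_submodule[OF this] show ?thesis by (simp add: a_kernel_def')
qed

end

lemma linear_mapI: "module R M \<Longrightarrow> module R N \<Longrightarrow> h \<in> linear_maps R M N \<Longrightarrow> linear_map R M N h"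
  by (simp add: linear_map_def linear_map_axioms_def)

lemma linear_maps_comp:
  "h \<in> linear_maps R M N \<Longrightarrow> k \<in> linear_maps R N P \<Longrightarrow> (\<lambda>x. k (h x)) \<in> linear_maps R M P"
  by (auto simp: linear_maps_def Pi_iff)

subsection \<open>Quotient modules\<close>

locale module_quotient = module R M for R (structure) and M (structure) +
  fixes H
  assumes sub: "submodule H R M"
begin

abbreviation coset where "coset x \<equiv> H +>\<^bsub>M\<^esub> x"

lemma abelian_subgroup: "abelian_subgroup H M"
  using sub by (intro abelian_subgroupI3 additive_subgroupI)
    (auto simp: submodule_def M.abelian_group_axioms)

lemma coset_eq_iff:
  assumes "x \<in> carrier M" "y \<in> carrier M"
  shows "coset x = coset y \<longleftrightarrow> x \<ominus>\<^bsub>M\<^esub> y \<in> H"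
proof -
  interpret S: abelian_subgroup H M by (rule abelian_subgroup)
  have "coset x = coset y \<longleftrightarrow> x \<in> coset y"
    using S.a_repr_independence'[of x y] S.a_repr_independenceD[of x y] assms by auto
  then show ?thesis
    using S.a_rcos_module[of y x] assms by (simp add: a_minus_def)
qed

lemma mem_coset: "x \<in> carrier M \<Longrightarrow> x \<in> coset x"
  using abelian_subgroup.a_rcos_self[OF abelian_subgroup] .

lemma coset_add:
  "x \<in> carrier M \<Longrightarrow> y \<in> carrier M \<Longrightarrow> coset x <+>\<^bsub>M\<^esub> coset y = coset (x \<oplus>\<^bsub>M\<^esub> y)"
  using abelian_subgroup.a_rcos_sum[OF abelian_subgroup] .

lemma coset_smult:
  assumes "r \<in> carrier R" "x \<in> carrier M"
  shows "(\<Union>x\<in>coset x. coset (r \<odot>\<^bsub>M\<^esub> x)) = coset (r \<odot>\<^bsub>M\<^esub> x)"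
proof -
  interpret S: abelian_subgroup H M by (rule abelian_subgroup)
  have "coset (r \<odot>\<^bsub>M\<^esub> y) = coset (r \<odot>\<^bsub>M\<^esub> x)" if "y \<in> coset x" for y
  proof -
    have y: "y \<in> carrier M" "y \<ominus>\<^bsub>M\<^esub> x \<in> H"
      using that assms S.a_elemrcos_carrier S.a_rcos_module[of x y] by (auto simp: a_minus_def)
    have "r \<odot>\<^bsub>M\<^esub> (y \<ominus>\<^bsub>M\<^esub> x) \<in> H"
      using y assms submoduleD(7)[OF module_axioms sub] by auto
    then show ?thesis
      using y assms by (simp add: coset_eq_iff a_minus_def smult_r_distr smult_r_minus)
  qed
  then show ?thesis using mem_coset[OF assms(2)] by blast
qed

abbreviation Q where "Q \<equiv> quotient_module M H"

lemma quotient_carrier: "carrier Q = coset ` carrier M"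
  by (auto simp: quotient_module_def A_RCOSETS_def')

lemma quotient_ops:
  "\<zero>\<^bsub>Q\<^esub> = coset \<zero>\<^bsub>M\<^esub>"
  "x \<in> carrier M \<Longrightarrow> y \<in> carrier M \<Longrightarrow> coset x \<oplus>\<^bsub>Q\<^esub> coset y = coset (x \<oplus>\<^bsub>M\<^esub> y)"
  "r \<in> carrier R \<Longrightarrow> x \<in> carrier M \<Longrightarrow> r \<odot>\<^bsub>Q\<^esub> coset x = coset (r \<odot>\<^bsub>M\<^esub> x)"
  using sub submoduleD(1)[OF module_axioms sub]
  by (auto simp: quotient_module_def coset_add coset_smult)

lemma quotient_is_module: "module R Q"
proof (rule moduleI)
  show "cring R" by (rule R.is_cring)
  show "abelian_group Q"
  proof (rule abelian_groupI)
    fix X assume "X \<in> carrier Q"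
    then obtain x where x: "x \<in> carrier M" "X = coset x" by (auto simp: quotient_carrier)
    show "\<exists>Y\<in>carrier Q. Y \<oplus>\<^bsub>Q\<^esub> X = \<zero>\<^bsub>Q\<^esub>"
      using x by (intro bexI[of _ "coset (\<ominus>\<^bsub>M\<^esub> x)"]) (auto simp: quotient_carrier quotient_ops M.l_neg)
    fix Y assume "Y \<in> carrier Q"
    then obtain y where y: "y \<in> carrier M" "Y = coset y" by (auto simp: quotient_carrier)
    show "X \<oplus>\<^bsub>Q\<^esub> Y = Y \<oplus>\<^bsub>Q\<^esub> X"
      using x y by (simp add: quotient_ops M.a_comm[of x y])
  qed (auto simp: quotient_carrier quotient_ops M.a_assoc)
qed (auto simp: quotient_carrier quotient_ops smult_l_distr smult_r_distr smult_assoc1)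

lemma coset_linear: "coset \<in> linear_maps R M Q"
  by (auto simp: linear_maps_def quotient_carrier quotient_ops)

lemma coset_eq_zero_iff: "x \<in> carrier M \<Longrightarrow> coset x = \<zero>\<^bsub>Q\<^esub> \<longleftrightarrow> x \<in> H"
  by (simp add: quotient_ops coset_eq_iff a_minus_def M.add.inv_one[folded a_inv_def])

lemma coset_minus_eq_iff: "x \<in> carrier M \<Longrightarrow> y \<in> carrier M \<Longrightarrow> x \<ominus>\<^bsub>M\<^esub> y \<in> H \<Longrightarrow> coset x = coset y"
  by (simp add: coset_eq_iff)

end

lemma submodule_span_is_submodule:
  assumes "module R M" "S \<subseteq> carrier M"
  shows "submodule (submodule_span R M S) R M" "S \<subseteq> submodule_span R M S"
    "\<And>H. submodule H R M \<Longrightarrow> S \<subseteq> H \<Longrightarrow> submodule_span R M S \<subseteq> H"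
proof -
  interpret module R M by fact
  show "submodule (submodule_span R M S) R M"
  proof (rule submoduleI)
    show "submodule_span R M S \<subseteq> carrier M"
      using carrier_is_submodule assms(2) by (auto simp: submodule_span_def)
  qed (auto simp: submodule_span_def submoduleD[OF assms(1)])
qed (auto simp: submodule_span_def)

section \<open>Free modules and tensor products\<close>

lemma (in module_quotient) factor_through_quotient:
  assumes "linear_map R M N h" "H \<subseteq> a_kernel M N h"
  shows "\<exists>k \<in> linear_maps R Q N. \<forall>x \<in> carrier M. k (coset x) = h x"
proof -
  interpret h: linear_map R M N h by fact
  define k where "k X = h (SOME x. x \<in> X)" for X
  have k: "k (coset x) = h x" if x: "x \<in> carrier M" for x
  proof -
    interpret S: abelian_subgroup H M by (rule abelian_subgroup)
    define y where "y = (SOME y. y \<in> coset x)"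
    have "y \<in> coset x" unfolding y_def using mem_coset[OF x] by (rule someI)
    then have y: "y \<in> carrier M" "y \<ominus>\<^bsub>M\<^esub> x \<in> H"
      using x S.a_elemrcos_carrier S.a_rcos_module[of x y] by (auto simp: a_minus_def)
    then have "h (y \<ominus>\<^bsub>M\<^esub> x) = \<zero>\<^bsub>N\<^esub>" using assms(2) by (auto simp: a_kernel_def')
    then have "h y \<ominus>\<^bsub>N\<^esub> h x = \<zero>\<^bsub>N\<^esub>" using x y by (simp add: h.hom_minus)
    then have "h y = h x" using x y
      by (metis a_minus_def h.N.M.add.inv_equality h.N.M.minus_minus h.hom_closed h.N.M.a_inv_closed)
    then show ?thesis by (simp add: k_def y_def)
  qed
  have "k \<in> linear_maps R Q N"
    by (auto simp: linear_maps_def quotient_carrier quotient_ops k h.hom_add h.hom_smult)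
  with k show ?thesis by blast
qed

locale free_mod = cring R for R (structure) + fixes X :: "'g set"
begin

abbreviation F where "F \<equiv> free_module R X"

lemma free_carrier:
  "u \<in> carrier F \<longleftrightarrow> (\<forall>x. u x \<in> carrier R) \<and> finite {x. u x \<noteq> \<zero>} \<and> {x. u x \<noteq> \<zero>} \<subseteq> X"
  by (auto simp: free_module_def)

lemma free_ops [simp]:
  "\<zero>\<^bsub>F\<^esub> = (\<lambda>x. \<zero>)" "u \<oplus>\<^bsub>F\<^esub> v = (\<lambda>x. u x \<oplus> v x)" "r \<odot>\<^bsub>F\<^esub> u = (\<lambda>x. r \<otimes> u x)"
  by (simp_all add: free_module_def)

lemma free_module_is_module: "module R F"
proof (rule moduleI)
  show "cring R" by (rule is_cring)
  have cl: "u \<oplus>\<^bsub>F\<^esub> v \<in> carrier F" if "u \<in> carrier F" "v \<in> carrier F" for u v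
  proof -
    have "{x. u x \<oplus> v x \<noteq> \<zero>} \<subseteq> {x. u x \<noteq> \<zero>} \<union> {x. v x \<noteq> \<zero>}" by auto
    with that show ?thesis by (auto simp: free_carrier intro: finite_subset)
  qed
  show "abelian_group F"
  proof (rule abelian_groupI)
    fix u assume u: "u \<in> carrier F"
    have "{x. \<ominus> u x \<noteq> \<zero>} \<subseteq> {x. u x \<noteq> \<zero>}" by auto
    with u show "\<exists>v\<in>carrier F. v \<oplus>\<^bsub>F\<^esub> u = \<zero>\<^bsub>F\<^esub>"
      by (intro bexI[of _ "\<lambda>x. \<ominus> u x"]) (auto simp: free_carrier l_neg intro: finite_subset)
  qed (use cl in \<open>auto simp: free_carrier a_assoc intro!: ext intro: a_comm\<close>)
  fix r u assume r: "r \<in> carrier R" and u: "u \<in> carrier F"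
  have "{x. r \<otimes> u x \<noteq> \<zero>} \<subseteq> {x. u x \<noteq> \<zero>}" using r by auto
  then show "r \<odot>\<^bsub>F\<^esub> u \<in> carrier F" using r u by (auto simp: free_carrier intro: finite_subset)
qed (auto simp: free_carrier l_distr r_distr m_assoc)

sublocale F: module R F by (rule free_module_is_module)
sublocale self: module R "self_module R" by (rule self_module_module[OF is_cring])

lemma basis_vec_closed [simp]: "x \<in> X \<Longrightarrow> basis_vec R x \<in> carrier F"
  by (auto simp: free_carrier basis_vec_def)

lemma eval_linear: "(\<lambda>u. u x) \<in> linear_maps R F (self_module R)"
  by (auto simp: linear_maps_def free_carrier)

lemma eval_linear_map: "linear_map R F (self_module R) (\<lambda>u. u x)"
  by (intro linear_mapI F.module_axioms self.module_axioms eval_linear)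

lemma free_minus: "u \<in> carrier F \<Longrightarrow> v \<in> carrier F \<Longrightarrow> (u \<ominus>\<^bsub>F\<^esub> v) x = u x \<ominus> v x"
  using linear_map.hom_minus[OF eval_linear_map] by simp

lemma lincomb_apply:
  "a \<in> I \<rightarrow> carrier R \<Longrightarrow> m \<in> I \<rightarrow> carrier F \<Longrightarrow>
   lincomb F I a m x = lincomb (self_module R) I a (\<lambda>i. m i x)"
  using linear_map.hom_lincomb[OF eval_linear_map] .

lemma free_expand:
  assumes "u \<in> carrier F" "finite Y" "{x. u x \<noteq> \<zero>} \<subseteq> Y" "Y \<subseteq> X"
  shows "lincomb F Y u (basis_vec R) = u"
proof
  fix x
  have u: "u x \<in> carrier R" for x using assms by (auto simp: free_carrier)
  have "lincomb F Y u (basis_vec R) x = lincomb (self_module R) Y u (\<lambda>i. basis_vec R i x)"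
    using assms u by (intro lincomb_apply) auto
  also have "\<dots> = (\<Oplus>y\<in>Y. if x = y then u y else \<zero>)"
    unfolding lincomb_def self_module_simps
    by (rule add.finprod_cong') (use u in \<open>auto simp: basis_vec_def\<close>)
  also have "\<dots> = u x"
  proof (cases "x \<in> Y")
    case True
    then show ?thesis using assms u by (intro add.finprod_singleton) auto
  next
    case False
    then have "(\<Oplus>y\<in>Y. if x = y then u y else \<zero>) = \<zero>"
      by (intro add.finprod_one_eqI) auto
    moreover have "u x = \<zero>" using False assms(3) by auto
    ultimately show ?thesis by simp
  qed
  finally show "lincomb F Y u (basis_vec R) x = u x" .
qed

lemma free_induct:
  assumes "u \<in> carrier F" "submodule H R F" "\<And>x. x \<in> X \<Longrightarrow> u x \<noteq> \<zero> \<Longrightarrow> basis_vec R x \<in> H"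
  shows "u \<in> H"
proof -
  have "lincomb F {x. u x \<noteq> \<zero>} u (basis_vec R) \<in> H"
    using assms by (intro F.lincomb_in_submodule) (auto simp: free_carrier)
  then show ?thesis using assms(1) free_expand[of u "{x. u x \<noteq> \<zero>}"] by (auto simp: free_carrier)
qed

end

locale free_hom = free_mod R X + M: module R M for R (structure) and X :: "'g set" and M (structure) +
  fixes h :: "'g \<Rightarrow> 'c"
  assumes h: "h \<in> X \<rightarrow> carrier M"
begin

lemma linear_ext_eq_lincomb:
  assumes "u \<in> carrier F" "finite Y" "{x. u x \<noteq> \<zero>\<^bsub>R\<^esub>} \<subseteq> Y" "Y \<subseteq> X"
  shows "linear_ext R M h u = lincomb M Y u h"
  unfolding linear_ext_def lincomb_def
  by (rule M.M.add.finprod_mono_neutral_cong_left)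
    (use assms h in \<open>auto simp: Pi_iff free_carrier subset_iff\<close>)

lemma linear_ext_linear: "linear_ext R M h \<in> linear_maps R F M"
proof -
  have supp: "lincomb M {x. u x \<noteq> \<zero>\<^bsub>R\<^esub>} u h \<in> carrier M" if "u \<in> carrier F" for u
    using that h by (intro M.lincomb_closed) (auto simp: free_carrier Pi_iff)
  have 1: "linear_ext R M h u \<in> carrier M" if "u \<in> carrier F" for u
    using that supp[OF that] linear_ext_eq_lincomb[of u "{x. u x \<noteq> \<zero>\<^bsub>R\<^esub>}"]
    by (auto simp: free_carrier)
  have 2: "linear_ext R M h (u \<oplus>\<^bsub>F\<^esub> v) = linear_ext R M h u \<oplus>\<^bsub>M\<^esub> linear_ext R M h v"
    if uv: "u \<in> carrier F" "v \<in> carrier F" for u v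
  proof -
    let ?Y = "{x. u x \<noteq> \<zero>\<^bsub>R\<^esub>} \<union> {x. v x \<noteq> \<zero>\<^bsub>R\<^esub>}"
    have Y: "finite ?Y" "?Y \<subseteq> X" using uv by (auto simp: free_carrier)
    have c: "u \<oplus>\<^bsub>F\<^esub> v \<in> carrier F" using uv by (rule F.M.a_closed)
    have "linear_ext R M h (u \<oplus>\<^bsub>F\<^esub> v) = lincomb M ?Y (u \<oplus>\<^bsub>F\<^esub> v) h"
      using uv Y c by (intro linear_ext_eq_lincomb) auto
    also have "\<dots> = lincomb M ?Y u h \<oplus>\<^bsub>M\<^esub> lincomb M ?Y v h"
      unfolding free_ops using uv Y h by (intro M.lincomb_add_left) (auto simp: free_carrier Pi_iff)
    finally show ?thesis
      using uv Y linear_ext_eq_lincomb[of u ?Y] linear_ext_eq_lincomb[of v ?Y] by auto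
  qed
  have 3: "linear_ext R M h (r \<odot>\<^bsub>F\<^esub> u) = r \<odot>\<^bsub>M\<^esub> linear_ext R M h u"
    if ru: "r \<in> carrier R" "u \<in> carrier F" for r u
  proof -
    let ?Y = "{x. u x \<noteq> \<zero>\<^bsub>R\<^esub>}"
    have Y: "finite ?Y" "?Y \<subseteq> X" using ru by (auto simp: free_carrier)
    have c: "r \<odot>\<^bsub>F\<^esub> u \<in> carrier F" using ru by (rule F.smult_closed)
    have "linear_ext R M h (r \<odot>\<^bsub>F\<^esub> u) = lincomb M ?Y (r \<odot>\<^bsub>F\<^esub> u) h"
      using ru Y c by (intro linear_ext_eq_lincomb) auto
    also have "\<dots> = r \<odot>\<^bsub>M\<^esub> lincomb M ?Y u h"
      unfolding free_ops using ru Y h by (intro M.smult_lincomb(1)[symmetric]) (auto simp: free_carrier Pi_iff)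
    finally show ?thesis using ru Y linear_ext_eq_lincomb[of u ?Y] by auto
  qed
  show ?thesis using 1 2 3 by (auto simp: linear_maps_def)
qed

lemma linear_ext_linear_map: "linear_map R F M (linear_ext R M h)"
  by (intro linear_mapI F.module_axioms M.module_axioms linear_ext_linear)

lemma linear_ext_basis [simp]:
  assumes "x \<in> X"
  shows "linear_ext R M h (basis_vec R x) = h x"
proof -
  have hx: "h x \<in> carrier M" using assms h by auto
  have "linear_ext R M h (basis_vec R x) = lincomb M {x} (basis_vec R x) h"
    using assms basis_vec_closed[OF assms]
    by (intro linear_ext_eq_lincomb) (simp_all, auto simp: basis_vec_def)
  also have "\<dots> = h x"
    using hx M.lincomb_insert[of "{}" x "basis_vec R x" h] by (simp add: basis_vec_def)
  finally show ?thesis .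
qed

end

lemma free_homI: "module R M \<Longrightarrow> h \<in> X \<rightarrow> carrier M \<Longrightarrow> free_hom R X M h"
  by (simp add: free_hom_def free_mod_def free_hom_axioms_def module.axioms)

locale tensor = M: module R M + N: module R N
  for R (structure) and M (structure) and N (structure)
begin

abbreviation F where "F \<equiv> free_module R (carrier M \<times> carrier N)"
abbreviation \<delta> where "\<delta> x y \<equiv> basis_vec R (x, y)"
abbreviation Rel where "Rel \<equiv> tensor_relations R M N"
abbreviation T where "T \<equiv> tensor_product R M N"
abbreviation tens where "tens x y \<equiv> Rel +>\<^bsub>F\<^esub> \<delta> x y"

sublocale free: free_mod R "carrier M \<times> carrier N"
  by unfold_locales

definition gens where "gens =
      {\<delta> (x \<oplus>\<^bsub>M\<^esub> x') y \<ominus>\<^bsub>F\<^esub> (\<delta> x y \<oplus>\<^bsub>F\<^esub> \<delta> x' y) | x x' y.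
          x \<in> carrier M \<and> x' \<in> carrier M \<and> y \<in> carrier N} \<union>
       {\<delta> x (y \<oplus>\<^bsub>N\<^esub> y') \<ominus>\<^bsub>F\<^esub> (\<delta> x y \<oplus>\<^bsub>F\<^esub> \<delta> x y') | x y y'.
          x \<in> carrier M \<and> y \<in> carrier N \<and> y' \<in> carrier N} \<union>
       {\<delta> (r \<odot>\<^bsub>M\<^esub> x) y \<ominus>\<^bsub>F\<^esub> (r \<odot>\<^bsub>F\<^esub> \<delta> x y) | r x y.
          r \<in> carrier R \<and> x \<in> carrier M \<and> y \<in> carrier N} \<union>
       {\<delta> x (r \<odot>\<^bsub>N\<^esub> y) \<ominus>\<^bsub>F\<^esub> (r \<odot>\<^bsub>F\<^esub> \<delta> x y) | r x y.
          r \<in> carrier R \<and> x \<in> carrier M \<and> y \<in> carrier N}"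

lemma Rel_eq: "Rel = submodule_span R F gens"
  by (simp add: tensor_relations_def Let_def gens_def)

lemma \<delta>_closed: "x \<in> carrier M \<Longrightarrow> y \<in> carrier N \<Longrightarrow> \<delta> x y \<in> carrier F"
  by simp

lemma gens_closed: "gens \<subseteq> carrier F"
  unfolding gens_def
  by (auto simp del: free.free_ops intro!: free.F.M.minus_closed free.F.M.a_closed free.F.smult_closed)

lemma Rel_submodule: "submodule Rel R F" and gens_Rel: "gens \<subseteq> Rel"
  and Rel_least: "submodule H R F \<Longrightarrow> gens \<subseteq> H \<Longrightarrow> Rel \<subseteq> H"
  using submodule_span_is_submodule[OF free.F.module_axioms gens_closed] by (auto simp: Rel_eq)

sublocale quot: module_quotient R F Rel
  by (simp add: module_quotient_def module_quotient_axioms_def Rel_submodule free.F.module_axioms)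

lemma T_eq: "T = quotient_module F Rel"
  by (simp add: tensor_product_def)

sublocale T: module R T
  unfolding T_eq by (rule quot.quotient_is_module)

sublocale coset: linear_map R F T "\<lambda>u. Rel +>\<^bsub>F\<^esub> u"
  unfolding T_eq by (intro linear_mapI quot.quotient_is_module quot.coset_linear) unfold_locales

lemma tens_closed [simp]: "x \<in> carrier M \<Longrightarrow> y \<in> carrier N \<Longrightarrow> tens x y \<in> carrier T"
  by (rule coset.hom_closed) simp

lemma coset_congI:
  assumes "u \<in> carrier F" "v \<in> carrier F" "u \<ominus>\<^bsub>F\<^esub> v \<in> gens"
  shows "Rel +>\<^bsub>F\<^esub> u = Rel +>\<^bsub>F\<^esub> v"
  using assms gens_Rel by (subst quot.coset_eq_iff) auto

lemma tens_add_left: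
  assumes "x \<in> carrier M" "x' \<in> carrier M" "y \<in> carrier N"
  shows "tens (x \<oplus>\<^bsub>M\<^esub> x') y = tens x y \<oplus>\<^bsub>T\<^esub> tens x' y"
  using assms unfolding coset.hom_add[OF \<delta>_closed \<delta>_closed, OF assms(1,3) assms(2,3), symmetric]
  by (intro coset_congI free.F.M.a_closed \<delta>_closed) (auto simp: gens_def simp del: free.free_ops)

lemma tens_add_right:
  assumes "x \<in> carrier M" "y \<in> carrier N" "y' \<in> carrier N"
  shows "tens x (y \<oplus>\<^bsub>N\<^esub> y') = tens x y \<oplus>\<^bsub>T\<^esub> tens x y'"
  using assms unfolding coset.hom_add[OF \<delta>_closed \<delta>_closed, OF assms(1,2) assms(1,3), symmetric]
  by (intro coset_congI free.F.M.a_closed \<delta>_closed) (auto simp: gens_def simp del: free.free_ops)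

lemma tens_smult_left:
  assumes "r \<in> carrier R" "x \<in> carrier M" "y \<in> carrier N"
  shows "tens (r \<odot>\<^bsub>M\<^esub> x) y = r \<odot>\<^bsub>T\<^esub> tens x y"
  using assms unfolding coset.hom_smult[OF assms(1) \<delta>_closed, OF assms(2,3), symmetric]
  by (intro coset_congI free.F.smult_closed \<delta>_closed) (auto simp: gens_def simp del: free.free_ops)

lemma tens_smult_right:
  assumes "r \<in> carrier R" "x \<in> carrier M" "y \<in> carrier N"
  shows "tens x (r \<odot>\<^bsub>N\<^esub> y) = r \<odot>\<^bsub>T\<^esub> tens x y"
  using assms unfolding coset.hom_smult[OF assms(1) \<delta>_closed, OF assms(2,3), symmetric]
  by (intro coset_congI free.F.smult_closed \<delta>_closed) (auto simp: gens_def simp del: free.free_ops)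

lemma tens_left_linear: "y \<in> carrier N \<Longrightarrow> linear_map R M T (\<lambda>x. tens x y)"
  by (intro linear_mapI M.module_axioms T.module_axioms)
    (auto simp: linear_maps_def tens_add_left tens_smult_left)

lemma tens_right_linear: "x \<in> carrier M \<Longrightarrow> linear_map R N T (\<lambda>y. tens x y)"
  by (intro linear_mapI N.module_axioms T.module_axioms)
    (auto simp: linear_maps_def tens_add_right tens_smult_right)

lemma T_carrier: "carrier T = (\<lambda>u. Rel +>\<^bsub>F\<^esub> u) ` carrier F"
  unfolding T_eq by (rule quot.quotient_carrier)

text \<open>
  For statements about the whole tensor product it suffices to look at pure tensors: a coset of
  a formal combination of pairs is the corresponding combination of pure tensors.
\<close>

lemma tensor_span:
  assumes "submodule K R T" "\<And>x y. x \<in> carrier M \<Longrightarrow> y \<in> carrier N \<Longrightarrow> tens x y \<in> K"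
  shows "carrier T \<subseteq> K"
proof
  fix t assume "t \<in> carrier T"
  then obtain u where u: "u \<in> carrier F" "t = Rel +>\<^bsub>F\<^esub> u" by (auto simp: T_carrier)
  have "u \<in> {u \<in> carrier F. Rel +>\<^bsub>F\<^esub> u \<in> K}"
  proof (rule free.free_induct[OF u(1) coset.preimage_submodule[OF assms(1)]])
    fix z assume "z \<in> carrier M \<times> carrier N"
    then obtain x y where "z = (x, y)" "x \<in> carrier M" "y \<in> carrier N" by blast
    then show "basis_vec R z \<in> {u \<in> carrier F. Rel +>\<^bsub>F\<^esub> u \<in> K}"
      using assms(2) \<delta>_closed by simp
  qed
  with u show "t \<in> K" by auto
qed

definition bilinear where "bilinear Q \<beta> \<longleftrightarrow>
   (\<forall>x\<in>carrier M. \<forall>y\<in>carrier N. \<beta> x y \<in> carrier Q) \<and>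
   (\<forall>x\<in>carrier M. \<forall>x'\<in>carrier M. \<forall>y\<in>carrier N. \<beta> (x \<oplus>\<^bsub>M\<^esub> x') y = \<beta> x y \<oplus>\<^bsub>Q\<^esub> \<beta> x' y) \<and>
   (\<forall>x\<in>carrier M. \<forall>y\<in>carrier N. \<forall>y'\<in>carrier N. \<beta> x (y \<oplus>\<^bsub>N\<^esub> y') = \<beta> x y \<oplus>\<^bsub>Q\<^esub> \<beta> x y') \<and>
   (\<forall>r\<in>carrier R. \<forall>x\<in>carrier M. \<forall>y\<in>carrier N. \<beta> (r \<odot>\<^bsub>M\<^esub> x) y = r \<odot>\<^bsub>Q\<^esub> \<beta> x y) \<and>
   (\<forall>r\<in>carrier R. \<forall>x\<in>carrier M. \<forall>y\<in>carrier N. \<beta> x (r \<odot>\<^bsub>N\<^esub> y) = r \<odot>\<^bsub>Q\<^esub> \<beta> x y)"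

lemma Rel_le_kernel:
  assumes "linear_map R F Q h" "bilinear Q (\<lambda>x y. h (\<delta> x y))"
  shows "Rel \<subseteq> a_kernel F Q h"
proof (rule Rel_least)
  interpret h: linear_map R F Q h by fact
  show "submodule (a_kernel F Q h) R F" by (rule h.kernel_submodule)
  note d = \<delta>_closed
  note b = assms(2)[unfolded bilinear_def]
  have *: "u \<ominus>\<^bsub>F\<^esub> v \<in> a_kernel F Q h" if "u \<in> carrier F" "v \<in> carrier F" "h u = h v" for u v
    using that by (auto simp: a_kernel_def' h.hom_minus simp del: free.free_ops)
      (simp add: a_minus_def h.N.M.r_neg)
  show "gens \<subseteq> a_kernel F Q h"
    unfolding gens_def using b
    by (auto simp del: free.free_ops intro!: * free.F.M.a_closed free.F.smult_closed d
        simp: h.hom_add[OF d d] h.hom_smult[OF _ d])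
qed

text \<open>
  The universal property: the linear extension of a bilinear map to formal combinations of pairs
  kills the defining relations.
\<close>

lemma tensor_lift:
  assumes "module R Q" "bilinear Q \<beta>"
  shows "\<exists>k. linear_map R T Q k \<and> (\<forall>x\<in>carrier M. \<forall>y\<in>carrier N. k (tens x y) = \<beta> x y)"
proof -
  interpret e: free_hom R "carrier M \<times> carrier N" Q "\<lambda>(x, y). \<beta> x y"
    using assms by (intro free_homI) (auto simp: bilinear_def)
  note L = e.linear_ext_linear_map
  have "Rel \<subseteq> a_kernel F Q (linear_ext R Q (\<lambda>(x, y). \<beta> x y))"
    using assms(2) by (intro Rel_le_kernel[OF L]) (simp add: bilinear_def)
  from quot.factor_through_quotient[OF L this]
  obtain k where k: "k \<in> linear_maps R T Q"
    "\<forall>u\<in>carrier F. k (Rel +>\<^bsub>F\<^esub> u) = linear_ext R Q (\<lambda>(x, y). \<beta> x y) u"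
    unfolding T_eq by blast
  then have "linear_map R T Q k" by (intro linear_mapI T.module_axioms assms)
  with k show ?thesis by (intro exI[of _ k]) auto
qed

end

locale tensor_hom = S: tensor R M N + S': tensor R M' N'
  for R (structure) and M (structure) and N (structure) and M' and N' +
  fixes h k
  assumes h: "h \<in> linear_maps R M M'" and k: "k \<in> linear_maps R N N'"
begin

sublocale h: linear_map R M M' h by unfold_locales (rule h)
sublocale k: linear_map R N N' k by unfold_locales (rule k)

definition push where "push = linear_ext R S'.F (\<lambda>(x, y). basis_vec R (h x, k y))"

sublocale push: free_hom R "carrier M \<times> carrier N" S'.F "\<lambda>(x, y). basis_vec R (h x, k y)"
  by (intro free_homI S'.free.F.module_axioms) auto

sublocale p: linear_map R S.F S'.F push
  unfolding push_def by (rule push.linear_ext_linear_map)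

sublocale c: linear_map R S.F S'.T "\<lambda>u. S'.Rel +>\<^bsub>S'.F\<^esub> push u"
  by (intro linear_mapI S.free.F.module_axioms S'.T.module_axioms
      linear_maps_comp[OF p.linear S'.coset.linear])

lemma push_delta: "x \<in> carrier M \<Longrightarrow> y \<in> carrier N \<Longrightarrow> push (S.\<delta> x y) = S'.\<delta> (h x) (k y)"
  by (simp add: push_def)

lemma push_Rel: "r \<in> S.Rel \<Longrightarrow> push r \<in> S'.Rel"
proof -
  assume r: "r \<in> S.Rel"
  have "S.bilinear S'.T (\<lambda>x y. S'.Rel +>\<^bsub>S'.F\<^esub> push (S.\<delta> x y))"
    by (auto simp: S.bilinear_def push_delta S'.tens_add_left S'.tens_add_right S'.tens_smult_left
        S'.tens_smult_right h.hom_add h.hom_smult k.hom_add k.hom_smult)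
  from S.Rel_le_kernel[OF c.linear_map_axioms this] r
  have "r \<in> carrier S.F" "S'.Rel +>\<^bsub>S'.F\<^esub> push r = \<zero>\<^bsub>S'.T\<^esub>" by (auto simp: a_kernel_def')
  then show ?thesis using S'.quot.coset_eq_zero_iff[of "push r"] by (auto simp: S'.T_eq)
qed

text \<open>
  The definition of \<open>tensor_map\<close> adds all relations to the images of all
  representatives of a coset. Since the pushforward sends relations to relations, the result is
  the coset of the pushforward of any single representative.
\<close>

lemma tensor_map_coset:
  assumes u: "u \<in> carrier S.F"
  shows "tensor_map R M' N' h k (S.Rel +>\<^bsub>S.F\<^esub> u) = S'.Rel +>\<^bsub>S'.F\<^esub> push u"
proof -
  have "tensor_map R M' N' h k (S.Rel +>\<^bsub>S.F\<^esub> u) = S'.Rel <+>\<^bsub>S'.F\<^esub> push ` (S.Rel +>\<^bsub>S.F\<^esub> u)"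
    by (simp add: tensor_map_def push_def Let_def)
  also have "\<dots> = S'.Rel +>\<^bsub>S'.F\<^esub> push u"
  proof (intro equalityI subsetI)
    note D = submoduleD[OF S.free.F.module_axioms S.Rel_submodule]
    note D' = submoduleD[OF S'.free.F.module_axioms S'.Rel_submodule]
    fix x assume "x \<in> S'.Rel <+>\<^bsub>S'.F\<^esub> push ` (S.Rel +>\<^bsub>S.F\<^esub> u)"
    then obtain s r where sr: "s \<in> S'.Rel" "r \<in> S.Rel" "x = s \<oplus>\<^bsub>S'.F\<^esub> push (r \<oplus>\<^bsub>S.F\<^esub> u)"
      by (auto simp: set_add_def' a_r_coset_def' simp del: S.free.free_ops S'.free.free_ops)
    then have "x = (s \<oplus>\<^bsub>S'.F\<^esub> push r) \<oplus>\<^bsub>S'.F\<^esub> push u"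
      using u D(3) D'(3) by (simp add: p.hom_add S'.free.F.M.a_assoc del: S.free.free_ops S'.free.free_ops)
    moreover have "s \<oplus>\<^bsub>S'.F\<^esub> push r \<in> S'.Rel" using sr push_Rel D'(5) by blast
    ultimately show "x \<in> S'.Rel +>\<^bsub>S'.F\<^esub> push u" by (auto simp: a_r_coset_def')
  next
    fix x assume "x \<in> S'.Rel +>\<^bsub>S'.F\<^esub> push u"
    then obtain s where s: "s \<in> S'.Rel" "x = s \<oplus>\<^bsub>S'.F\<^esub> push u"
      unfolding a_r_coset_def' by blast
    have "push u \<in> push ` (S.Rel +>\<^bsub>S.F\<^esub> u)"
      using S.quot.mem_coset[OF u] by (rule imageI)
    with s show "x \<in> S'.Rel <+>\<^bsub>S'.F\<^esub> push ` (S.Rel +>\<^bsub>S.F\<^esub> u)"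
      unfolding set_add_def' by blast
  qed
  finally show ?thesis .
qed

lemma tensor_map_linear: "linear_map R S.T S'.T (tensor_map R M' N' h k)"
proof (intro linear_mapI S.T.module_axioms S'.T.module_axioms)
  have 1: "tensor_map R M' N' h k (S.Rel +>\<^bsub>S.F\<^esub> u) \<in> carrier S'.T" if "u \<in> carrier S.F" for u
    using that c.hom_closed by (simp add: tensor_map_coset)
  show "tensor_map R M' N' h k \<in> linear_maps R S.T S'.T"
    unfolding linear_maps_def S.T_carrier using 1 S.free.F.M.a_closed S.free.F.smult_closed
    by (auto simp: S.coset.hom_add[symmetric] S.coset.hom_smult[symmetric] tensor_map_coset
        c.hom_add c.hom_smult simp del: S.free.free_ops S'.free.free_ops)
qed

lemma tensor_map_tens:
  "x \<in> carrier M \<Longrightarrow> y \<in> carrier N \<Longrightarrow> tensor_map R M' N' h k (S.tens x y) = S'.tens (h x) (k y)"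
  by (simp add: tensor_map_coset push_delta)

end

section \<open>Flatness in terms of linear relations\<close>

text \<open>
  The additive span of the products of elements of \<open>E\<close> and \<open>Z\<close>; for a
  submodule \<open>Z\<close> it is the submodule \<open>EZ\<close>. As an inductive set it needs
  no finite families of products in proofs by induction. With the ring itself in place of
  \<open>Z\<close> it is the ideal generated by \<open>E\<close>.
\<close>

inductive_set scaled :: "('r, 'm, 'y) module_scheme \<Rightarrow> 'r set \<Rightarrow> 'm set \<Rightarrow> 'm set"
  for M E Z where
    zero: "\<zero>\<^bsub>M\<^esub> \<in> scaled M E Z"
  | step: "e \<in> E \<Longrightarrow> z \<in> Z \<Longrightarrow> x \<in> scaled M E Z \<Longrightarrow> e \<odot>\<^bsub>M\<^esub> z \<oplus>\<^bsub>M\<^esub> x \<in> scaled M E Z"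

abbreviation ideal_span where "ideal_span R E \<equiv> scaled (self_module R) E (carrier R)"

lemma scaled_mono: "E \<subseteq> E' \<Longrightarrow> Z \<subseteq> Z' \<Longrightarrow> scaled M E Z \<subseteq> scaled M E' Z'"
proof
  fix x assume "x \<in> scaled M E Z" "E \<subseteq> E'" "Z \<subseteq> Z'"
  then show "x \<in> scaled M E' Z'" by (induction rule: scaled.induct) (auto intro: scaled.intros)
qed

lemma scaled_empty [simp]: "scaled M {} Z = {\<zero>\<^bsub>M\<^esub>}"
  by (auto elim: scaled.cases intro: scaled.intros)

context module
begin

lemma scaled_mult:
  "e \<in> E \<Longrightarrow> z \<in> Z \<Longrightarrow> e \<odot>\<^bsub>M\<^esub> z \<in> carrier M \<Longrightarrow> e \<odot>\<^bsub>M\<^esub> z \<in> scaled M E Z"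
  using scaled.step[OF _ _ scaled.zero, of e E z Z M] by simp

lemma scaled_least:
  assumes "submodule H R M" "\<And>e z. e \<in> E \<Longrightarrow> z \<in> Z \<Longrightarrow> e \<odot>\<^bsub>M\<^esub> z \<in> H"
  shows "scaled M E Z \<subseteq> H"
proof
  fix x assume "x \<in> scaled M E Z"
  then show "x \<in> H"
    using assms submoduleD[OF module_axioms assms(1)] by (induction rule: scaled.induct) auto
qed

lemma scaled_submodule:
  assumes "E \<subseteq> carrier R" "submodule Z R M"
  shows "submodule (scaled M E Z) R M"
proof (rule submoduleI)
  note Z = submoduleD[OF module_axioms assms(2)]
  have e: "e \<in> E \<Longrightarrow> e \<in> carrier R" for e using assms by auto
  show sub: "scaled M E Z \<subseteq> carrier M"
    by (rule scaled_least[OF carrier_is_submodule]) (use e Z in auto)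
  show "\<zero>\<^bsub>M\<^esub> \<in> scaled M E Z" by (rule scaled.zero)
  show "x \<oplus>\<^bsub>M\<^esub> y \<in> scaled M E Z" if "x \<in> scaled M E Z" "y \<in> scaled M E Z" for x y
    using that
  proof (induction rule: scaled.induct)
    case zero
    then show ?case using sub by auto
  next
    case (step e z x)
    have "(e \<odot>\<^bsub>M\<^esub> z \<oplus>\<^bsub>M\<^esub> x) \<oplus>\<^bsub>M\<^esub> y = e \<odot>\<^bsub>M\<^esub> z \<oplus>\<^bsub>M\<^esub> (x \<oplus>\<^bsub>M\<^esub> y)"
      using step e Z sub by (intro M.a_assoc) auto
    then show ?case using step by (auto intro: scaled.intros)
  qed
  show "r \<odot>\<^bsub>M\<^esub> x \<in> scaled M E Z" if r: "r \<in> carrier R" and "x \<in> scaled M E Z" for r x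
    using that(2)
  proof (induction rule: scaled.induct)
    case zero
    then show ?case using r by (auto intro: scaled.zero)
  next
    case (step e z x)
    have "r \<odot>\<^bsub>M\<^esub> (e \<odot>\<^bsub>M\<^esub> z \<oplus>\<^bsub>M\<^esub> x) = e \<odot>\<^bsub>M\<^esub> (r \<odot>\<^bsub>M\<^esub> z) \<oplus>\<^bsub>M\<^esub> r \<odot>\<^bsub>M\<^esub> x"
      using step e Z sub r
      by (auto simp: smult_r_distr smult_assoc1[symmetric] R.m_comm subset_iff)
    then show ?case using step r Z by (auto intro: scaled.intros)
  qed
  then have "(\<ominus> \<one>) \<odot>\<^bsub>M\<^esub> x \<in> scaled M E Z" if "x \<in> scaled M E Z" for x
    using that by auto
  then show "\<ominus>\<^bsub>M\<^esub> x \<in> scaled M E Z" if "x \<in> scaled M E Z" for x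
    using that sub by (metis R.one_closed smult_l_minus smult_one subsetD)
qed

lemma scaled_lincomb:
  assumes "x \<in> scaled M E Z" "E \<subseteq> carrier R" "Z \<subseteq> carrier M"
  shows "\<exists>(n::nat) e z. e \<in> {..<n} \<rightarrow> E \<and> z \<in> {..<n} \<rightarrow> Z \<and> x = lincomb M {..<n} e z"
  using assms(1)
proof (induction rule: scaled.induct)
  case zero
  show ?case by (intro exI[of _ "0::nat"]) auto
next
  case (step e0 z0 x)
  then obtain n :: nat and e z where n: "e \<in> {..<n} \<rightarrow> E" "z \<in> {..<n} \<rightarrow> Z" "x = lincomb M {..<n} e z"
    by blast
  have "lincomb M {..<Suc n} (e(n := e0)) (z(n := z0)) =
        e0 \<odot>\<^bsub>M\<^esub> z0 \<oplus>\<^bsub>M\<^esub> lincomb M {..<n} (e(n := e0)) (z(n := z0))"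
    unfolding lessThan_Suc using n step assms
    by (subst lincomb_insert) (auto simp: Pi_iff)
  also have "lincomb M {..<n} (e(n := e0)) (z(n := z0)) = x"
    unfolding n(3) using n assms by (intro lincomb_cong) (auto simp: Pi_iff)
  finally have "lincomb M {..<Suc n} (e(n := e0)) (z(n := z0)) = e0 \<odot>\<^bsub>M\<^esub> z0 \<oplus>\<^bsub>M\<^esub> x" .
  then show ?case using n(1,2) step.hyps(1,2)
    by (intro exI[of _ "Suc n"] exI[of _ "e(n := e0)"] exI[of _ "z(n := z0)"])
      (simp del: fun_upd_apply, auto simp: Pi_iff)
qed

lemma self_module: "module R (self_module R)"
  by (rule self_module_module[OF R.is_cring])

lemma ideal_span_submodule: "E \<subseteq> carrier R \<Longrightarrow> submodule (ideal_span R E) R (self_module R)"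
  using module.scaled_submodule[OF self_module _ module.carrier_is_submodule[OF self_module]] by simp

lemma ideal_span_smult:
  assumes "j \<in> ideal_span R E" "z \<in> Z" "E \<subseteq> carrier R" "submodule Z R M"
  shows "j \<odot>\<^bsub>M\<^esub> z \<in> scaled M E Z"
proof -
  note Z = submoduleD[OF module_axioms assms(4)]
  have sub: "ideal_span R E \<subseteq> carrier R"
    using submoduleD(1)[OF self_module ideal_span_submodule[OF assms(3)]] by simp
  show ?thesis using assms(1)
  proof (induction rule: scaled.induct)
    case zero
    then show ?case using assms Z by (auto intro: scaled.zero)
  next
    case (step e c x)
    then have "e \<in> carrier R" "c \<in> carrier R" "x \<in> carrier R" "z \<in> carrier M"
      using assms sub Z by auto
    then have "(e \<odot>\<^bsub>self_module R\<^esub> c \<oplus>\<^bsub>self_module R\<^esub> x) \<odot>\<^bsub>M\<^esub> z = e \<odot>\<^bsub>M\<^esub> (c \<odot>\<^bsub>M\<^esub> z) \<oplus>\<^bsub>M\<^esub> x \<odot>\<^bsub>M\<^esub> z"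
      by (simp add: smult_l_distr smult_assoc1)
    then show ?case using step Z assms by (auto intro: scaled.intros)
  qed
qed

lemma lincomb_ideal_span:
  assumes "finite I" "a \<in> I \<rightarrow> ideal_span R E" "z \<in> I \<rightarrow> Z" "E \<subseteq> carrier R" "submodule Z R M"
  shows "lincomb M I a z \<in> scaled M E Z"
proof -
  note D = submoduleD[OF module_axioms scaled_submodule[OF assms(4,5)]]
  have sub: "ideal_span R E \<subseteq> carrier R"
    using submoduleD(1)[OF self_module ideal_span_submodule[OF assms(4)]] by simp
  show ?thesis using assms(1-3)
  proof (induction I rule: finite_induct)
    case empty
    then show ?case by (simp add: scaled.zero)
  next
    case (insert i I)
    have "lincomb M (insert i I) a z = a i \<odot>\<^bsub>M\<^esub> z i \<oplus>\<^bsub>M\<^esub> lincomb M I a z"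
      using insert sub submoduleD(1)[OF module_axioms assms(5)]
      by (intro lincomb_insert) (auto simp: Pi_iff)
    then show ?case
      using insert D(5) ideal_span_smult[OF _ _ assms(4,5), of "a i" "z i"] by auto
  qed
qed

end

lemma (in linear_map) scaled_image:
  assumes "E \<subseteq> carrier R" "Z \<subseteq> carrier M"
  shows "h ` scaled M E Z = scaled N E (h ` Z)"
proof (intro equalityI subsetI)
  have sub: "x \<in> carrier M" if "x \<in> scaled M E Z" for x
    using M.scaled_least[OF M.carrier_is_submodule, of E Z] assms that by blast
  fix y assume "y \<in> h ` scaled M E Z"
  then obtain x where x: "x \<in> scaled M E Z" "y = h x" by blast
  have "h x \<in> scaled N E (h ` Z)" using x(1)
  proof (induction rule: scaled.induct)
    case (step e z x)
    then have "h (e \<odot>\<^bsub>M\<^esub> z \<oplus>\<^bsub>M\<^esub> x) = e \<odot>\<^bsub>N\<^esub> h z \<oplus>\<^bsub>N\<^esub> h x"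
      using assms sub by (subst hom_add) (auto simp: hom_smult subset_iff)
    with step show ?case by (auto intro: scaled.intros)
  qed (auto intro: scaled.zero)
  with x show "y \<in> scaled N E (h ` Z)" by simp
next
  have sub: "x \<in> carrier M" if "x \<in> scaled M E Z" for x
    using M.scaled_least[OF M.carrier_is_submodule, of E Z] assms that by blast
  fix y assume "y \<in> scaled N E (h ` Z)"
  then show "y \<in> h ` scaled M E Z"
  proof (induction rule: scaled.induct)
    case zero
    show ?case using scaled.zero hom_zero by (metis image_eqI)
  next
    case (step e y x)
    then obtain z x' where zx: "z \<in> Z" "y = h z" "x' \<in> scaled M E Z" "x = h x'" by blast
    then have "h (e \<odot>\<^bsub>M\<^esub> z \<oplus>\<^bsub>M\<^esub> x') = e \<odot>\<^bsub>N\<^esub> y \<oplus>\<^bsub>N\<^esub> x"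
      using assms sub step by (subst hom_add) (auto simp: hom_smult subset_iff)
    then show ?case using step zx by (metis image_eqI scaled.step)
  qed
qed

text \<open>
  Here \<open>r q\<close>, for \<open>q\<close> in \<open>Q\<close>, are the coefficient
  vectors of relations between the entries of \<open>m\<close>. The relations are trivial if
  \<open>m\<close> is, modulo \<open>EZ\<close>, the image of some vector \<open>w\<close> under
  a matrix \<open>S\<close> over \<open>A0\<close> whose columns satisfy the same relations
  modulo the ideal generated by \<open>E\<close>: the relations of \<open>m\<close> are then
  consequences of relations in the ring.
\<close>

definition trivial_relations ::
    "('r, 'x) ring_scheme \<Rightarrow> 'r set \<Rightarrow> 'r set \<Rightarrow> ('r, 'm, 'y) module_scheme \<Rightarrow> 'm set \<Rightarrow>
     'i set \<Rightarrow> 'q set \<Rightarrow> ('q \<Rightarrow> 'i \<Rightarrow> 'r) \<Rightarrow> ('i \<Rightarrow> 'm) \<Rightarrow> bool"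
  where "trivial_relations R A0 E M Z I Q r m \<longleftrightarrow>
    (\<exists>(p::nat) S w. S \<in> I \<rightarrow> {..<p} \<rightarrow> A0 \<and> w \<in> {..<p} \<rightarrow> Z \<and>
       (\<forall>q\<in>Q. \<forall>j<p. lincomb (self_module R) I (r q) (\<lambda>i. S i j) \<in> ideal_span R E) \<and>
       (\<forall>i\<in>I. m i \<ominus>\<^bsub>M\<^esub> lincomb M {..<p} (S i) w \<in> scaled M E Z))"

text \<open>
  The equational criterion. For empty \<open>E\<close> it expresses that \<open>Z\<close> is
  flat over the subring \<open>A0\<close>. If \<open>A0\<close> is the whole ring, it expresses
  that \<open>Z/EZ\<close> is flat over the quotient of the ring by the ideal of
  \<open>E\<close>, without reference to cosets.
\<close>

definition relation_flat ::
    "('r, 'x) ring_scheme \<Rightarrow> 'r set \<Rightarrow> 'r set \<Rightarrow> ('r, 'm, 'y) module_scheme \<Rightarrow> 'm set \<Rightarrow> bool"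
  where "relation_flat R A0 E M Z \<longleftrightarrow>
    (\<forall>(n::nat) r m. r \<in> {..<n} \<rightarrow> A0 \<longrightarrow> m \<in> {..<n} \<rightarrow> Z \<longrightarrow>
       lincomb M {..<n} r m \<in> scaled M E Z \<longrightarrow>
       trivial_relations R A0 E M Z {..<n} {()} (\<lambda>_. r) m)"

locale coefficients = cring R for R (structure) +
  fixes A0 E
  assumes A0_sub: "A0 \<subseteq> carrier R" and E_sub: "E \<subseteq> carrier R"
    and A0_zero: "\<zero> \<in> A0" and A0_one: "\<one> \<in> A0"
    and A0_add: "a \<in> A0 \<Longrightarrow> b \<in> A0 \<Longrightarrow> a \<oplus> b \<in> A0"
    and A0_mult: "a \<in> A0 \<Longrightarrow> b \<in> A0 \<Longrightarrow> a \<otimes> b \<in> A0"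
begin

sublocale self: module R "self_module R" by (rule self_module_module[OF is_cring])

lemma A0_lincomb: "finite I \<Longrightarrow> a \<in> I \<rightarrow> A0 \<Longrightarrow> b \<in> I \<rightarrow> A0 \<Longrightarrow> lincomb (self_module R) I a b \<in> A0"
proof (induction I rule: finite_induct)
  case empty
  then show ?case by (simp add: A0_zero)
next
  case (insert i I)
  have "lincomb (self_module R) (insert i I) a b = a i \<otimes> b i \<oplus> lincomb (self_module R) I a b"
    using insert A0_sub by (subst self.lincomb_insert) (auto simp: Pi_iff)
  then show ?case using insert by (auto intro: A0_add A0_mult)
qed

end

locale coefficient_module = coefficients R A0 E + M: module R M
  for R (structure) and A0 and E and M (structure) +
  fixes Z
  assumes Z_sub: "submodule Z R M"
begin

lemma EZ: "submodule (scaled M E Z) R M"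
  by (rule M.scaled_submodule[OF E_sub Z_sub])

lemmas Z = submoduleD[OF M.module_axioms Z_sub]
lemmas EZD = submoduleD[OF M.module_axioms EZ]

lemma trivial_cong:
  "trivial_relations R A0 E M Z I Q r m \<Longrightarrow> (\<And>i. i \<in> I \<Longrightarrow> m' i = m i) \<Longrightarrow>
   trivial_relations R A0 E M Z I Q r m'"
  unfolding trivial_relations_def by auto

lemma trivial_zero: "trivial_relations R A0 E M Z I Q r (\<lambda>i. \<zero>\<^bsub>M\<^esub>)"
  unfolding trivial_relations_def
  by (intro exI[of _ "0::nat"]) (auto simp: a_minus_def scaled.zero M.M.r_neg)

lemma trivial_single:
  assumes "s \<in> I \<rightarrow> A0" "w \<in> Z" "\<And>q. q \<in> Q \<Longrightarrow> lincomb (self_module R) I (r q) s \<in> ideal_span R E"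
  shows "trivial_relations R A0 E M Z I Q r (\<lambda>i. s i \<odot>\<^bsub>M\<^esub> w)"
proof -
  have "s i \<odot>\<^bsub>M\<^esub> w \<ominus>\<^bsub>M\<^esub> lincomb M {..<1::nat} (\<lambda>_. s i) (\<lambda>_. w) = \<zero>\<^bsub>M\<^esub>" if "i \<in> I" for i
  proof -
    have c: "s i \<in> carrier R" "w \<in> carrier M" using assms that A0_sub Z by auto
    then have "lincomb M {..<1::nat} (\<lambda>_. s i) (\<lambda>_. w) = s i \<odot>\<^bsub>M\<^esub> w"
      using M.lincomb_insert[of "{}" "0::nat" "\<lambda>_. s i" "\<lambda>_. w"] by (simp add: lessThan_Suc)
    then show ?thesis using c by (simp add: a_minus_def M.M.r_neg)
  qed
  then show ?thesis unfolding trivial_relations_def using assms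
    by (intro exI[of _ "1::nat"] exI[of _ "\<lambda>i _. s i"] exI[of _ "\<lambda>_. w"]) (auto intro: scaled.zero)
qed

lemma trivial_add:
  assumes "trivial_relations R A0 E M Z I Q r m" "trivial_relations R A0 E M Z I Q r m'"
    and "m \<in> I \<rightarrow> carrier M" "m' \<in> I \<rightarrow> carrier M"
  shows "trivial_relations R A0 E M Z I Q r (\<lambda>i. m i \<oplus>\<^bsub>M\<^esub> m' i)"
proof -
  obtain p :: nat and S w where 1: "S \<in> I \<rightarrow> {..<p} \<rightarrow> A0" "w \<in> {..<p} \<rightarrow> Z"
    "\<forall>q\<in>Q. \<forall>j<p. lincomb (self_module R) I (r q) (\<lambda>i. S i j) \<in> ideal_span R E"
    "\<forall>i\<in>I. m i \<ominus>\<^bsub>M\<^esub> lincomb M {..<p} (S i) w \<in> scaled M E Z"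
    using assms(1) unfolding trivial_relations_def by blast
  obtain p' :: nat and S' w' where 2: "S' \<in> I \<rightarrow> {..<p'} \<rightarrow> A0" "w' \<in> {..<p'} \<rightarrow> Z"
    "\<forall>q\<in>Q. \<forall>j<p'. lincomb (self_module R) I (r q) (\<lambda>i. S' i j) \<in> ideal_span R E"
    "\<forall>i\<in>I. m' i \<ominus>\<^bsub>M\<^esub> lincomb M {..<p'} (S' i) w' \<in> scaled M E Z"
    using assms(2) unfolding trivial_relations_def by blast
  have "(m i \<oplus>\<^bsub>M\<^esub> m' i) \<ominus>\<^bsub>M\<^esub> lincomb M {..<p + p'} (cat p (S i) (S' i)) (cat p w w') \<in> scaled M E Z"
    if i: "i \<in> I" for i
  proof -
    have c: "S i \<in> {..<p} \<rightarrow> carrier R" "S' i \<in> {..<p'} \<rightarrow> carrier R" "w \<in> {..<p} \<rightarrow> carrier M"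
      "w' \<in> {..<p'} \<rightarrow> carrier M" "m i \<in> carrier M" "m' i \<in> carrier M"
      using 1 2 i assms Z(1) A0_sub by (auto simp: Pi_iff subset_iff)
    let ?a = "lincomb M {..<p} (S i) w" and ?b = "lincomb M {..<p'} (S' i) w'"
    have ab: "?a \<in> carrier M" "?b \<in> carrier M" using c by auto
    have "(m i \<oplus>\<^bsub>M\<^esub> m' i) \<ominus>\<^bsub>M\<^esub> (?a \<oplus>\<^bsub>M\<^esub> ?b) = (m i \<ominus>\<^bsub>M\<^esub> ?a) \<oplus>\<^bsub>M\<^esub> (m' i \<ominus>\<^bsub>M\<^esub> ?b)"
      using c ab by (simp add: a_minus_def M.M.minus_add M.M.add.m_ac)
    then show ?thesis
      using 1(4) 2(4) i EZD(5) M.lincomb_cat[OF c(1-4)] by auto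
  qed
  moreover have "lincomb (self_module R) I (r q) (\<lambda>i. cat p (S i) (S' i) j) \<in> ideal_span R E"
    if "q \<in> Q" "j < p + p'" for q j
    using 1(3) 2(3) that by (cases "j < p") (auto simp: cat_def)
  moreover have "(\<lambda>i. cat p (S i) (S' i)) \<in> I \<rightarrow> {..<p + p'} \<rightarrow> A0"
  proof
    fix i assume "i \<in> I"
    then show "cat p (S i) (S' i) \<in> {..<p + p'} \<rightarrow> A0" using 1(1) 2(1) by (intro cat_Pi) auto
  qed
  moreover have "cat p w w' \<in> {..<p + p'} \<rightarrow> Z" using 1 2 by (intro cat_Pi)
  ultimately show ?thesis
    unfolding trivial_relations_def
    by (intro exI[of _ "p + p'"] exI[of _ "\<lambda>i. cat p (S i) (S' i)"] exI[of _ "cat p w w'"]) auto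
qed

lemma trivial_finsum:
  assumes "finite K" "\<And>k. k \<in> K \<Longrightarrow> trivial_relations R A0 E M Z I Q r (m k)"
    "\<And>k. k \<in> K \<Longrightarrow> m k \<in> I \<rightarrow> carrier M"
  shows "trivial_relations R A0 E M Z I Q r (\<lambda>i. \<Oplus>\<^bsub>M\<^esub>k\<in>K. m k i)"
  using assms
proof (induction K rule: finite_induct)
  case empty
  then show ?case by (simp add: trivial_zero)
next
  case (insert k K)
  have "trivial_relations R A0 E M Z I Q r (\<lambda>i. m k i \<oplus>\<^bsub>M\<^esub> (\<Oplus>\<^bsub>M\<^esub>k\<in>K. m k i))"
    using insert by (intro trivial_add) (auto simp: Pi_iff intro!: M.M.finsum_closed)
  then show ?case
    using insert by (elim trivial_cong) (auto simp: Pi_iff)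
qed

lemma trivial_smult:
  assumes "trivial_relations R A0 E M Z I Q r m" "c \<in> carrier R" "m \<in> I \<rightarrow> carrier M"
  shows "trivial_relations R A0 E M Z I Q r (\<lambda>i. c \<odot>\<^bsub>M\<^esub> m i)"
proof -
  obtain p :: nat and S w where 1: "S \<in> I \<rightarrow> {..<p} \<rightarrow> A0" "w \<in> {..<p} \<rightarrow> Z"
    "\<forall>q\<in>Q. \<forall>j<p. lincomb (self_module R) I (r q) (\<lambda>i. S i j) \<in> ideal_span R E"
    "\<forall>i\<in>I. m i \<ominus>\<^bsub>M\<^esub> lincomb M {..<p} (S i) w \<in> scaled M E Z"
    using assms(1) unfolding trivial_relations_def by blast
  have "c \<odot>\<^bsub>M\<^esub> m i \<ominus>\<^bsub>M\<^esub> lincomb M {..<p} (S i) (\<lambda>j. c \<odot>\<^bsub>M\<^esub> w j) \<in> scaled M E Z" if i: "i \<in> I" for i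
  proof -
    have cc: "S i \<in> {..<p} \<rightarrow> carrier R" "w \<in> {..<p} \<rightarrow> carrier M" "m i \<in> carrier M"
      using 1 i assms Z(1) A0_sub by (auto simp: Pi_iff subset_iff)
    have "c \<odot>\<^bsub>M\<^esub> m i \<ominus>\<^bsub>M\<^esub> lincomb M {..<p} (S i) (\<lambda>j. c \<odot>\<^bsub>M\<^esub> w j) =
          c \<odot>\<^bsub>M\<^esub> (m i \<ominus>\<^bsub>M\<^esub> lincomb M {..<p} (S i) w)"
      using cc assms by (simp add: M.smult_lincomb(2)[symmetric] a_minus_def M.smult_r_distr M.smult_r_minus)
    then show ?thesis using 1(4) i EZD(7) assms by auto
  qed
  then show ?thesis using 1 Z(7) assms(2) unfolding trivial_relations_def
    by (intro exI[of _ p] exI[of _ S] exI[of _ "\<lambda>j. c \<odot>\<^bsub>M\<^esub> w j"]) (auto simp: Pi_iff)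
qed

lemma trivial_no_relations:
  assumes "finite I" "m \<in> I \<rightarrow> Z"
  shows "trivial_relations R A0 E M Z I {} r m"
proof -
  have m: "m \<in> I \<rightarrow> carrier M" using assms Z by auto
  have s: "(if i = k then \<one> else \<zero>) \<in> A0" for i k using A0_zero A0_one by auto
  have "trivial_relations R A0 E M Z I {} r (\<lambda>i. \<Oplus>\<^bsub>M\<^esub>k\<in>I. (if i = k then \<one> else \<zero>) \<odot>\<^bsub>M\<^esub> m k)"
  proof (rule trivial_finsum[OF assms(1)])
    fix k assume "k \<in> I"
    then show "trivial_relations R A0 E M Z I {} r (\<lambda>i. (if i = k then \<one> else \<zero>) \<odot>\<^bsub>M\<^esub> m k)"
      using A0_zero A0_one assms by (intro trivial_single[where w = "m k"]) auto
    show "(\<lambda>i. (if i = k then \<one> else \<zero>) \<odot>\<^bsub>M\<^esub> m k) \<in> I \<rightarrow> carrier M"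
      using \<open>k \<in> I\<close> m by auto
  qed
  then show ?thesis
  proof (rule trivial_cong)
    fix i assume i: "i \<in> I"
    have "(\<Oplus>\<^bsub>M\<^esub>k\<in>I. (if i = k then \<one> else \<zero>) \<odot>\<^bsub>M\<^esub> m k) = (\<Oplus>\<^bsub>M\<^esub>k\<in>I. if i = k then m k else \<zero>\<^bsub>M\<^esub>)"
      by (rule M.M.finsum_cong') (use m in \<open>auto simp: Pi_iff\<close>)
    also have "\<dots> = m i" using i m assms(1) by (intro M.M.add.finprod_singleton)
    finally show "m i = (\<Oplus>\<^bsub>M\<^esub>k\<in>I. (if i = k then \<one> else \<zero>) \<odot>\<^bsub>M\<^esub> m k)" by simp
  qed
qed

lemma relation_flat_index:
  assumes flat: "relation_flat R A0 E M Z" and "finite I" "r \<in> I \<rightarrow> A0" "m \<in> I \<rightarrow> Z"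
    "lincomb M I r m \<in> scaled M E Z"
  shows "trivial_relations R A0 E M Z I {()} (\<lambda>_. r) m"
proof -
  obtain h where h: "bij_betw h {..<card I} I"
    using ex_bij_betw_nat_finite[OF assms(2)] by (auto simp: atLeast0LessThan)
  define g where "g = the_inv_into {..<card I} h"
  have inj: "inj_on h {..<card I}" and im: "h ` {..<card I} = I" using h by (auto simp: bij_betw_def)
  have gh: "g (h k) = k" if "k < card I" for k
    unfolding g_def using inj that by (simp add: the_inv_into_f_f)
  have hg: "h (g i) = i" "g i < card I" if "i \<in> I" for i
  proof -
    have "i \<in> h ` {..<card I}" using that im by simp
    then show "h (g i) = i" "g i < card I" using gh by auto
  qed
  have hI: "h k \<in> I" if "k < card I" for k using im that by auto
  have rm: "r \<in> h ` {..<card I} \<rightarrow> carrier R" "m \<in> h ` {..<card I} \<rightarrow> carrier M"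
    using im assms A0_sub Z by auto
  have "lincomb M {..<card I} (\<lambda>k. r (h k)) (\<lambda>k. m (h k)) \<in> scaled M E Z"
    using assms(5) M.lincomb_reindex[OF inj rm] im by simp
  then have "trivial_relations R A0 E M Z {..<card I} {()} (\<lambda>_ k. r (h k)) (\<lambda>k. m (h k))"
    using assms(3,4) hI flat[unfolded relation_flat_def, rule_format, of "\<lambda>k. r (h k)" "card I" "\<lambda>k. m (h k)"]
    by (auto simp: Pi_iff)
  then obtain p :: nat and S w where 1: "S \<in> {..<card I} \<rightarrow> {..<p} \<rightarrow> A0" "w \<in> {..<p} \<rightarrow> Z"
    "\<forall>j<p. lincomb (self_module R) {..<card I} (\<lambda>k. r (h k)) (\<lambda>i. S i j) \<in> ideal_span R E"
    "\<forall>i<card I. m (h i) \<ominus>\<^bsub>M\<^esub> lincomb M {..<p} (S i) w \<in> scaled M E Z"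
    unfolding trivial_relations_def by auto
  have "lincomb (self_module R) I r (\<lambda>i. S (g i) j) \<in> ideal_span R E" if j: "j < p" for j
  proof -
    have "lincomb (self_module R) (h ` {..<card I}) r (\<lambda>i. S (g i) j) =
          lincomb (self_module R) {..<card I} (\<lambda>k. r (h k)) (\<lambda>k. S (g (h k)) j)"
      using 1(1) gh j rm A0_sub by (intro self.lincomb_reindex inj) (auto simp: Pi_iff subset_iff)
    also have "\<dots> = lincomb (self_module R) {..<card I} (\<lambda>k. r (h k)) (\<lambda>k. S k j)"
      using 1(1) gh j rm A0_sub by (intro self.lincomb_cong) (auto simp: Pi_iff subset_iff)
    finally show ?thesis using 1(3) j im by simp
  qed
  moreover have "m i \<ominus>\<^bsub>M\<^esub> lincomb M {..<p} (S (g i)) w \<in> scaled M E Z" if "i \<in> I" for i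
    using 1(4) hg that by (metis (no_types))
  ultimately show ?thesis
    unfolding trivial_relations_def using 1(1,2) hg
    by (intro exI[of _ p] exI[of _ "\<lambda>i. S (g i)"] exI[of _ w]) auto
qed

text \<open>
  Several relations are made trivial one after the other: once \<open>m = S w\<close> for the
  first relations, the next relation becomes a relation for \<open>w\<close>. Making it trivial
  writes \<open>w\<close> as \<open>S' w'\<close>, and the columns of the product of
  \<open>S\<close> and \<open>S'\<close> still satisfy the first relations.
\<close>

lemma relation_flat_rows:
  assumes flat: "relation_flat R A0 E M Z" and "finite I" "finite Q" "r \<in> Q \<rightarrow> I \<rightarrow> A0" "m \<in> I \<rightarrow> Z"
    "\<And>q. q \<in> Q \<Longrightarrow> lincomb M I (r q) m \<in> scaled M E Z"
  shows "trivial_relations R A0 E M Z I Q r m"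
  using assms(3,4,6)
proof (induction Q rule: finite_induct)
  case empty
  show ?case using assms by (intro trivial_no_relations)
next
  case (insert q Q)
  then have "trivial_relations R A0 E M Z I Q r m" by auto
  then obtain p :: nat and S w where 1: "S \<in> I \<rightarrow> {..<p} \<rightarrow> A0" "w \<in> {..<p} \<rightarrow> Z"
    "\<forall>q\<in>Q. \<forall>j<p. lincomb (self_module R) I (r q) (\<lambda>i. S i j) \<in> ideal_span R E"
    "\<forall>i\<in>I. m i \<ominus>\<^bsub>M\<^esub> lincomb M {..<p} (S i) w \<in> scaled M E Z"
    unfolding trivial_relations_def by blast
  have rA: "r q' i \<in> A0" if "q' \<in> insert q Q" "i \<in> I" for q' i using insert.prems that by auto
  have r: "r q' \<in> I \<rightarrow> carrier R" if "q' \<in> insert q Q" for q' using rA that A0_sub by auto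
  have SA: "S i j \<in> A0" if "i \<in> I" "j < p" for i j using 1(1) that by auto
  have S: "S \<in> I \<rightarrow> {..<p} \<rightarrow> carrier R" using SA A0_sub by auto
  have w: "w \<in> {..<p} \<rightarrow> carrier M" and m: "m \<in> I \<rightarrow> carrier M" using 1(2) assms(5) Z by auto
  define t where "t j = lincomb (self_module R) I (r q) (\<lambda>i. S i j)" for j
  have t: "t \<in> {..<p} \<rightarrow> A0" unfolding t_def using SA rA by (auto intro!: A0_lincomb assms)
  have Sw: "(\<lambda>i. lincomb M {..<p} (S i) w) \<in> I \<rightarrow> carrier M" using S w by auto
  have "lincomb M I (r q) (\<lambda>i. m i \<ominus>\<^bsub>M\<^esub> lincomb M {..<p} (S i) w) \<in> scaled M E Z"
    using 1(4) r by (intro M.lincomb_in_submodule[OF EZ]) auto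
  then have d: "lincomb M I (r q) m \<ominus>\<^bsub>M\<^esub> lincomb M {..<p} t w \<in> scaled M E Z"
    using M.lincomb_minus_right[OF r m Sw, of q] M.lincomb_lincomb[OF assms(2) _ r S w, of q]
    by (simp add: t_def[abs_def])
  have c: "lincomb M I (r q) m \<in> carrier M" "lincomb M {..<p} t w \<in> carrier M"
    using r m w t A0_sub by (auto intro!: M.lincomb_closed)
  have "lincomb M {..<p} t w = lincomb M I (r q) m \<ominus>\<^bsub>M\<^esub> (lincomb M I (r q) m \<ominus>\<^bsub>M\<^esub> lincomb M {..<p} t w)"
    using c by (simp add: a_minus_def M.M.minus_add M.M.r_neg2)
  then have "lincomb M {..<p} t w \<in> scaled M E Z"
    using EZD(6)[OF insert.prems(2)[OF insertI1] d] by metis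
  then have "trivial_relations R A0 E M Z {..<p} {()} (\<lambda>_. t) w"
    using t 1(2) by (intro relation_flat_index[OF flat]) auto
  then obtain p' :: nat and S' w' where 2: "S' \<in> {..<p} \<rightarrow> {..<p'} \<rightarrow> A0" "w' \<in> {..<p'} \<rightarrow> Z"
    "\<forall>k<p'. lincomb (self_module R) {..<p} t (\<lambda>j. S' j k) \<in> ideal_span R E"
    "\<forall>j<p. w j \<ominus>\<^bsub>M\<^esub> lincomb M {..<p'} (S' j) w' \<in> scaled M E Z"
    unfolding trivial_relations_def by auto
  have SA': "S' j k \<in> A0" if "j < p" "k < p'" for j k using 2(1) that by auto
  have S': "S' \<in> {..<p} \<rightarrow> {..<p'} \<rightarrow> carrier R" using SA' A0_sub by auto
  have w': "w' \<in> {..<p'} \<rightarrow> carrier M" using 2(2) Z by auto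
  define S'' where "S'' i k = lincomb (self_module R) {..<p} (S i) (\<lambda>j. S' j k)" for i k
  have SA'': "S'' \<in> I \<rightarrow> {..<p'} \<rightarrow> A0" unfolding S''_def using SA SA' by (auto intro!: A0_lincomb)
  have rows: "lincomb (self_module R) I (r q') (\<lambda>i. S'' i k) =
     lincomb (self_module R) {..<p} (\<lambda>j. lincomb (self_module R) I (r q') (\<lambda>i. S i j)) (\<lambda>j. S' j k)"
    if "q' \<in> insert q Q" "k < p'" for q' k
    unfolding S''_def using that S S' r assms by (intro self.lincomb_lincomb) auto
  have "lincomb (self_module R) I (r q') (\<lambda>i. S'' i k) \<in> ideal_span R E"
    if q': "q' \<in> insert q Q" and k: "k < p'" for q' k
  proof (cases "q' = q")
    case True
    then show ?thesis using 2(3) k rows[OF q' k] by (simp add: t_def[abs_def])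
  next
    case False
    then show ?thesis unfolding rows[OF q' k] using 1(3) q' k S'
      by (intro self.lincomb_ideal_span E_sub) (auto intro: self.carrier_is_submodule[simplified])
  qed
  moreover have "m i \<ominus>\<^bsub>M\<^esub> lincomb M {..<p'} (S'' i) w' \<in> scaled M E Z" if i: "i \<in> I" for i
  proof -
    have Si: "S i \<in> {..<p} \<rightarrow> carrier R" using S i by auto
    have S'w': "(\<lambda>j. lincomb M {..<p'} (S' j) w') \<in> {..<p} \<rightarrow> carrier M" using S' w' by auto
    have e: "lincomb M {..<p'} (S'' i) w' = lincomb M {..<p} (S i) (\<lambda>j. lincomb M {..<p'} (S' j) w')"
      unfolding S''_def using Si S' w' by (intro M.lincomb_lincomb[symmetric]) auto
    have "lincomb M {..<p} (S i) (\<lambda>j. w j \<ominus>\<^bsub>M\<^esub> lincomb M {..<p'} (S' j) w') \<in> scaled M E Z"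
      using 2(4) Si by (intro M.lincomb_in_submodule[OF EZ]) auto
    then have "lincomb M {..<p} (S i) w \<ominus>\<^bsub>M\<^esub> lincomb M {..<p'} (S'' i) w' \<in> scaled M E Z"
      using M.lincomb_minus_right[OF Si w S'w'] e by simp
    from EZD(5)[OF 1(4)[rule_format, OF i] this]
    show ?thesis
    proof (rule back_subst[of "\<lambda>x. x \<in> scaled M E Z"])
      let ?a = "lincomb M {..<p} (S i) w" and ?b = "lincomb M {..<p'} (S'' i) w'"
      have "m i \<in> carrier M" "?a \<in> carrier M" "?b \<in> carrier M"
        using m i Si w e S'w' by auto
      then show "m i \<ominus>\<^bsub>M\<^esub> ?a \<oplus>\<^bsub>M\<^esub> (?a \<ominus>\<^bsub>M\<^esub> ?b) = m i \<ominus>\<^bsub>M\<^esub> ?b"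
        by (simp add: a_minus_def M.M.a_assoc M.M.r_neg1)
    qed
  qed
  ultimately show ?case
    unfolding trivial_relations_def using SA'' 2(2)
    by (intro exI[of _ p'] exI[of _ S''] exI[of _ w']) auto
qed

end

lemma (in coefficients) coefficient_moduleI:
  "module R M \<Longrightarrow> submodule Z R M \<Longrightarrow> coefficient_module R A0 E M Z"
  by (simp add: coefficient_module_def coefficient_module_axioms_def coefficients_axioms)

lemma (in linear_map) trivial_image:
  assumes "trivial_relations R A0 E M Z I Q r m" "h ` Z \<subseteq> Z'" "m \<in> I \<rightarrow> carrier M" "Z \<subseteq> carrier M"
    "A0 \<subseteq> carrier R" "E \<subseteq> carrier R"
  shows "trivial_relations R A0 E N Z' I Q r (\<lambda>i. h (m i))"
proof -
  obtain p :: nat and S w where 1: "S \<in> I \<rightarrow> {..<p} \<rightarrow> A0" "w \<in> {..<p} \<rightarrow> Z"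
    "\<forall>q\<in>Q. \<forall>j<p. lincomb (self_module R) I (r q) (\<lambda>i. S i j) \<in> ideal_span R E"
    "\<forall>i\<in>I. m i \<ominus>\<^bsub>M\<^esub> lincomb M {..<p} (S i) w \<in> scaled M E Z"
    using assms(1) unfolding trivial_relations_def by blast
  have "h (m i) \<ominus>\<^bsub>N\<^esub> lincomb N {..<p} (S i) (\<lambda>j. h (w j)) \<in> scaled N E Z'" if i: "i \<in> I" for i
  proof -
    have c: "S i \<in> {..<p} \<rightarrow> carrier R" "w \<in> {..<p} \<rightarrow> carrier M" "m i \<in> carrier M"
      using 1 i assms by (auto simp: Pi_iff subset_iff)
    then have "h (m i \<ominus>\<^bsub>M\<^esub> lincomb M {..<p} (S i) w) = h (m i) \<ominus>\<^bsub>N\<^esub> lincomb N {..<p} (S i) (\<lambda>j. h (w j))"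
      by (simp add: hom_minus M.lincomb_closed hom_lincomb)
    moreover have "h (m i \<ominus>\<^bsub>M\<^esub> lincomb M {..<p} (S i) w) \<in> scaled N E (h ` Z)"
      using 1(4) i scaled_image[OF assms(6,4)] by blast
    ultimately show ?thesis using scaled_mono[OF subset_refl assms(2), where E = E and M = N] by auto
  qed
  then show ?thesis unfolding trivial_relations_def using 1 assms(2)
    by (intro exI[of _ p] exI[of _ S] exI[of _ "\<lambda>j. h (w j)"]) (auto simp: Pi_iff)
qed

text \<open>
  The finitely many vectors in a relation have a common finite support. Each coordinate is a
  relation in the ring, and the solutions for the coordinates add up to one for the vectors.
\<close>

lemma (in coefficients) free_module_relation_flat:
  assumes "relation_flat R A0 E (self_module R) (carrier R)"
  shows "relation_flat R A0 E (free_module R X) (carrier (free_module R X))"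
  unfolding relation_flat_def
proof (intro allI impI)
  interpret fm: free_mod R X by unfold_locales
  interpret S: coefficient_module R A0 E "self_module R" "carrier R"
    using self.carrier_is_submodule by (intro coefficient_moduleI self.module_axioms) simp
  interpret FF: coefficient_module R A0 E fm.F "carrier fm.F"
    by (intro coefficient_moduleI fm.F.module_axioms fm.F.carrier_is_submodule)
  fix n :: nat and r m
  assume r: "r \<in> {..<n} \<rightarrow> A0" and m: "m \<in> {..<n} \<rightarrow> carrier fm.F"
    and rel: "lincomb fm.F {..<n} r m \<in> scaled fm.F E (carrier fm.F)"
  have rR: "r \<in> {..<n} \<rightarrow> carrier R" using r A0_sub by auto
  define Y where "Y = (\<Union>i<n. {x. m i x \<noteq> \<zero>})"
  have "finite {x. m i x \<noteq> \<zero>} \<and> {x. m i x \<noteq> \<zero>} \<subseteq> X" if "i < n" for i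
    using m that by (simp add: Pi_iff fm.free_carrier)
  then have Y: "finite Y" "Y \<subseteq> X" unfolding Y_def by blast+
  have mc: "m i x \<in> carrier R" if "i < n" for i x
    using m that by (simp add: Pi_iff fm.free_carrier)
  have "trivial_relations R A0 E fm.F (carrier fm.F) {..<n} {()} (\<lambda>_. r)
          (\<lambda>i. \<Oplus>\<^bsub>fm.F\<^esub>x\<in>Y. m i x \<odot>\<^bsub>fm.F\<^esub> basis_vec R x)"
  proof (rule FF.trivial_finsum[OF Y(1)])
    fix x assume x: "x \<in> Y"
    then have b: "basis_vec R x \<in> carrier fm.F" using Y by auto
    interpret ev: linear_map R fm.F "self_module R" "\<lambda>u. u x" by (rule fm.eval_linear_map)
    have "(\<lambda>u. u x) ` carrier fm.F \<subseteq> carrier R" by (auto simp: fm.free_carrier)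
    then have "lincomb fm.F {..<n} r m x \<in> ideal_span R E"
      using ev.scaled_image[OF E_sub, of "carrier fm.F"] rel scaled_mono[of E E] by blast
    then have "lincomb (self_module R) {..<n} r (\<lambda>i. m i x) \<in> ideal_span R E"
      using fm.lincomb_apply[OF rR m] by simp
    then have t: "trivial_relations R A0 E (self_module R) (carrier R) {..<n} {()} (\<lambda>_. r) (\<lambda>i. m i x)"
      using mc r by (intro S.relation_flat_index[OF assms]) auto
    interpret sc: linear_map R "self_module R" fm.F "\<lambda>c. c \<odot>\<^bsub>fm.F\<^esub> basis_vec R x"
      using b by (intro linear_mapI self.module_axioms fm.F.module_axioms)
        (auto simp: linear_maps_def fm.F.smult_l_distr fm.F.smult_assoc1 simp del: fm.free_ops)
    show "trivial_relations R A0 E fm.F (carrier fm.F) {..<n} {()} (\<lambda>_. r)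
            (\<lambda>i. m i x \<odot>\<^bsub>fm.F\<^esub> basis_vec R x)"
      by (rule sc.trivial_image[OF t]) (use mc b E_sub A0_sub fm.F.smult_closed in \<open>auto simp del: fm.free_ops\<close>)
    show "(\<lambda>i. m i x \<odot>\<^bsub>fm.F\<^esub> basis_vec R x) \<in> {..<n} \<rightarrow> carrier fm.F"
      using mc b fm.F.smult_closed by (auto simp del: fm.free_ops)
  qed
  then show "trivial_relations R A0 E fm.F (carrier fm.F) {..<n} {()} (\<lambda>_. r) m"
  proof (rule FF.trivial_cong)
    fix i assume i: "i \<in> {..<n}"
    then have "lincomb fm.F Y (m i) (basis_vec R) = m i"
      using m Y by (intro fm.free_expand) (auto simp: Y_def)
    then show "m i = (\<Oplus>\<^bsub>fm.F\<^esub>x\<in>Y. m i x \<odot>\<^bsub>fm.F\<^esub> basis_vec R x)" by (simp add: lincomb_def)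
  qed
qed

lemma (in coefficients) self_relation_flat:
  assumes "A0 = carrier R"
  shows "relation_flat R A0 E (self_module R) (carrier R)"
  unfolding relation_flat_def
proof (intro allI impI)
  interpret S: coefficient_module R A0 E "self_module R" "carrier R"
    using self.carrier_is_submodule by (intro coefficient_moduleI self.module_axioms) simp
  fix n :: nat and r m
  assume r: "r \<in> {..<n} \<rightarrow> A0" and m: "m \<in> {..<n} \<rightarrow> carrier R"
    and rel: "lincomb (self_module R) {..<n} r m \<in> ideal_span R E"
  have "trivial_relations R A0 E (self_module R) (carrier R) {..<n} {()} (\<lambda>_. r) (\<lambda>i. m i \<odot>\<^bsub>self_module R\<^esub> \<one>)"
    using m rel by (intro S.trivial_single) (auto simp: assms)
  then show "trivial_relations R A0 E (self_module R) (carrier R) {..<n} {()} (\<lambda>_. r) m"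
    by (rule S.trivial_cong) (use m in \<open>auto simp: Pi_iff\<close>)
qed

locale coefficient_map = coefficients R A0 E + h: linear_map R F G h
  for R (structure) and A0 and E and F and G and h +
  assumes flat_image: "relation_flat R A0 E G (h ` carrier F)"
begin

abbreviation Y where "Y \<equiv> h ` carrier F"
abbreviation K where "K \<equiv> a_kernel F G h"

lemma Y_submodule: "submodule Y R G"
  by (intro h.image_submodule h.M.carrier_is_submodule)

sublocale Y: coefficient_module R A0 E G Y
  by (intro coefficient_moduleI h.N.module_axioms Y_submodule)

sublocale F: coefficient_module R A0 E F "carrier F"
  by (intro coefficient_moduleI h.M.module_axioms h.M.carrier_is_submodule)

lemma K_submodule: "submodule K R F" by (rule h.kernel_submodule)

text \<open>
  Let the images of the \<open>f i\<close> satisfy the relations \<open>r q\<close>. As the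
  image \<open>Y\<close> is flat, \<open>h (f i) = \<Sum>\<^sub>j U i j w j\<close>
  modulo \<open>EY\<close>, with columns of \<open>U\<close> that satisfy the relations.
  Subtracting from \<open>f i\<close> a lift \<open>\<Sum>\<^sub>j U i j u j\<close> of
  this sum and a lift of the error moves \<open>f i\<close> into the kernel, and changes the
  combinations with coefficients \<open>r q\<close> by elements of \<open>EF\<close> only.
\<close>

lemma kernel_lift:
  assumes "finite I" "finite Q" "r \<in> Q \<rightarrow> I \<rightarrow> A0" "f \<in> I \<rightarrow> carrier F"
    and rel: "\<And>q. q \<in> Q \<Longrightarrow> lincomb G I (r q) (\<lambda>i. h (f i)) \<in> scaled G E Y"
  shows "\<exists>z \<in> I \<rightarrow> K. \<forall>q\<in>Q. lincomb F I (r q) f \<ominus>\<^bsub>F\<^esub> lincomb F I (r q) z \<in> scaled F E (carrier F)"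
proof -
  have "trivial_relations R A0 E G Y I Q r (\<lambda>i. h (f i))"
    using assms by (intro Y.relation_flat_rows flat_image) auto
  then obtain p :: nat and U w where 1: "U \<in> I \<rightarrow> {..<p} \<rightarrow> A0" "w \<in> {..<p} \<rightarrow> Y"
    "\<forall>q\<in>Q. \<forall>j<p. lincomb (self_module R) I (r q) (\<lambda>i. U i j) \<in> ideal_span R E"
    "\<forall>i\<in>I. h (f i) \<ominus>\<^bsub>G\<^esub> lincomb G {..<p} (U i) w \<in> scaled G E Y"
    unfolding trivial_relations_def by blast
  have "\<forall>j<p. \<exists>u\<in>carrier F. h u = w j"
  proof (intro allI impI)
    fix j assume "j < p"
    then have "w j \<in> Y" using 1(2) by auto
    then show "\<exists>u\<in>carrier F. h u = w j" by (elim imageE) (rule bexI, auto)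
  qed
  then obtain u where u: "\<And>j. j < p \<Longrightarrow> u j \<in> carrier F" "\<And>j. j < p \<Longrightarrow> h (u j) = w j" by metis
  have U: "U \<in> I \<rightarrow> {..<p} \<rightarrow> carrier R" using 1(1) A0_sub by (auto simp: Pi_iff)
  have uF: "u \<in> {..<p} \<rightarrow> carrier F" using u by auto
  have Uu: "lincomb F {..<p} (U i) u \<in> carrier F" if "i \<in> I" for i using U uF that by auto
  have hU: "h (lincomb F {..<p} (U i) u) = lincomb G {..<p} (U i) w" if "i \<in> I" for i
  proof -
    have "U i \<in> {..<p} \<rightarrow> carrier R" using U that by auto
    then have "h (lincomb F {..<p} (U i) u) = lincomb G {..<p} (U i) (\<lambda>j. h (u j))"
      using uF by (rule h.hom_lincomb)
    also have "\<dots> = lincomb G {..<p} (U i) w"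
      using U u that 1(2) Y.Z(1) by (intro h.N.lincomb_cong) (auto simp: Pi_iff)
    finally show ?thesis .
  qed
  have "\<forall>i\<in>I. \<exists>g\<in>scaled F E (carrier F). h g = h (f i \<ominus>\<^bsub>F\<^esub> lincomb F {..<p} (U i) u)"
  proof
    fix i assume i: "i \<in> I"
    have "h (f i \<ominus>\<^bsub>F\<^esub> lincomb F {..<p} (U i) u) = h (f i) \<ominus>\<^bsub>G\<^esub> lincomb G {..<p} (U i) w"
      using i assms Uu[OF i] hU[OF i] by (subst h.hom_minus) auto
    then have "h (f i \<ominus>\<^bsub>F\<^esub> lincomb F {..<p} (U i) u) \<in> h ` scaled F E (carrier F)"
      using 1(4) i h.scaled_image[OF E_sub subset_refl] by auto
    then show "\<exists>g\<in>scaled F E (carrier F). h g = h (f i \<ominus>\<^bsub>F\<^esub> lincomb F {..<p} (U i) u)"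
      by (elim imageE) (rule bexI, auto)
  qed
  then obtain g where g: "\<And>i. i \<in> I \<Longrightarrow> g i \<in> scaled F E (carrier F)"
    "\<And>i. i \<in> I \<Longrightarrow> h (g i) = h (f i \<ominus>\<^bsub>F\<^esub> lincomb F {..<p} (U i) u)" by metis
  have gF: "g i \<in> carrier F" if "i \<in> I" for i using g(1)[OF that] F.EZD by auto
  define z where "z i = f i \<ominus>\<^bsub>F\<^esub> (lincomb F {..<p} (U i) u \<oplus>\<^bsub>F\<^esub> g i)" for i
  have z: "z i \<in> K" if i: "i \<in> I" for i
  proof -
    have fi: "f i \<in> carrier F" using assms i by auto
    have "h (z i) = h (f i \<ominus>\<^bsub>F\<^esub> lincomb F {..<p} (U i) u) \<ominus>\<^bsub>G\<^esub> h (g i)"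
      unfolding z_def using fi gF[OF i] Uu[OF i]
      by (simp add: h.hom_minus h.hom_add a_minus_def h.N.M.minus_add h.N.M.a_assoc h.hom_neg)
    also have "\<dots> = \<zero>\<^bsub>G\<^esub>"
      using g(2)[OF i] fi Uu[OF i] by (simp add: a_minus_def h.N.M.r_neg del: h.hom_zero)
    finally show ?thesis using fi gF[OF i] Uu[OF i] by (simp add: a_kernel_def' z_def)
  qed
  have "lincomb F I (r q) f \<ominus>\<^bsub>F\<^esub> lincomb F I (r q) z \<in> scaled F E (carrier F)" if q: "q \<in> Q" for q
  proof -
    have rq: "r q \<in> I \<rightarrow> carrier R" using assms(3) q A0_sub by (auto simp: Pi_iff)
    have zF: "z \<in> I \<rightarrow> carrier F" using z by (auto simp: a_kernel_def')
    have fz: "f i \<ominus>\<^bsub>F\<^esub> z i = lincomb F {..<p} (U i) u \<oplus>\<^bsub>F\<^esub> g i" if "i \<in> I" for i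
    proof -
      have "f i \<in> carrier F" using assms that by auto
      then show ?thesis unfolding z_def using gF[OF that] Uu[OF that]
        by (simp add: a_minus_def h.M.M.minus_add h.M.M.r_neg2)
    qed
    have "lincomb F I (r q) f \<ominus>\<^bsub>F\<^esub> lincomb F I (r q) z = lincomb F I (r q) (\<lambda>i. f i \<ominus>\<^bsub>F\<^esub> z i)"
      using rq assms(4) zF by (rule h.M.lincomb_minus_right[symmetric])
    also have "\<dots> = lincomb F I (r q) (\<lambda>i. lincomb F {..<p} (U i) u \<oplus>\<^bsub>F\<^esub> g i)"
      using fz rq gF Uu by (intro h.M.lincomb_cong) auto
    also have "\<dots> = lincomb F I (r q) (\<lambda>i. lincomb F {..<p} (U i) u) \<oplus>\<^bsub>F\<^esub> lincomb F I (r q) g"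
      using rq gF Uu by (intro h.M.lincomb_add_right) auto
    also have "lincomb F I (r q) (\<lambda>i. lincomb F {..<p} (U i) u) =
        lincomb F {..<p} (\<lambda>j. lincomb (self_module R) I (r q) (\<lambda>i. U i j)) u"
      using assms rq U uF by (intro h.M.lincomb_lincomb) auto
    finally have e: "lincomb F I (r q) f \<ominus>\<^bsub>F\<^esub> lincomb F I (r q) z =
        lincomb F {..<p} (\<lambda>j. lincomb (self_module R) I (r q) (\<lambda>i. U i j)) u \<oplus>\<^bsub>F\<^esub> lincomb F I (r q) g" .
    have "lincomb F {..<p} (\<lambda>j. lincomb (self_module R) I (r q) (\<lambda>i. U i j)) u \<in> scaled F E (carrier F)"
      using 1(3) q uF by (intro h.M.lincomb_ideal_span E_sub h.M.carrier_is_submodule) auto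
    moreover have "lincomb F I (r q) g \<in> scaled F E (carrier F)"
      using rq g by (intro h.M.lincomb_in_submodule F.EZ) auto
    ultimately show ?thesis unfolding e by (rule F.EZD(5))
  qed
  with z show ?thesis by (intro bexI[of _ z]) auto
qed

text \<open>
  The kernel of a surjection between flat modules is flat: a relation in the kernel is trivial
  in \<open>F\<close>, say \<open>m = S w\<close>, and by \<open>kernel_lift\<close>, applied
  to the rows of \<open>S\<close> as relations for the image of \<open>w\<close>, the vector
  \<open>w\<close> can be moved into the kernel. The error is then in
  \<open>K \<inter> EF\<close>, hence in \<open>EK\<close>.
\<close>

lemma kernel_relation_flat:
  assumes "relation_flat R A0 E F (carrier F)" "K \<inter> scaled F E (carrier F) \<subseteq> scaled F E K"
  shows "relation_flat R A0 E F K"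
  unfolding relation_flat_def
proof (intro allI impI)
  interpret K: coefficient_module R A0 E F K
    by (intro coefficient_moduleI h.M.module_axioms K_submodule)
  fix n :: nat and r m
  assume r: "r \<in> {..<n} \<rightarrow> A0" and m: "m \<in> {..<n} \<rightarrow> K" and rel: "lincomb F {..<n} r m \<in> scaled F E K"
  have mF: "m \<in> {..<n} \<rightarrow> carrier F" using m K.Z by (auto simp: Pi_iff)
  have "lincomb F {..<n} r m \<in> scaled F E (carrier F)"
    using rel scaled_mono[OF subset_refl K.Z(1), where M = F and E = E] by auto
  then have "trivial_relations R A0 E F (carrier F) {..<n} {()} (\<lambda>_. r) m"
    using assms(1) r mF unfolding relation_flat_def by blast
  then obtain p :: nat and S f where 1: "S \<in> {..<n} \<rightarrow> {..<p} \<rightarrow> A0" "f \<in> {..<p} \<rightarrow> carrier F"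
    "\<forall>j<p. lincomb (self_module R) {..<n} r (\<lambda>i. S i j) \<in> ideal_span R E"
    "\<forall>i<n. m i \<ominus>\<^bsub>F\<^esub> lincomb F {..<p} (S i) f \<in> scaled F E (carrier F)"
    unfolding trivial_relations_def by auto
  have S: "S i \<in> {..<p} \<rightarrow> carrier R" if "i < n" for i using 1(1) that A0_sub by (auto simp: Pi_iff)
  have Sf: "lincomb F {..<p} (S i) f \<in> carrier F" if "i < n" for i using S[OF that] 1(2) by auto
  have "lincomb G {..<p} (S i) (\<lambda>j. h (f j)) \<in> scaled G E Y" if i: "i \<in> {..<n}" for i
  proof -
    have mi: "m i \<in> carrier F" "h (m i) = \<zero>\<^bsub>G\<^esub>" using m i by (auto simp: a_kernel_def' Pi_iff)
    have c: "lincomb G {..<p} (S i) (\<lambda>j. h (f j)) \<in> carrier G" using S i 1(2) by (auto intro!: h.N.lincomb_closed)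
    have "h (m i \<ominus>\<^bsub>F\<^esub> lincomb F {..<p} (S i) f) = \<ominus>\<^bsub>G\<^esub> lincomb G {..<p} (S i) (\<lambda>j. h (f j))"
    proof -
      have "h (m i \<ominus>\<^bsub>F\<^esub> lincomb F {..<p} (S i) f) = h (m i) \<ominus>\<^bsub>G\<^esub> h (lincomb F {..<p} (S i) f)"
        using mi Sf i by (intro h.hom_minus) auto
      also have "h (lincomb F {..<p} (S i) f) = lincomb G {..<p} (S i) (\<lambda>j. h (f j))"
        using S i 1(2) by (intro h.hom_lincomb) auto
      finally show ?thesis using mi c by (simp add: a_minus_def)
    qed
    moreover have "h (m i \<ominus>\<^bsub>F\<^esub> lincomb F {..<p} (S i) f) \<in> scaled G E Y"
      using 1(4) i h.scaled_image[OF E_sub subset_refl] by auto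
    ultimately show ?thesis using c Y.EZD(4) by (metis h.N.M.minus_minus)
  qed
  then obtain z where z: "z \<in> {..<p} \<rightarrow> K"
    "\<And>i. i < n \<Longrightarrow> lincomb F {..<p} (S i) f \<ominus>\<^bsub>F\<^esub> lincomb F {..<p} (S i) z \<in> scaled F E (carrier F)"
    using kernel_lift[of "{..<p}" "{..<n}" S f] 1 by auto
  have "m i \<ominus>\<^bsub>F\<^esub> lincomb F {..<p} (S i) z \<in> scaled F E K" if i: "i < n" for i
  proof -
    have mi: "m i \<in> K" "m i \<in> carrier F" using m mF i by auto
    have Sz: "lincomb F {..<p} (S i) z \<in> K" using S i z by (intro h.M.lincomb_in_submodule K_submodule) auto
    have Szc: "lincomb F {..<p} (S i) z \<in> carrier F" using Sz K.Z by auto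
    have "m i \<ominus>\<^bsub>F\<^esub> lincomb F {..<p} (S i) z = (m i \<ominus>\<^bsub>F\<^esub> lincomb F {..<p} (S i) f) \<oplus>\<^bsub>F\<^esub>
            (lincomb F {..<p} (S i) f \<ominus>\<^bsub>F\<^esub> lincomb F {..<p} (S i) z)"
      using mi Sf[OF i] Szc by (simp add: a_minus_def h.M.M.a_assoc h.M.M.r_neg1)
    also have "\<dots> \<in> scaled F E (carrier F)" using 1(4) z(2) i F.EZD(5) by auto
    finally show ?thesis using assms(2) K.Z(6)[OF mi(1) Sz] by auto
  qed
  then show "trivial_relations R A0 E F K {..<n} {()} (\<lambda>_. r) m"
    unfolding trivial_relations_def using 1 z(1)
    by (intro exI[of _ p] exI[of _ S] exI[of _ z]) auto
qed

end

text \<open>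
  This is the vanishing of \<open>Tor\<^sub>1\<close> of the image and \<open>A0/(E)\<close>
  over \<open>A0\<close>: reduction modulo \<open>E\<close> keeps the sequence of kernel, source
  and image exact. An element \<open>\<Sum> e i f i\<close> of the kernel is a relation for
  the images of the \<open>f i\<close> with coefficients in \<open>A0\<close>, so
  \<open>kernel_lift\<close> replaces the \<open>f i\<close> by elements of the kernel.
\<close>

lemma kernel_inter_scaled:
  assumes "coefficient_map R A0 {} F G h" "E \<subseteq> A0"
  shows "a_kernel F G h \<inter> scaled F E (carrier F) \<subseteq> scaled F E (a_kernel F G h)"
proof
  interpret coefficient_map R A0 "{}" F G h by fact
  fix x assume x: "x \<in> K \<inter> scaled F E (carrier F)"
  have ER: "E \<subseteq> carrier R" using assms(2) A0_sub by auto
  obtain n :: nat and e f where 1: "e \<in> {..<n} \<rightarrow> E" "f \<in> {..<n} \<rightarrow> carrier F" "x = lincomb F {..<n} e f"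
    using h.M.scaled_lincomb[of x E "carrier F"] x ER by auto
  have e: "e \<in> {..<n} \<rightarrow> carrier R" using 1(1) ER by auto
  have "lincomb G {..<n} e (\<lambda>i. h (f i)) = \<zero>\<^bsub>G\<^esub>"
    using h.hom_lincomb[OF e 1(2)] x 1(3) by (auto simp: a_kernel_def')
  then obtain z where z: "z \<in> {..<n} \<rightarrow> K" "x \<ominus>\<^bsub>F\<^esub> lincomb F {..<n} e z = \<zero>\<^bsub>F\<^esub>"
    using kernel_lift[of "{..<n}" "{()}" "\<lambda>_. e" f] 1 assms(2) by (auto simp: Pi_iff subset_iff)
  have zF: "z \<in> {..<n} \<rightarrow> carrier F" using z(1) by (auto simp: a_kernel_def' Pi_iff)
  have c: "lincomb F {..<n} e z \<in> carrier F" "x \<in> carrier F" using e zF x by (auto simp: a_kernel_def')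
  have "x = lincomb F {..<n} e z"
    using z(2) c by (metis a_minus_def h.M.M.minus_equality h.M.M.minus_minus h.M.M.a_inv_closed)
  also have "\<dots> \<in> scaled F E K"
  proof -
    have D: "submodule (scaled F E K) R F" by (rule h.M.scaled_submodule[OF ER K_submodule])
    have "e i \<odot>\<^bsub>F\<^esub> z i \<in> scaled F E K" if "i < n" for i
      using that 1(1) z(1) zF e by (intro h.M.scaled_mult) (auto simp: Pi_iff)
    then have "lincomb F {..<n} (\<lambda>_. \<one>\<^bsub>R\<^esub>) (\<lambda>i. e i \<odot>\<^bsub>F\<^esub> z i) \<in> scaled F E K"
      by (intro h.M.lincomb_in_submodule[OF D]) auto
    moreover have "lincomb F {..<n} (\<lambda>_. \<one>\<^bsub>R\<^esub>) (\<lambda>i. e i \<odot>\<^bsub>F\<^esub> z i) = lincomb F {..<n} e z"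
      unfolding lincomb_def using e zF by (intro h.M.M.finsum_cong') (auto simp: Pi_iff)
    ultimately show ?thesis by simp
  qed
  finally show "x \<in> scaled F E K" .
qed

text \<open>
  Vectors of any finite length \<open>n\<close> are represented by infinite sequences of which
  only the first \<open>n\<close> entries are used. Thus one module serves all lengths.
\<close>

definition sequence_module :: "('r, 'm, 'y) module_scheme \<Rightarrow> ('r, nat \<Rightarrow> 'm) module"
  where "sequence_module M =
    \<lparr>carrier = UNIV \<rightarrow> carrier M, monoid.mult = undefined, one = undefined,
     zero = (\<lambda>i. \<zero>\<^bsub>M\<^esub>), add = (\<lambda>u v i. u i \<oplus>\<^bsub>M\<^esub> v i), smult = (\<lambda>r u i. r \<odot>\<^bsub>M\<^esub> u i)\<rparr>"

lemma sequence_module_simps [simp]: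
  "carrier (sequence_module M) = UNIV \<rightarrow> carrier M" "\<zero>\<^bsub>sequence_module M\<^esub> = (\<lambda>i. \<zero>\<^bsub>M\<^esub>)"
  "u \<oplus>\<^bsub>sequence_module M\<^esub> v = (\<lambda>i. u i \<oplus>\<^bsub>M\<^esub> v i)" "r \<odot>\<^bsub>sequence_module M\<^esub> u = (\<lambda>i. r \<odot>\<^bsub>M\<^esub> u i)"
  by (simp_all add: sequence_module_def)

lemma sequence_module_module: "module R M \<Longrightarrow> module R (sequence_module M)"
proof -
  assume "module R M"
  then interpret module R M .
  show ?thesis
  proof (rule moduleI)
    show "cring R" by (rule R.is_cring)
    show "abelian_group (sequence_module M)"
    proof (rule abelian_groupI)
      fix u assume "u \<in> carrier (sequence_module M)"
      then show "\<exists>v\<in>carrier (sequence_module M). v \<oplus>\<^bsub>sequence_module M\<^esub> u = \<zero>\<^bsub>sequence_module M\<^esub>"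
        by (intro bexI[of _ "\<lambda>i. \<ominus>\<^bsub>M\<^esub> u i"]) (auto simp: Pi_iff M.l_neg)
    qed (auto simp: Pi_iff M.a_assoc intro!: ext intro: M.a_comm)
  qed (auto simp: Pi_iff smult_l_distr smult_r_distr smult_assoc1)
qed

lemma (in module) sequence_eval: "linear_map R (sequence_module M) M (\<lambda>u. u i)"
  by (intro linear_mapI sequence_module_module module_axioms) (auto simp: linear_maps_def)

lemma (in module) trivial_submodule: "submodule {\<zero>\<^bsub>M\<^esub>} R M"
  by (rule submoduleI) auto

lemma (in module) lincomb_sequence_linear:
  assumes "r \<in> {..<n} \<rightarrow> carrier R"
  shows "linear_map R (sequence_module M) M (lincomb M {..<n} r)"
proof (intro linear_mapI sequence_module_module module_axioms)
  show "lincomb M {..<n} r \<in> linear_maps R (sequence_module M) M"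
    unfolding linear_maps_def
  proof (intro CollectI conjI ballI Pi_I)
    fix c c' assume cc': "c \<in> carrier (sequence_module M)" "c' \<in> carrier (sequence_module M)"
    then show "lincomb M {..<n} r c \<in> carrier M"
      using assms lincomb_closed[of r "{..<n}" c] by (auto simp: Pi_iff)
    show "lincomb M {..<n} r (c \<oplus>\<^bsub>sequence_module M\<^esub> c') =
          lincomb M {..<n} r c \<oplus>\<^bsub>M\<^esub> lincomb M {..<n} r c'"
      using cc' assms lincomb_add_right[of r "{..<n}" c c'] by (auto simp: Pi_iff)
  next
    fix a c assume ac: "a \<in> carrier R" "c \<in> carrier (sequence_module M)"
    show "lincomb M {..<n} r (a \<odot>\<^bsub>sequence_module M\<^esub> c) = a \<odot>\<^bsub>M\<^esub> lincomb M {..<n} r c"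
      using ac assms smult_lincomb(2)[of a r "{..<n}" c] by (auto simp: Pi_iff)
  qed
qed

lemma (in cring) lincomb_unit:
  assumes "r \<in> {..<n::nat} \<rightarrow> carrier R" "i < n"
  shows "lincomb (self_module R) {..<n} r (\<lambda>l. if l = i then \<one> else \<zero>) = r i"
proof -
  have "lincomb (self_module R) {..<n} r (\<lambda>l. if l = i then \<one> else \<zero>) =
        (\<Oplus>l\<in>{..<n}. if i = l then r l else \<zero>)"
    unfolding lincomb_def self_module_simps
    by (rule add.finprod_cong') (use assms in \<open>auto simp: Pi_iff\<close>)
  also have "\<dots> = r i" using assms by (intro add.finprod_singleton) auto
  finally show ?thesis .
qed

text \<open>
  Let \<open>I\<close> be the ideal generated by the coefficients \<open>r\<close>. By exactness
  of tensoring with \<open>P\<close> on \<open>0 \<rightarrow> I \<rightarrow> R\<close>,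
  the relation \<open>\<Sum> r i m i = 0\<close> gives
  \<open>\<Sum> m i \<otimes> r i = 0\<close> in the tensor product of \<open>P\<close>
  and \<open>I\<close>. The vectors over \<open>P\<close> on which \<open>r\<close> is trivial
  form a submodule \<open>K\<close>. If \<open>x = \<Sum> r l c l\<close>, then the class
  modulo \<open>K\<close> of the vector with entries \<open>c l p\<close> depends only on
  \<open>x\<close> and \<open>p\<close>, since two choices of \<open>c\<close> differ by a
  vector that satisfies the relation. This gives a map from the tensor product to the vectors
  modulo \<open>K\<close> which sends the zero element
  \<open>\<Sum> m i \<otimes> r i\<close> to the class of \<open>m\<close>. Hence
  \<open>m\<close> lies in \<open>K\<close>.
\<close>

theorem relation_flat_of_flat:
  assumes "flat_module R P"
  shows "relation_flat R (carrier R) {} P (carrier P)"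
  unfolding relation_flat_def
proof (intro allI impI)
  from assms interpret P: module R P by (simp add: flat_module_def)
  interpret co: coefficients R "carrier R" "{}"
    by unfold_locales auto
  interpret cm: coefficient_module R "carrier R" "{}" P "carrier P"
    by (intro co.coefficient_moduleI P.module_axioms P.carrier_is_submodule)
  let ?S = "self_module R"
  fix n :: nat and r m
  assume r: "r \<in> {..<n} \<rightarrow> carrier R" and m: "m \<in> {..<n} \<rightarrow> carrier P"
    and "lincomb P {..<n} r m \<in> scaled P {} (carrier P)"
  then have rel: "lincomb P {..<n} r m = \<zero>\<^bsub>P\<^esub>" by simp
  interpret seqR: linear_map R "sequence_module ?S" ?S "\<lambda>c. lincomb ?S {..<n} r c"
    by (rule co.self.lincomb_sequence_linear[OF r])
  define I where "I = (\<lambda>c. lincomb ?S {..<n} r c) ` (UNIV \<rightarrow> carrier R)"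
  have I: "submodule I R ?S"
    unfolding I_def using seqR.image_submodule[OF seqR.M.carrier_is_submodule] by simp
  define c where "c x = (SOME c. c \<in> UNIV \<rightarrow> carrier R \<and> lincomb ?S {..<n} r c = x)" for x
  have c: "c x \<in> UNIV \<rightarrow> carrier R" "lincomb ?S {..<n} r (c x) = x" if "x \<in> I" for x
  proof -
    have "\<exists>c. c \<in> UNIV \<rightarrow> carrier R \<and> lincomb ?S {..<n} r c = x" using that by (auto simp: I_def)
    from someI_ex[OF this] show "c x \<in> UNIV \<rightarrow> carrier R" "lincomb ?S {..<n} r (c x) = x"
      by (auto simp: c_def)
  qed
  have unit: "(\<lambda>l. if l = i then \<one>\<^bsub>R\<^esub> else \<zero>\<^bsub>R\<^esub>) \<in> UNIV \<rightarrow> carrier R \<and>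
     lincomb ?S {..<n} r (\<lambda>l. if l = i then \<one>\<^bsub>R\<^esub> else \<zero>\<^bsub>R\<^esub>) = r i" if i: "i < n" for i
    using P.R.lincomb_unit[OF r i] by simp
  have rI: "r i \<in> I" if "i < n" for i using unit[OF that] unfolding I_def by (metis image_eqI)

  \<comment> \<open>The test sequence of the flatness condition: the zero module, the ideal
    \<open>I\<close>, and the ring.\<close>
  define L where "L = ?S\<lparr>carrier := {\<zero>\<^bsub>R\<^esub>}\<rparr>"
  define J where "J = ?S\<lparr>carrier := I\<rparr>"
  have simpsL [simp]: "carrier L = {\<zero>\<^bsub>R\<^esub>}" "\<zero>\<^bsub>L\<^esub> = \<zero>\<^bsub>R\<^esub>" "add L = add R" "smult L = monoid.mult R"
    by (simp_all add: L_def)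
  have simpsJ [simp]: "carrier J = I" "\<zero>\<^bsub>J\<^esub> = \<zero>\<^bsub>R\<^esub>" "add J = add R" "smult J = monoid.mult R"
    by (simp_all add: J_def)
  have modL: "module R L"
    unfolding L_def using co.self.trivial_submodule
    by (intro submodule.submodule_is_module co.self.module_axioms) simp
  have modJ: "module R J"
    unfolding J_def by (intro submodule.submodule_is_module co.self.module_axioms I)
  have ID: "\<zero>\<^bsub>R\<^esub> \<in> I" "I \<subseteq> carrier R" "\<And>a x. a \<in> carrier R \<Longrightarrow> x \<in> I \<Longrightarrow> a \<otimes>\<^bsub>R\<^esub> x \<in> I"
      "\<And>x y. x \<in> I \<Longrightarrow> y \<in> I \<Longrightarrow> x \<oplus>\<^bsub>R\<^esub> y \<in> I"
    using submoduleD[OF co.self.module_axioms I] by auto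
  have h: "(\<lambda>x. x) \<in> linear_maps R L J" "(\<lambda>x. x) \<in> linear_maps R J ?S"
    using ID by (auto simp: linear_maps_def)
  have ex: "(\<lambda>x. x) ` carrier L = a_kernel J ?S (\<lambda>x. x)"
    using ID by (auto simp: a_kernel_def')
  interpret TL: tensor R P L
    unfolding tensor_def using P.module_axioms modL by auto
  interpret TJ: tensor R P J
    unfolding tensor_def using P.module_axioms modJ by auto
  interpret TS: tensor R P ?S
    unfolding tensor_def using P.module_axioms co.self.module_axioms by auto
  define t where "t = lincomb TJ.T {..<n} (\<lambda>_. \<one>\<^bsub>R\<^esub>) (\<lambda>i. TJ.tens (m i) (r i))"
  have tens_mr: "(\<lambda>i. TJ.tens (m i) (r i)) \<in> {..<n} \<rightarrow> carrier TJ.T"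
  proof
    fix i assume "i \<in> {..<n}"
    then have "m i \<in> carrier P" "r i \<in> carrier J" using m rI by auto
    then show "TJ.tens (m i) (r i) \<in> carrier TJ.T" by (rule TJ.tens_closed)
  qed
  have tT: "t \<in> carrier TJ.T" unfolding t_def using tens_mr by (intro TJ.T.lincomb_closed) auto
  have t0: "t = \<zero>\<^bsub>TJ.T\<^esub>"
  proof -
    interpret th: tensor_hom R P L P J "\<lambda>p. p" "\<lambda>x. x"
      unfolding tensor_hom_def tensor_hom_axioms_def tensor_def using P.module_axioms modL modJ h
      by (auto simp: linear_maps_def)
    interpret tk: tensor_hom R P J P ?S "\<lambda>p. p" "\<lambda>x. x"
      unfolding tensor_hom_def tensor_hom_axioms_def tensor_def
      using P.module_axioms modJ h co.self.module_axioms
      by (auto simp: linear_maps_def)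
    interpret Th: linear_map R TL.T TJ.T "tensor_map R P J (\<lambda>p. p) (\<lambda>x. x)" by (rule th.tensor_map_linear)
    interpret Tk: linear_map R TJ.T TS.T "tensor_map R P ?S (\<lambda>p. p) (\<lambda>x. x)" by (rule tk.tensor_map_linear)
    let ?h = "tensor_map R P J (\<lambda>p. p) (\<lambda>x. x)" and ?k = "tensor_map R P ?S (\<lambda>p. p) (\<lambda>x. x)"
    have exact: "?h ` carrier TL.T = a_kernel TJ.T TS.T ?k"
      using assms modL modJ co.self.module_axioms h ex unfolding flat_module_def by blast
    have "?k t = \<zero>\<^bsub>TS.T\<^esub>"
    proof -
      interpret left: linear_map R P TS.T "\<lambda>x. TS.tens x \<one>\<^bsub>R\<^esub>"
        by (rule TS.tens_left_linear) simp
      have "?k t = lincomb TS.T {..<n} (\<lambda>_. \<one>\<^bsub>R\<^esub>) (\<lambda>i. ?k (TJ.tens (m i) (r i)))"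
        unfolding t_def using tens_mr by (intro Tk.hom_lincomb) auto
      also have "\<dots> = lincomb TS.T {..<n} r (\<lambda>i. TS.tens (m i) \<one>\<^bsub>R\<^esub>)"
        unfolding lincomb_def
      proof (rule TS.T.M.finsum_cong')
        fix i assume i: "i \<in> {..<n}"
        have mi: "m i \<in> carrier P" "r i \<in> carrier R" "r i \<in> I" using i m r rI by auto
        then have "?k (TJ.tens (m i) (r i)) = TS.tens (m i) (r i)"
          by (intro tk.tensor_map_tens) auto
        also have "\<dots> = TS.tens (m i) (r i \<odot>\<^bsub>?S\<^esub> \<one>\<^bsub>R\<^esub>)" using mi by simp
        also have "\<dots> = r i \<odot>\<^bsub>TS.T\<^esub> TS.tens (m i) \<one>\<^bsub>R\<^esub>"
          using mi by (intro TS.tens_smult_right) auto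
        finally have eq: "?k (TJ.tens (m i) (r i)) = r i \<odot>\<^bsub>TS.T\<^esub> TS.tens (m i) \<one>\<^bsub>R\<^esub>" .
        have "?k (TJ.tens (m i) (r i)) \<in> carrier TS.T"
          using tens_mr i by (intro Tk.hom_closed) auto
        from TS.T.smult_one[OF this]
        show "\<one>\<^bsub>R\<^esub> \<odot>\<^bsub>TS.T\<^esub> ?k (TJ.tens (m i) (r i)) = r i \<odot>\<^bsub>TS.T\<^esub> TS.tens (m i) \<one>\<^bsub>R\<^esub>"
          unfolding eq .
      next
        show "(\<lambda>i. r i \<odot>\<^bsub>TS.T\<^esub> TS.tens (m i) \<one>\<^bsub>R\<^esub>) \<in> {..<n} \<rightarrow> carrier TS.T"
          using m r by (intro Pi_I TS.T.smult_closed TS.tens_closed) auto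
      qed simp
      also have "\<dots> = TS.tens (lincomb P {..<n} r m) \<one>\<^bsub>R\<^esub>"
        using r m by (intro left.hom_lincomb[symmetric])
      also have "\<dots> = TS.tens \<zero>\<^bsub>P\<^esub> \<one>\<^bsub>R\<^esub>" unfolding rel ..
      also have "\<dots> = \<zero>\<^bsub>TS.T\<^esub>" by (rule left.hom_zero)
      finally show ?thesis .
    qed
    with tT have "t \<in> ?h ` carrier TL.T" unfolding exact by (simp add: a_kernel_def')
    moreover have "carrier TL.T \<subseteq> {x \<in> carrier TL.T. ?h x \<in> {\<zero>\<^bsub>TJ.T\<^esub>}}"
    proof (intro TL.tensor_span Th.preimage_submodule TJ.T.trivial_submodule)
      fix x y assume x: "x \<in> carrier P" and y: "y \<in> carrier L"
      interpret right: linear_map R J TJ.T "\<lambda>y. TJ.tens x y"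
        by (rule TJ.tens_right_linear[OF x])
      have "?h (TL.tens x y) = TJ.tens x y" using x y by (rule th.tensor_map_tens)
      also have "\<dots> = TJ.tens x \<zero>\<^bsub>J\<^esub>" using y by simp
      also have "\<dots> = \<zero>\<^bsub>TJ.T\<^esub>" by (rule right.hom_zero)
      finally show "TL.tens x y \<in> {x \<in> carrier TL.T. ?h x \<in> {\<zero>\<^bsub>TJ.T\<^esub>}}"
        using TL.tens_closed[OF x y] by blast
    qed
    ultimately show ?thesis by auto
  qed

  let ?PN = "sequence_module P"
  interpret PN: module R ?PN by (rule sequence_module_module[OF P.module_axioms])
  let ?triv = "trivial_relations R (carrier R) {} P (carrier P) {..<n} {()} (\<lambda>_. r)"
  define K where "K = {u \<in> UNIV \<rightarrow> carrier P. ?triv u}"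
  have "submodule K R ?PN"
  proof (rule PN.submoduleI)
    have sm: "a \<odot>\<^bsub>?PN\<^esub> u \<in> K" if "a \<in> carrier R" "u \<in> K" for a u
      using that cm.trivial_smult[of "{..<n}" "{()}" "\<lambda>_. r" u a] by (auto simp: K_def Pi_iff)
    then show "\<And>a x. a \<in> carrier R \<Longrightarrow> x \<in> K \<Longrightarrow> a \<odot>\<^bsub>?PN\<^esub> x \<in> K" .
    show "\<ominus>\<^bsub>?PN\<^esub> u \<in> K" if u: "u \<in> K" for u
    proof -
      have "u \<in> carrier ?PN" using u by (auto simp: K_def)
      then have "\<ominus>\<^bsub>?PN\<^esub> u = (\<ominus>\<^bsub>R\<^esub> \<one>\<^bsub>R\<^esub>) \<odot>\<^bsub>?PN\<^esub> u"
        by (metis P.R.one_closed PN.smult_l_minus PN.smult_one)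
      then show ?thesis using sm[OF _ u] by auto
    qed
    show "K \<subseteq> carrier ?PN" by (simp add: K_def)
    show "\<zero>\<^bsub>?PN\<^esub> \<in> K"
      unfolding K_def sequence_module_simps by (intro CollectI conjI cm.trivial_zero Pi_I P.M.zero_closed)
    show "u \<oplus>\<^bsub>?PN\<^esub> v \<in> K" if "u \<in> K" "v \<in> K" for u v
      using that cm.trivial_add[of "{..<n}" "{()}" "\<lambda>_. r" u v] by (auto simp: K_def Pi_iff)
  qed
  then interpret q: module_quotient R ?PN K
    by (simp add: module_quotient_def module_quotient_axioms_def PN.module_axioms)
  interpret Q: module R q.Q by (rule q.quotient_is_module)
  interpret cos: linear_map R ?PN q.Q q.coset
    by (intro linear_mapI PN.module_axioms q.quotient_is_module q.coset_linear)
  have single: "(\<lambda>l. s l \<odot>\<^bsub>P\<^esub> p) \<in> carrier ?PN" if "s \<in> UNIV \<rightarrow> carrier R" "p \<in> carrier P" for s p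
    using that by (auto simp: Pi_iff)
  \<comment> \<open>The class of \<open>s l p\<close> modulo \<open>K\<close> depends on
    \<open>s\<close> only through the ring element \<open>\<Sum> r l s l\<close>.\<close>
  have key: "q.coset (\<lambda>l. s l \<odot>\<^bsub>P\<^esub> p) = q.coset (\<lambda>l. s' l \<odot>\<^bsub>P\<^esub> p)"
    if s: "s \<in> UNIV \<rightarrow> carrier R" "s' \<in> UNIV \<rightarrow> carrier R" "p \<in> carrier P"
      and eq: "lincomb ?S {..<n} r s = lincomb ?S {..<n} r s'" for s s' p
  proof (rule q.coset_minus_eq_iff)
    let ?d = "\<lambda>l. s l \<ominus>\<^bsub>R\<^esub> s' l"
    have sl: "s l \<in> carrier R" "s' l \<in> carrier R" for l using s by auto
    have e: "(\<lambda>l. s l \<odot>\<^bsub>P\<^esub> p) \<ominus>\<^bsub>?PN\<^esub> (\<lambda>l. s' l \<odot>\<^bsub>P\<^esub> p) = (\<lambda>l. ?d l \<odot>\<^bsub>P\<^esub> p)"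
    proof
      fix l
      interpret ev: linear_map R ?PN P "\<lambda>u. u l" by (rule P.sequence_eval)
      have "((\<lambda>l. s l \<odot>\<^bsub>P\<^esub> p) \<ominus>\<^bsub>?PN\<^esub> (\<lambda>l. s' l \<odot>\<^bsub>P\<^esub> p)) l = s l \<odot>\<^bsub>P\<^esub> p \<ominus>\<^bsub>P\<^esub> s' l \<odot>\<^bsub>P\<^esub> p"
        using single[OF s(1,3)] single[OF s(2,3)] by (rule ev.hom_minus)
      also have "\<dots> = ?d l \<odot>\<^bsub>P\<^esub> p"
        unfolding a_minus_def using sl[of l] s(3) by (simp add: P.smult_l_distr P.smult_l_minus)
      finally show "((\<lambda>l. s l \<odot>\<^bsub>P\<^esub> p) \<ominus>\<^bsub>?PN\<^esub> (\<lambda>l. s' l \<odot>\<^bsub>P\<^esub> p)) l = ?d l \<odot>\<^bsub>P\<^esub> p" .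
    qed
    have "lincomb ?S {..<n} r ?d = lincomb ?S {..<n} r s \<ominus>\<^bsub>R\<^esub> lincomb ?S {..<n} r s'"
      using co.self.lincomb_minus_right[of r "{..<n}" s s'] r sl by (auto simp: Pi_iff)
    also have "\<dots> = \<zero>\<^bsub>R\<^esub>"
      using eq co.self.lincomb_closed[of r "{..<n}" s'] r sl by (simp add: a_minus_def P.R.r_neg Pi_iff)
    finally have "?triv (\<lambda>l. ?d l \<odot>\<^bsub>P\<^esub> p)"
      using sl s by (intro cm.trivial_single) auto
    then show "(\<lambda>l. s l \<odot>\<^bsub>P\<^esub> p) \<ominus>\<^bsub>?PN\<^esub> (\<lambda>l. s' l \<odot>\<^bsub>P\<^esub> p) \<in> K"
      unfolding e using sl s by (auto simp: K_def)
  qed (use single s in auto)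
  define \<beta> where "\<beta> p x = q.coset (\<lambda>l. c x l \<odot>\<^bsub>P\<^esub> p)" for p x
  have \<beta>c: "(\<lambda>l. c x l \<odot>\<^bsub>P\<^esub> p) \<in> carrier ?PN" if "x \<in> I" "p \<in> carrier P" for x p
    using single[OF c(1)] that by blast
  have bil: "TJ.bilinear q.Q \<beta>"
    unfolding TJ.bilinear_def
  proof (intro conjI ballI)
    fix p x assume p: "p \<in> carrier P" and "x \<in> carrier J"
    then have x: "x \<in> I" by simp
    show "\<beta> p x \<in> carrier q.Q" unfolding \<beta>_def using \<beta>c[OF x p] by (rule cos.hom_closed)
    have cx: "c x l \<in> carrier R" for l using c(1)[OF x] by auto
    show "\<beta> (p \<oplus>\<^bsub>P\<^esub> p') x = \<beta> p x \<oplus>\<^bsub>q.Q\<^esub> \<beta> p' x" if p': "p' \<in> carrier P" for p'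
      unfolding \<beta>_def using cos.hom_add[OF \<beta>c[OF x p] \<beta>c[OF x p']] p p' cx
      by (simp add: P.smult_r_distr)
    show "\<beta> p (x \<oplus>\<^bsub>J\<^esub> y) = \<beta> p x \<oplus>\<^bsub>q.Q\<^esub> \<beta> p y" if "y \<in> carrier J" for y
    proof -
      have y: "y \<in> I" using that by simp
      have cy: "c y l \<in> carrier R" for l using c(1)[OF y] by auto
      have "\<beta> p (x \<oplus>\<^bsub>J\<^esub> y) = q.coset (\<lambda>l. (c x l \<oplus>\<^bsub>R\<^esub> c y l) \<odot>\<^bsub>P\<^esub> p)"
        unfolding \<beta>_def using c ID(4)[OF x y] x y p cx cy seqR.hom_add[of "c x" "c y"]
        by (intro key) auto
      also have "\<dots> = \<beta> p x \<oplus>\<^bsub>q.Q\<^esub> \<beta> p y"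
        unfolding \<beta>_def using cos.hom_add[OF \<beta>c[OF x p] \<beta>c[OF y p]] p cx cy
        by (simp add: P.smult_l_distr)
      finally show ?thesis .
    qed
    fix a assume a: "a \<in> carrier R"
    have sm: "q.coset (\<lambda>l. (a \<otimes>\<^bsub>R\<^esub> c x l) \<odot>\<^bsub>P\<^esub> p) = a \<odot>\<^bsub>q.Q\<^esub> \<beta> p x"
      unfolding \<beta>_def using cos.hom_smult[OF a \<beta>c[OF x p]] p cx a by (simp add: P.smult_assoc1)
    have "a \<odot>\<^bsub>P\<^esub> p \<in> carrier P" using a p by simp
    have "c x l \<odot>\<^bsub>P\<^esub> (a \<odot>\<^bsub>P\<^esub> p) = (a \<otimes>\<^bsub>R\<^esub> c x l) \<odot>\<^bsub>P\<^esub> p" for l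
      using cx a p by (simp add: P.smult_assoc1[symmetric] P.R.m_comm)
    then show "\<beta> (a \<odot>\<^bsub>P\<^esub> p) x = a \<odot>\<^bsub>q.Q\<^esub> \<beta> p x" using sm by (simp add: \<beta>_def)
    have "\<beta> p (a \<odot>\<^bsub>J\<^esub> x) = q.coset (\<lambda>l. (a \<otimes>\<^bsub>R\<^esub> c x l) \<odot>\<^bsub>P\<^esub> p)"
      unfolding \<beta>_def using c ID(3)[OF a x] x p cx a seqR.hom_smult[of a "c x"]
      by (intro key) auto
    then show "\<beta> p (a \<odot>\<^bsub>J\<^esub> x) = a \<odot>\<^bsub>q.Q\<^esub> \<beta> p x" using sm by simp
  qed
  from TJ.tensor_lift[OF q.quotient_is_module bil] obtain k
    where k: "linear_map R TJ.T q.Q k" "\<forall>x\<in>carrier P. \<forall>y\<in>carrier J. k (TJ.tens x y) = \<beta> x y" by blast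
  interpret k: linear_map R TJ.T q.Q k by (rule k(1))
  define e where "e i l = (if l = i then m i else \<zero>\<^bsub>P\<^esub>)" for i l :: nat
  have e: "e \<in> {..<n} \<rightarrow> carrier ?PN"
    unfolding sequence_module_simps
  proof (intro Pi_I)
    fix i l assume "i \<in> {..<n}"
    then have "m i \<in> carrier P" using m by blast
    then show "e i l \<in> carrier P" unfolding e_def by (cases "l = i") simp_all
  qed
  have ke: "k (TJ.tens (m i) (r i)) = q.coset (e i)" if i: "i < n" for i
  proof -
    have mi: "m i \<in> carrier P" using m i by auto
    have "k (TJ.tens (m i) (r i)) = q.coset (\<lambda>l. c (r i) l \<odot>\<^bsub>P\<^esub> m i)"
      using k(2) mi rI[OF i] by (simp add: \<beta>_def)
    also have "\<dots> = q.coset (\<lambda>l. (if l = i then \<one>\<^bsub>R\<^esub> else \<zero>\<^bsub>R\<^esub>) \<odot>\<^bsub>P\<^esub> m i)"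
      using c[OF rI[OF i]] unit[OF i] mi by (intro key) auto
    also have "(\<lambda>l. (if l = i then \<one>\<^bsub>R\<^esub> else \<zero>\<^bsub>R\<^esub>) \<odot>\<^bsub>P\<^esub> m i) = e i"
      using mi by (auto simp: e_def)
    finally show ?thesis .
  qed
  have "q.coset (lincomb ?PN {..<n} (\<lambda>_. \<one>\<^bsub>R\<^esub>) e) = lincomb q.Q {..<n} (\<lambda>_. \<one>\<^bsub>R\<^esub>) (\<lambda>i. q.coset (e i))"
    using e by (intro cos.hom_lincomb) auto
  also have "\<dots> = lincomb q.Q {..<n} (\<lambda>_. \<one>\<^bsub>R\<^esub>) (\<lambda>i. k (TJ.tens (m i) (r i)))"
  proof (rule Q.lincomb_cong)
    show "(\<lambda>i. k (TJ.tens (m i) (r i))) \<in> {..<n} \<rightarrow> carrier q.Q"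
      using tens_mr by (intro Pi_I k.hom_closed) auto
  qed (use ke in auto)
  also have "\<dots> = k t" unfolding t_def using tens_mr by (intro k.hom_lincomb[symmetric]) auto
  also have "\<dots> = \<zero>\<^bsub>q.Q\<^esub>" using t0 k.hom_zero by simp
  finally have "lincomb ?PN {..<n} (\<lambda>_. \<one>\<^bsub>R\<^esub>) e \<in> K"
    using q.coset_eq_zero_iff PN.lincomb_closed[of "\<lambda>_. \<one>\<^bsub>R\<^esub>" "{..<n}" e] e by auto
  then have "?triv (lincomb ?PN {..<n} (\<lambda>_. \<one>\<^bsub>R\<^esub>) e)" by (simp add: K_def)
  then show "?triv m"
  proof (rule cm.trivial_cong)
    fix l assume l: "l \<in> {..<n}"
    interpret ev: linear_map R ?PN P "\<lambda>u. u l" by (rule P.sequence_eval)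
    have "lincomb ?PN {..<n} (\<lambda>_. \<one>\<^bsub>R\<^esub>) e l = lincomb P {..<n} (\<lambda>_. \<one>\<^bsub>R\<^esub>) (\<lambda>i. e i l)"
      using e by (intro ev.hom_lincomb) auto
    also have "\<dots> = (\<Oplus>\<^bsub>P\<^esub>i\<in>{..<n}. if l = i then m i else \<zero>\<^bsub>P\<^esub>)"
      unfolding lincomb_def by (rule P.M.finsum_cong') (use m in \<open>auto simp: e_def Pi_iff\<close>)
    also have "\<dots> = m l" using l m by (intro P.M.add.finprod_singleton) auto
    finally show "m l = lincomb ?PN {..<n} (\<lambda>_. \<one>\<^bsub>R\<^esub>) e l" by simp
  qed
qed

section \<open>Vanishing of Tor\<close>

lemma (in module) submoduleI2:
  assumes "H \<subseteq> carrier M" "\<zero>\<^bsub>M\<^esub> \<in> H" "\<And>x y. x \<in> H \<Longrightarrow> y \<in> H \<Longrightarrow> x \<oplus>\<^bsub>M\<^esub> y \<in> H"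
    "\<And>r x. r \<in> carrier R \<Longrightarrow> x \<in> H \<Longrightarrow> r \<odot>\<^bsub>M\<^esub> x \<in> H"
  shows "submodule H R M"
proof (rule submoduleI)
  show "\<ominus>\<^bsub>M\<^esub> x \<in> H" if x: "x \<in> H" for x
  proof -
    have "x \<in> carrier M" using x assms(1) by blast
    then have "\<ominus>\<^bsub>M\<^esub> x = (\<ominus> \<one>) \<odot>\<^bsub>M\<^esub> x" by (simp add: smult_l_minus)
    then show ?thesis using assms(4)[OF _ x, of "\<ominus> \<one>"] by simp
  qed
qed (fact assms)+

text \<open>
  Let \<open>\<Sum> b x \<otimes> \<nu> x\<close> be a cycle, where the \<open>b x\<close>
  are basis vectors of \<open>F'\<close> and \<open>E\<close> kills all \<open>\<nu> x\<close>.
  It is rewritten with cycles \<open>e x\<close> of \<open>F'\<close> in place of the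
  \<open>b x\<close>. Put \<open>z x = d (b x)\<close>. Since the image of
  \<open>h\<close> is flat modulo \<open>E\<close>, there are \<open>\<theta> y\<close> in the
  kernel of \<open>h\<close> with \<open>z x = \<Sum>\<^sub>y z x y \<theta> y\<close>
  modulo \<open>E\<close> times the kernel. With lifts \<open>\<epsilon> y\<close> of
  \<open>\<theta> y\<close>, and \<open>g x\<close> in \<open>EF'\<close> of the error,
  \<open>e x = b x - \<Sum>\<^sub>y z x y \<epsilon> y - g x\<close> is a cycle.
  In \<open>\<Sum> e x \<otimes> \<nu> x\<close> the terms with \<open>g x\<close> vanish
  because \<open>E\<close> kills \<open>\<nu> x\<close>, and the terms with
  \<open>\<epsilon> y\<close> vanish because their coefficients
  \<open>\<Sum>\<^sub>x z x y \<nu> x\<close> are the coordinates of the boundary of the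
  given cycle.
\<close>

lemma lift_cycle:
  fixes R (structure) and X :: "'g set"
  defines "F \<equiv> free_module R X"
  assumes cm: "coefficient_map R (carrier R) E F G h"
    and K: "a_kernel F G h \<inter> scaled F E (carrier F) \<subseteq> scaled F E (a_kernel F G h)"
    and d: "linear_map R (free_module R X') F d" and im: "d ` carrier (free_module R X') = a_kernel F G h"
    and N: "module R N" and X0: "finite X0" "X0 \<subseteq> X'" and \<nu>: "\<nu> \<in> X0 \<rightarrow> carrier N"
    and kill: "\<And>e x. e \<in> E \<Longrightarrow> x \<in> X0 \<Longrightarrow> e \<odot>\<^bsub>N\<^esub> \<nu> x = \<zero>\<^bsub>N\<^esub>"
    and cycle: "\<And>y. y \<in> X \<Longrightarrow> lincomb N X0 (\<lambda>x. d (basis_vec R x) y) \<nu> = \<zero>\<^bsub>N\<^esub>"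
  shows "\<exists>e \<in> X0 \<rightarrow> a_kernel (free_module R X') F d.
    \<forall>x. lincomb N X0 (\<lambda>x'. e x' x) \<nu> = lincomb N X0 (\<lambda>x'. basis_vec R x' x) \<nu>"
proof -
  let ?F' = "free_module R X'"
  interpret coefficient_map R "carrier R" E F G h by (rule cm)
  note F = F_def
  interpret fm: free_mod R X by unfold_locales
  interpret fm': free_mod R X' by unfold_locales
  interpret N: module R N by (rule N)
  interpret d: linear_map R ?F' F d by (rule d)
  define z where "z x = d (basis_vec R x)" for x
  have b: "basis_vec R x \<in> carrier ?F'" if "x \<in> X0" for x using that X0 by auto
  have zK: "z x \<in> K" if "x \<in> X0" for x unfolding z_def im[symmetric] using b[OF that] by (rule imageI)
  have zF: "z x \<in> carrier fm.F" if "x \<in> X0" for x using zK[OF that] by (simp add: a_kernel_def' F)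
  have zR: "z x y \<in> carrier R" if "x \<in> X0" for x y using zF[OF that] by (simp add: fm.free_carrier)
  define Y0 where "Y0 = (\<Union>x\<in>X0. {y. z x y \<noteq> \<zero>})"
  have supp: "finite {y. z x y \<noteq> \<zero>} \<and> {y. z x y \<noteq> \<zero>} \<subseteq> X" if "x \<in> X0" for x
    using zF[OF that] by (simp add: fm.free_carrier)
  have Y0: "finite Y0" "Y0 \<subseteq> X" unfolding Y0_def using X0(1) supp by blast+
  have bY: "basis_vec R \<in> Y0 \<rightarrow> carrier F" using Y0 by (auto simp: F)
  have zb: "lincomb F Y0 (z x) (basis_vec R) = z x" if x: "x \<in> X0" for x
    unfolding F using zF[OF x] Y0 x by (intro fm.free_expand) (auto simp: Y0_def)
  have zrow: "z x \<in> Y0 \<rightarrow> carrier R" if "x \<in> X0" for x using zR[OF that] by auto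
  have "lincomb G Y0 (z x) (\<lambda>y. h (basis_vec R y)) \<in> scaled G E Y" if x: "x \<in> X0" for x
  proof -
    have "lincomb G Y0 (z x) (\<lambda>y. h (basis_vec R y)) = h (lincomb F Y0 (z x) (basis_vec R))"
      using zrow[OF x] bY by (rule h.hom_lincomb[symmetric])
    also have "\<dots> = \<zero>\<^bsub>G\<^esub>" unfolding zb[OF x] using zK[OF x] by (simp add: a_kernel_def')
    finally show ?thesis by (simp add: scaled.zero)
  qed
  then obtain \<theta> where \<theta>: "\<theta> \<in> Y0 \<rightarrow> K"
    "\<And>x. x \<in> X0 \<Longrightarrow> lincomb F Y0 (z x) (basis_vec R) \<ominus>\<^bsub>F\<^esub> lincomb F Y0 (z x) \<theta> \<in> scaled F E (carrier F)"
    using kernel_lift[OF Y0(1) X0(1) _ bY, of z] zrow by auto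
  have "\<forall>y\<in>Y0. \<exists>u\<in>carrier ?F'. d u = \<theta> y"
  proof
    fix y assume "y \<in> Y0"
    then have "\<theta> y \<in> d ` carrier ?F'" using \<theta>(1) im by auto
    then show "\<exists>u\<in>carrier ?F'. d u = \<theta> y" by (elim imageE) (rule bexI, auto)
  qed
  then obtain \<epsilon> where \<epsilon>: "\<And>y. y \<in> Y0 \<Longrightarrow> \<epsilon> y \<in> carrier ?F'" "\<And>y. y \<in> Y0 \<Longrightarrow> d (\<epsilon> y) = \<theta> y" by metis
  have \<epsilon>F: "\<epsilon> \<in> Y0 \<rightarrow> carrier ?F'" using \<epsilon> by auto
  have \<epsilon>R: "\<epsilon> y x \<in> carrier R" if "y \<in> Y0" for x y using \<epsilon>(1)[OF that] by (simp add: fm'.free_carrier)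
  have \<theta>F: "\<theta> \<in> Y0 \<rightarrow> carrier F" using \<theta>(1) by (auto simp: a_kernel_def' Pi_iff)
  note KD = submoduleD[OF h.M.module_axioms K_submodule]
  have "\<forall>x\<in>X0. \<exists>g\<in>scaled ?F' E (carrier ?F'). d g = z x \<ominus>\<^bsub>F\<^esub> lincomb F Y0 (z x) \<theta>"
  proof
    fix x assume x: "x \<in> X0"
    have "lincomb F Y0 (z x) \<theta> \<in> K"
      using zrow[OF x] \<theta>(1) by (intro h.M.lincomb_in_submodule K_submodule) auto
    then have "z x \<ominus>\<^bsub>F\<^esub> lincomb F Y0 (z x) \<theta> \<in> scaled F E K"
      using \<theta>(2)[OF x] zb[OF x] KD(6)[OF zK[OF x]] K by auto
    also have "scaled F E K = d ` scaled ?F' E (carrier ?F')"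
      unfolding im[symmetric] by (rule d.scaled_image[OF E_sub subset_refl, symmetric])
    finally show "\<exists>g\<in>scaled ?F' E (carrier ?F'). d g = z x \<ominus>\<^bsub>F\<^esub> lincomb F Y0 (z x) \<theta>"
      by (elim imageE) (rule bexI, auto)
  qed
  then obtain g where g: "\<And>x. x \<in> X0 \<Longrightarrow> g x \<in> scaled ?F' E (carrier ?F')"
    "\<And>x. x \<in> X0 \<Longrightarrow> d (g x) = z x \<ominus>\<^bsub>F\<^esub> lincomb F Y0 (z x) \<theta>" by metis
  have gF: "g x \<in> carrier ?F'" if "x \<in> X0" for x
    using g(1)[OF that] submoduleD(3)[OF fm'.F.module_axioms
        fm'.F.scaled_submodule[OF E_sub fm'.F.carrier_is_submodule]] by blast
  define L where "L x = lincomb ?F' Y0 (z x) \<epsilon>" for x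
  have LF: "L x \<in> carrier ?F'" if "x \<in> X0" for x
    unfolding L_def using zrow[OF that] \<epsilon>F by (rule fm'.F.lincomb_closed)
  have dL: "d (L x) = lincomb F Y0 (z x) \<theta>" if "x \<in> X0" for x
  proof -
    have "d (L x) = lincomb F Y0 (z x) (\<lambda>y. d (\<epsilon> y))"
      unfolding L_def using zrow[OF that] \<epsilon>F by (rule d.hom_lincomb)
    also have "\<dots> = lincomb F Y0 (z x) \<theta>"
      using \<epsilon>(2) zrow[OF that] \<theta>F by (intro h.M.lincomb_cong) auto
    finally show ?thesis .
  qed
  define e where "e x = basis_vec R x \<ominus>\<^bsub>?F'\<^esub> (L x \<oplus>\<^bsub>?F'\<^esub> g x)" for x
  have eF: "e x \<in> carrier ?F'" if "x \<in> X0" for x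
    unfolding e_def using b[OF that] LF[OF that] gF[OF that]
    by (intro fm'.F.M.minus_closed fm'.F.M.a_closed)
  have "e x \<in> a_kernel ?F' F d" if x: "x \<in> X0" for x
  proof -
    have c: "lincomb F Y0 (z x) \<theta> \<in> carrier F" "z x \<in> carrier F"
      using zrow[OF x] \<theta>F zF[OF x] by (auto simp: F)
    have "d (e x) = d (basis_vec R x) \<ominus>\<^bsub>F\<^esub> d (L x \<oplus>\<^bsub>?F'\<^esub> g x)"
      unfolding e_def using b[OF x] LF[OF x] gF[OF x] by (intro d.hom_minus fm'.F.M.a_closed)
    also have "d (L x \<oplus>\<^bsub>?F'\<^esub> g x) = d (L x) \<oplus>\<^bsub>F\<^esub> d (g x)"
      using LF[OF x] gF[OF x] by (rule d.hom_add)
    also have "\<dots> = z x"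
      unfolding dL[OF x] g(2)[OF x] a_minus_def using c by (metis h.M.M.a_comm h.M.M.a_inv_closed h.M.M.a_assoc h.M.M.r_neg h.M.M.r_zero h.M.M.l_neg)
    finally have "d (e x) = z x \<ominus>\<^bsub>F\<^esub> z x" by (simp add: z_def)
    also have "\<dots> = \<zero>\<^bsub>F\<^esub>" unfolding a_minus_def using c(2) by (rule h.M.M.r_neg)
    finally show ?thesis using eF[OF x] by (simp add: a_kernel_def')
  qed
  moreover have "lincomb N X0 (\<lambda>x'. e x' x) \<nu> = lincomb N X0 (\<lambda>x'. basis_vec R x' x) \<nu>" for x
  proof -
    have R: "e x' x \<in> carrier R" "L x' x \<in> carrier R" "g x' x \<in> carrier R" if "x' \<in> X0" for x'
      using eF[OF that] LF[OF that] gF[OF that] by (simp_all add: fm'.free_carrier)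
    have split: "basis_vec R x' x = e x' x \<oplus> (L x' x \<oplus> g x' x)" if "x' \<in> X0" for x'
    proof -
      have "e x' x = basis_vec R x' x \<ominus> (L x' x \<oplus> g x' x)"
        unfolding e_def using fm'.free_minus[OF b[OF that] fm'.F.M.a_closed[OF LF[OF that] gF[OF that]]] by simp
      moreover have "basis_vec R x' x \<in> carrier R" by (simp add: basis_vec_def)
      ultimately show ?thesis
        using R[OF that] by (simp add: a_minus_def a_assoc l_neg)
    qed
    have "lincomb N X0 (\<lambda>x'. basis_vec R x' x) \<nu> = lincomb N X0 (\<lambda>x'. e x' x \<oplus> (L x' x \<oplus> g x' x)) \<nu>"
      using split R \<nu> by (intro N.lincomb_cong) auto
    also have "\<dots> = lincomb N X0 (\<lambda>x'. e x' x) \<nu> \<oplus>\<^bsub>N\<^esub> lincomb N X0 (\<lambda>x'. L x' x \<oplus> g x' x) \<nu>"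
      using R \<nu> by (intro N.lincomb_add_left) auto
    also have "lincomb N X0 (\<lambda>x'. L x' x \<oplus> g x' x) \<nu> =
               lincomb N X0 (\<lambda>x'. L x' x) \<nu> \<oplus>\<^bsub>N\<^esub> lincomb N X0 (\<lambda>x'. g x' x) \<nu>"
      using R \<nu> by (intro N.lincomb_add_left) auto
    also have "lincomb N X0 (\<lambda>x'. g x' x) \<nu> = \<zero>\<^bsub>N\<^esub>"
    proof -
      interpret ev: linear_map R ?F' "self_module R" "\<lambda>u. u x" by (rule fm'.eval_linear_map)
      have "g x' x \<odot>\<^bsub>N\<^esub> \<nu> x' = \<zero>\<^bsub>N\<^esub>" if x': "x' \<in> X0" for x'
      proof -
        have "g x' x \<in> scaled (self_module R) E ((\<lambda>u. u x) ` carrier ?F')"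
          using g(1)[OF x'] unfolding ev.scaled_image[OF E_sub subset_refl, symmetric] by (rule imageI)
        moreover have "(\<lambda>u. u x) ` carrier ?F' \<subseteq> carrier R"
          by (rule image_subsetI) (simp add: fm'.free_carrier)
        ultimately have gE: "g x' x \<in> ideal_span R E"
          using scaled_mono[OF subset_refl, of "(\<lambda>u. u x) ` carrier ?F'" "carrier R" "self_module R" E]
          by blast
        have "submodule {c \<in> carrier (self_module R). c \<odot>\<^bsub>N\<^esub> \<nu> x' \<in> {\<zero>\<^bsub>N\<^esub>}} R (self_module R)"
        proof (rule linear_map.preimage_submodule)
          show "linear_map R (self_module R) N (\<lambda>c. c \<odot>\<^bsub>N\<^esub> \<nu> x')"
            using \<nu> x' by (intro linear_mapI self.module_axioms N)
              (auto simp: linear_maps_def N.smult_l_distr N.smult_assoc1 Pi_iff)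
        qed (rule N.trivial_submodule)
        then have "ideal_span R E \<subseteq> {c \<in> carrier (self_module R). c \<odot>\<^bsub>N\<^esub> \<nu> x' \<in> {\<zero>\<^bsub>N\<^esub>}}"
        proof (rule self.scaled_least)
          fix e c assume ec: "e \<in> E" "c \<in> carrier R"
          have eR: "e \<in> carrier R" "\<nu> x' \<in> carrier N" using ec E_sub \<nu> x' by auto
          have "(e \<otimes> c) \<odot>\<^bsub>N\<^esub> \<nu> x' = c \<odot>\<^bsub>N\<^esub> (e \<odot>\<^bsub>N\<^esub> \<nu> x')"
            using eR ec(2) by (simp add: N.smult_assoc1[symmetric] m_comm)
          then show "e \<odot>\<^bsub>self_module R\<^esub> c \<in> {c \<in> carrier (self_module R). c \<odot>\<^bsub>N\<^esub> \<nu> x' \<in> {\<zero>\<^bsub>N\<^esub>}}"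
            using eR ec kill[OF ec(1) x'] by simp
        qed
        with gE show ?thesis by blast
      qed
      then show ?thesis unfolding lincomb_def by (intro N.M.add.finprod_one_eqI)
    qed
    also have "lincomb N X0 (\<lambda>x'. L x' x) \<nu> = \<zero>\<^bsub>N\<^esub>"
    proof -
      have "L x' x = lincomb (self_module R) Y0 (\<lambda>y. \<epsilon> y x) (\<lambda>y. z x' y)" if x': "x' \<in> X0" for x'
      proof -
        have "L x' x = lincomb (self_module R) Y0 (z x') (\<lambda>y. \<epsilon> y x)"
          unfolding L_def using zrow[OF x'] \<epsilon>F by (rule fm'.lincomb_apply)
        also have "\<dots> = lincomb (self_module R) Y0 (\<lambda>y. \<epsilon> y x) (\<lambda>y. z x' y)"
          unfolding lincomb_def self_module_simps
          using zR[OF x'] \<epsilon>R by (intro finsum_cong') (auto simp: m_comm)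
        finally show ?thesis .
      qed
      then have "lincomb N X0 (\<lambda>x'. L x' x) \<nu> =
          lincomb N X0 (\<lambda>x'. lincomb (self_module R) Y0 (\<lambda>y. \<epsilon> y x) (\<lambda>y. z x' y)) \<nu>"
        using R \<nu> by (intro N.lincomb_cong) auto
      also have "\<dots> = lincomb N Y0 (\<lambda>y. \<epsilon> y x) (\<lambda>y. lincomb N X0 (\<lambda>x'. z x' y) \<nu>)"
        using X0 Y0 \<epsilon>R zR \<nu> by (intro N.lincomb_lincomb[symmetric]) auto
      also have "\<dots> = lincomb N Y0 (\<lambda>y. \<epsilon> y x) (\<lambda>y. \<zero>\<^bsub>N\<^esub>)"
        using cycle Y0 \<epsilon>R by (intro N.lincomb_cong) (auto simp: z_def)
      also have "\<dots> = \<zero>\<^bsub>N\<^esub>" using \<epsilon>R by (intro N.lincomb_zero_right) auto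
      finally show ?thesis .
    qed
    finally show ?thesis using R \<nu> N.lincomb_closed[of "\<lambda>x'. e x' x" X0 \<nu>] by simp
  qed
  ultimately show ?thesis by (intro bexI[of _ e]) auto
qed

subsection \<open>Coordinates in the tensor product with a free module\<close>

text \<open>
  An element of the tensor product of a free module with \<open>N\<close> amounts to a finitely
  supported family in \<open>N\<close>, its coordinates. They turn equations between cosets of
  formal combinations into equations in \<open>N\<close>.
\<close>

locale free_tensor = free_mod R X + N: module R N for R (structure) and X :: "'g set" and N (structure)
begin

sublocale t: tensor R F N by unfold_locales

lemma coordinate: "\<exists>k. linear_map R t.T N k \<and> (\<forall>\<phi>\<in>carrier F. \<forall>y\<in>carrier N. k (t.tens \<phi> y) = \<phi> x \<odot>\<^bsub>N\<^esub> y)"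
proof (rule t.tensor_lift[OF N.module_axioms])
  show "t.bilinear N (\<lambda>\<phi> y. \<phi> x \<odot>\<^bsub>N\<^esub> y)"
    unfolding t.bilinear_def
    by (auto simp: free_carrier N.smult_l_distr N.smult_r_distr N.smult_assoc1)
      (simp add: N.smult_assoc1[symmetric] m_comm)
qed

definition coord where
  "coord x = (SOME k. linear_map R t.T N k \<and> (\<forall>\<phi>\<in>carrier F. \<forall>y\<in>carrier N. k (t.tens \<phi> y) = \<phi> x \<odot>\<^bsub>N\<^esub> y))"

lemma coord_linear: "linear_map R t.T N (coord x)"
  and coord_tens: "\<phi> \<in> carrier F \<Longrightarrow> y \<in> carrier N \<Longrightarrow> coord x (t.tens \<phi> y) = \<phi> x \<odot>\<^bsub>N\<^esub> y"
  using someI_ex[OF coordinate[of x], folded coord_def] by auto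

abbreviation tsum where
  "tsum X0 f \<nu> \<equiv> lincomb t.T X0 (\<lambda>_. \<one>\<^bsub>R\<^esub>) (\<lambda>x. t.tens (f x) (\<nu> x))"

lemma tsum_closed: "f \<in> X0 \<rightarrow> carrier F \<Longrightarrow> \<nu> \<in> X0 \<rightarrow> carrier N \<Longrightarrow> tsum X0 f \<nu> \<in> carrier t.T"
  by (intro t.T.lincomb_closed Pi_I t.tens_closed) auto

lemma coord_tsum:
  assumes "f \<in> X0 \<rightarrow> carrier F" "\<nu> \<in> X0 \<rightarrow> carrier N"
  shows "coord x (tsum X0 f \<nu>) = lincomb N X0 (\<lambda>x'. f x' x) \<nu>"
proof -
  interpret c: linear_map R t.T N "coord x" by (rule coord_linear)
  have fR: "f x' x \<in> carrier R" if "x' \<in> X0" for x' using assms(1) that by (simp add: Pi_iff free_carrier)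
  have "coord x (tsum X0 f \<nu>) = lincomb N X0 (\<lambda>_. \<one>\<^bsub>R\<^esub>) (\<lambda>x'. coord x (t.tens (f x') (\<nu> x')))"
    using assms by (intro c.hom_lincomb Pi_I t.tens_closed) auto
  also have "\<dots> = lincomb N X0 (\<lambda>x'. f x' x) \<nu>"
    unfolding lincomb_def using assms fR by (intro N.M.finsum_cong') (auto simp: coord_tens Pi_iff)
  finally show ?thesis .
qed

text \<open>
  Such sums contain the pure tensors, by expansion of the first factor in the basis, and are
  closed under addition, after both index sets have been enlarged to their union.
\<close>

lemma normal_form:
  assumes "t \<in> carrier t.T"
  shows "\<exists>X0 \<nu>. finite X0 \<and> X0 \<subseteq> X \<and> \<nu> \<in> X0 \<rightarrow> carrier N \<and> t = tsum X0 (basis_vec R) \<nu>"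
proof -
  define NF where "NF = {t. \<exists>X0 \<nu>. finite X0 \<and> X0 \<subseteq> X \<and> \<nu> \<in> UNIV \<rightarrow> carrier N \<and>
      (\<forall>x. x \<notin> X0 \<longrightarrow> \<nu> x = \<zero>\<^bsub>N\<^esub>) \<and> t = tsum X0 (basis_vec R) \<nu>}"
  have bas: "basis_vec R \<in> X0 \<rightarrow> carrier F" if "X0 \<subseteq> X" for X0 using that by auto
  have tens0: "t.tens (basis_vec R x) \<zero>\<^bsub>N\<^esub> = \<zero>\<^bsub>t.T\<^esub>" if "x \<in> X" for x
    using linear_map.hom_zero[OF t.tens_right_linear[OF basis_vec_closed[OF that]]] .
  have enlarge: "tsum X0 (basis_vec R) \<nu> = tsum X1 (basis_vec R) \<nu>"
    if X: "finite X1" "X0 \<subseteq> X1" "X1 \<subseteq> X" and \<nu>: "\<nu> \<in> UNIV \<rightarrow> carrier N" "\<forall>x. x \<notin> X0 \<longrightarrow> \<nu> x = \<zero>\<^bsub>N\<^esub>" for X0 X1 \<nu>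
    unfolding lincomb_def
  proof (rule t.T.M.add.finprod_mono_neutral_cong_left[OF X(1,2)])
    show "(\<lambda>x. \<one>\<^bsub>R\<^esub> \<odot>\<^bsub>t.T\<^esub> t.tens (basis_vec R x) (\<nu> x)) \<in> X1 \<rightarrow> carrier t.T"
      using X(3) \<nu>(1) by (intro Pi_I t.T.smult_closed t.tens_closed) auto
    fix x assume x: "x \<in> X1 - X0"
    then have "\<one>\<^bsub>R\<^esub> \<odot>\<^bsub>t.T\<^esub> t.tens (basis_vec R x) (\<nu> x) = \<one>\<^bsub>R\<^esub> \<odot>\<^bsub>t.T\<^esub> \<zero>\<^bsub>t.T\<^esub>"
      using \<nu>(2) X(3) tens0[of x] by auto
    then show "\<one>\<^bsub>R\<^esub> \<odot>\<^bsub>t.T\<^esub> t.tens (basis_vec R x) (\<nu> x) = \<zero>\<^bsub>t.T\<^esub>" by (simp del: free_ops)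
  qed auto
  have "submodule NF R t.T"
  proof (rule t.T.submoduleI2)
    show "NF \<subseteq> carrier t.T"
    proof
      fix t assume "t \<in> NF"
      then obtain X0 \<nu> where "X0 \<subseteq> X" "\<nu> \<in> UNIV \<rightarrow> carrier N" "t = tsum X0 (basis_vec R) \<nu>"
        unfolding NF_def by blast
      then show "t \<in> carrier t.T" using bas by (simp only:) (rule tsum_closed, auto)
    qed
    show "\<zero>\<^bsub>t.T\<^esub> \<in> NF"
      unfolding NF_def by (intro CollectI exI[of _ "{}"] exI[of _ "\<lambda>_. \<zero>\<^bsub>N\<^esub>"]) auto
  next
    fix s t assume "s \<in> NF" "t \<in> NF"
    then obtain X0 \<nu> X1 \<mu> where 1: "finite X0" "X0 \<subseteq> X" "\<nu> \<in> UNIV \<rightarrow> carrier N"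
      "\<forall>x. x \<notin> X0 \<longrightarrow> \<nu> x = \<zero>\<^bsub>N\<^esub>" "s = tsum X0 (basis_vec R) \<nu>"
      "finite X1" "X1 \<subseteq> X" "\<mu> \<in> UNIV \<rightarrow> carrier N"
      "\<forall>x. x \<notin> X1 \<longrightarrow> \<mu> x = \<zero>\<^bsub>N\<^esub>" "t = tsum X1 (basis_vec R) \<mu>"
      unfolding NF_def by blast
    let ?Y = "X0 \<union> X1"
    have \<nu>\<mu>: "\<nu> x \<in> carrier N" "\<mu> x \<in> carrier N" for x using 1 by auto
    have "s = tsum ?Y (basis_vec R) \<nu>" unfolding 1(5) by (rule enlarge) (use 1 in auto)
    moreover have "t = tsum ?Y (basis_vec R) \<mu>" unfolding 1(10) by (rule enlarge) (use 1 in auto)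
    ultimately have "s \<oplus>\<^bsub>t.T\<^esub> t = lincomb t.T ?Y (\<lambda>_. \<one>\<^bsub>R\<^esub>)
        (\<lambda>x. t.tens (basis_vec R x) (\<nu> x) \<oplus>\<^bsub>t.T\<^esub> t.tens (basis_vec R x) (\<mu> x))"
      using 1 \<nu>\<mu> by (simp only:) (intro t.T.lincomb_add_right[symmetric] Pi_I t.tens_closed; auto)
    also have "\<dots> = tsum ?Y (basis_vec R) (\<lambda>x. \<nu> x \<oplus>\<^bsub>N\<^esub> \<mu> x)"
    proof (rule t.T.lincomb_cong)
      fix x assume "x \<in> ?Y"
      then have "basis_vec R x \<in> carrier F" using 1 by auto
      then show "t.tens (basis_vec R x) (\<nu> x) \<oplus>\<^bsub>t.T\<^esub> t.tens (basis_vec R x) (\<mu> x) =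
            t.tens (basis_vec R x) (\<nu> x \<oplus>\<^bsub>N\<^esub> \<mu> x)"
        using \<nu>\<mu> by (intro t.tens_add_right[symmetric])
    next
      show "(\<lambda>x. t.tens (basis_vec R x) (\<nu> x \<oplus>\<^bsub>N\<^esub> \<mu> x)) \<in> ?Y \<rightarrow> carrier t.T"
        using 1 \<nu>\<mu> by (intro Pi_I t.tens_closed) auto
    qed auto
    finally show "s \<oplus>\<^bsub>t.T\<^esub> t \<in> NF"
      unfolding NF_def using 1 \<nu>\<mu>
      by (intro CollectI exI[of _ ?Y] exI[of _ "\<lambda>x. \<nu> x \<oplus>\<^bsub>N\<^esub> \<mu> x"]) auto
  next
    fix r t assume r: "r \<in> carrier R" and "t \<in> NF"
    then obtain X0 \<nu> where 1: "finite X0" "X0 \<subseteq> X" "\<nu> \<in> UNIV \<rightarrow> carrier N"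
      "\<forall>x. x \<notin> X0 \<longrightarrow> \<nu> x = \<zero>\<^bsub>N\<^esub>" "t = tsum X0 (basis_vec R) \<nu>"
      unfolding NF_def by blast
    have \<nu>: "\<nu> x \<in> carrier N" for x using 1 by auto
    have "r \<odot>\<^bsub>t.T\<^esub> t = lincomb t.T X0 (\<lambda>_. \<one>\<^bsub>R\<^esub>) (\<lambda>x. r \<odot>\<^bsub>t.T\<^esub> t.tens (basis_vec R x) (\<nu> x))"
      unfolding 1(5) using 1 \<nu> r by (intro t.T.smult_lincomb(2) Pi_I t.tens_closed) auto
    also have "\<dots> = tsum X0 (basis_vec R) (\<lambda>x. r \<odot>\<^bsub>N\<^esub> \<nu> x)"
    proof (rule t.T.lincomb_cong)
      fix x assume "x \<in> X0"
      then have "basis_vec R x \<in> carrier F" using 1 by auto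
      then show "r \<odot>\<^bsub>t.T\<^esub> t.tens (basis_vec R x) (\<nu> x) = t.tens (basis_vec R x) (r \<odot>\<^bsub>N\<^esub> \<nu> x)"
        using \<nu> r by (intro t.tens_smult_right[symmetric])
    next
      show "(\<lambda>x. t.tens (basis_vec R x) (r \<odot>\<^bsub>N\<^esub> \<nu> x)) \<in> X0 \<rightarrow> carrier t.T"
        using 1 \<nu> r by (intro Pi_I t.tens_closed) auto
    qed auto
    finally show "r \<odot>\<^bsub>t.T\<^esub> t \<in> NF"
      unfolding NF_def using 1 \<nu> r
      by (intro CollectI exI[of _ X0] exI[of _ "\<lambda>x. r \<odot>\<^bsub>N\<^esub> \<nu> x"]) auto
  qed
  then have "carrier t.T \<subseteq> NF"
  proof (rule t.tensor_span)
    fix \<phi> y assume \<phi>: "\<phi> \<in> carrier F" and y: "y \<in> carrier N"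
    let ?X0 = "{x. \<phi> x \<noteq> \<zero>\<^bsub>R\<^esub>}"
    have X0: "finite ?X0" "?X0 \<subseteq> X" and \<phi>R: "\<phi> x \<in> carrier R" for x using \<phi> by (auto simp: free_carrier)
    interpret l: linear_map R F t.T "\<lambda>\<phi>. t.tens \<phi> y" by (rule t.tens_left_linear[OF y])
    have "t.tens \<phi> y = t.tens (lincomb F ?X0 \<phi> (basis_vec R)) y"
      using free_expand[OF \<phi> X0(1) subset_refl X0(2)] by simp
    also have "\<dots> = lincomb t.T ?X0 \<phi> (\<lambda>x. t.tens (basis_vec R x) y)"
      using \<phi>R X0 by (intro l.hom_lincomb) auto
    also have "\<dots> = tsum ?X0 (basis_vec R) (\<lambda>x. \<phi> x \<odot>\<^bsub>N\<^esub> y)"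
      unfolding lincomb_def
    proof (rule t.T.M.finsum_cong')
      fix x assume "x \<in> ?X0"
      then have b: "basis_vec R x \<in> carrier F" using X0 by auto
      have "t.tens (basis_vec R x) (\<phi> x \<odot>\<^bsub>N\<^esub> y) = \<phi> x \<odot>\<^bsub>t.T\<^esub> t.tens (basis_vec R x) y"
        using \<phi>R b y by (intro t.tens_smult_right)
      moreover have "t.tens (basis_vec R x) (\<phi> x \<odot>\<^bsub>N\<^esub> y) \<in> carrier t.T"
        using \<phi>R b y by (intro t.tens_closed) auto
      ultimately show "\<phi> x \<odot>\<^bsub>t.T\<^esub> t.tens (basis_vec R x) y =
          \<one>\<^bsub>R\<^esub> \<odot>\<^bsub>t.T\<^esub> t.tens (basis_vec R x) (\<phi> x \<odot>\<^bsub>N\<^esub> y)"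
        using t.T.smult_one by metis
    next
      show "(\<lambda>x. \<one>\<^bsub>R\<^esub> \<odot>\<^bsub>t.T\<^esub> t.tens (basis_vec R x) (\<phi> x \<odot>\<^bsub>N\<^esub> y)) \<in> ?X0 \<rightarrow> carrier t.T"
        using \<phi>R X0 y by (intro Pi_I t.T.smult_closed t.tens_closed) auto
    qed simp
    finally show "t.tens \<phi> y \<in> NF"
      unfolding NF_def using X0 \<phi>R y
      by (intro CollectI exI[of _ ?X0] exI[of _ "\<lambda>x. \<phi> x \<odot>\<^bsub>N\<^esub> y"]) auto
  qed
  with assms have "t \<in> NF" by blast
  then obtain X0 \<nu> where "finite X0" "X0 \<subseteq> X" "\<nu> \<in> UNIV \<rightarrow> carrier N" "t = tsum X0 (basis_vec R) \<nu>"
    unfolding NF_def by blast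
  then show ?thesis by (intro exI[of _ X0] exI[of _ \<nu>]) auto
qed

lemma coord_inject:
  assumes s: "s \<in> carrier t.T" and t: "t \<in> carrier t.T" and eq: "\<And>x. coord x s = coord x t"
  shows "s = t"
proof -
  have c: "s \<ominus>\<^bsub>t.T\<^esub> t \<in> carrier t.T" using s t by (rule t.T.M.minus_closed)
  obtain X0 \<nu> where 1: "finite X0" "X0 \<subseteq> X" "\<nu> \<in> X0 \<rightarrow> carrier N" "s \<ominus>\<^bsub>t.T\<^esub> t = tsum X0 (basis_vec R) \<nu>"
    using normal_form[OF c] by blast
  have b: "basis_vec R \<in> X0 \<rightarrow> carrier F" using 1(2) by auto
  have "\<nu> x = \<zero>\<^bsub>N\<^esub>" if x: "x \<in> X0" for x
  proof -
    have "\<nu> x = (\<Oplus>\<^bsub>N\<^esub>x'\<in>X0. if x = x' then \<nu> x' else \<zero>\<^bsub>N\<^esub>)"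
      using 1 x by (intro N.M.add.finprod_singleton[symmetric]) auto
    also have "\<dots> = lincomb N X0 (\<lambda>x'. basis_vec R x' x) \<nu>"
      unfolding lincomb_def using 1(3) by (intro N.M.finsum_cong') (auto simp: basis_vec_def Pi_iff)
    also have "\<dots> = coord x (s \<ominus>\<^bsub>t.T\<^esub> t)" unfolding 1(4) by (rule coord_tsum[OF b 1(3), symmetric])
    also have "\<dots> = coord x s \<ominus>\<^bsub>N\<^esub> coord x t" using s t by (rule linear_map.hom_minus[OF coord_linear])
    also have "\<dots> = \<zero>\<^bsub>N\<^esub>"
      unfolding eq a_minus_def using linear_map.hom_closed[OF coord_linear t] by (rule N.M.r_neg)
    finally show ?thesis .
  qed
  then have "tsum X0 (basis_vec R) \<nu> = lincomb t.T X0 (\<lambda>_. \<one>\<^bsub>R\<^esub>) (\<lambda>_. \<zero>\<^bsub>t.T\<^esub>)"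
  proof (intro t.T.lincomb_cong)
    fix x assume x: "x \<in> X0" and "\<And>x. x \<in> X0 \<Longrightarrow> \<nu> x = \<zero>\<^bsub>N\<^esub>"
    then show "t.tens (basis_vec R x) (\<nu> x) = \<zero>\<^bsub>t.T\<^esub>"
      using linear_map.hom_zero[OF t.tens_right_linear, of "basis_vec R x"] b by auto
  qed auto
  also have "\<dots> = \<zero>\<^bsub>t.T\<^esub>" by (rule t.T.lincomb_zero_right) auto
  finally have "s \<ominus>\<^bsub>t.T\<^esub> t = \<zero>\<^bsub>t.T\<^esub>" using 1(4) by simp
  then show "s = t"
    using s t unfolding a_minus_def by (metis t.T.M.minus_equality t.T.M.minus_minus t.T.M.a_inv_closed)
qed

end

lemma formal_sum_Nil [simp]: "formal_sum R [] = (\<lambda>x. \<zero>\<^bsub>R\<^esub>)"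
  and formal_sum_Cons: "formal_sum R ((r, y) # l) = (\<lambda>x. if x = y then r \<oplus>\<^bsub>R\<^esub> formal_sum R l x else formal_sum R l x)"
  by (auto simp: formal_sum_def fun_eq_iff)

context free_mod
begin

lemma formal_sum_closed: "set l \<subseteq> carrier R \<times> X \<Longrightarrow> formal_sum R l \<in> carrier F"
proof (induction l)
  case Nil
  then show ?case by (simp add: free_carrier)
next
  case (Cons p l)
  obtain r y where p: "p = (r, y)" by (cases p)
  have l: "\<forall>x. formal_sum R l x \<in> carrier R" "finite {x. formal_sum R l x \<noteq> \<zero>}" "{x. formal_sum R l x \<noteq> \<zero>} \<subseteq> X"
    using Cons by (simp_all add: free_carrier)
  have "{x. formal_sum R (p # l) x \<noteq> \<zero>} \<subseteq> insert y {x. formal_sum R l x \<noteq> \<zero>}"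
    by (auto simp: p formal_sum_Cons)
  moreover have ry: "r \<in> carrier R" "y \<in> X" using Cons.prems p by simp_all
  ultimately have "finite {x. formal_sum R (p # l) x \<noteq> \<zero>}" "{x. formal_sum R (p # l) x \<noteq> \<zero>} \<subseteq> X"
    using l(2,3) finite_subset[OF _ finite.insertI[OF l(2)]] by blast+
  moreover have "\<forall>x. formal_sum R (p # l) x \<in> carrier R"
    using l(1) ry by (simp add: p formal_sum_Cons)
  ultimately show ?case unfolding free_carrier by blast
qed

lemma formal_sum_surj:
  assumes "u \<in> carrier F"
  shows "\<exists>l. set l \<subseteq> carrier R \<times> X \<and> formal_sum R l = u"
proof -
  have u: "finite {x. u x \<noteq> \<zero>}" "{x. u x \<noteq> \<zero>} \<subseteq> X" "\<And>x. u x \<in> carrier R"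
    using assms by (simp_all add: free_carrier)
  obtain ys where ys: "set ys = {x. u x \<noteq> \<zero>}" "distinct ys"
    using finite_distinct_list[OF u(1)] by blast
  have "formal_sum R (map (\<lambda>y. (u y, y)) zs) = (\<lambda>x. if x \<in> set zs then u x else \<zero>)" if "distinct zs" for zs
    using that u(3) by (induction zs) (auto simp: formal_sum_Cons fun_eq_iff)
  from this[OF ys(2)] have "formal_sum R (map (\<lambda>y. (u y, y)) ys) = u"
    using ys(1) by auto
  then show ?thesis using ys u by (intro exI[of _ "map (\<lambda>y. (u y, y)) ys"]) auto
qed

end

locale resolution = module R P for R (structure) and P (structure)
begin

abbreviation X where "X n \<equiv> res_gens R P n"
abbreviation F where "F n \<equiv> res_module R P n"
abbreviation d where "d n \<equiv> res_diff R P n"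
abbreviation aug where "aug \<equiv> res_aug R P"

lemma F_eq: "F n = free_module R (X n)" by (simp add: res_module_def)

lemma F_module: "module R (F n)"
  unfolding F_eq by (intro free_mod.free_module_is_module) (simp add: free_mod_def R.is_cring)

sublocale Fm: free_mod R "X n" for n by (simp add: free_mod_def R.is_cring)

lemma aug_linear: "linear_map R (F 0) P aug"
  and aug_basis: "p \<in> carrier P \<Longrightarrow> aug (basis_vec R (Elem p)) = p"
proof -
  interpret free_hom R "X 0" P elem_of
    by (intro free_homI module_axioms) auto
  show "linear_map R (F 0) P aug" unfolding F_eq res_aug_def by (rule linear_ext_linear_map)
  show "p \<in> carrier P \<Longrightarrow> aug (basis_vec R (Elem p)) = p"
    unfolding res_aug_def by (subst linear_ext_basis) auto
qed

lemma aug_surj: "aug ` carrier (F 0) = carrier P"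
proof (intro equalityI subsetI)
  fix p assume p: "p \<in> carrier P"
  then have "basis_vec R (Elem p) \<in> carrier (F 0)" unfolding F_eq by (intro Fm.basis_vec_closed) auto
  then show "p \<in> aug ` carrier (F 0)" using aug_basis[OF p] by (metis image_eqI)
qed (use linear_map.hom_closed[OF aug_linear] in auto)

lemma X_Suc: "X (Suc n) = {Rel l | l. set l \<subseteq> carrier R \<times> X n \<and>
    (case n of 0 \<Rightarrow> aug (formal_sum R l) = \<zero>\<^bsub>P\<^esub> | Suc m \<Rightarrow> d m (formal_sum R l) = \<zero>\<^bsub>F m\<^esub>)}"
  by (cases n) (auto simp: res_aug_def res_diff_def res_module_def Let_def)

lemma terms_closed: "g \<in> X (Suc n) \<Longrightarrow> formal_sum R (terms_of g) \<in> carrier (F n)"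
  unfolding X_Suc F_eq using Fm.formal_sum_closed by auto

lemma d_linear: "linear_map R (F (Suc n)) (F n) (d n)"
  and d_basis: "g \<in> X (Suc n) \<Longrightarrow> d n (basis_vec R g) = formal_sum R (terms_of g)"
proof -
  interpret free_hom R "X (Suc n)" "F n" "\<lambda>g. formal_sum R (terms_of g)"
    using terms_closed by (intro free_homI F_module) blast
  show "linear_map R (F (Suc n)) (F n) (d n)"
    unfolding F_eq[of "Suc n"] res_diff_def by (rule linear_ext_linear_map)
  show "g \<in> X (Suc n) \<Longrightarrow> d n (basis_vec R g) = formal_sum R (terms_of g)"
    unfolding res_diff_def by (rule linear_ext_basis)
qed

text \<open>
  Every element of a free module is the formal sum of some list, hence every cycle is the image
  of a generator. Conversely, generators are sent to cycles by their definition.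
\<close>

lemma image_d:
  "d n ` carrier (F (Suc n)) =
   (case n of 0 \<Rightarrow> a_kernel (F 0) P aug | Suc m \<Rightarrow> a_kernel (F (Suc m)) (F m) (d m))" (is "_ = ?K")
proof (intro equalityI subsetI)
  have K: "submodule ?K R (F n)"
    using linear_map.kernel_submodule[OF aug_linear] linear_map.kernel_submodule[OF d_linear]
    by (cases n) auto
  fix v assume "v \<in> d n ` carrier (F (Suc n))"
  then obtain u where u: "u \<in> carrier (free_module R (X (Suc n)))" "v = d n u" by (auto simp: F_eq)
  have sub: "submodule {u \<in> carrier (F (Suc n)). d n u \<in> ?K} R (free_module R (X (Suc n)))"
    using linear_map.preimage_submodule[OF d_linear K] by (simp add: F_eq)
  have "u \<in> {u \<in> carrier (F (Suc n)). d n u \<in> ?K}"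
  proof (rule Fm.free_induct[OF u(1) sub])
    fix g assume g: "g \<in> X (Suc n)"
    have "basis_vec R g \<in> carrier (F (Suc n))" unfolding F_eq using g by (rule Fm.basis_vec_closed)
    moreover have "d n (basis_vec R g) \<in> ?K"
      unfolding d_basis[OF g] using g terms_closed[OF g] unfolding X_Suc
      by (cases n) (auto simp: a_kernel_def')
    ultimately show "basis_vec R g \<in> {u \<in> carrier (F (Suc n)). d n u \<in> ?K}" by blast
  qed
  then show "v \<in> ?K" using u by simp
next
  fix v assume v: "v \<in> ?K"
  then have "v \<in> carrier (F n)" by (cases n) (auto simp: a_kernel_def')
  then obtain l where l: "set l \<subseteq> carrier R \<times> X n" "formal_sum R l = v"
    unfolding F_eq using Fm.formal_sum_surj by blast
  have g: "Rel l \<in> X (Suc n)"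
    unfolding X_Suc using l v by (cases n) (auto simp: a_kernel_def')
  have "basis_vec R (Rel l) \<in> carrier (F (Suc n))" unfolding F_eq using g by (rule Fm.basis_vec_closed)
  moreover have "d n (basis_vec R (Rel l)) = v" using d_basis[OF g] l by simp
  ultimately show "v \<in> d n ` carrier (F (Suc n))" by (metis image_eqI)
qed

lemma image_d_0: "d 0 ` carrier (F (Suc 0)) = a_kernel (F 0) P aug"
  and image_d_Suc: "d (Suc n) ` carrier (F (Suc (Suc n))) = a_kernel (F (Suc n)) (F n) (d n)"
  using image_d[of 0] image_d[of "Suc n"] by auto

end

text \<open>
  As the ring and \<open>P\<close> are both flat over \<open>A0\<close>, they are
  \<open>Tor\<close>-independent of the quotients of \<open>A0\<close>: reduction of the
  resolution modulo elements of \<open>A0\<close> is a resolution of the reduction of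
  \<open>P\<close>.
\<close>

locale flat_resolution = resolution R P + coefficients R A0 "{}" for R (structure) and P (structure) and A0 +
  assumes P_flat: "relation_flat R A0 {} P (carrier P)"
    and R_flat: "relation_flat R A0 {} (self_module R) (carrier R)"
begin

lemma F_flat: "relation_flat R A0 {} (F n) (carrier (F n))"
  unfolding F_eq by (rule free_module_relation_flat[OF R_flat])

lemma coefficient_mapI:
  "coefficients R A1 E \<Longrightarrow> linear_map R M N h \<Longrightarrow> relation_flat R A1 E N (h ` carrier M) \<Longrightarrow>
   coefficient_map R A1 E M N h"
  by (simp add: coefficient_map_def coefficient_map_axioms_def)

text \<open>
  The induction step along a resolution. Flatness of the image over \<open>A0\<close> gives the
  intersection property of the kernel, and this property is what passes flatness modulo
  \<open>E\<close> on to the kernel.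
\<close>

lemma kernel_flat_step:
  fixes M :: "('a, 'e) module" and N :: "('a, 'f, 'g) module_scheme"
  assumes h: "linear_map R M N h" and E: "E \<subseteq> A0"
    and flat0: "relation_flat R A0 {} N (h ` carrier M)"
    and flat1: "relation_flat R (carrier R) E N (h ` carrier M)"
    and M0: "relation_flat R A0 {} M (carrier M)"
    and M1: "relation_flat R (carrier R) E M (carrier M)"
  shows "relation_flat R A0 {} M (a_kernel M N h)"
    and "relation_flat R (carrier R) E M (a_kernel M N h)"
    and "a_kernel M N h \<inter> scaled M E (carrier M) \<subseteq> scaled M E (a_kernel M N h)"
    and "coefficient_map R (carrier R) E M N h"
proof -
  have c0: "coefficient_map R A0 {} M N h"
    by (intro coefficient_mapI coefficients_axioms h flat0)
  have "coefficients R (carrier R) E"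
    using E A0_sub by unfold_locales auto
  then show c1: "coefficient_map R (carrier R) E M N h"
    by (intro coefficient_mapI h flat1)
  show i: "a_kernel M N h \<inter> scaled M E (carrier M) \<subseteq> scaled M E (a_kernel M N h)"
    by (rule kernel_inter_scaled[OF c0 E])
  show "relation_flat R (carrier R) E M (a_kernel M N h)"
    by (rule coefficient_map.kernel_relation_flat[OF c1 M1 i])
  have "\<zero>\<^bsub>M\<^esub> \<in> scaled M {} (a_kernel M N h)" by (rule scaled.zero)
  then show "relation_flat R A0 {} M (a_kernel M N h)"
    by (intro coefficient_map.kernel_relation_flat[OF c0 M0]) simp
qed

context
  fixes E assumes E: "E \<subseteq> A0" and P_flat_E: "relation_flat R (carrier R) E P (carrier P)"
begin

lemma F_flat_E: "relation_flat R (carrier R) E (F n) (carrier (F n))"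
proof -
  interpret c: coefficients R "carrier R" E using E A0_sub by unfold_locales auto
  show ?thesis unfolding F_eq by (rule c.free_module_relation_flat[OF c.self_relation_flat]) simp
qed

lemmas aug_flat = kernel_flat_step[OF aug_linear E, unfolded aug_surj, OF P_flat P_flat_E F_flat F_flat_E]

lemma image_d_flat:
  "relation_flat R A0 {} (F n) (d n ` carrier (F (Suc n))) \<and>
   relation_flat R (carrier R) E (F n) (d n ` carrier (F (Suc n)))"
proof (induction n)
  case 0
  show ?case unfolding image_d_0 using aug_flat by blast
next
  case (Suc n)
  then show ?case unfolding image_d_Suc
    using kernel_flat_step(1,2)[OF d_linear E _ _ F_flat F_flat_E] by blast
qed

lemmas d_flat = kernel_flat_step[OF d_linear E conjunct1[OF image_d_flat] conjunct2[OF image_d_flat] F_flat F_flat_E]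

lemma resolution_lift_cycle:
  assumes "module R N" "finite X0" "X0 \<subseteq> X (Suc n)" "\<nu> \<in> X0 \<rightarrow> carrier N"
    and "\<And>e x. e \<in> E \<Longrightarrow> x \<in> X0 \<Longrightarrow> e \<odot>\<^bsub>N\<^esub> \<nu> x = \<zero>\<^bsub>N\<^esub>"
    and "\<And>y. y \<in> X n \<Longrightarrow> lincomb N X0 (\<lambda>x. d n (basis_vec R x) y) \<nu> = \<zero>\<^bsub>N\<^esub>"
  shows "\<exists>e \<in> X0 \<rightarrow> a_kernel (F (Suc n)) (F n) (d n).
    \<forall>x. lincomb N X0 (\<lambda>x'. e x' x) \<nu> = lincomb N X0 (\<lambda>x'. basis_vec R x' x) \<nu>"
proof (cases n)
  case 0
  show ?thesis unfolding 0 F_eq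
    by (rule lift_cycle[OF aug_flat(4)[unfolded F_eq] aug_flat(3)[unfolded F_eq]
          d_linear[of 0, unfolded F_eq] image_d_0[unfolded F_eq] assms(1,2) _ assms(4,5)])
      (use assms 0 in auto)
next
  case (Suc m)
  show ?thesis unfolding Suc F_eq
    by (rule lift_cycle[OF d_flat(4)[unfolded F_eq] d_flat(3)[unfolded F_eq]
          d_linear[of "Suc m", unfolded F_eq] image_d_Suc[unfolded F_eq] assms(1,2) _ assms(4,5)])
      (use assms Suc in auto)
qed

end

text \<open>
  A cycle in positive degree has the form \<open>\<Sum> b x \<otimes> \<nu> x\<close> with
  finitely many \<open>\<nu> x\<close>, so some \<open>E\<close> in \<open>A0\<close> modulo
  which \<open>P\<close> is flat kills all of them. By \<open>lift_cycle\<close> it equals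
  \<open>\<Sum> e x \<otimes> \<nu> x\<close> with cycles \<open>e x\<close> of the
  resolution. These are boundaries, and then so is the sum.
\<close>

theorem Tor_vanishes:
  fixes N :: "('a, 'n, 'q) module_scheme"
  assumes N: "module R N"
    and kill: "\<And>W. finite W \<Longrightarrow> W \<subseteq> carrier N \<Longrightarrow> \<exists>E \<subseteq> A0. (\<forall>e\<in>E. \<forall>y\<in>W. e \<odot>\<^bsub>N\<^esub> y = \<zero>\<^bsub>N\<^esub>) \<and>
                 relation_flat R (carrier R) E P (carrier P)"
    and i: "i > 0"
  shows "carrier (Tor R i P N) = {\<zero>\<^bsub>Tor R i P N\<^esub>}"
proof -
  obtain n :: nat where n: "i = Suc n" using i by (cases i) auto
  interpret N: module R N by (rule N)
  interpret T: free_tensor R "X k" N for k by unfold_locales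
  have th: "tensor_hom R (free_module R (X (Suc n))) N (free_module R (X n)) N (d n) (\<lambda>y. y)" for n
    unfolding tensor_hom_def tensor_hom_axioms_def
    using T.t.tensor_axioms linear_map.linear[OF d_linear[unfolded F_eq]]
    by (auto simp: linear_maps_def)
  define \<tau> where "\<tau> n = tor_diff R P N n" for n
  have \<tau>: "\<tau> n = tensor_map R (free_module R (X n)) N (d n) (\<lambda>y. y)" for n
    by (simp add: \<tau>_def tor_diff_def F_eq)
  note \<tau>_linear = tensor_hom.tensor_map_linear[OF th, folded \<tau>]
  note \<tau>_tens = tensor_hom.tensor_map_tens[OF th, folded \<tau>]
  have T: "tor_module R P N n = T.t.T n" for n by (simp add: tor_module_def F_eq)
  have \<tau>_sum: "\<tau> k (T.tsum (Suc k) X0 f \<nu>) = T.tsum k X0 (\<lambda>x. d k (f x)) \<nu>"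
    if f: "f \<in> X0 \<rightarrow> carrier (F (Suc k))" and \<nu>: "\<nu> \<in> X0 \<rightarrow> carrier N" for k f \<nu> and X0 :: "('a, 'c) res_gen set"
  proof -
    interpret \<tau>: linear_map R "T.t.T (Suc k)" "T.t.T k" "\<tau> k" by (rule \<tau>_linear)
    have f': "f x \<in> carrier (free_module R (X (Suc k)))" "\<nu> x \<in> carrier N" if "x \<in> X0" for x
      using f \<nu> that by (auto simp: F_eq)
    have "\<tau> k (T.tsum (Suc k) X0 f \<nu>) =
        lincomb (T.t.T k) X0 (\<lambda>_. \<one>\<^bsub>R\<^esub>) (\<lambda>x. \<tau> k (tensor_relations R (free_module R (X (Suc k))) N +>\<^bsub>free_module R (carrier (free_module R (X (Suc k))) \<times> carrier N)\<^esub> basis_vec R (f x, \<nu> x)))"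
      using f' by (intro \<tau>.hom_lincomb Pi_I T.t.tens_closed) auto
    also have "\<dots> = T.tsum k X0 (\<lambda>x. d k (f x)) \<nu>"
    proof (rule T.t.T.lincomb_cong)
      show "(\<lambda>x. tensor_relations R (free_module R (X k)) N +>\<^bsub>free_module R (carrier (free_module R (X k)) \<times> carrier N)\<^esub> basis_vec R (d k (f x), \<nu> x))
         \<in> X0 \<rightarrow> carrier (T.t.T k)"
        using f f' linear_map.hom_closed[OF d_linear[of k]] by (intro Pi_I T.t.tens_closed) (auto simp: F_eq)
    qed (use f' \<tau>_tens in auto)
    finally show ?thesis .
  qed
  have cyc: "tor_cycles R P N i = a_kernel (T.t.T (Suc n)) (T.t.T n) (\<tau> n)"
    by (simp add: n T \<tau>_def)
  define H where "H = \<tau> i ` carrier (T.t.T (Suc i))"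
  have Hsub: "submodule H R (T.t.T i)"
    unfolding H_def by (intro linear_map.image_submodule[OF \<tau>_linear] T.t.T.carrier_is_submodule)
  have cyc_H: "tor_cycles R P N i \<subseteq> H"
  proof
    fix t assume "t \<in> tor_cycles R P N i"
    then have t: "t \<in> carrier (T.t.T (Suc n))" "\<tau> n t = \<zero>\<^bsub>T.t.T n\<^esub>"
      unfolding cyc a_kernel_def' by auto
    obtain X0 \<nu> where X0: "finite X0" "X0 \<subseteq> X (Suc n)" and \<nu>: "\<nu> \<in> X0 \<rightarrow> carrier N"
      and tsum: "t = T.tsum (Suc n) X0 (basis_vec R) \<nu>"
      using T.normal_form[OF t(1)] by blast
    have b: "basis_vec R \<in> X0 \<rightarrow> carrier (F (Suc n))"
      using X0(2) Fm.basis_vec_closed unfolding F_eq by blast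
    have db: "(\<lambda>x. d n (basis_vec R x)) \<in> X0 \<rightarrow> carrier (F n)"
      using b linear_map.hom_closed[OF d_linear] by blast
    obtain E where E: "E \<subseteq> A0" "\<And>e y. e \<in> E \<Longrightarrow> y \<in> \<nu> ` X0 \<Longrightarrow> e \<odot>\<^bsub>N\<^esub> y = \<zero>\<^bsub>N\<^esub>"
      "relation_flat R (carrier R) E P (carrier P)"
      using kill[of "\<nu> ` X0"] X0(1) \<nu> by blast
    have "lincomb N X0 (\<lambda>x. d n (basis_vec R x) y) \<nu> = \<zero>\<^bsub>N\<^esub>" for y
    proof -
      have "\<zero>\<^bsub>N\<^esub> = T.coord n y (\<tau> n t)"
        unfolding t(2) by (rule linear_map.hom_zero[OF T.coord_linear, symmetric])
      also have "\<dots> = T.coord n y (T.tsum n X0 (\<lambda>x. d n (basis_vec R x)) \<nu>)"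
        unfolding tsum using \<tau>_sum[OF b \<nu>] by simp
      also have "\<dots> = lincomb N X0 (\<lambda>x. d n (basis_vec R x) y) \<nu>"
        using db \<nu> by (intro T.coord_tsum) (simp_all add: F_eq)
      finally show ?thesis by simp
    qed
    then obtain e where e: "e \<in> X0 \<rightarrow> a_kernel (F (Suc n)) (F n) (d n)"
      "\<And>x. lincomb N X0 (\<lambda>x'. e x' x) \<nu> = lincomb N X0 (\<lambda>x'. basis_vec R x' x) \<nu>"
      using resolution_lift_cycle[OF E(1,3) N X0 \<nu>] E(2) by blast
    have "\<forall>x\<in>X0. \<exists>f\<in>carrier (F (Suc i)). d i f = e x"
    proof
      fix x assume "x \<in> X0"
      then have "e x \<in> d (Suc n) ` carrier (F (Suc (Suc n)))" unfolding image_d_Suc using e(1) by blast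
      then show "\<exists>f\<in>carrier (F (Suc i)). d i f = e x" unfolding n by (elim imageE) (rule bexI, auto)
    qed
    then obtain f where f: "\<And>x. x \<in> X0 \<Longrightarrow> f x \<in> carrier (F (Suc i))" "\<And>x. x \<in> X0 \<Longrightarrow> d i (f x) = e x"
      by metis
    have fF: "f \<in> X0 \<rightarrow> carrier (F (Suc i))" using f(1) by blast
    have eF: "e \<in> X0 \<rightarrow> carrier (free_module R (X i))" using e(1) unfolding n F_eq a_kernel_def' by blast
    define s where "s = T.tsum (Suc i) X0 f \<nu>"
    have s: "s \<in> carrier (T.t.T (Suc i))"
      unfolding s_def using fF \<nu> by (intro T.tsum_closed) (simp_all add: F_eq)
    have "\<tau> i s = T.tsum i X0 (\<lambda>x. d i (f x)) \<nu>" unfolding s_def by (rule \<tau>_sum[OF fF \<nu>])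
    also have "\<dots> = T.tsum i X0 e \<nu>"
      by (rule T.t.T.lincomb_cong) (use f(2) eF \<nu> in \<open>auto intro!: T.t.tens_closed\<close>)
    finally have s': "\<tau> i s = T.tsum i X0 e \<nu>" .
    have "t = \<tau> i s"
    proof (rule T.coord_inject)
      show "t \<in> carrier (T.t.T i)" using t n by simp
      show "\<tau> i s \<in> carrier (T.t.T i)" using linear_map.hom_closed[OF \<tau>_linear s] .
      fix x
      have "T.coord i x t = lincomb N X0 (\<lambda>x'. basis_vec R x' x) \<nu>"
        unfolding tsum n using b \<nu> by (intro T.coord_tsum) (simp_all add: F_eq)
      also have "\<dots> = T.coord i x (\<tau> i s)"
        unfolding s' e(2)[symmetric] using eF \<nu> by (intro T.coord_tsum[symmetric])
      finally show "T.coord i x t = T.coord i x (\<tau> i s)" .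
    qed
    then show "t \<in> H" unfolding H_def using s by blast
  qed
  have zero: "\<zero>\<^bsub>T.t.T i\<^esub> \<in> tor_cycles R P N i"
  proof -
    have "\<zero>\<^bsub>T.t.T (Suc n)\<^esub> \<in> a_kernel (T.t.T (Suc n)) (T.t.T n) (\<tau> n)"
      unfolding a_kernel_def' using linear_map.hom_zero[OF \<tau>_linear, of n] T.t.T.M.zero_closed by blast
    then show ?thesis by (simp only: cyc) (simp only: n)
  qed
  interpret q: module_quotient R "T.t.T i" H
    by (simp add: module_quotient_def module_quotient_axioms_def T.t.T.module_axioms Hsub)
  have coset: "H +>\<^bsub>T.t.T i\<lparr>carrier := tor_cycles R P N i\<rparr>\<^esub> x = H" if "x \<in> tor_cycles R P N i" for x
  proof -
    have "H +>\<^bsub>T.t.T i\<lparr>carrier := tor_cycles R P N i\<rparr>\<^esub> x = H +>\<^bsub>T.t.T i\<^esub> x"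
      by (simp add: a_r_coset_def')
    also have "\<dots> = H"
      using abelian_subgroup.a_rcos_const[OF q.abelian_subgroup] cyc_H that by blast
    finally show ?thesis .
  qed
  have Tor: "Tor R i P N = quotient_module (T.t.T i\<lparr>carrier := tor_cycles R P N i\<rparr>) H"
    by (simp add: Tor_def T H_def \<tau>_def)
  have "carrier (Tor R i P N) = {H}"
    unfolding Tor quotient_module_def using zero coset
    by (auto simp: A_RCOSETS_def')
  moreover have "\<zero>\<^bsub>Tor R i P N\<^esub> = H"
    unfolding Tor quotient_module_def by simp
  ultimately show ?thesis by simp
qed

end

section \<open>Noetherian rings\<close>

context cring
begin

abbreviation ideal_power :: "'a set \<Rightarrow> nat \<Rightarrow> 'a set"
  where "ideal_power I k \<equiv> I [^]\<^bsub>ideals_set R\<^esub> k"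

lemma self_is_module: "module R (self_module R)"
  by (rule self_module_module[OF is_cring])

lemma ideal_iff_submodule: "ideal I R \<longleftrightarrow> submodule I R (self_module R)"
proof
  interpret self: module R "self_module R" by (rule self_is_module)
  assume "ideal I R"
  then interpret ideal I R .
  show "submodule I R (self_module R)"
    by (rule self.submoduleI2) (auto simp: I_l_closed a_subset[THEN subsetD])
next
  assume s: "submodule I R (self_module R)"
  note D = submoduleD[OF self_is_module s]
  have neg: "\<ominus> x \<in> I" if "x \<in> I" for x using D(4)[OF that] by simp
  have "subgroup I (add_monoid R)"
    using D neg by (intro add.subgroupI) (auto simp: a_inv_def[symmetric])
  then show "ideal I R"
  proof (intro idealI ring_axioms)
    fix a x assume ax: "a \<in> I" "x \<in> carrier R"
    show "x \<otimes> a \<in> I" using D(7)[OF ax(2,1)] by simp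
    then show "a \<otimes> x \<in> I" using m_comm[of a x] ax D(3)[OF ax(1)] by simp
  qed
qed

lemma Idl_eq_ideal_span:
  assumes "E \<subseteq> carrier R"
  shows "Idl E = ideal_span R E"
proof
  interpret self: module R "self_module R" by (rule self_is_module)
  have i: "ideal (ideal_span R E) R"
    unfolding ideal_iff_submodule by (rule self.ideal_span_submodule[OF assms])
  have "e \<in> ideal_span R E" if "e \<in> E" for e
  proof -
    have e: "e \<in> carrier R" using that assms by auto
    have "e \<odot>\<^bsub>self_module R\<^esub> \<one> \<in> ideal_span R E"
      using that e by (intro self.scaled_mult) auto
    then show ?thesis using e by simp
  qed
  then show "Idl E \<subseteq> ideal_span R E" by (intro genideal_minimal i) auto
  show "ideal_span R E \<subseteq> Idl E"
  proof (rule self.scaled_least)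
    show "submodule (Idl E) R (self_module R)"
      using genideal_ideal[OF assms] by (simp add: ideal_iff_submodule)
    show "\<And>e z. e \<in> E \<Longrightarrow> z \<in> carrier R \<Longrightarrow> e \<odot>\<^bsub>self_module R\<^esub> z \<in> Idl E"
      using genideal_self[OF assms] ideal.I_r_closed[OF genideal_ideal[OF assms]] by auto
  qed
qed

lemma ideal_power_0 [simp]: "ideal_power I 0 = carrier R"
  by (simp add: ideals_set_def)

lemma ideal_power_Suc: "ideal_power I (Suc k) = ideal_power I k \<cdot>\<^bsub>R\<^esub> I"
  by (simp add: ideals_set_def)

lemma ideal_power_ideal: "ideal I R \<Longrightarrow> ideal (ideal_power I k) R"
  using monoid.nat_pow_closed[OF comm_monoid.axioms(1)[OF ideals_set_is_comm_monoid], of I k]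
  by (simp add: ideals_set_def)

lemma ideal_power_add: "ideal I R \<Longrightarrow> ideal_power I (k + l) = ideal_power I k \<cdot>\<^bsub>R\<^esub> ideal_power I l"
  using monoid.nat_pow_mult[OF comm_monoid.axioms(1)[OF ideals_set_is_comm_monoid], of I k l]
  by (simp add: ideals_set_def)

lemma ideal_power_antimono: "ideal I R \<Longrightarrow> k \<le> l \<Longrightarrow> ideal_power I l \<subseteq> ideal_power I k"
  using ideal_prod_inter[OF ideal_power_ideal ideal_power_ideal, of I I k "l - k"]
    ideal_power_add[of I k "l - k"] by auto

lemma ideal_power_sub: "ideal I R \<Longrightarrow> ideal_power I k \<subseteq> carrier R"
  using ideal.Icarr[OF ideal_power_ideal] by auto

lemma power_in_ideal_power: "ideal I R \<Longrightarrow> a \<in> I \<Longrightarrow> a [^] k \<in> ideal_power I k" for k :: nat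
proof (induction k)
  case 0
  show ?case unfolding ideal_power_0 by simp
next
  case (Suc k)
  then show ?case unfolding ideal_power_Suc nat_pow_Suc by (intro ideal_prod.prod) auto
qed

lemma ideal_add_principal:
  assumes "ideal L R" "b \<in> carrier R"
  shows "ideal {l \<oplus> b \<otimes> m | l m. l \<in> L \<and> m \<in> carrier R} R" (is "ideal ?S R")
    and "L \<subseteq> {l \<oplus> b \<otimes> m | l m. l \<in> L \<and> m \<in> carrier R}"
    and "b \<in> {l \<oplus> b \<otimes> m | l m. l \<in> L \<and> m \<in> carrier R}"
proof -
  interpret self: module R "self_module R" by (rule self_is_module)
  interpret L: ideal L R by fact
  note Lc = L.Icarr
  show "ideal ?S R"
    unfolding ideal_iff_submodule
  proof (rule self.submoduleI2)
    show "?S \<subseteq> carrier (self_module R)" using assms Lc by auto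
    have "\<zero> = \<zero> \<oplus> b \<otimes> \<zero>" using assms by simp
    then show "\<zero>\<^bsub>self_module R\<^esub> \<in> ?S" using L.zero_closed by force
  next
    fix x y assume "x \<in> ?S" "y \<in> ?S"
    then obtain l m l' m' where 1: "l \<in> L" "m \<in> carrier R" "x = l \<oplus> b \<otimes> m"
      "l' \<in> L" "m' \<in> carrier R" "y = l' \<oplus> b \<otimes> m'" by blast
    then have "x \<oplus> y = (l \<oplus> l') \<oplus> b \<otimes> (m \<oplus> m')"
      using assms Lc by (simp add: r_distr add.m_ac)
    moreover have "l \<oplus> l' \<in> L" using 1 by (intro L.a_closed)
    moreover have "m \<oplus> m' \<in> carrier R" using 1 by simp
    ultimately show "x \<oplus>\<^bsub>self_module R\<^esub> y \<in> ?S" by auto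
  next
    fix r x assume r: "r \<in> carrier R" and "x \<in> ?S"
    then obtain l m where 1: "l \<in> L" "m \<in> carrier R" "x = l \<oplus> b \<otimes> m" by blast
    then have "r \<otimes> x = r \<otimes> l \<oplus> b \<otimes> (r \<otimes> m)"
      using assms Lc r by (simp add: r_distr m_ac)
    moreover have "r \<otimes> l \<in> L" using 1 r by (intro L.I_l_closed)
    moreover have "r \<otimes> m \<in> carrier R" using 1 r by simp
    ultimately show "r \<odot>\<^bsub>self_module R\<^esub> x \<in> ?S" by auto
  qed
  show "L \<subseteq> ?S"
  proof
    fix l assume l: "l \<in> L"
    then have "l = l \<oplus> b \<otimes> \<zero>" using assms Lc by simp
    then show "l \<in> ?S" using l by blast
  qed
  have "b = \<zero> \<oplus> b \<otimes> \<one>" using assms by simp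
  then show "b \<in> ?S" using L.zero_closed by blast
qed

end

locale noetherian_cring = noetherian_ring R + cring R for R (structure)
begin

sublocale self: module R "self_module R" by (rule self_is_module)

lemma maximal_ideal_exists:
  assumes "S \<noteq> {}" "\<And>I. I \<in> S \<Longrightarrow> ideal I R"
  shows "\<exists>L\<in>S. \<forall>I\<in>S. L \<subseteq> I \<longrightarrow> I = L"
proof (rule subset_Zorn_nonempty[OF assms(1)])
  fix C assume C: "C \<noteq> {}" "subset.chain S C"
  then have "subset.chain {I. ideal I R} C"
    using assms(2) by (auto simp: subset.chain_def)
  then have "\<Union>C \<in> C" using C(1) by (rule ideal_chain_is_trivial[rotated])
  then show "\<Union>C \<in> S" using C(2) by (auto simp: subset.chain_def)
qed

lemma ideal_finitely_generated:
  assumes "ideal I R"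
  shows "\<exists>(q::nat) \<rho>. \<rho> \<in> {..<q} \<rightarrow> I \<and> (\<forall>x\<in>I. \<exists>c \<in> UNIV \<rightarrow> carrier R. x = lincomb (self_module R) {..<q} \<rho> c)"
proof -
  obtain E where E: "E \<subseteq> carrier R" "finite E" "I = Idl E" using finetely_gen[OF assms] by blast
  obtain \<rho> where \<rho>: "bij_betw \<rho> {..<card E} E"
    using ex_bij_betw_nat_finite[OF E(2)] by (auto simp: atLeast0LessThan)
  have im: "\<rho> ` {..<card E} = E" using \<rho> by (simp add: bij_betw_def)
  have \<rho>E: "\<rho> \<in> {..<card E} \<rightarrow> carrier R" using im E(1) by auto
  let ?S = "lincomb (self_module R) {..<card E} \<rho> ` (UNIV \<rightarrow> carrier R)"
  interpret l: linear_map R "sequence_module (self_module R)" "self_module R" "lincomb (self_module R) {..<card E} \<rho>"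
    by (rule self.lincomb_sequence_linear[OF \<rho>E])
  have "ideal ?S R"
    unfolding ideal_iff_submodule using l.image_submodule[OF l.M.carrier_is_submodule] by simp
  moreover have "E \<subseteq> ?S"
  proof
    fix e assume "e \<in> E"
    then obtain i where i: "i < card E" "e = \<rho> i" using im by auto
    have "(\<lambda>l. if l = i then \<one> else \<zero>) \<in> UNIV \<rightarrow> carrier R" by auto
    then show "e \<in> ?S" unfolding i(2) lincomb_unit[OF \<rho>E i(1), symmetric] by (rule imageI)
  qed
  ultimately have "I \<subseteq> ?S" unfolding E(3) by (rule genideal_minimal)
  moreover have "\<rho> \<in> {..<card E} \<rightarrow> I" using im genideal_self[OF E(1)] E(3) by auto
  ultimately show ?thesis by (intro exI[of _ "card E"] exI[of _ \<rho>]) blast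
qed

text \<open>
  Otherwise let \<open>M\<close> be maximal among the ideals that contain \<open>L\<close> but
  no power of \<open>\<aa>\<close>. Then \<open>M\<close> is prime: if \<open>x\<close> and
  \<open>y\<close> are not in \<open>M\<close>, then powers of \<open>\<aa>\<close> lie in
  \<open>M + (x)\<close> and \<open>M + (y)\<close>, and if \<open>x y\<close> were in
  \<open>M\<close>, their product would lie in \<open>M\<close>. As \<open>L\<close> contains a
  power of each element of \<open>\<aa>\<close>, it follows that
  \<open>\<aa> \<subseteq> M\<close>, a contradiction.
\<close>

lemma nil_ideal_power:
  assumes a: "ideal \<aa> R" and L: "ideal L R" and nil: "\<And>a. a \<in> \<aa> \<Longrightarrow> \<exists>j::nat. a [^] j \<in> L"
  shows "\<exists>k. ideal_power \<aa> k \<subseteq> L"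
proof (rule ccontr)
  assume no: "\<nexists>k. ideal_power \<aa> k \<subseteq> L"
  define S where "S = {I. ideal I R \<and> L \<subseteq> I \<and> (\<nexists>k. ideal_power \<aa> k \<subseteq> I)}"
  have "S \<noteq> {}" using no L by (auto simp: S_def)
  moreover have "\<And>I. I \<in> S \<Longrightarrow> ideal I R" by (simp add: S_def)
  ultimately obtain M where M: "M \<in> S" "\<And>I. I \<in> S \<Longrightarrow> M \<subseteq> I \<Longrightarrow> I = M"
    using maximal_ideal_exists[of S] by blast
  interpret M: ideal M R using M(1) by (simp add: S_def)
  have LM: "L \<subseteq> M" and notM: "\<And>k. \<not> ideal_power \<aa> k \<subseteq> M" using M(1) by (simp_all add: S_def)
  have grow: "\<exists>k. ideal_power \<aa> k \<subseteq> {l \<oplus> b \<otimes> m | l m. l \<in> M \<and> m \<in> carrier R}"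
    if b: "b \<in> carrier R" "b \<notin> M" for b
  proof (rule ccontr)
    note I = ideal_add_principal[OF M.ideal_axioms b(1)]
    assume "\<not> ?thesis"
    then have "{l \<oplus> b \<otimes> m | l m. l \<in> M \<and> m \<in> carrier R} \<in> S" using I LM unfolding S_def by blast
    from M(2)[OF this I(2)] show False using I(3) b(2) by blast
  qed
  have prime: "x \<otimes> y \<notin> M" if x: "x \<in> carrier R" "x \<notin> M" and y: "y \<in> carrier R" "y \<notin> M" for x y
  proof
    assume xy: "x \<otimes> y \<in> M"
    obtain k l where kl: "ideal_power \<aa> k \<subseteq> {l \<oplus> x \<otimes> m | l m. l \<in> M \<and> m \<in> carrier R}"
      "ideal_power \<aa> l \<subseteq> {l \<oplus> y \<otimes> m | l m. l \<in> M \<and> m \<in> carrier R}"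
      using grow[OF x] grow[OF y] by blast
    have "ideal_power \<aa> k \<cdot>\<^bsub>R\<^esub> ideal_power \<aa> l \<subseteq> M"
    proof
      fix s assume "s \<in> ideal_power \<aa> k \<cdot>\<^bsub>R\<^esub> ideal_power \<aa> l"
      then show "s \<in> M"
      proof (induction rule: ideal_prod.induct)
        case (prod i j)
        obtain u m where 0: "u \<in> M" "m \<in> carrier R" "i = u \<oplus> x \<otimes> m"
          using subsetD[OF kl(1) prod(1)] by blast
        obtain v n where 1: "v \<in> M" "n \<in> carrier R" "j = v \<oplus> y \<otimes> n"
          using subsetD[OF kl(2) prod(2)] by blast
        note 1 = 0 1
        have uv: "u \<in> carrier R" "v \<in> carrier R" using 1 M.Icarr by auto
        have "i \<otimes> j = (u \<otimes> (v \<oplus> y \<otimes> n) \<oplus> (x \<otimes> m) \<otimes> v) \<oplus> (x \<otimes> y) \<otimes> (m \<otimes> n)"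
          using 1 uv x y by (simp add: l_distr r_distr m_ac add.m_ac)
        moreover have "u \<otimes> (v \<oplus> y \<otimes> n) \<in> M" using 1 uv y by (intro M.I_r_closed) auto
        moreover have "(x \<otimes> m) \<otimes> v \<in> M" using 1 uv x by (intro M.I_l_closed) auto
        moreover have "(x \<otimes> y) \<otimes> (m \<otimes> n) \<in> M" using M.I_r_closed[OF xy, of "m \<otimes> n"] 1 by simp
        ultimately show ?case by auto
      next
        case (sum s1 s2)
        then show ?case by auto
      qed
    qed
    then have "ideal_power \<aa> (k + l) \<subseteq> M" using ideal_power_add[OF a] by simp
    then show False using notM by blast
  qed
  have "\<one> \<notin> M"
  proof
    assume "\<one> \<in> M"
    then have "carrier R \<subseteq> M" using M.I_l_closed[of \<one>] by force
    then have "ideal_power \<aa> 0 \<subseteq> M" unfolding ideal_power_0 .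
    then show False using notM by blast
  qed
  have "a \<in> M" if aa: "a \<in> \<aa>" for a
  proof (rule ccontr)
    assume "a \<notin> M"
    have ac: "a \<in> carrier R" using aa a by (rule ideal.Icarr[rotated])
    have "a [^] j \<notin> M" for j :: nat
    proof (induction j)
      case 0
      then show ?case using \<open>\<one> \<notin> M\<close> by simp
    next
      case (Suc j)
      then show ?case using prime[OF _ Suc ac \<open>a \<notin> M\<close>] ac by simp
    qed
    moreover obtain j :: nat where "a [^] j \<in> L" using nil[OF aa] by blast
    ultimately show False using LM by blast
  qed
  then have "ideal_power \<aa> (Suc 0) \<subseteq> M"
    unfolding ideal_power_Suc ideal_power_0 using ideal_prod_inter[OF oneideal a] by blast
  then show False using notM by blast
qed

lemma ascending_ideals_stabilize:
  assumes "\<And>k. ideal (I k) R" "\<And>k. I k \<subseteq> I (Suc k)"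
  shows "\<exists>j::nat. \<forall>m. I (j + m) = I j"
proof -
  obtain j where j: "\<And>k. I j \<subseteq> I k \<Longrightarrow> I k = I j"
    using maximal_ideal_exists[of "range I"] assms(1) by auto
  have "I j \<subseteq> I (j + m)" for m by (induction m) (use assms(2) in auto)
  then show ?thesis using j by blast
qed

text \<open>
  For the ideal \<open>I\<close> generated by \<open>s\<close> this says that
  \<open>I \<inter> \<aa>\<^sup>k' \<subseteq> \<aa>\<^sup>kI\<close> for some
  \<open>k'\<close>. Let \<open>L\<close> be maximal among the ideals containing
  \<open>K = \<aa>\<^sup>kI\<close> that meet \<open>I\<close> only in \<open>K\<close>. It
  suffices to find a power of \<open>\<aa>\<close> in \<open>L\<close>, hence a power of each
  \<open>a\<close> in \<open>\<aa>\<close> (\<open>nil_ideal_power\<close>). The ideals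
  \<open>(L : a\<^sup>j)\<close> stabilise at some \<open>j\<close>. If
  \<open>x = l + a\<^sup>j m\<close> is in \<open>I\<close>, with \<open>l\<close> in
  \<open>L\<close>, then \<open>a\<^sup>k x\<close> is in \<open>K\<close>, so
  \<open>a\<^sup>j\<^sup>+\<^sup>k m\<close> is in \<open>L\<close>, so
  \<open>a\<^sup>j m\<close> is in \<open>L\<close>, and \<open>x\<close> is in
  \<open>L \<inter> I\<close>. Thus \<open>L + (a\<^sup>j)\<close> also meets
  \<open>I\<close> only in \<open>K\<close>, and equals \<open>L\<close> by maximality.
\<close>

theorem weak_artin_rees:
  assumes a: "ideal \<aa> R" and s: "s \<in> {..<p::nat} \<rightarrow> carrier R"
  shows "\<exists>k'. \<forall>c \<in> UNIV \<rightarrow> carrier R. lincomb (self_module R) {..<p} s c \<in> ideal_power \<aa> k' \<longrightarrow>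
    (\<exists>t \<in> UNIV \<rightarrow> ideal_power \<aa> k. lincomb (self_module R) {..<p} s c = lincomb (self_module R) {..<p} s t)"
proof -
  let ?s = "lincomb (self_module R) {..<p} s"
  interpret s: linear_map R "sequence_module (self_module R)" "self_module R" ?s
    by (rule self.lincomb_sequence_linear[OF s])
  define I where "I = ?s ` (UNIV \<rightarrow> carrier R)"
  define K where "K = ?s ` (UNIV \<rightarrow> ideal_power \<aa> k)"
  interpret ak: ideal "ideal_power \<aa> k" R by (rule ideal_power_ideal[OF a])
  have "submodule (UNIV \<rightarrow> ideal_power \<aa> k) R (sequence_module (self_module R))"
    by (rule s.M.submoduleI2) (auto simp: Pi_iff ak.I_l_closed ak.Icarr)
  then have Kid: "ideal K R" unfolding ideal_iff_submodule K_def by (rule s.image_submodule)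
  interpret K: ideal K R by (rule Kid)
  have Ic: "I \<subseteq> carrier R" unfolding I_def using s.hom_closed by auto
  have KI: "\<And>b x. b \<in> ideal_power \<aa> k \<Longrightarrow> x \<in> I \<Longrightarrow> b \<otimes> x \<in> K"
  proof -
    fix b x assume b: "b \<in> ideal_power \<aa> k" and "x \<in> I"
    then obtain c where c: "c \<in> UNIV \<rightarrow> carrier R" "x = ?s c" by (auto simp: I_def)
    have "b \<otimes> x = ?s (\<lambda>i. b \<otimes> c i)"
      using s.hom_smult[of b c] c b ak.Icarr by auto
    moreover have "(\<lambda>i. b \<otimes> c i) \<in> UNIV \<rightarrow> ideal_power \<aa> k" using b c by (auto intro: ak.I_r_closed)
    ultimately show "b \<otimes> x \<in> K" unfolding K_def by blast
  qed
  define S where "S = {L. ideal L R \<and> K \<subseteq> L \<and> L \<inter> I \<subseteq> K}"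
  have "K \<in> S" using Kid by (simp add: S_def)
  moreover have "\<And>J. J \<in> S \<Longrightarrow> ideal J R" by (simp add: S_def)
  ultimately obtain L where L: "L \<in> S" "\<And>J. J \<in> S \<Longrightarrow> L \<subseteq> J \<Longrightarrow> J = L"
    using maximal_ideal_exists[of S] by blast
  interpret L: ideal L R using L(1) by (simp add: S_def)
  have LS: "K \<subseteq> L" "L \<inter> I \<subseteq> K" using L(1) by (auto simp: S_def)
  have "\<exists>j::nat. a [^] j \<in> L" if aa: "a \<in> \<aa>" for a
  proof -
    have ac: "a \<in> carrier R" using aa a by (rule ideal.Icarr[rotated])
    have pc: "a [^] j \<in> carrier R" for j :: nat using ac by simp
    define Q where "Q j = {m \<in> carrier R. a [^] j \<otimes> m \<in> L}" for j :: nat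
    have "ideal (Q j) R" for j
      unfolding ideal_iff_submodule Q_def
      by (rule self.submoduleI2)
        (use pc[of j] in \<open>auto simp: r_distr m_lcomm intro: L.I_l_closed\<close>)
    moreover have "Q j \<subseteq> Q (Suc j)" for j
    proof
      fix m assume "m \<in> Q j"
      then have m: "m \<in> carrier R" "a [^] j \<otimes> m \<in> L" by (simp_all add: Q_def)
      have "a [^] Suc j \<otimes> m = (a [^] j \<otimes> m) \<otimes> a"
        unfolding nat_pow_Suc using pc[of j] ac m(1) by (simp add: m_assoc m_comm[of m a])
      also have "\<dots> \<in> L" using m(2) ac by (rule L.I_r_closed)
      finally show "m \<in> Q (Suc j)" using m(1) unfolding Q_def by blast
    qed
    ultimately obtain j where j: "\<And>m. Q (j + m) = Q j"
      using ascending_ideals_stabilize[of Q] by blast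
    let ?J = "{l \<oplus> a [^] j \<otimes> m | l m. l \<in> L \<and> m \<in> carrier R}"
    note J = ideal_add_principal[OF L.ideal_axioms pc[of j]]
    have "?J \<inter> I \<subseteq> K"
    proof
      fix x assume "x \<in> ?J \<inter> I"
      then obtain l m where lm: "l \<in> L" "m \<in> carrier R" "x = l \<oplus> a [^] j \<otimes> m" and x: "x \<in> I" by blast
      have lc: "l \<in> carrier R" using lm L.Icarr by simp
      have "a [^] k \<otimes> x \<in> L" using KI[OF power_in_ideal_power[OF a aa] x] LS by blast
      then have 1: "a [^] k \<otimes> l \<oplus> a [^] (j + k) \<otimes> m \<in> L"
        using lm lc pc ac by (simp add: r_distr m_assoc[symmetric] nat_pow_mult add.commute)
      have 2: "\<ominus> (a [^] k \<otimes> l) \<in> L" using L.I_l_closed[OF lm(1) pc] by auto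
      have "\<ominus> (a [^] k \<otimes> l) \<oplus> (a [^] k \<otimes> l \<oplus> a [^] (j + k) \<otimes> m) = a [^] (j + k) \<otimes> m"
        using lm lc pc by (simp add: r_neg1)
      then have "a [^] (j + k) \<otimes> m \<in> L" using L.a_closed[OF 2 1] by simp
      then have "m \<in> Q (j + k)" using lm by (simp add: Q_def)
      then have "m \<in> Q j" using j by simp
      then have "x \<in> L" using lm by (auto simp: Q_def)
      then show "x \<in> K" using x LS by blast
    qed
    then have "?J \<in> S" unfolding S_def using J LS by blast
    then have "?J = L" using J(2) L(2) by blast
    then show ?thesis using J(3) by blast
  qed
  then obtain k' where k': "ideal_power \<aa> k' \<subseteq> L" using nil_ideal_power[OF a L.ideal_axioms] by blast
  show ?thesis
  proof (intro exI[of _ k'] ballI impI)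
    fix c assume "c \<in> UNIV \<rightarrow> carrier R" "?s c \<in> ideal_power \<aa> k'"
    then have "?s c \<in> L \<inter> I" using k' by (auto simp: I_def)
    then have "?s c \<in> K" using LS by blast
    then show "\<exists>t \<in> UNIV \<rightarrow> ideal_power \<aa> k. ?s c = ?s t" by (auto simp: K_def)
  qed
qed

text \<open>
  A finite free module over a noetherian ring is noetherian. The last entries of the elements of
  \<open>W\<close> form a finitely generated ideal. Subtracting a combination of elements of
  \<open>W\<close> whose last entries generate it reduces the claim to the elements with last
  entry zero, that is, to shorter vectors.
\<close>

lemma vectors_finitely_generated:
  assumes "submodule W R (sequence_module (self_module R))"
  shows "\<exists>(p::nat) U. U \<in> {..<p} \<rightarrow> W \<and> (\<forall>c\<in>W. \<exists>w \<in> {..<p} \<rightarrow> carrier R. \<forall>i<n.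
     c i = lincomb (self_module R) {..<p} (\<lambda>j. U j i) w)"
  using assms
proof (induction n arbitrary: W)
  case 0
  show ?case by (intro exI[of _ "0::nat"]) auto
next
  case (Suc n)
  let ?V = "sequence_module (self_module R)"
  interpret V: module R ?V by (rule sequence_module_module[OF self_is_module])
  note W = submoduleD[OF V.module_axioms Suc.prems]
  interpret ev: linear_map R ?V "self_module R" "\<lambda>u. u n" by (rule self.sequence_eval)
  have "ideal ((\<lambda>u. u n) ` W) R"
    unfolding ideal_iff_submodule by (rule ev.image_submodule[OF Suc.prems])
  then obtain q :: nat and \<rho> where \<rho>: "\<rho> \<in> {..<q} \<rightarrow> (\<lambda>u. u n) ` W"
    "\<And>x. x \<in> (\<lambda>u. u n) ` W \<Longrightarrow> \<exists>c \<in> UNIV \<rightarrow> carrier R. x = lincomb (self_module R) {..<q} \<rho> c"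
    using ideal_finitely_generated by blast
  have "\<forall>j<q. \<exists>e\<in>W. e n = \<rho> j"
  proof (intro allI impI)
    fix j assume "j < q"
    then have "\<rho> j \<in> (\<lambda>u. u n) ` W" using \<rho>(1) by auto
    then show "\<exists>e\<in>W. e n = \<rho> j" by (elim imageE) (rule bexI, auto)
  qed
  then obtain e where e: "\<And>j. j < q \<Longrightarrow> e j \<in> W" "\<And>j. j < q \<Longrightarrow> e j n = \<rho> j" by metis
  define W' where "W' = {u \<in> W. u n = \<zero>}"
  have "submodule W' R ?V"
  proof (rule V.submoduleI2)
    show "W' \<subseteq> carrier ?V" using W(1) by (auto simp: W'_def)
    show "\<zero>\<^bsub>?V\<^esub> \<in> W'" using W(2) by (simp add: W'_def)
    show "\<And>x y. x \<in> W' \<Longrightarrow> y \<in> W' \<Longrightarrow> x \<oplus>\<^bsub>?V\<^esub> y \<in> W'" using W(5) by (auto simp: W'_def)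
    show "\<And>r x. r \<in> carrier R \<Longrightarrow> x \<in> W' \<Longrightarrow> r \<odot>\<^bsub>?V\<^esub> x \<in> W'" using W(7) by (auto simp: W'_def)
  qed
  from Suc.IH[OF this] obtain p :: nat and U where U: "U \<in> {..<p} \<rightarrow> W'"
    "\<And>c. c \<in> W' \<Longrightarrow> \<exists>w \<in> {..<p} \<rightarrow> carrier R. \<forall>i<n. c i = lincomb (self_module R) {..<p} (\<lambda>j. U j i) w"
    by blast
  have WR: "u i \<in> carrier R" if "u \<in> W" for u i using W(1) that by (auto simp: Pi_iff subset_iff)
  have eR: "e j i \<in> carrier R" if "j < q" for j i using e(1)[OF that] by (rule WR)
  have UR: "U j i \<in> carrier R" if "j < p" for j i using U(1) that WR by (auto simp: W'_def Pi_iff)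
  have "\<exists>w \<in> {..<q + p} \<rightarrow> carrier R. \<forall>i<Suc n. c i = lincomb (self_module R) {..<q + p} (\<lambda>j. cat q e U j i) w"
    if c: "c \<in> W" for c
  proof -
    obtain v where v: "v \<in> UNIV \<rightarrow> carrier R" "c n = lincomb (self_module R) {..<q} \<rho> v"
      using \<rho>(2)[of "c n"] c by blast
    have eV: "e \<in> {..<q} \<rightarrow> carrier ?V" using e(1) W(1) by blast
    have vR: "v \<in> {..<q} \<rightarrow> carrier R" using v by auto
    define f where "f = lincomb ?V {..<q} v e"
    have fi: "f i = lincomb (self_module R) {..<q} (\<lambda>j. e j i) v" for i
    proof -
      have "f i = lincomb (self_module R) {..<q} v (\<lambda>j. e j i)"
        unfolding f_def by (rule linear_map.hom_lincomb[OF self.sequence_eval vR eV])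
      also have "\<dots> = lincomb (self_module R) {..<q} (\<lambda>j. e j i) v"
        unfolding lincomb_def self_module_simps using eR vR by (intro finsum_cong') (auto simp: m_comm Pi_iff)
      finally show ?thesis .
    qed
    have fW: "f \<in> W" unfolding f_def using vR e(1) by (intro V.lincomb_in_submodule[OF Suc.prems]) auto
    have "f n = c n"
    proof -
      have "\<rho> j \<in> carrier R" if "j < q" for j using e(2) eR that by metis
      then show ?thesis
        unfolding fi v(2) using e(2) vR by (intro self.lincomb_cong) (auto simp: Pi_iff)
    qed
    define c' where "c' = c \<ominus>\<^bsub>?V\<^esub> f"
    have c'i: "c' i = c i \<ominus> f i" for i
      unfolding c'_def using linear_map.hom_minus[OF self.sequence_eval, of c f i] c fW W(1) by auto
    have "c' \<in> W'"
      unfolding W'_def using W(6)[OF c fW] \<open>f n = c n\<close> c'i[of n] WR[OF c, of n]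
      by (auto simp: c'_def a_minus_def r_neg)
    then obtain w where w: "w \<in> {..<p} \<rightarrow> carrier R" "\<And>i. i < n \<Longrightarrow> c' i = lincomb (self_module R) {..<p} (\<lambda>j. U j i) w"
      using U(2) by blast
    have c'w: "c' i = lincomb (self_module R) {..<p} (\<lambda>j. U j i) w" if "i < Suc n" for i
    proof (cases "i = n")
      case True
      have "lincomb (self_module R) {..<p} (\<lambda>j. U j n) w = \<zero>"
        unfolding lincomb_def self_module_simps using U(1) w(1)
        by (intro add.finprod_one_eqI) (auto simp: W'_def Pi_iff)
      then show ?thesis using \<open>c' \<in> W'\<close> True by (simp add: W'_def)
    qed (use w that in simp)
    have "c i = lincomb (self_module R) {..<q + p} (\<lambda>j. cat q e U j i) (cat q v w)" if i: "i < Suc n" for i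
    proof -
      have "(\<lambda>j. cat q e U j i) = cat q (\<lambda>j. e j i) (\<lambda>j. U j i)" by (auto simp: cat_def)
      then have "lincomb (self_module R) {..<q + p} (\<lambda>j. cat q e U j i) (cat q v w) = f i \<oplus> c' i"
        unfolding fi c'w[OF i] using eR UR vR w(1)
        by (simp add: self.lincomb_cat[simplified] Pi_iff)
      also have "\<dots> = c i"
        unfolding c'i using WR[OF c, of i] WR[OF fW, of i] by (simp add: a_minus_def a_lcomm r_neg)
      finally show ?thesis by simp
    qed
    moreover have "cat q v w \<in> {..<q + p} \<rightarrow> carrier R" using vR w(1) by (rule cat_Pi)
    ultimately show ?thesis by blast
  qed
  moreover have "cat q e U \<in> {..<q + p} \<rightarrow> W"
    using e(1) U(1) by (intro cat_Pi) (auto simp: W'_def)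
  ultimately show ?case by (intro exI[of _ "q + p"] exI[of _ "cat q e U"]) blast
qed

lemma syzygies_finitely_generated:
  assumes r: "r \<in> {..<n::nat} \<rightarrow> carrier R"
  shows "\<exists>(p::nat) U. (\<forall>i j. j < p \<longrightarrow> U i j \<in> carrier R) \<and>
    (\<forall>j<p. lincomb (self_module R) {..<n} r (\<lambda>i. U i j) = \<zero>) \<and>
    (\<forall>c \<in> UNIV \<rightarrow> carrier R. lincomb (self_module R) {..<n} r c = \<zero> \<longrightarrow>
       (\<exists>w \<in> {..<p} \<rightarrow> carrier R. \<forall>i<n. c i = lincomb (self_module R) {..<p} (U i) w))"
proof -
  interpret l: linear_map R "sequence_module (self_module R)" "self_module R" "lincomb (self_module R) {..<n} r"
    by (rule self.lincomb_sequence_linear[OF r])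
  define K where "K = a_kernel (sequence_module (self_module R)) (self_module R) (lincomb (self_module R) {..<n} r)"
  obtain p :: nat and U where U: "U \<in> {..<p} \<rightarrow> K"
    "\<And>c. c \<in> K \<Longrightarrow>
      \<exists>w \<in> {..<p} \<rightarrow> carrier R. \<forall>i<n. c i = lincomb (self_module R) {..<p} (\<lambda>j. U j i) w"
    using vectors_finitely_generated[OF l.kernel_submodule, of n, folded K_def] by blast
  have UK: "U j \<in> UNIV \<rightarrow> carrier R \<and> lincomb (self_module R) {..<n} r (U j) = \<zero>" if "j < p" for j
    using U(1) that by (simp add: K_def a_kernel_def' Pi_iff)
  show ?thesis
  proof (intro exI[of _ p] exI[of _ "\<lambda>i j. U j i"] conjI allI impI ballI)
    fix j assume j: "j < p"
    show "U j i \<in> carrier R" for i using UK[OF j] by blast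
    show "lincomb (self_module R) {..<n} r (\<lambda>i. U j i) = \<zero>" using UK[OF j] by simp
  next
    fix c assume "c \<in> UNIV \<rightarrow> carrier R" "lincomb (self_module R) {..<n} r c = \<zero>"
    then have "c \<in> K"
      by (simp add: K_def a_kernel_def')
    from U(2)[OF this]
    show "\<exists>w \<in> {..<p} \<rightarrow> carrier R. \<forall>i<n. c i = lincomb (self_module R) {..<p} (\<lambda>j. U j i) w" .
  qed
qed

end

locale flat_over_noetherian = noetherian_cring R + M: module R M for R (structure) and M (structure) +
  fixes \<aa>
  assumes ideal_a: "ideal \<aa> R"
    and flat: "relation_flat R (carrier R) {} M (carrier M)"
begin

abbreviation D where "D k \<equiv> scaled M (ideal_power \<aa> k) (carrier M)"

lemma D_submodule: "submodule (D k) R M"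
  by (intro M.scaled_submodule ideal_power_sub ideal_a M.carrier_is_submodule)

lemma D_antimono: "k \<le> l \<Longrightarrow> D l \<subseteq> D k"
  by (intro scaled_mono ideal_power_antimono ideal_a) auto

lemmas DD = submoduleD[OF M.module_axioms D_submodule]

lemma relation_trivial:
  assumes "r \<in> {..<n::nat} \<rightarrow> carrier R" "m \<in> {..<n} \<rightarrow> carrier M" "lincomb M {..<n} r m = \<zero>\<^bsub>M\<^esub>"
  shows "\<exists>(h::nat) S w. (\<forall>i<n. \<forall>j<h. S i j \<in> carrier R) \<and> w \<in> {..<h} \<rightarrow> carrier M \<and>
     (\<forall>j<h. lincomb (self_module R) {..<n} r (\<lambda>i. S i j) = \<zero>) \<and>
     (\<forall>i<n. m i = lincomb M {..<h} (S i) w)"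
proof -
  have "trivial_relations R (carrier R) {} M (carrier M) {..<n} {()} (\<lambda>_. r) m"
    using flat assms unfolding relation_flat_def by simp
  then obtain h :: nat and S w where 1: "S \<in> {..<n} \<rightarrow> {..<h} \<rightarrow> carrier R" "w \<in> {..<h} \<rightarrow> carrier M"
     "\<forall>j<h. lincomb (self_module R) {..<n} r (\<lambda>i. S i j) = \<zero>"
     "\<forall>i<n. m i \<ominus>\<^bsub>M\<^esub> lincomb M {..<h} (S i) w = \<zero>\<^bsub>M\<^esub>"
    unfolding trivial_relations_def by auto
  have "m i = lincomb M {..<h} (S i) w" if i: "i < n" for i
  proof -
    have "lincomb M {..<h} (S i) w \<in> carrier M" "m i \<in> carrier M" using 1 assms i by auto
    then show ?thesis using 1(4) i by (metis M.M.minus_eq M.M.minus_equality M.M.minus_minus M.M.a_inv_closed)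
  qed
  with 1 show ?thesis by (intro exI[of _ h] exI[of _ S] exI[of _ w]) (simp add: Pi_iff)
qed

text \<open>
  An equation between \<open>\<Sum> s i w i\<close> and an element
  \<open>\<Sum> \<alpha> l y l\<close> of \<open>\<aa>\<^sup>k'M\<close> is a relation for
  the joint family of \<open>w\<close> and \<open>y\<close>. By flatness this family is the
  image of some \<open>m\<close> under a matrix over the ring whose columns satisfy the
  relation. The version for the ring applies to the part of each column that belongs to
  \<open>s\<close>.
\<close>

lemma weak_artin_rees_row:
  assumes s: "s \<in> {..<p::nat} \<rightarrow> carrier R"
  shows "\<exists>k'. \<forall>w \<in> {..<p} \<rightarrow> carrier M. lincomb M {..<p} s w \<in> D k' \<longrightarrow>
    (\<exists>w' \<in> {..<p} \<rightarrow> D k. lincomb M {..<p} s w = lincomb M {..<p} s w')"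
proof -
  obtain k' where k': "\<And>c. c \<in> UNIV \<rightarrow> carrier R \<Longrightarrow> lincomb (self_module R) {..<p} s c \<in> ideal_power \<aa> k' \<Longrightarrow>
    \<exists>t \<in> UNIV \<rightarrow> ideal_power \<aa> k. lincomb (self_module R) {..<p} s c = lincomb (self_module R) {..<p} s t"
    using weak_artin_rees[OF ideal_a s, of k] by blast
  show ?thesis
  proof (intro exI[of _ k'] ballI impI)
    fix w assume w: "w \<in> {..<p} \<rightarrow> carrier M" and sw: "lincomb M {..<p} s w \<in> D k'"
    interpret I: ideal "ideal_power \<aa> k'" R by (rule ideal_power_ideal[OF ideal_a])
    obtain n :: nat and \<alpha> y where \<alpha>: "\<alpha> \<in> {..<n} \<rightarrow> ideal_power \<aa> k'" and y: "y \<in> {..<n} \<rightarrow> carrier M"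
      and eq: "lincomb M {..<p} s w = lincomb M {..<n} \<alpha> y"
      using M.scaled_lincomb[OF sw ideal_power_sub[OF ideal_a] subset_refl] by blast
    have \<alpha>R: "\<alpha> \<in> {..<n} \<rightarrow> carrier R" using \<alpha> I.Icarr by blast
    define \<beta> where "\<beta> = (\<lambda>i. \<ominus> \<alpha> i)"
    have \<beta>: "\<beta> \<in> {..<n} \<rightarrow> ideal_power \<aa> k'" "\<beta> \<in> {..<n} \<rightarrow> carrier R"
      using \<alpha> \<alpha>R unfolding \<beta>_def by auto
    have "lincomb M {..<n} \<beta> y \<oplus>\<^bsub>M\<^esub> lincomb M {..<n} \<alpha> y = lincomb M {..<n} (\<lambda>i. \<beta> i \<oplus> \<alpha> i) y"
      using \<beta>(2) \<alpha>R y by (rule M.lincomb_add_left[symmetric])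
    also have "\<dots> = \<zero>\<^bsub>M\<^esub>"
      unfolding lincomb_def using \<alpha>R y by (intro M.M.add.finprod_one_eqI) (auto simp: \<beta>_def l_neg Pi_iff)
    finally have "lincomb M {..<p + n} (cat p s \<beta>) (cat p w y) = \<zero>\<^bsub>M\<^esub>"
      using M.lincomb_cat[OF s \<beta>(2) w y] eq M.lincomb_closed[OF \<beta>(2) y] M.lincomb_closed[OF \<alpha>R y]
      by (simp add: M.M.a_comm)
    then obtain h :: nat and S m where S: "\<And>i j. i < p + n \<Longrightarrow> j < h \<Longrightarrow> S i j \<in> carrier R"
      and m: "m \<in> {..<h} \<rightarrow> carrier M"
      and rel: "\<And>j. j < h \<Longrightarrow> lincomb (self_module R) {..<p + n} (cat p s \<beta>) (\<lambda>i. S i j) = \<zero>"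
      and wy: "\<And>i. i < p + n \<Longrightarrow> cat p w y i = lincomb M {..<h} (S i) m"
      using relation_trivial[OF cat_Pi[OF s \<beta>(2)] cat_Pi[OF w y]] by blast
    have "\<exists>t \<in> UNIV \<rightarrow> ideal_power \<aa> k. lincomb (self_module R) {..<p} s (\<lambda>i. S i j) = lincomb (self_module R) {..<p} s t"
      if j: "j < h" for j
    proof -
      let ?c = "\<lambda>i. if i < p then S i j else \<zero>"
      have cp: "(\<lambda>i. S i j) \<in> {..<p} \<rightarrow> carrier R" using S j by auto
      have cn: "(\<lambda>l. S (p + l) j) \<in> {..<n} \<rightarrow> carrier R" using S j by auto
      have "(\<lambda>i. S i j) = cat p (\<lambda>i. S i j) (\<lambda>l. S (p + l) j)" by (auto simp: cat_def)
      then have "lincomb (self_module R) {..<p + n} (cat p s \<beta>) (\<lambda>i. S i j) =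
         lincomb (self_module R) {..<p} s (\<lambda>i. S i j) \<oplus> lincomb (self_module R) {..<n} \<beta> (\<lambda>l. S (p + l) j)"
        using self.lincomb_cat[of s p \<beta> n "\<lambda>i. S i j" "\<lambda>l. S (p + l) j"] s \<beta>(2) cp cn by simp
      with rel[OF j] have 0: "lincomb (self_module R) {..<p} s (\<lambda>i. S i j) \<oplus>
          lincomb (self_module R) {..<n} \<beta> (\<lambda>l. S (p + l) j) = \<zero>" by simp
      have "submodule (ideal_power \<aa> k') R (self_module R)"
        using I.ideal_axioms by (simp add: ideal_iff_submodule)
      moreover have "lincomb (self_module R) {..<n} \<beta> (\<lambda>l. S (p + l) j) =
          lincomb (self_module R) {..<n} (\<lambda>l. S (p + l) j) \<beta>"
        unfolding lincomb_def self_module_simps using \<beta>(2) cn by (intro finsum_cong') (auto simp: m_comm Pi_iff)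
      ultimately have 1: "lincomb (self_module R) {..<n} \<beta> (\<lambda>l. S (p + l) j) \<in> ideal_power \<aa> k'"
        using self.lincomb_in_submodule[OF _ cn \<beta>(1)] by simp
      have "lincomb (self_module R) {..<p} s (\<lambda>i. S i j) = \<ominus> lincomb (self_module R) {..<n} \<beta> (\<lambda>l. S (p + l) j)"
        using minus_equality[OF 0] self.lincomb_closed[OF s, of "\<lambda>i. S i j"] cp 1 I.Icarr by simp
      then have 2: "lincomb (self_module R) {..<p} s (\<lambda>i. S i j) \<in> ideal_power \<aa> k'"
        using I.a_inv_closed[OF 1] by simp
      have 3: "lincomb (self_module R) {..<p} s ?c = lincomb (self_module R) {..<p} s (\<lambda>i. S i j)"
        using s cp by (intro self.lincomb_cong) auto
      have "?c \<in> UNIV \<rightarrow> carrier R" using cp by auto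
      from k'[OF this] show ?thesis using 2 3 by simp
    qed
    then obtain t where t: "\<And>j. j < h \<Longrightarrow> t j \<in> UNIV \<rightarrow> ideal_power \<aa> k"
      "\<And>j. j < h \<Longrightarrow> lincomb (self_module R) {..<p} s (\<lambda>i. S i j) = lincomb (self_module R) {..<p} s (t j)"
      by metis
    have tR: "t j i \<in> carrier R" "t j i \<in> ideal_power \<aa> k" if "j < h" for i j
      using t(1)[OF that] ideal.Icarr[OF ideal_power_ideal[OF ideal_a]] by auto
    define w' where "w' i = lincomb M {..<h} (\<lambda>j. t j i) m" for i
    have "w' \<in> {..<p} \<rightarrow> D k"
    proof
      fix i
      have "lincomb M {..<h} (\<lambda>_. \<one>) (\<lambda>j. t j i \<odot>\<^bsub>M\<^esub> m j) \<in> D k"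
        using tR m by (intro M.lincomb_in_submodule[OF D_submodule] Pi_I M.scaled_mult) auto
      moreover have "lincomb M {..<h} (\<lambda>_. \<one>) (\<lambda>j. t j i \<odot>\<^bsub>M\<^esub> m j) = w' i"
        unfolding w'_def lincomb_def using tR m by (intro M.M.finsum_cong') (auto simp: Pi_iff)
      ultimately show "w' i \<in> D k" by simp
    qed
    moreover have "lincomb M {..<p} s w = lincomb M {..<p} s w'"
    proof -
      have "lincomb M {..<p} s w = lincomb M {..<p} s (\<lambda>i. lincomb M {..<h} (S i) m)"
      proof (rule M.lincomb_cong)
        show "\<And>i. i \<in> {..<p} \<Longrightarrow> w i = lincomb M {..<h} (S i) m" using wy by (metis cat_less lessThan_iff trans_less_add1)
        show "(\<lambda>i. lincomb M {..<h} (S i) m) \<in> {..<p} \<rightarrow> carrier M"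
          using S m by (intro Pi_I M.lincomb_closed) auto
      qed (use s in auto)
      also have "\<dots> = lincomb M {..<h} (\<lambda>j. lincomb (self_module R) {..<p} s (\<lambda>i. S i j)) m"
        using s S m by (intro M.lincomb_lincomb) auto
      also have "\<dots> = lincomb M {..<h} (\<lambda>j. lincomb (self_module R) {..<p} s (t j)) m"
      proof (rule M.lincomb_cong)
        show "(\<lambda>j. lincomb (self_module R) {..<p} s (t j)) \<in> {..<h} \<rightarrow> carrier R"
        proof
          fix j assume "j \<in> {..<h}"
          then show "lincomb (self_module R) {..<p} s (t j) \<in> carrier R"
            using self.lincomb_closed[OF s, of "t j"] tR by auto
        qed
      qed (use t(2) m in auto)
      also have "\<dots> = lincomb M {..<p} s w'"
        unfolding w'_def using s tR m by (intro M.lincomb_lincomb[symmetric]) auto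
      finally show ?thesis .
    qed
    ultimately show "\<exists>w' \<in> {..<p} \<rightarrow> D k. lincomb M {..<p} s w = lincomb M {..<p} s w'" by blast
  qed
qed

text \<open>
  Tensoring with a flat module preserves kernels: the syzygies of \<open>s\<close> in the module
  are generated by those in the ring.
\<close>

lemma syzygies_generate:
  assumes s: "s \<in> {..<p::nat} \<rightarrow> carrier R"
  shows "\<exists>(q::nat) U. (\<forall>i. \<forall>j<q. U i j \<in> carrier R) \<and>
    (\<forall>j<q. lincomb (self_module R) {..<p} s (\<lambda>i. U i j) = \<zero>) \<and>
    (\<forall>w \<in> {..<p} \<rightarrow> carrier M. lincomb M {..<p} s w = \<zero>\<^bsub>M\<^esub> \<longrightarrow>
       (\<exists>v \<in> {..<q} \<rightarrow> carrier M. \<forall>i<p. w i = lincomb M {..<q} (U i) v))"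
proof -
  obtain q :: nat and U where U: "\<And>i j. j < q \<Longrightarrow> U i j \<in> carrier R"
    "\<And>j. j < q \<Longrightarrow> lincomb (self_module R) {..<p} s (\<lambda>i. U i j) = \<zero>"
    "\<And>c. c \<in> UNIV \<rightarrow> carrier R \<Longrightarrow> lincomb (self_module R) {..<p} s c = \<zero> \<Longrightarrow>
       \<exists>w \<in> {..<q} \<rightarrow> carrier R. \<forall>i<p. c i = lincomb (self_module R) {..<q} (U i) w"
    using syzygies_finitely_generated[OF s] by blast
  have "\<exists>v \<in> {..<q} \<rightarrow> carrier M. \<forall>i<p. w i = lincomb M {..<q} (U i) v"
    if w: "w \<in> {..<p} \<rightarrow> carrier M" and sw: "lincomb M {..<p} s w = \<zero>\<^bsub>M\<^esub>" for w
  proof -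
    obtain h :: nat and S m where S: "\<And>i j. i < p \<Longrightarrow> j < h \<Longrightarrow> S i j \<in> carrier R"
      and m: "m \<in> {..<h} \<rightarrow> carrier M"
      and rel: "\<And>j. j < h \<Longrightarrow> lincomb (self_module R) {..<p} s (\<lambda>i. S i j) = \<zero>"
      and wS: "\<And>i. i < p \<Longrightarrow> w i = lincomb M {..<h} (S i) m"
      using relation_trivial[OF s w sw] by blast
    have "\<exists>W \<in> {..<q} \<rightarrow> carrier R. \<forall>i<p. S i j = lincomb (self_module R) {..<q} (U i) W" if j: "j < h" for j
    proof -
      let ?c = "\<lambda>i. if i < p then S i j else \<zero>"
      have cp: "(\<lambda>i. S i j) \<in> {..<p} \<rightarrow> carrier R" using S j by auto
      have "lincomb (self_module R) {..<p} s ?c = lincomb (self_module R) {..<p} s (\<lambda>i. S i j)"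
        using s cp by (intro self.lincomb_cong) auto
      moreover have "?c \<in> UNIV \<rightarrow> carrier R" using cp by auto
      ultimately show ?thesis using U(3)[of ?c] rel[OF j] by auto
    qed
    then obtain W where W: "\<And>j. j < h \<Longrightarrow> W j \<in> {..<q} \<rightarrow> carrier R"
      "\<And>i j. j < h \<Longrightarrow> i < p \<Longrightarrow> S i j = lincomb (self_module R) {..<q} (U i) (W j)" by metis
    define v where "v g = lincomb M {..<h} (\<lambda>j. W j g) m" for g
    have v: "v \<in> {..<q} \<rightarrow> carrier M"
      unfolding v_def using W(1) m by (intro Pi_I M.lincomb_closed) auto
    have "w i = lincomb M {..<q} (U i) v" if i: "i < p" for i
    proof -
      have "w i = lincomb M {..<h} (\<lambda>j. lincomb (self_module R) {..<q} (U i) (W j)) m"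
        unfolding wS[OF i]
      proof (rule M.lincomb_cong)
        show "(\<lambda>j. lincomb (self_module R) {..<q} (U i) (W j)) \<in> {..<h} \<rightarrow> carrier R"
        proof
          fix j assume "j \<in> {..<h}"
          then show "lincomb (self_module R) {..<q} (U i) (W j) \<in> carrier R"
            using self.lincomb_closed[of "U i" "{..<q}" "W j"] U(1) W(1) by auto
        qed
      qed (use W(2) i m in auto)
      also have "\<dots> = lincomb M {..<q} (U i) v"
        unfolding v_def using U(1) W(1) m by (intro M.lincomb_lincomb[symmetric]) (auto simp: Pi_iff)
      finally show ?thesis .
    qed
    with v show ?thesis by blast
  qed
  with U(1,2) show ?thesis by (intro exI[of _ q] exI[of _ U]) auto
qed

text \<open>
  By induction on the number of rows. The version for one row yields \<open>w0\<close> with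
  small entries and the same value \<open>S n w\<close> in the last row. The difference
  \<open>w - w0\<close> is killed by the last row, so it is \<open>U v\<close> for a matrix
  \<open>U\<close> that generates the syzygies of that row. The induction hypothesis for the
  remaining rows of the product \<open>T = S U\<close> replaces \<open>v\<close> by a small
  \<open>v'\<close>.
\<close>

theorem weak_artin_rees_matrix:
  assumes "\<And>i j. i < n \<Longrightarrow> j < p \<Longrightarrow> S i j \<in> carrier R"
  shows "\<exists>k'. \<forall>w \<in> {..<p::nat} \<rightarrow> carrier M. (\<forall>i<n::nat. lincomb M {..<p} (S i) w \<in> D k') \<longrightarrow>
    (\<exists>w' \<in> {..<p} \<rightarrow> D k. \<forall>i<n. lincomb M {..<p} (S i) w = lincomb M {..<p} (S i) w')"
  using assms
proof (induction n arbitrary: p S k)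
  case 0
  have "(\<lambda>_. \<zero>\<^bsub>M\<^esub>) \<in> {..<p} \<rightarrow> D k" using DD(2) by auto
  then show ?case by auto
next
  case (Suc n)
  have Sn: "S i \<in> {..<p} \<rightarrow> carrier R" if "i < Suc n" for i using Suc.prems that by auto
  obtain q :: nat and U where "\<forall>i. \<forall>j<q. U i j \<in> carrier R"
    "\<forall>j<q. lincomb (self_module R) {..<p} (S n) (\<lambda>i. U i j) = \<zero>"
    "\<forall>w \<in> {..<p} \<rightarrow> carrier M. lincomb M {..<p} (S n) w = \<zero>\<^bsub>M\<^esub> \<longrightarrow>
       (\<exists>v \<in> {..<q} \<rightarrow> carrier M. \<forall>i<p. w i = lincomb M {..<q} (U i) v)"
    using syzygies_generate[OF Sn[OF lessI]] by (elim exE conjE)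
  note U = this(1)[rule_format] this(2)[rule_format] this(3)[rule_format]
  define T where "T i g = lincomb (self_module R) {..<p} (S i) (\<lambda>j. U j g)" for i g
  have TR: "T i g \<in> carrier R" if "i < Suc n" "g < q" for i g
    unfolding T_def using self.lincomb_closed[OF Sn[OF that(1)], of "\<lambda>j. U j g"] U(1) that by auto
  have TU: "lincomb M {..<p} (S i) (\<lambda>j. lincomb M {..<q} (U j) v) = lincomb M {..<q} (T i) v"
    if "i < Suc n" "v \<in> {..<q} \<rightarrow> carrier M" for i v
    unfolding T_def using Sn[OF that(1)] U(1) that(2) by (intro M.lincomb_lincomb) (auto simp: Pi_iff)
  obtain k1 where k1: "\<And>v. v \<in> {..<q} \<rightarrow> carrier M \<Longrightarrow> (\<And>i. i < n \<Longrightarrow> lincomb M {..<q} (T i) v \<in> D k1) \<Longrightarrow>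
      \<exists>v' \<in> {..<q} \<rightarrow> D k. \<forall>i<n. lincomb M {..<q} (T i) v = lincomb M {..<q} (T i) v'"
    using Suc.IH[of q T k] TR by force
  obtain k2 where k2: "\<And>w. w \<in> {..<p} \<rightarrow> carrier M \<Longrightarrow> lincomb M {..<p} (S n) w \<in> D k2 \<Longrightarrow>
      \<exists>w' \<in> {..<p} \<rightarrow> D (max k k1). lincomb M {..<p} (S n) w = lincomb M {..<p} (S n) w'"
    using weak_artin_rees_row[OF Sn[OF lessI], of "max k k1"] by blast
  show ?case
  proof (intro exI[of _ "max k1 k2"] ballI impI)
    fix w assume w: "w \<in> {..<p} \<rightarrow> carrier M"
      and Sw: "\<forall>i<Suc n. lincomb M {..<p} (S i) w \<in> D (max k1 k2)"
    have "lincomb M {..<p} (S n) w \<in> D k2" using Sw D_antimono[of k2 "max k1 k2"] by auto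
    then obtain w0 where w0: "w0 \<in> {..<p} \<rightarrow> D (max k k1)" "lincomb M {..<p} (S n) w = lincomb M {..<p} (S n) w0"
      using k2[OF w] by blast
    have w0M: "w0 \<in> {..<p} \<rightarrow> carrier M" using w0(1) DD(1) by blast
    have dM: "(\<lambda>i. w i \<ominus>\<^bsub>M\<^esub> w0 i) \<in> {..<p} \<rightarrow> carrier M" using w w0M by auto
    have diff: "lincomb M {..<p} (S i) (\<lambda>i. w i \<ominus>\<^bsub>M\<^esub> w0 i) = lincomb M {..<p} (S i) w \<ominus>\<^bsub>M\<^esub> lincomb M {..<p} (S i) w0"
      if "i < Suc n" for i
      using Sn[OF that] w w0M by (rule M.lincomb_minus_right)
    have "lincomb M {..<p} (S n) (\<lambda>i. w i \<ominus>\<^bsub>M\<^esub> w0 i) = \<zero>\<^bsub>M\<^esub>"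
      unfolding diff[OF lessI] w0(2) using M.M.r_neg[OF M.lincomb_closed[OF Sn[OF lessI] w0M]]
      by (simp add: a_minus_def)
    then obtain v where v: "v \<in> {..<q} \<rightarrow> carrier M" "\<And>i. i < p \<Longrightarrow> w i \<ominus>\<^bsub>M\<^esub> w0 i = lincomb M {..<q} (U i) v"
      using U(3)[OF dM] by blast
    have UvM: "(\<lambda>j. lincomb M {..<q} (U j) v) \<in> {..<p} \<rightarrow> carrier M"
      if "v \<in> {..<q} \<rightarrow> carrier M" for v using U(1) that by (intro Pi_I M.lincomb_closed) auto
    have Tv: "lincomb M {..<q} (T i) v = lincomb M {..<p} (S i) w \<ominus>\<^bsub>M\<^esub> lincomb M {..<p} (S i) w0"
      if i: "i < Suc n" for i
    proof -
      have "lincomb M {..<p} (S i) (\<lambda>i. w i \<ominus>\<^bsub>M\<^esub> w0 i) = lincomb M {..<p} (S i) (\<lambda>j. lincomb M {..<q} (U j) v)"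
        using v(2) Sn[OF i] UvM[OF v(1)] by (intro M.lincomb_cong) auto
      then show ?thesis using diff[OF i] TU[OF i v(1)] by simp
    qed
    have "lincomb M {..<q} (T i) v \<in> D k1" if i: "i < n" for i
    proof -
      have "lincomb M {..<p} (S i) w \<in> D k1" using Sw i D_antimono[of k1 "max k1 k2"] by auto
      moreover have "lincomb M {..<p} (S i) w0 \<in> D k1"
        using w0(1) D_antimono[of k1 "max k k1"] Sn[of i] i by (intro M.lincomb_in_submodule[OF D_submodule]) auto
      ultimately show ?thesis using Tv[of i] i DD(6) by auto
    qed
    then obtain v' where v': "v' \<in> {..<q} \<rightarrow> D k" "\<And>i. i < n \<Longrightarrow> lincomb M {..<q} (T i) v = lincomb M {..<q} (T i) v'"
      using k1[OF v(1)] by blast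
    have v'M: "v' \<in> {..<q} \<rightarrow> carrier M" using v'(1) DD(1) by blast
    define w' where "w' i = w0 i \<oplus>\<^bsub>M\<^esub> lincomb M {..<q} (U i) v'" for i
    have "w' \<in> {..<p} \<rightarrow> D k"
    proof
      fix i assume "i \<in> {..<p}"
      then have "w0 i \<in> D k" using w0(1) D_antimono[of k "max k k1"] by auto
      moreover have "lincomb M {..<q} (U i) v' \<in> D k"
        using U(1) v'(1) by (intro M.lincomb_in_submodule[OF D_submodule]) auto
      ultimately show "w' i \<in> D k" unfolding w'_def by (rule DD(5))
    qed
    moreover have "lincomb M {..<p} (S i) w = lincomb M {..<p} (S i) w'" if i: "i < Suc n" for i
    proof -
      have c: "lincomb M {..<p} (S i) w \<in> carrier M" "lincomb M {..<p} (S i) w0 \<in> carrier M"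
        using Sn[OF i] w w0M by auto
      have TT: "lincomb M {..<q} (T i) v' = lincomb M {..<q} (T i) v"
      proof (cases "i = n")
        case True
        have "lincomb M {..<q} (T n) u = \<zero>\<^bsub>M\<^esub>" if "u \<in> {..<q} \<rightarrow> carrier M" for u
          unfolding lincomb_def using that U(2)
          by (intro M.M.add.finprod_one_eqI) (auto simp: T_def Pi_iff)
        then show ?thesis using v(1) v'M True by simp
      next
        case False
        then show ?thesis using v'(2) i by simp
      qed
      have "lincomb M {..<p} (S i) w' = lincomb M {..<p} (S i) w0 \<oplus>\<^bsub>M\<^esub> lincomb M {..<p} (S i) (\<lambda>j. lincomb M {..<q} (U j) v')"
        unfolding w'_def using Sn[OF i] w0M UvM[OF v'M] by (rule M.lincomb_add_right)
      also have "lincomb M {..<p} (S i) (\<lambda>j. lincomb M {..<q} (U j) v') = lincomb M {..<p} (S i) w \<ominus>\<^bsub>M\<^esub> lincomb M {..<p} (S i) w0"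
        unfolding TU[OF i v'M] TT Tv[OF i] ..
      also have "lincomb M {..<p} (S i) w0 \<oplus>\<^bsub>M\<^esub> \<dots> = lincomb M {..<p} (S i) w"
        unfolding a_minus_def using c
        by (subst M.M.a_comm) (simp_all add: M.M.a_assoc M.M.l_neg)
      finally show ?thesis by simp
    qed
    ultimately show "\<exists>w' \<in> {..<p} \<rightarrow> D k. \<forall>i<Suc n. lincomb M {..<p} (S i) w = lincomb M {..<p} (S i) w'" by blast
  qed
qed

end

section \<open>Adic completions\<close>

lemma (in module) submodule_diff:
  assumes "submodule H R M" "x \<in> carrier M" "y \<in> carrier M"
  shows diff_sym: "x \<ominus>\<^bsub>M\<^esub> y \<in> H \<Longrightarrow> y \<ominus>\<^bsub>M\<^esub> x \<in> H"
    and diff_trans: "z \<in> carrier M \<Longrightarrow> x \<ominus>\<^bsub>M\<^esub> y \<in> H \<Longrightarrow> y \<ominus>\<^bsub>M\<^esub> z \<in> H \<Longrightarrow> x \<ominus>\<^bsub>M\<^esub> z \<in> H"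
    and diff_mem: "x \<ominus>\<^bsub>M\<^esub> y \<in> H \<Longrightarrow> y \<in> H \<Longrightarrow> x \<in> H"
proof -
  note D = submoduleD[OF module_axioms assms(1)]
  have "\<ominus>\<^bsub>M\<^esub> (x \<ominus>\<^bsub>M\<^esub> y) = y \<ominus>\<^bsub>M\<^esub> x"
    using assms by (simp add: a_minus_def M.minus_add M.a_comm)
  then show "x \<ominus>\<^bsub>M\<^esub> y \<in> H \<Longrightarrow> y \<ominus>\<^bsub>M\<^esub> x \<in> H" using D(4)[of "x \<ominus>\<^bsub>M\<^esub> y"] by simp
  show "x \<ominus>\<^bsub>M\<^esub> z \<in> H" if "z \<in> carrier M" "x \<ominus>\<^bsub>M\<^esub> y \<in> H" "y \<ominus>\<^bsub>M\<^esub> z \<in> H" for z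
  proof -
    have "(x \<ominus>\<^bsub>M\<^esub> y) \<oplus>\<^bsub>M\<^esub> (y \<ominus>\<^bsub>M\<^esub> z) = x \<ominus>\<^bsub>M\<^esub> z"
      using assms that(1) by (simp add: a_minus_def M.a_assoc M.r_neg1)
    then show ?thesis using D(5)[OF that(2,3)] by simp
  qed
  show "x \<in> H" if "x \<ominus>\<^bsub>M\<^esub> y \<in> H" "y \<in> H"
  proof -
    have "(x \<ominus>\<^bsub>M\<^esub> y) \<oplus>\<^bsub>M\<^esub> y = x"
      using assms by (simp add: a_minus_def M.a_assoc M.l_neg)
    then show ?thesis using D(5)[OF that] by simp
  qed
qed

locale completion = cring S for S (structure) +
  fixes I
  assumes I: "ideal I S"
begin

definition J where "J k = ideal_power I (Suc k)"
abbreviation Cpl where "Cpl \<equiv> adic_completion S I"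

lemma J_ideal: "ideal (J k) S" unfolding J_def by (rule ideal_power_ideal[OF I])

lemma Cpl_eq: "Cpl = \<lparr>carrier = {x. (\<forall>k. x k \<in> carrier (S Quot J k)) \<and> (\<forall>k. J k <+>\<^bsub>S\<^esub> x (Suc k) = x k)},
      monoid.mult = (\<lambda>x y k. x k \<otimes>\<^bsub>S Quot J k\<^esub> y k), one = (\<lambda>k. \<one>\<^bsub>S Quot J k\<^esub>),
      zero = (\<lambda>k. \<zero>\<^bsub>S Quot J k\<^esub>), add = (\<lambda>x y k. x k \<oplus>\<^bsub>S Quot J k\<^esub> y k)\<rparr>"
  unfolding adic_completion_def Let_def J_def ..

sublocale self: module S "self_module S" by (rule self_is_module)

lemma J_submodule: "submodule (J k) S (self_module S)"
  using J_ideal ideal_iff_submodule by blast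

lemmas J_diff_sym = self.diff_sym[OF J_submodule, simplified]
  and J_diff_trans = self.diff_trans[OF J_submodule, simplified]
  and J_diff_mem = self.diff_mem[OF J_submodule, simplified]
lemmas JD = submoduleD[OF self_is_module J_submodule, simplified]

lemma J_mono: "k \<le> l \<Longrightarrow> J l \<subseteq> J k"
  unfolding J_def by (rule ideal_power_antimono[OF I]) simp

text \<open>
  Elements of the completion are represented by sequences that change by \<open>J k\<close> in
  step \<open>k\<close>, so that the \<open>k\<close>-th term determines the component in the
  \<open>k\<close>-th quotient. Every element has such a representative, and all algebra takes
  place termwise.
\<close>

definition cauchy where "cauchy s \<longleftrightarrow> (\<forall>k. s k \<in> carrier S \<and> s (Suc k) \<ominus> s k \<in> J k)"

definition cls where "cls s = (\<lambda>k. J k +> s k)"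

lemma cauchy_closed: "cauchy s \<Longrightarrow> s k \<in> carrier S" by (simp add: cauchy_def)

lemma cauchy_step: "cauchy s \<Longrightarrow> s (Suc k) \<ominus> s k \<in> J k" by (simp add: cauchy_def)

lemma cauchy_diff:
  assumes s: "cauchy s" and "k \<le> l"
  shows "s l \<ominus> s k \<in> J k"
  using assms(2)
proof (induction l rule: dec_induct)
  case base
  from s show ?case using JD(2) by (simp add: a_minus_def r_neg cauchy_closed)
next
  case (step l)
  then have "s (Suc l) \<ominus> s l \<in> J k" using cauchy_step[OF s, of l] J_mono[of k l] by auto
  with step s show ?case using J_diff_trans[of "s (Suc l)" "s l" "s k" k] by (auto simp: cauchy_closed)
qed

lemma cauchy_diff': "cauchy s \<Longrightarrow> k \<le> l \<Longrightarrow> s k \<ominus> s l \<in> J k"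
  by (rule J_diff_sym[OF cauchy_closed cauchy_closed cauchy_diff])

lemma cauchy_const: "r \<in> carrier S \<Longrightarrow> cauchy (\<lambda>_. r)"
  unfolding cauchy_def using JD(2) by (simp add: a_minus_def r_neg)

lemma cauchy_add: "cauchy s \<Longrightarrow> cauchy t \<Longrightarrow> cauchy (\<lambda>k. s k \<oplus> t k)"
  unfolding cauchy_def
proof (intro allI conjI)
  fix k assume st: "\<forall>k. s k \<in> carrier S \<and> s (Suc k) \<ominus> s k \<in> J k" "\<forall>k. t k \<in> carrier S \<and> t (Suc k) \<ominus> t k \<in> J k"
  then show "s k \<oplus> t k \<in> carrier S" by simp
  have "(s (Suc k) \<oplus> t (Suc k)) \<ominus> (s k \<oplus> t k) = (s (Suc k) \<ominus> s k) \<oplus> (t (Suc k) \<ominus> t k)"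
    using st by (simp add: a_minus_def minus_add add.m_ac)
  then show "(s (Suc k) \<oplus> t (Suc k)) \<ominus> (s k \<oplus> t k) \<in> J k" using JD(5) st by metis
qed

lemma cauchy_mult: "cauchy s \<Longrightarrow> cauchy t \<Longrightarrow> cauchy (\<lambda>k. s k \<otimes> t k)"
  unfolding cauchy_def
proof (intro allI conjI)
  fix k assume st: "\<forall>k. s k \<in> carrier S \<and> s (Suc k) \<ominus> s k \<in> J k" "\<forall>k. t k \<in> carrier S \<and> t (Suc k) \<ominus> t k \<in> J k"
  then show "s k \<otimes> t k \<in> carrier S" by simp
  have c: "s k \<in> carrier S" "s (Suc k) \<in> carrier S" "t k \<in> carrier S" "t (Suc k) \<in> carrier S" using st by auto
  have "(s (Suc k) \<otimes> t (Suc k)) \<ominus> (s k \<otimes> t k) = s (Suc k) \<otimes> (t (Suc k) \<ominus> t k) \<oplus> t k \<otimes> (s (Suc k) \<ominus> s k)"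
  proof -
    have "s (Suc k) \<otimes> (t (Suc k) \<ominus> t k) = s (Suc k) \<otimes> t (Suc k) \<ominus> s (Suc k) \<otimes> t k"
      using c by (simp add: a_minus_def r_distr r_minus)
    moreover have "t k \<otimes> (s (Suc k) \<ominus> s k) = s (Suc k) \<otimes> t k \<ominus> s k \<otimes> t k"
      using c by (simp add: a_minus_def r_distr r_minus m_comm)
    ultimately show ?thesis using c by (simp add: a_minus_def a_assoc r_neg1)
  qed
  moreover have "s (Suc k) \<otimes> (t (Suc k) \<ominus> t k) \<in> J k" "t k \<otimes> (s (Suc k) \<ominus> s k) \<in> J k"
    using JD(7) c st by blast+
  ultimately show "(s (Suc k) \<otimes> t (Suc k)) \<ominus> (s k \<otimes> t k) \<in> J k" using JD(5) by metis
qed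

lemma coset_eq_iff:
  assumes "x \<in> carrier S" "y \<in> carrier S"
  shows "J k +> x = J k +> y \<longleftrightarrow> x \<ominus> y \<in> J k"
proof -
  interpret ideal "J k" S by (rule J_ideal)
  have "J k +> x = J k +> y \<longleftrightarrow> x \<in> J k +> y"
    using a_repr_independence'[of x y] a_repr_independenceD[of x y] assms by auto
  then show ?thesis
    using a_rcos_module[of y x] assms by (simp add: a_minus_def)
qed

lemma cls_eq_iff:
  assumes "\<And>k. s k \<in> carrier S" "\<And>k. t k \<in> carrier S"
  shows "cls s = cls t \<longleftrightarrow> (\<forall>k. s k \<ominus> t k \<in> J k)"
  unfolding cls_def fun_eq_iff using assms by (simp add: coset_eq_iff)

lemma coset_enlarge:
  assumes "x \<in> carrier S"
  shows "J k <+>\<^bsub>S\<^esub> (J (Suc k) +> x) = J k +> x"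
proof (intro equalityI subsetI)
  fix y assume "y \<in> J k <+>\<^bsub>S\<^esub> (J (Suc k) +> x)"
  then obtain u v where uv: "u \<in> J k" "v \<in> J (Suc k)" "y = u \<oplus> (v \<oplus> x)"
    unfolding set_add_def' a_r_coset_def' by blast
  have "v \<in> J k" using uv(2) J_mono[of k "Suc k"] by auto
  then have "u \<oplus> v \<in> J k" "y = (u \<oplus> v) \<oplus> x"
    using uv JD(3,5) assms by (auto simp: a_assoc)
  then show "y \<in> J k +> x" unfolding a_r_coset_def' by blast
next
  fix y assume "y \<in> J k +> x"
  then obtain u where u: "u \<in> J k" "y = u \<oplus> x" unfolding a_r_coset_def' by blast
  have "y = u \<oplus> (\<zero> \<oplus> x)" using u assms JD(3) by simp
  then show "y \<in> J k <+>\<^bsub>S\<^esub> (J (Suc k) +> x)"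
    unfolding set_add_def' a_r_coset_def' using u(1) JD(2)[of "Suc k"] by blast
qed

lemma Cpl_carrier: "carrier Cpl = {x. (\<forall>k. x k \<in> a_rcosets (J k)) \<and> (\<forall>k. J k <+>\<^bsub>S\<^esub> x (Suc k) = x k)}"
  by (simp add: Cpl_eq FactRing_def)

lemma cls_closed: "cauchy s \<Longrightarrow> cls s \<in> carrier Cpl"
  unfolding Cpl_carrier
proof (intro CollectI conjI allI)
  fix k assume s: "cauchy s"
  show "cls s k \<in> a_rcosets (J k)" using cauchy_closed[OF s] by (auto simp: cls_def A_RCOSETS_def')
  show "J k <+>\<^bsub>S\<^esub> cls s (Suc k) = cls s k"
    unfolding cls_def coset_enlarge[OF cauchy_closed[OF s]]
    using cauchy_step[OF s] by (simp add: coset_eq_iff cauchy_closed[OF s])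
qed

lemma Cpl_cases:
  assumes "x \<in> carrier Cpl"
  obtains s where "cauchy s" "x = cls s"
proof -
  have "\<forall>k. \<exists>r. r \<in> carrier S \<and> x k = J k +> r"
    using assms unfolding Cpl_carrier A_RCOSETS_def' by blast
  then obtain s where s: "\<And>k. s k \<in> carrier S" "\<And>k. x k = J k +> s k" by metis
  have "s (Suc k) \<ominus> s k \<in> J k" for k
  proof -
    have "J k <+>\<^bsub>S\<^esub> x (Suc k) = x k" using assms unfolding Cpl_carrier by blast
    then show ?thesis unfolding s(2) coset_enlarge[OF s(1)] using s(1) by (simp add: coset_eq_iff)
  qed
  then have "cauchy s" using s(1) by (simp add: cauchy_def)
  moreover have "x = cls s" using s(2) by (auto simp: cls_def)
  ultimately show ?thesis by (rule that)
qed

lemma cls_ops: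
  "\<zero>\<^bsub>Cpl\<^esub> = cls (\<lambda>_. \<zero>)" "\<one>\<^bsub>Cpl\<^esub> = cls (\<lambda>_. \<one>)"
  "cauchy s \<Longrightarrow> cauchy t \<Longrightarrow> cls s \<oplus>\<^bsub>Cpl\<^esub> cls t = cls (\<lambda>k. s k \<oplus> t k)"
  "cauchy s \<Longrightarrow> cauchy t \<Longrightarrow> cls s \<otimes>\<^bsub>Cpl\<^esub> cls t = cls (\<lambda>k. s k \<otimes> t k)"
proof -
  have z: "J k +> \<zero> = J k" for k
    using JD(1) by (intro a_coset_add_zero) 
  show "\<zero>\<^bsub>Cpl\<^esub> = cls (\<lambda>_. \<zero>)"
    by (simp add: Cpl_eq FactRing_def cls_def z)
  show "\<one>\<^bsub>Cpl\<^esub> = cls (\<lambda>_. \<one>)"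
    by (simp add: Cpl_eq FactRing_def cls_def)
  assume s: "cauchy s" and t: "cauchy t"
  have "(J k +> s k) <+>\<^bsub>S\<^esub> (J k +> t k) = J k +> (s k \<oplus> t k)" for k
  proof -
    interpret ideal "J k" S by (rule J_ideal)
    show ?thesis using s t by (intro a_rcos_sum) (auto simp: cauchy_closed)
  qed
  then show "cls s \<oplus>\<^bsub>Cpl\<^esub> cls t = cls (\<lambda>k. s k \<oplus> t k)"
    by (simp add: Cpl_eq FactRing_def cls_def)
  have "rcoset_mult S (J k) (J k +> s k) (J k +> t k) = J k +> (s k \<otimes> t k)" for k
  proof -
    interpret ideal "J k" S by (rule J_ideal)
    show ?thesis using s t by (intro rcoset_mult_add) (auto simp: cauchy_closed)
  qed
  then show "cls s \<otimes>\<^bsub>Cpl\<^esub> cls t = cls (\<lambda>k. s k \<otimes> t k)"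
    by (simp add: Cpl_eq FactRing_def cls_def)
qed

lemma Cpl_cring: "cring Cpl"
proof (rule cringI)
  have zero: "cauchy (\<lambda>_. \<zero>)" and one: "cauchy (\<lambda>_. \<one>)" by (simp_all add: cauchy_const)
  note closed = cauchy_add cauchy_mult zero one
  show "abelian_group Cpl"
  proof (rule abelian_groupI)
    fix x y z assume "x \<in> carrier Cpl" "y \<in> carrier Cpl" "z \<in> carrier Cpl"
    then obtain s t u where st: "cauchy s" "x = cls s" "cauchy t" "y = cls t" "cauchy u" "z = cls u"
      by (metis Cpl_cases)
    then show "x \<oplus>\<^bsub>Cpl\<^esub> y \<oplus>\<^bsub>Cpl\<^esub> z = x \<oplus>\<^bsub>Cpl\<^esub> (y \<oplus>\<^bsub>Cpl\<^esub> z)"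
      by (simp add: cls_ops closed cauchy_closed a_assoc)
  next
    fix x y assume "x \<in> carrier Cpl" "y \<in> carrier Cpl"
    then obtain s t where st: "cauchy s" "x = cls s" "cauchy t" "y = cls t" by (metis Cpl_cases)
    then show "x \<oplus>\<^bsub>Cpl\<^esub> y \<in> carrier Cpl" by (simp add: cls_ops cls_closed closed)
    have "s k \<oplus> t k = t k \<oplus> s k" for k using st by (intro a_comm cauchy_closed)
    then show "x \<oplus>\<^bsub>Cpl\<^esub> y = y \<oplus>\<^bsub>Cpl\<^esub> x" using st by (simp add: cls_ops)
  next
    fix x assume "x \<in> carrier Cpl"
    then obtain s where s: "cauchy s" "x = cls s" by (rule Cpl_cases)
    then show "\<zero>\<^bsub>Cpl\<^esub> \<oplus>\<^bsub>Cpl\<^esub> x = x" by (simp add: cls_ops zero cauchy_closed)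
    have "cauchy (\<lambda>k. \<ominus> \<one> \<otimes> s k)"
      using cauchy_mult[OF cauchy_const[of "\<ominus> \<one>"] s(1)] by simp
    moreover have "(\<lambda>k. \<ominus> \<one> \<otimes> s k \<oplus> s k) = (\<lambda>_. \<zero>)"
      using s(1) by (auto simp: l_minus l_neg cauchy_closed)
    ultimately show "\<exists>y\<in>carrier Cpl. y \<oplus>\<^bsub>Cpl\<^esub> x = \<zero>\<^bsub>Cpl\<^esub>"
      using s by (intro bexI[of _ "cls (\<lambda>k. \<ominus> \<one> \<otimes> s k)"]) (simp_all add: cls_ops cls_closed)
  qed (simp add: cls_ops cls_closed zero)
  show "comm_monoid Cpl"
  proof (rule comm_monoidI)
    fix x y z assume "x \<in> carrier Cpl" "y \<in> carrier Cpl" "z \<in> carrier Cpl"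
    then obtain s t u where st: "cauchy s" "x = cls s" "cauchy t" "y = cls t" "cauchy u" "z = cls u"
      by (metis Cpl_cases)
    then show "x \<otimes>\<^bsub>Cpl\<^esub> y \<otimes>\<^bsub>Cpl\<^esub> z = x \<otimes>\<^bsub>Cpl\<^esub> (y \<otimes>\<^bsub>Cpl\<^esub> z)"
      by (simp add: cls_ops closed cauchy_closed m_assoc)
  next
    fix x y assume "x \<in> carrier Cpl" "y \<in> carrier Cpl"
    then obtain s t where st: "cauchy s" "x = cls s" "cauchy t" "y = cls t" by (metis Cpl_cases)
    then show "x \<otimes>\<^bsub>Cpl\<^esub> y \<in> carrier Cpl" by (simp add: cls_ops cls_closed closed)
    have "s k \<otimes> t k = t k \<otimes> s k" for k using st by (intro m_comm cauchy_closed)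
    then show "x \<otimes>\<^bsub>Cpl\<^esub> y = y \<otimes>\<^bsub>Cpl\<^esub> x" using st by (simp add: cls_ops)
  next
    fix x assume "x \<in> carrier Cpl"
    then obtain s where s: "cauchy s" "x = cls s" by (rule Cpl_cases)
    then show "\<one>\<^bsub>Cpl\<^esub> \<otimes>\<^bsub>Cpl\<^esub> x = x" by (simp add: cls_ops one cauchy_closed)
  qed (simp add: cls_ops cls_closed one)
  fix x y z assume "x \<in> carrier Cpl" "y \<in> carrier Cpl" "z \<in> carrier Cpl"
  then obtain s t u where st: "cauchy s" "x = cls s" "cauchy t" "y = cls t" "cauchy u" "z = cls u"
    by (metis Cpl_cases)
  then show "(x \<oplus>\<^bsub>Cpl\<^esub> y) \<otimes>\<^bsub>Cpl\<^esub> z = x \<otimes>\<^bsub>Cpl\<^esub> z \<oplus>\<^bsub>Cpl\<^esub> y \<otimes>\<^bsub>Cpl\<^esub> z"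
    by (simp add: cls_ops closed cauchy_closed l_distr)
qed

lemma to_completion_cls: "to_completion S I r = cls (\<lambda>_. r)"
  unfolding to_completion_def cls_def J_def ..

lemma to_completion_hom: "ring_hom_cring S Cpl (to_completion S I)"
proof -
  have "to_completion S I \<in> ring_hom S Cpl"
    by (rule ring_hom_memI) (simp_all add: to_completion_cls cls_closed cls_ops cauchy_const)
  then show ?thesis
    by (simp add: ring_hom_cring_def ring_hom_cring_axioms_def is_cring Cpl_cring)
qed

lemma lincomb_cls:
  assumes f: "ring_hom_cring A S f" and "finite K" "a \<in> K \<rightarrow> carrier A" "\<And>i. i \<in> K \<Longrightarrow> cauchy (\<xi> i)"
  shows "cauchy (\<lambda>k. lincomb (algebra_module f S) K a (\<lambda>i. \<xi> i k)) \<and>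
    lincomb (algebra_module (to_completion S I \<circ> f) Cpl) K a (\<lambda>i. cls (\<xi> i)) =
    cls (\<lambda>k. lincomb (algebra_module f S) K a (\<lambda>i. \<xi> i k))"
  using assms(2-4)
proof (induction K rule: finite_induct)
  interpret f: ring_hom_cring A S f by (rule f)
  interpret t: ring_hom_cring S Cpl "to_completion S I" by (rule to_completion_hom)
  have "ring_hom_cring A Cpl (to_completion S I \<circ> f)"
    using ring_hom_trans[OF f.homh t.homh] by (simp add: ring_hom_cring_def ring_hom_cring_axioms_def f.R.is_cring Cpl_cring)
  then interpret T: module A "algebra_module (to_completion S I \<circ> f) Cpl" by (rule algebra_module_module)
  interpret M: module A "algebra_module f S" by (rule algebra_module_module[OF f])
  {
    case empty
    then show ?case
      unfolding T.lincomb_empty M.lincomb_empty by (simp add: cls_ops cauchy_const)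
  next
    case (insert i K)
    then have ai: "a i \<in> carrier A" "f (a i) \<in> carrier S" and \<xi>: "cauchy (\<xi> i)" by auto
    have ih: "cauchy (\<lambda>k. lincomb (algebra_module f S) K a (\<lambda>i. \<xi> i k))"
      "lincomb (algebra_module (to_completion S I \<circ> f) Cpl) K a (\<lambda>i. cls (\<xi> i)) =
       cls (\<lambda>k. lincomb (algebra_module f S) K a (\<lambda>i. \<xi> i k))"
      using insert.IH insert.prems by blast+
    have 1: "lincomb (algebra_module f S) (insert i K) a (\<lambda>i. \<xi> i k) =
        f (a i) \<otimes> \<xi> i k \<oplus> lincomb (algebra_module f S) K a (\<lambda>i. \<xi> i k)" for k
      using insert by (subst M.lincomb_insert) (auto simp: cauchy_closed)
    have p: "cauchy (\<lambda>k. f (a i) \<otimes> \<xi> i k)" using cauchy_mult[OF cauchy_const[OF ai(2)] \<xi>] .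
    have "lincomb (algebra_module (to_completion S I \<circ> f) Cpl) (insert i K) a (\<lambda>i. cls (\<xi> i)) =
        cls (\<lambda>_. f (a i)) \<otimes>\<^bsub>Cpl\<^esub> cls (\<xi> i) \<oplus>\<^bsub>Cpl\<^esub> cls (\<lambda>k. lincomb (algebra_module f S) K a (\<lambda>i. \<xi> i k))"
      using insert ih by (subst T.lincomb_insert) (auto simp: cls_closed to_completion_cls)
    also have "\<dots> = cls (\<lambda>k. f (a i) \<otimes> \<xi> i k \<oplus> lincomb (algebra_module f S) K a (\<lambda>i. \<xi> i k))"
      using cls_ops(4)[OF cauchy_const[OF ai(2)] \<xi>] cls_ops(3)[OF p ih(1)] by simp
    finally show ?case unfolding 1 using cauchy_add[OF p ih(1)] by blast
  }
qed

end

subsection \<open>Extension of ideals along a ring homomorphism\<close>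

lemma scaled_algebra_module_ideal:
  assumes "ring_hom_cring A S f" "ideal \<aa> A"
  shows "ideal (scaled (algebra_module f S) \<aa> (carrier S)) S"
proof -
  interpret f: ring_hom_cring A S f by fact
  interpret M: module A "algebra_module f S" by (rule algebra_module_module[OF assms(1)])
  interpret self: module S "self_module S" by (rule self_module_module[OF f.S.is_cring])
  interpret a: ideal \<aa> A by fact
  have aA: "\<aa> \<subseteq> carrier A" using a.Icarr by auto
  let ?T = "scaled (algebra_module f S) \<aa> (carrier S)"
  have T: "submodule ?T A (algebra_module f S)"
    using M.scaled_submodule[OF aA M.carrier_is_submodule] by simp
  note D = submoduleD[OF M.module_axioms T, simplified]
  show ?thesis unfolding f.S.ideal_iff_submodule
  proof (rule self.submoduleI2)
    show "?T \<subseteq> carrier (self_module S)" using D(1) by simp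
    show "\<zero>\<^bsub>self_module S\<^esub> \<in> ?T" using D(2) by simp
    show "\<And>x y. x \<in> ?T \<Longrightarrow> y \<in> ?T \<Longrightarrow> x \<oplus>\<^bsub>self_module S\<^esub> y \<in> ?T" using D(5) by simp
    fix r x assume r: "r \<in> carrier S" and "x \<in> ?T"
    have "r \<otimes>\<^bsub>S\<^esub> x \<in> ?T" using \<open>x \<in> ?T\<close>
    proof (induction rule: scaled.induct)
      case zero
      then show ?case using r D(2) by simp
    next
      case (step e z x)
      have c: "f e \<in> carrier S" "z \<in> carrier S" "x \<in> carrier S" using step D(3) a.Icarr by auto
      have "r \<otimes>\<^bsub>S\<^esub> (f e \<otimes>\<^bsub>S\<^esub> z \<oplus>\<^bsub>S\<^esub> x) = f e \<otimes>\<^bsub>S\<^esub> (r \<otimes>\<^bsub>S\<^esub> z) \<oplus>\<^bsub>S\<^esub> r \<otimes>\<^bsub>S\<^esub> x"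
        using c r by (simp add: f.S.r_distr f.S.m_lcomm)
      moreover have "e \<odot>\<^bsub>algebra_module f S\<^esub> (r \<otimes>\<^bsub>S\<^esub> z) \<oplus>\<^bsub>algebra_module f S\<^esub> r \<otimes>\<^bsub>S\<^esub> x \<in> ?T"
        using step r c by (intro scaled.step) auto
      ultimately show ?case by simp
    qed
    then show "r \<odot>\<^bsub>self_module S\<^esub> x \<in> ?T" by simp
  qed
qed

lemma Idl_image_eq_scaled:
  assumes "ring_hom_cring A S f" "ideal \<aa> A"
  shows "Idl\<^bsub>S\<^esub> (f ` \<aa>) = scaled (algebra_module f S) \<aa> (carrier S)"
proof -
  interpret f: ring_hom_cring A S f by fact
  interpret M: module A "algebra_module f S" by (rule algebra_module_module[OF assms(1)])
  interpret a: ideal \<aa> A by fact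
  have fa: "f ` \<aa> \<subseteq> carrier S" using a.Icarr by auto
  have Id: "ideal (Idl\<^bsub>S\<^esub> (f ` \<aa>)) S" by (rule f.S.genideal_ideal[OF fa])
  interpret G: ideal "Idl\<^bsub>S\<^esub> (f ` \<aa>)" S by (rule Id)
  show ?thesis
  proof
    show "Idl\<^bsub>S\<^esub> (f ` \<aa>) \<subseteq> scaled (algebra_module f S) \<aa> (carrier S)"
    proof (rule f.S.genideal_minimal[OF scaled_algebra_module_ideal[OF assms]], rule image_subsetI)
      fix a assume a: "a \<in> \<aa>"
      have "a \<odot>\<^bsub>algebra_module f S\<^esub> \<one>\<^bsub>S\<^esub> \<in> scaled (algebra_module f S) \<aa> (carrier S)"
        using a a.Icarr by (intro M.scaled_mult) auto
      then show "f a \<in> scaled (algebra_module f S) \<aa> (carrier S)" using a a.Icarr by simp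
    qed
    show "scaled (algebra_module f S) \<aa> (carrier S) \<subseteq> Idl\<^bsub>S\<^esub> (f ` \<aa>)"
    proof
      fix x assume "x \<in> scaled (algebra_module f S) \<aa> (carrier S)"
      then show "x \<in> Idl\<^bsub>S\<^esub> (f ` \<aa>)"
      proof (induction rule: scaled.induct)
        case zero
        then show ?case using G.zero_closed by simp
      next
        case (step e z x)
        have "f e \<in> Idl\<^bsub>S\<^esub> (f ` \<aa>)" using f.S.genideal_self[OF fa] step by auto
        then show ?case using step G.I_r_closed G.a_closed by simp
      qed
    qed
  qed
qed

lemma image_ideal_power:
  assumes f: "ring_hom_cring A S f" and a: "ideal \<aa> A" and b: "ideal \<bb> S" "f ` \<aa> \<subseteq> \<bb>"
  shows "f ` (\<aa> [^]\<^bsub>ideals_set A\<^esub> k) \<subseteq> \<bb> [^]\<^bsub>ideals_set S\<^esub> (k::nat)"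
proof (induction k)
  interpret f: ring_hom_cring A S f by fact
  {
    case 0
    show ?case unfolding f.R.ideal_power_0 f.S.ideal_power_0 by auto
  next
    case (Suc k)
    show ?case
    proof
      fix y assume "y \<in> f ` (\<aa> [^]\<^bsub>ideals_set A\<^esub> Suc k)"
      then obtain x where x: "x \<in> ideal_prod A (\<aa> [^]\<^bsub>ideals_set A\<^esub> k) \<aa>" "y = f x"
        unfolding f.R.ideal_power_Suc by blast
      have sub: "ideal_prod A (\<aa> [^]\<^bsub>ideals_set A\<^esub> k) \<aa> \<subseteq> carrier A"
        by (rule f.R.ideal_prod_in_carrier[OF f.R.ideal_power_ideal[OF a] a])
      have "f x \<in> ideal_prod S (\<bb> [^]\<^bsub>ideals_set S\<^esub> k) \<bb>" using x(1)
      proof (induction rule: ideal_prod.induct)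
        case (prod i j)
        have c: "i \<in> carrier A" "j \<in> carrier A"
          using prod ideal.Icarr[OF f.R.ideal_power_ideal[OF a]] ideal.Icarr[OF a] by auto
        have "f i \<in> \<bb> [^]\<^bsub>ideals_set S\<^esub> k" "f j \<in> \<bb>" using prod Suc b(2) by auto
        then show ?case using ideal_prod.prod[of "f i" _ "f j" \<bb> S] c by simp
      next
        case (sum x y)
        then have "x \<in> carrier A" "y \<in> carrier A" using sub by auto
        then show ?case using sum ideal_prod.sum by simp
      qed
      then show "y \<in> \<bb> [^]\<^bsub>ideals_set S\<^esub> Suc k" unfolding f.S.ideal_power_Suc x(2) .
    qed
  }
qed

text \<open>
  Powers commute with extension of ideals. Hence the filtration of \<open>S\<close> by the
  powers of the extended ideal depends only on \<open>S\<close> as an \<open>A\<close>-module.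
\<close>

lemma extended_ideal_power:
  assumes f: "ring_hom_cring A S f" and a: "ideal \<aa> A"
  shows "(Idl\<^bsub>S\<^esub> (f ` \<aa>)) [^]\<^bsub>ideals_set S\<^esub> (k::nat) =
         scaled (algebra_module f S) (\<aa> [^]\<^bsub>ideals_set A\<^esub> k) (carrier S)"
proof -
  interpret f: ring_hom_cring A S f by fact
  interpret M: module A "algebra_module f S" by (rule algebra_module_module[OF f])
  let ?b = "Idl\<^bsub>S\<^esub> (f ` \<aa>)"
  have fa: "f ` \<aa> \<subseteq> carrier S" using ideal.Icarr[OF a] by auto
  have b: "ideal ?b S" by (rule f.S.genideal_ideal[OF fa])
  note ak = f.R.ideal_power_ideal[OF a]
  show ?thesis
  proof
    have bk: "ideal (?b [^]\<^bsub>ideals_set S\<^esub> k) S" by (rule f.S.ideal_power_ideal[OF b])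
    have "Idl\<^bsub>S\<^esub> (f ` (\<aa> [^]\<^bsub>ideals_set A\<^esub> k)) \<subseteq> ?b [^]\<^bsub>ideals_set S\<^esub> k"
      by (rule f.S.genideal_minimal[OF bk image_ideal_power[OF f a b f.S.genideal_self[OF fa]]])
    then show "scaled (algebra_module f S) (\<aa> [^]\<^bsub>ideals_set A\<^esub> k) (carrier S) \<subseteq> ?b [^]\<^bsub>ideals_set S\<^esub> k"
      unfolding Idl_image_eq_scaled[OF f ak] .
    show "?b [^]\<^bsub>ideals_set S\<^esub> k \<subseteq> scaled (algebra_module f S) (\<aa> [^]\<^bsub>ideals_set A\<^esub> k) (carrier S)"
    proof (induction k)
      case 0
      have "x \<in> scaled (algebra_module f S) (carrier A) (carrier S)" if "x \<in> carrier S" for x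
        using M.scaled_mult[of "\<one>\<^bsub>A\<^esub>" "carrier A" x "carrier S"] that by simp
      then show ?case unfolding f.R.ideal_power_0 f.S.ideal_power_0 by blast
    next
      case (Suc k)
      let ?T = "scaled (algebra_module f S) (\<aa> [^]\<^bsub>ideals_set A\<^esub> Suc k) (carrier S)"
      interpret T: ideal ?T S by (rule scaled_algebra_module_ideal[OF f ak])
      have bs: "?b = scaled (algebra_module f S) \<aa> (carrier S)" by (rule Idl_image_eq_scaled[OF f a])
      interpret bb: ideal ?b S by (rule b)
      interpret kk: ideal "scaled (algebra_module f S) (\<aa> [^]\<^bsub>ideals_set A\<^esub> k) (carrier S)" S
        by (rule scaled_algebra_module_ideal[OF f ak])
      have 1: "f \<alpha> \<otimes>\<^bsub>S\<^esub> j \<in> ?T" if \<alpha>: "\<alpha> \<in> \<aa> [^]\<^bsub>ideals_set A\<^esub> k" and j: "j \<in> ?b" for \<alpha> j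
        using j unfolding bs
      proof (induction rule: scaled.induct)
        have \<alpha>c: "f \<alpha> \<in> carrier S" "\<alpha> \<in> carrier A" using \<alpha> ideal.Icarr[OF ak] by auto
        {
          case zero
          then show ?case using \<alpha>c T.zero_closed by simp
        next
          case (step e z x)
          have c: "e \<in> carrier A" "f e \<in> carrier S" "z \<in> carrier S" "x \<in> carrier S"
            using step ideal.Icarr[OF a] bb.Icarr unfolding bs by auto
          have "\<alpha> \<otimes>\<^bsub>A\<^esub> e \<in> \<aa> [^]\<^bsub>ideals_set A\<^esub> Suc k"
            unfolding f.R.ideal_power_Suc using \<alpha> step by (intro ideal_prod.prod)
          then have "(\<alpha> \<otimes>\<^bsub>A\<^esub> e) \<odot>\<^bsub>algebra_module f S\<^esub> z \<oplus>\<^bsub>algebra_module f S\<^esub> f \<alpha> \<otimes>\<^bsub>S\<^esub> x \<in> ?T"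
            using step by (intro scaled.step) auto
          moreover have "f \<alpha> \<otimes>\<^bsub>S\<^esub> (f e \<otimes>\<^bsub>S\<^esub> z \<oplus>\<^bsub>S\<^esub> x) = f (\<alpha> \<otimes>\<^bsub>A\<^esub> e) \<otimes>\<^bsub>S\<^esub> z \<oplus>\<^bsub>S\<^esub> f \<alpha> \<otimes>\<^bsub>S\<^esub> x"
            using \<alpha>c c by (simp add: f.S.r_distr f.S.m_assoc)
          ultimately show ?case by simp
        }
      qed
      have 2: "i \<otimes>\<^bsub>S\<^esub> j \<in> ?T" if i: "i \<in> scaled (algebra_module f S) (\<aa> [^]\<^bsub>ideals_set A\<^esub> k) (carrier S)" and j: "j \<in> ?b" for i j
        using i
      proof (induction rule: scaled.induct)
        case zero
        then show ?case using j bb.Icarr T.zero_closed by simp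
      next
        case (step e z x)
        have c: "f e \<in> carrier S" "z \<in> carrier S" "x \<in> carrier S" "j \<in> carrier S"
          using step ideal.Icarr[OF ak] kk.Icarr bb.Icarr j by auto
        have "(f e \<otimes>\<^bsub>S\<^esub> z \<oplus>\<^bsub>S\<^esub> x) \<otimes>\<^bsub>S\<^esub> j = z \<otimes>\<^bsub>S\<^esub> (f e \<otimes>\<^bsub>S\<^esub> j) \<oplus>\<^bsub>S\<^esub> x \<otimes>\<^bsub>S\<^esub> j"
          using c by (simp add: f.S.l_distr f.S.r_distr f.S.m_ac)
        moreover have "z \<otimes>\<^bsub>S\<^esub> (f e \<otimes>\<^bsub>S\<^esub> j) \<in> ?T" by (rule T.I_l_closed[OF 1[OF step(1) j] c(2)])
        ultimately show ?case using step T.a_closed by simp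
      qed
      show ?case
        unfolding f.S.ideal_power_Suc
      proof
        fix x assume "x \<in> ideal_prod S (?b [^]\<^bsub>ideals_set S\<^esub> k) ?b"
        then show "x \<in> ?T"
        proof (induction rule: ideal_prod.induct)
          case (prod i j)
          then show ?case using 2 Suc by blast
        next
          case (sum x y)
          show ?case by (rule T.a_closed[OF sum.IH])
        qed
      qed
    qed
  qed
qed

locale completed_flat_algebra = noetherian_cring A + f: ring_hom_cring A S f
  for A (structure) and S and f +
  fixes \<aa>
  assumes a: "ideal \<aa> A"
    and S_flat: "relation_flat A (carrier A) {} (algebra_module f S) (carrier S)"
begin

abbreviation \<bb> where "\<bb> \<equiv> Idl\<^bsub>S\<^esub> (f ` \<aa>)"
abbreviation M where "M \<equiv> algebra_module f S"

lemma M_module: "module A M" by (rule algebra_module_module) unfold_locales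

lemma \<bb>_ideal: "ideal \<bb> S"
  using ideal.Icarr[OF a] by (intro f.S.genideal_ideal) auto

sublocale flat_over_noetherian A M \<aa>
  unfolding flat_over_noetherian_def flat_over_noetherian_axioms_def
  using noetherian_cring_axioms M_module a S_flat by simp

sublocale cpl?: completion S \<bb>
  by (simp add: completion_def completion_axioms_def f.S.is_cring \<bb>_ideal)

abbreviation \<phi> where "\<phi> \<equiv> to_completion S \<bb> \<circ> f"
abbreviation M' where "M' \<equiv> algebra_module \<phi> Cpl"

lemma J_eq: "J k = D (Suc k)"
  unfolding J_def using extended_ideal_power[OF f.ring_hom_cring_axioms a, of "Suc k"] by simp

lemma \<phi>_hom: "ring_hom_cring A Cpl \<phi>"
  using ring_hom_trans[OF f.homh ring_hom_cring.homh[OF to_completion_hom]]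
  by (simp add: ring_hom_cring_def ring_hom_cring_axioms_def is_cring Cpl_cring)

sublocale M': module A M' by (rule algebra_module_module[OF \<phi>_hom])

lemmas lincomb_cls' = lincomb_cls[OF f.ring_hom_cring_axioms]

text \<open>
  Solutions \<open>w k\<close> modulo the individual ideals need not be compatible. The image
  of \<open>w (k + 1) - w k\<close> under the matrix is small, so by the weak Artin-Rees
  lemma it is also the image of a vector \<open>v k\<close> that is itself small. Starting with
  \<open>w 0\<close> and adding the corrections \<open>v k\<close> instead of the differences
  gives a convergent sequence with the same images.
\<close>

lemma lift_to_completion:
  assumes S: "\<And>i j. i < n \<Longrightarrow> j < p \<Longrightarrow> S' i j \<in> carrier A"
    and \<xi>: "\<And>i. i < n \<Longrightarrow> cauchy (\<xi> i)"
    and approx: "\<And>k. \<exists>w \<in> {..<p::nat} \<rightarrow> carrier S. \<forall>i<n::nat. \<xi> i k \<ominus>\<^bsub>S\<^esub> lincomb M {..<p} (S' i) w \<in> J k"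
  shows "\<exists>\<omega>. (\<forall>j<p. cauchy (\<omega> j)) \<and> (\<forall>i<n. cls (\<xi> i) = lincomb M' {..<p} (S' i) (\<lambda>j. cls (\<omega> j)))"
proof -
  have Si: "S' i \<in> {..<p} \<rightarrow> carrier A" if "i < n" for i using S that by auto
  have SM: "lincomb M {..<p} (S' i) w \<in> carrier S" if "i < n" "w \<in> {..<p} \<rightarrow> carrier S" for i w
    using M.lincomb_closed[OF Si[OF that(1)], of w] that(2) by simp
  have "\<forall>k. \<exists>k'. \<forall>w \<in> {..<p} \<rightarrow> carrier M. (\<forall>i<n. lincomb M {..<p} (S' i) w \<in> D k') \<longrightarrow>
    (\<exists>w' \<in> {..<p} \<rightarrow> D (Suc k). \<forall>i<n. lincomb M {..<p} (S' i) w = lincomb M {..<p} (S' i) w')"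
    by (intro allI weak_artin_rees_matrix S)
  then obtain K where K: "\<And>k w. w \<in> {..<p} \<rightarrow> carrier M \<Longrightarrow> (\<And>i. i < n \<Longrightarrow> lincomb M {..<p} (S' i) w \<in> D (K k)) \<Longrightarrow>
    \<exists>w' \<in> {..<p} \<rightarrow> D (Suc k). \<forall>i<n. lincomb M {..<p} (S' i) w = lincomb M {..<p} (S' i) w'" by metis
  \<comment> \<open>Solutions are taken at an accuracy \<open>\<kappa> k\<close> that suffices
    for the \<open>k\<close>-th component and for the weak Artin-Rees lemma; as
    \<open>\<kappa>\<close> is monotone, later solutions are also approximate solutions at
    earlier stages.\<close>
  define \<kappa> where "\<kappa> k = k + (\<Sum>l\<le>k. K l)" for k
  have \<kappa>: "k \<le> \<kappa> k" "K k \<le> \<kappa> k" "\<kappa> k \<le> \<kappa> (Suc k)" for k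
  proof -
    have "K k \<le> (\<Sum>l\<le>k. K l)" by (rule member_le_sum) auto
    then show "K k \<le> \<kappa> k" by (simp add: \<kappa>_def)
  qed (auto simp: \<kappa>_def)
  have "\<forall>k. \<exists>w. w \<in> {..<p} \<rightarrow> carrier S \<and> (\<forall>i<n. \<xi> i (\<kappa> k) \<ominus>\<^bsub>S\<^esub> lincomb M {..<p} (S' i) w \<in> J (\<kappa> k))"
    using approx by blast
  then obtain w where w: "\<And>k. w k \<in> {..<p} \<rightarrow> carrier S"
    "\<And>k i. i < n \<Longrightarrow> \<xi> i (\<kappa> k) \<ominus>\<^bsub>S\<^esub> lincomb M {..<p} (S' i) (w k) \<in> J (\<kappa> k)" by metis
  have "\<exists>v. v \<in> {..<p} \<rightarrow> D (Suc k) \<and> (\<forall>i<n. lincomb M {..<p} (S' i) (w (Suc k)) \<ominus>\<^bsub>S\<^esub> lincomb M {..<p} (S' i) (w k) =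
       lincomb M {..<p} (S' i) v)" for k
  proof -
    let ?d = "\<lambda>j. w (Suc k) j \<ominus>\<^bsub>S\<^esub> w k j"
    have d: "?d \<in> {..<p} \<rightarrow> carrier M"
    proof
      fix j assume "j \<in> {..<p}"
      then have "w (Suc k) j \<in> carrier S" "w k j \<in> carrier S" using w(1) by blast+
      then show "?d j \<in> carrier M" by simp
    qed
    have Sd: "lincomb M {..<p} (S' i) ?d = lincomb M {..<p} (S' i) (w (Suc k)) \<ominus>\<^bsub>S\<^esub> lincomb M {..<p} (S' i) (w k)"
      if i: "i < n" for i
      using M.lincomb_minus_right[OF Si[OF i], of "w (Suc k)" "w k"] w(1) by simp
    have "lincomb M {..<p} (S' i) ?d \<in> D (K k)" if i: "i < n" for i
    proof -
      have c: "lincomb M {..<p} (S' i) (w (Suc k)) \<in> carrier S" "lincomb M {..<p} (S' i) (w k) \<in> carrier S"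
        "\<xi> i (\<kappa> k) \<in> carrier S" "\<xi> i (\<kappa> (Suc k)) \<in> carrier S"
        using SM[OF i w(1)] cauchy_closed[OF \<xi>[OF i]] by auto
      have 1: "\<xi> i (\<kappa> (Suc k)) \<ominus>\<^bsub>S\<^esub> lincomb M {..<p} (S' i) (w (Suc k)) \<in> J (\<kappa> k)"
        using w(2)[OF i] J_mono[OF \<kappa>(3)] by blast
      have 2: "\<xi> i (\<kappa> (Suc k)) \<ominus>\<^bsub>S\<^esub> \<xi> i (\<kappa> k) \<in> J (\<kappa> k)" by (rule cauchy_diff[OF \<xi>[OF i] \<kappa>(3)])
      have 3: "lincomb M {..<p} (S' i) (w (Suc k)) \<ominus>\<^bsub>S\<^esub> \<xi> i (\<kappa> k) \<in> J (\<kappa> k)"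
        by (rule J_diff_trans[OF c(1,4,3) J_diff_sym[OF c(4,1) 1] 2])
      have "lincomb M {..<p} (S' i) ?d \<in> J (\<kappa> k)"
        unfolding Sd[OF i] by (rule J_diff_trans[OF c(1,3,2) 3 w(2)[OF i]])
      moreover have "J (\<kappa> k) \<subseteq> D (K k)" unfolding J_eq using \<kappa>(2)[of k] by (intro D_antimono) simp
      ultimately show ?thesis by blast
    qed
    then obtain v where "v \<in> {..<p} \<rightarrow> D (Suc k)" "\<And>i. i < n \<Longrightarrow> lincomb M {..<p} (S' i) ?d = lincomb M {..<p} (S' i) v"
      using K[OF d, of k] by blast
    then show ?thesis using Sd by (intro exI[of _ v]) simp
  qed
  then obtain v where v: "\<And>k. v k \<in> {..<p} \<rightarrow> D (Suc k)"
    "\<And>k i. i < n \<Longrightarrow> lincomb M {..<p} (S' i) (w (Suc k)) \<ominus>\<^bsub>S\<^esub> lincomb M {..<p} (S' i) (w k) = lincomb M {..<p} (S' i) (v k)"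
    by metis
  have vS: "v k \<in> {..<p} \<rightarrow> carrier S" for k using v(1)[of k] DD(1)[of "Suc k"] by (simp add: Pi_iff subset_iff)
  define \<omega> where "\<omega> j = rec_nat (w 0 j) (\<lambda>k x. x \<oplus>\<^bsub>S\<^esub> v k j)" for j
  have \<omega>_simps: "\<omega> j 0 = w 0 j" "\<omega> j (Suc k) = \<omega> j k \<oplus>\<^bsub>S\<^esub> v k j" for j k by (simp_all add: \<omega>_def)
  have \<omega>S: "\<omega> j k \<in> carrier S" if "j < p" for j k
  proof (induction k)
    case 0
    then show ?case using w(1)[of 0] that by (auto simp: \<omega>_simps)
  next
    case (Suc k)
    then show ?case using vS[of k] that by (auto simp: \<omega>_simps)
  qed
  have \<omega>c: "cauchy (\<omega> j)" if j: "j < p" for j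
    unfolding cauchy_def
  proof (intro allI conjI)
    fix k
    show "\<omega> j k \<in> carrier S" by (rule \<omega>S[OF j])
    have vk: "v k j \<in> carrier S" "v k j \<in> J k" using vS[of k] v(1)[of k] j by (auto simp: J_eq)
    have "\<omega> j (Suc k) \<ominus>\<^bsub>S\<^esub> \<omega> j k = v k j"
      unfolding \<omega>_simps a_minus_def using \<omega>S[OF j, of k] vk(1)
      by (subst f.S.a_comm) (simp_all add: f.S.r_neg1 f.S.a_comm[of "v k j"] f.S.a_assoc f.S.r_neg f.S.r_neg2)
    then show "\<omega> j (Suc k) \<ominus>\<^bsub>S\<^esub> \<omega> j k \<in> J k" using vk by simp
  qed
  have \<omega>w: "lincomb M {..<p} (S' i) (\<lambda>j. \<omega> j k) = lincomb M {..<p} (S' i) (w k)" if i: "i < n" for i k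
  proof (induction k)
    case 0
    show ?case by (simp add: \<omega>_simps)
  next
    case (Suc k)
    have c: "lincomb M {..<p} (S' i) (w (Suc k)) \<in> carrier S" "lincomb M {..<p} (S' i) (w k) \<in> carrier S"
      using SM[OF i w(1)] by auto
    have "lincomb M {..<p} (S' i) (\<lambda>j. \<omega> j (Suc k)) = lincomb M {..<p} (S' i) (\<lambda>j. \<omega> j k) \<oplus>\<^bsub>S\<^esub> lincomb M {..<p} (S' i) (v k)"
      unfolding \<omega>_simps using M.lincomb_add_right[OF Si[OF i], of "\<lambda>j. \<omega> j k" "v k"] \<omega>S vS[of k] by (simp add: Pi_iff)
    also have "\<dots> = lincomb M {..<p} (S' i) (w k) \<oplus>\<^bsub>S\<^esub>
        (lincomb M {..<p} (S' i) (w (Suc k)) \<ominus>\<^bsub>S\<^esub> lincomb M {..<p} (S' i) (w k))"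
      unfolding Suc v(2)[OF i] ..
    also have "\<dots> = lincomb M {..<p} (S' i) (w (Suc k))"
      unfolding a_minus_def using c by (subst f.S.a_comm) (simp_all add: f.S.a_assoc f.S.l_neg)
    finally show ?case .
  qed
  have "cls (\<xi> i) = lincomb M' {..<p} (S' i) (\<lambda>j. cls (\<omega> j))" if i: "i < n" for i
  proof -
    have L: "cauchy (\<lambda>k. lincomb M {..<p} (S' i) (\<lambda>j. \<omega> j k))"
      "lincomb M' {..<p} (S' i) (\<lambda>j. cls (\<omega> j)) = cls (\<lambda>k. lincomb M {..<p} (S' i) (\<lambda>j. \<omega> j k))"
      using lincomb_cls'[of "{..<p}" "S' i" \<omega>] Si[OF i] \<omega>c by blast+
    have "\<xi> i k \<ominus>\<^bsub>S\<^esub> lincomb M {..<p} (S' i) (\<lambda>j. \<omega> j k) \<in> J k" for k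
      unfolding \<omega>w[OF i]
    proof (rule J_diff_trans[of "\<xi> i k" "\<xi> i (\<kappa> k)"])
      show "\<xi> i k \<ominus>\<^bsub>S\<^esub> \<xi> i (\<kappa> k) \<in> J k"
        by (rule cauchy_diff'[OF \<xi>[OF i] \<kappa>(1)])
      show "\<xi> i (\<kappa> k) \<ominus>\<^bsub>S\<^esub> lincomb M {..<p} (S' i) (w k) \<in> J k"
        using w(2)[OF i] J_mono[OF \<kappa>(1)] by blast
    qed (use cauchy_closed[OF \<xi>[OF i]] SM[OF i w(1)] in auto)
    then show ?thesis
      unfolding L(2) using cauchy_closed[OF \<xi>[OF i]] cauchy_closed[OF L(1)] by (subst cls_eq_iff) auto
  qed
  with \<omega>c show ?thesis by (intro exI[of _ \<omega>]) auto
qed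

text \<open>
  Truncating a relation in the completion at a late stage gives a relation in the flat module up
  to a small error. By the weak Artin-Rees lemma the error is removed by a small change of the
  vector, which then comes from the matrix \<open>U\<close> of syzygies of \<open>r\<close>. So
  the equations \<open>m = U w\<close> are solvable approximately, and hence exactly by
  \<open>lift_to_completion\<close>.
\<close>

theorem completion_relation_flat: "relation_flat A (carrier A) {} M' (carrier Cpl)"
  unfolding relation_flat_def
proof (intro allI impI)
  fix n :: nat and r m
  assume r: "r \<in> {..<n} \<rightarrow> carrier A" and m: "m \<in> {..<n} \<rightarrow> carrier Cpl"
    and "lincomb M' {..<n} r m \<in> scaled M' {} (carrier Cpl)"
  then have rel: "lincomb M' {..<n} r m = \<zero>\<^bsub>Cpl\<^esub>" by simp
  have "\<forall>i<n. \<exists>s. cauchy s \<and> m i = cls s" using m by (metis Cpl_cases PiE lessThan_iff)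
  then obtain \<xi> where \<xi>: "\<And>i. i < n \<Longrightarrow> cauchy (\<xi> i)" "\<And>i. i < n \<Longrightarrow> m i = cls (\<xi> i)" by metis
  have \<xi>S: "(\<lambda>i. \<xi> i k) \<in> {..<n} \<rightarrow> carrier M" for k using cauchy_closed[OF \<xi>(1)] by auto
  have mc: "lincomb M' {..<n} r m = lincomb M' {..<n} r (\<lambda>i. cls (\<xi> i))"
    using r \<xi> by (intro M'.lincomb_cong) (auto simp: cls_closed)
  have L: "cauchy (\<lambda>k. lincomb M {..<n} r (\<lambda>i. \<xi> i k))"
    "lincomb M' {..<n} r (\<lambda>i. cls (\<xi> i)) = cls (\<lambda>k. lincomb M {..<n} r (\<lambda>i. \<xi> i k))"
    using lincomb_cls'[of "{..<n}" r \<xi>] r \<xi>(1) by blast+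
  have "cls (\<lambda>k. lincomb M {..<n} r (\<lambda>i. \<xi> i k)) = cls (\<lambda>_. \<zero>\<^bsub>S\<^esub>)"
    using rel mc L(2) cls_ops(1) by simp
  then have "lincomb M {..<n} r (\<lambda>i. \<xi> i k) \<ominus>\<^bsub>S\<^esub> \<zero>\<^bsub>S\<^esub> \<in> J k" for k
    using cls_eq_iff[of "\<lambda>k. lincomb M {..<n} r (\<lambda>i. \<xi> i k)" "\<lambda>_. \<zero>\<^bsub>S\<^esub>"] cauchy_closed[OF L(1)] by simp
  then have relk: "lincomb M {..<n} r (\<lambda>i. \<xi> i k) \<in> J k" for k
    using J_diff_mem[of _ "\<zero>\<^bsub>S\<^esub>" k] cauchy_closed[OF L(1)] JD(2) f.S.zero_closed by blast
  obtain q :: nat and U where "\<forall>i. \<forall>j<q. U i j \<in> carrier A"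
    "\<forall>j<q. lincomb (self_module A) {..<n} r (\<lambda>i. U i j) = \<zero>"
    "\<forall>w \<in> {..<n} \<rightarrow> carrier M. lincomb M {..<n} r w = \<zero>\<^bsub>M\<^esub> \<longrightarrow>
       (\<exists>v \<in> {..<q} \<rightarrow> carrier M. \<forall>i<n. w i = lincomb M {..<q} (U i) v)"
    using syzygies_generate[OF r] by (elim exE conjE)
  note U = this(1)[rule_format] this(2)[rule_format] this(3)[rule_format]
  have "\<exists>w \<in> {..<q} \<rightarrow> carrier S. \<forall>i<n. \<xi> i k \<ominus>\<^bsub>S\<^esub> lincomb M {..<q} (U i) w \<in> J k" for k
  proof -
    obtain K where K: "\<forall>w \<in> {..<n} \<rightarrow> carrier M. lincomb M {..<n} r w \<in> D K \<longrightarrow>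
        (\<exists>w' \<in> {..<n} \<rightarrow> D (Suc k). lincomb M {..<n} r w = lincomb M {..<n} r w')"
      using weak_artin_rees_row[OF r, of "Suc k"] by (elim exE)
    define \<kappa> where "\<kappa> = max K k"
    have "lincomb M {..<n} r (\<lambda>i. \<xi> i \<kappa>) \<in> D K"
    proof -
      have "D (Suc \<kappa>) \<subseteq> D K" by (rule D_antimono) (simp add: \<kappa>_def)
      then show ?thesis using relk[of \<kappa>] unfolding J_eq by blast
    qed
    then obtain y where y: "y \<in> {..<n} \<rightarrow> D (Suc k)" "lincomb M {..<n} r (\<lambda>i. \<xi> i \<kappa>) = lincomb M {..<n} r y"
      using K \<xi>S by blast
    have yM: "y \<in> {..<n} \<rightarrow> carrier M" using y(1) DD(1) by blast
    have "lincomb M {..<n} r (\<lambda>i. \<xi> i \<kappa> \<ominus>\<^bsub>M\<^esub> y i) = lincomb M {..<n} r (\<lambda>i. \<xi> i \<kappa>) \<ominus>\<^bsub>M\<^esub> lincomb M {..<n} r y"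
      using r \<xi>S yM by (rule M.lincomb_minus_right)
    also have "\<dots> = \<zero>\<^bsub>M\<^esub>"
      unfolding y(2) a_minus_def using M.lincomb_closed[OF r yM] by (rule M.M.r_neg)
    finally have 0: "lincomb M {..<n} r (\<lambda>i. \<xi> i \<kappa> \<ominus>\<^bsub>M\<^esub> y i) = \<zero>\<^bsub>M\<^esub>" .
    have "(\<lambda>i. \<xi> i \<kappa> \<ominus>\<^bsub>M\<^esub> y i) \<in> {..<n} \<rightarrow> carrier M"
    proof
      fix i assume "i \<in> {..<n}"
      then show "\<xi> i \<kappa> \<ominus>\<^bsub>M\<^esub> y i \<in> carrier M" using \<xi>S[of \<kappa>] yM by (intro M.M.minus_closed) auto
    qed
    from U(3)[OF this 0] obtain v where v: "v \<in> {..<q} \<rightarrow> carrier M"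
      "\<And>i. i < n \<Longrightarrow> \<xi> i \<kappa> \<ominus>\<^bsub>M\<^esub> y i = lincomb M {..<q} (U i) v" by blast
    have "\<xi> i k \<ominus>\<^bsub>S\<^esub> lincomb M {..<q} (U i) v \<in> J k" if i: "i < n" for i
    proof -
      have yi: "y i \<in> carrier S" "y i \<in> J k" using y(1) yM i by (auto simp: J_eq)
      have c: "\<xi> i k \<in> carrier S" "\<xi> i \<kappa> \<in> carrier S" using cauchy_closed[OF \<xi>(1)[OF i]] by auto
      have e: "lincomb M {..<q} (U i) v = \<xi> i \<kappa> \<ominus>\<^bsub>S\<^esub> y i" using v(2)[OF i] by simp
      have "\<xi> i \<kappa> \<ominus>\<^bsub>S\<^esub> (\<xi> i \<kappa> \<ominus>\<^bsub>S\<^esub> y i) = y i"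
        using c yi by (simp add: a_minus_def f.S.minus_add f.S.r_neg2)
      moreover have "\<xi> i k \<ominus>\<^bsub>S\<^esub> \<xi> i \<kappa> \<in> J k"
        by (rule cauchy_diff'[OF \<xi>(1)[OF i]]) (simp add: \<kappa>_def)
      ultimately show ?thesis
        unfolding e using J_diff_trans[of "\<xi> i k" "\<xi> i \<kappa>" "\<xi> i \<kappa> \<ominus>\<^bsub>S\<^esub> y i" k] c yi by simp
    qed
    with v(1) show ?thesis by (intro bexI[of _ v]) auto
  qed
  then obtain \<omega> where \<omega>: "\<And>j. j < q \<Longrightarrow> cauchy (\<omega> j)"
    "\<And>i. i < n \<Longrightarrow> cls (\<xi> i) = lincomb M' {..<q} (U i) (\<lambda>j. cls (\<omega> j))"
    using lift_to_completion[of n q U \<xi>] U(1) \<xi>(1) by blast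
  have \<omega>C: "(\<lambda>j. cls (\<omega> j)) \<in> {..<q} \<rightarrow> carrier M'" using \<omega>(1) by (auto simp: cls_closed)
  have "m i \<ominus>\<^bsub>M'\<^esub> lincomb M' {..<q} (U i) (\<lambda>j. cls (\<omega> j)) = \<zero>\<^bsub>M'\<^esub>" if i: "i < n" for i
  proof -
    have "lincomb M' {..<q} (U i) (\<lambda>j. cls (\<omega> j)) \<in> carrier M'"
      using U(1) \<omega>C by (intro M'.lincomb_closed) auto
    then show ?thesis unfolding \<xi>(2)[OF i] \<omega>(2)[OF i] a_minus_def by (rule M'.M.r_neg)
  qed
  then show "trivial_relations A (carrier A) {} M' (carrier Cpl) {..<n} {()} (\<lambda>_. r) m"
    unfolding trivial_relations_def using U(1,2) \<omega>C
    by (intro exI[of _ q] exI[of _ U] exI[of _ "\<lambda>j. cls (\<omega> j)"]) auto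
qed

text \<open>
  The kernel of the projection of the completion to the \<open>k\<close>-th quotient is not only
  the closure of the extended ideal: it is the ideal itself. With finitely many generators
  \<open>\<rho>\<close> of \<open>\<aa>\<^sup>k\<^sup>+\<^sup>1\<close>, all terms of the
  sequence from some index on are combinations of \<open>\<rho>\<close>, and
  \<open>lift_to_completion\<close> applies to the matrix with the single row
  \<open>\<rho>\<close>.
\<close>

lemma cls_in_scaled:
  assumes \<xi>: "cauchy \<xi>" and k: "\<xi> k \<in> J k"
  shows "cls \<xi> \<in> scaled M' (ideal_power \<aa> (Suc k)) (carrier Cpl)"
proof -
  have ak: "ideal (ideal_power \<aa> (Suc k)) A" by (rule ideal_power_ideal[OF a])
  obtain q :: nat and \<rho> where \<rho>: "\<rho> \<in> {..<q} \<rightarrow> ideal_power \<aa> (Suc k)"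
    "\<And>x. x \<in> ideal_power \<aa> (Suc k) \<Longrightarrow> \<exists>c \<in> UNIV \<rightarrow> carrier A. x = lincomb (self_module A) {..<q} \<rho> c"
    using ideal_finitely_generated[OF ak] by blast
  have \<rho>A: "\<rho> \<in> {..<q} \<rightarrow> carrier A" using \<rho>(1) ideal.Icarr[OF ak] by (simp add: Pi_iff)
  interpret l: linear_map A "sequence_module M" M "lincomb M {..<q} \<rho>"
    by (rule M.lincomb_sequence_linear[OF \<rho>A])
  have sub: "D (Suc k) \<subseteq> lincomb M {..<q} \<rho> ` carrier (sequence_module M)"
  proof (rule M.scaled_least)
    show "submodule (lincomb M {..<q} \<rho> ` carrier (sequence_module M)) A M"
      by (rule l.image_submodule[OF l.M.carrier_is_submodule])
    fix e z assume e: "e \<in> ideal_power \<aa> (Suc k)" and z: "z \<in> carrier M"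
    obtain c where c: "c \<in> UNIV \<rightarrow> carrier A" "e = lincomb (self_module A) {..<q} \<rho> c" using \<rho>(2)[OF e] by blast
    interpret sc: linear_map A "self_module A" M "\<lambda>c. c \<odot>\<^bsub>M\<^esub> z"
      using z by (intro linear_mapI noetherian_cring.axioms(2)[OF noetherian_cring_axioms, THEN cring.self_is_module] M.module_axioms)
        (auto simp: linear_maps_def f.S.l_distr f.S.m_assoc)
    have "e \<odot>\<^bsub>M\<^esub> z = lincomb M {..<q} \<rho> (\<lambda>i. c i \<odot>\<^bsub>M\<^esub> z)"
      unfolding c(2) using \<rho>A c(1) by (intro sc.hom_lincomb) auto
    moreover have "(\<lambda>i. c i \<odot>\<^bsub>M\<^esub> z) \<in> carrier (sequence_module M)"
      using c(1) z M.smult_closed unfolding sequence_module_simps by blast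
    ultimately show "e \<odot>\<^bsub>M\<^esub> z \<in> lincomb M {..<q} \<rho> ` carrier (sequence_module M)" by (rule image_eqI)
  qed
  have gen: "\<exists>w. w \<in> {..<q} \<rightarrow> carrier S \<and> x = lincomb M {..<q} \<rho> w" if "x \<in> J k" for x
  proof -
    have "x \<in> lincomb M {..<q} \<rho> ` carrier (sequence_module M)"
      using that[unfolded J_eq] by (rule subsetD[OF sub])
    then obtain w where "w \<in> carrier (sequence_module M)" "x = lincomb M {..<q} \<rho> w" by (rule imageE)
    then show ?thesis by (intro exI[of _ w]) (simp add: Pi_iff)
  qed
  have "\<exists>w \<in> {..<q} \<rightarrow> carrier S. \<forall>i<(1::nat). \<xi> l \<ominus>\<^bsub>S\<^esub> lincomb M {..<q} \<rho> w \<in> J l" for l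
  proof -
    define \<kappa> where "\<kappa> = max k l"
    have "\<xi> \<kappa> \<ominus>\<^bsub>S\<^esub> \<xi> k \<in> J k" by (rule cauchy_diff[OF \<xi>]) (simp add: \<kappa>_def)
    then have "\<xi> \<kappa> \<in> J k" using J_diff_mem[of "\<xi> \<kappa>" "\<xi> k" k] k cauchy_closed[OF \<xi>] by blast
    then obtain w where w: "w \<in> {..<q} \<rightarrow> carrier S" "\<xi> \<kappa> = lincomb M {..<q} \<rho> w" using gen by blast
    have "\<xi> l \<ominus>\<^bsub>S\<^esub> \<xi> \<kappa> \<in> J l"
      by (rule cauchy_diff'[OF \<xi>]) (simp add: \<kappa>_def)
    then show ?thesis using w by (intro bexI[of _ w]) auto
  qed
  then obtain \<omega> where \<omega>: "\<And>j. j < q \<Longrightarrow> cauchy (\<omega> j)" "cls \<xi> = lincomb M' {..<q} \<rho> (\<lambda>j. cls (\<omega> j))"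
    using lift_to_completion[of 1 q "\<lambda>_. \<rho>" "\<lambda>_. \<xi>"] \<rho>A \<xi> by auto
  have aA: "ideal_power \<aa> (Suc k) \<subseteq> carrier A" by (rule ideal_power_sub[OF a])
  have sub: "submodule (scaled M' (ideal_power \<aa> (Suc k)) (carrier Cpl)) A M'"
    using M'.scaled_submodule[OF aA M'.carrier_is_submodule] by simp
  have \<omega>C: "cls (\<omega> j) \<in> carrier M'" if "j < q" for j using \<omega>(1)[OF that] by (simp add: cls_closed)
  have "lincomb M' {..<q} (\<lambda>_. \<one>) (\<lambda>j. \<rho> j \<odot>\<^bsub>M'\<^esub> cls (\<omega> j)) \<in> scaled M' (ideal_power \<aa> (Suc k)) (carrier Cpl)"
  proof (rule M'.lincomb_in_submodule[OF sub])
    show "(\<lambda>j. \<rho> j \<odot>\<^bsub>M'\<^esub> cls (\<omega> j)) \<in> {..<q} \<rightarrow> scaled M' (ideal_power \<aa> (Suc k)) (carrier Cpl)"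
    proof
      fix j assume "j \<in> {..<q}"
      then have "\<rho> j \<in> ideal_power \<aa> (Suc k)" "\<rho> j \<in> carrier A" "cls (\<omega> j) \<in> carrier M'"
        using \<rho>(1) \<rho>A \<omega>C by blast+
      then show "\<rho> j \<odot>\<^bsub>M'\<^esub> cls (\<omega> j) \<in> scaled M' (ideal_power \<aa> (Suc k)) (carrier Cpl)"
        by (intro M'.scaled_mult M'.smult_closed) simp_all
    qed
  qed simp
  also have "lincomb M' {..<q} (\<lambda>_. \<one>) (\<lambda>j. \<rho> j \<odot>\<^bsub>M'\<^esub> cls (\<omega> j)) = lincomb M' {..<q} \<rho> (\<lambda>j. cls (\<omega> j))"
    unfolding lincomb_def
  proof (rule M'.M.finsum_cong')
    have c: "\<rho> j \<odot>\<^bsub>M'\<^esub> cls (\<omega> j) \<in> carrier M'" if "j \<in> {..<q}" for j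
      using \<rho>A \<omega>C that by (intro M'.smult_closed) auto
    then show "(\<lambda>j. \<rho> j \<odot>\<^bsub>M'\<^esub> cls (\<omega> j)) \<in> {..<q} \<rightarrow> carrier M'" by blast
    show "\<one> \<odot>\<^bsub>M'\<^esub> (\<rho> j \<odot>\<^bsub>M'\<^esub> cls (\<omega> j)) = \<rho> j \<odot>\<^bsub>M'\<^esub> cls (\<omega> j)" if "j \<in> {..<q}" for j
      using c[OF that] by (rule M'.smult_one)
  qed simp
  finally show ?thesis unfolding \<omega>(2) .
qed

end

section \<open>Adic flatness of the completed algebra\<close>

context completion
begin

lemma finsum_cls:
  assumes "finite K" "\<And>i. i \<in> K \<Longrightarrow> cauchy (s i)"
  shows "cauchy (\<lambda>k. \<Oplus>i\<in>K. s i k) \<and> (\<Oplus>\<^bsub>Cpl\<^esub>i\<in>K. cls (s i)) = cls (\<lambda>k. \<Oplus>i\<in>K. s i k)"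
  using assms
proof (induction K rule: finite_induct)
  interpret Cpl: cring Cpl by (rule Cpl_cring)
  {
    case empty
    then show ?case by (simp add: cls_ops cauchy_const)
  next
    case (insert i K)
    have si: "cauchy (s i)" and ih: "cauchy (\<lambda>k. \<Oplus>i\<in>K. s i k)"
      "(\<Oplus>\<^bsub>Cpl\<^esub>i\<in>K. cls (s i)) = cls (\<lambda>k. \<Oplus>i\<in>K. s i k)"
      using insert by blast+
    have "(\<Oplus>i\<in>insert i K. s i k) = s i k \<oplus> (\<Oplus>i\<in>K. s i k)" for k
      using insert by (intro finsum_insert) (auto simp: cauchy_closed)
    moreover have "(\<Oplus>\<^bsub>Cpl\<^esub>i\<in>insert i K. cls (s i)) = cls (s i) \<oplus>\<^bsub>Cpl\<^esub> (\<Oplus>\<^bsub>Cpl\<^esub>i\<in>K. cls (s i))"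
      using insert by (intro Cpl.finsum_insert) (auto simp: cls_closed)
    ultimately show ?case using cauchy_add[OF si ih(1)] cls_ops(3)[OF si ih(1)] ih(2) by simp
  }
qed

lemma cls_minus:
  assumes s: "cauchy s" and t: "cauchy t"
  shows "cauchy (\<lambda>k. s k \<ominus> t k)" and "cls s \<ominus>\<^bsub>Cpl\<^esub> cls t = cls (\<lambda>k. s k \<ominus> t k)"
proof -
  interpret Cpl: cring Cpl by (rule Cpl_cring)
  have "cauchy (\<lambda>k. s k \<oplus> (\<ominus> \<one>) \<otimes> t k)"
    by (intro cauchy_add cauchy_mult cauchy_const s t) simp
  moreover have "(\<lambda>k. s k \<oplus> (\<ominus> \<one>) \<otimes> t k) = (\<lambda>k. s k \<ominus> t k)"
    using cauchy_closed[OF s] cauchy_closed[OF t] by (simp add: a_minus_def l_minus)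
  ultimately show c: "cauchy (\<lambda>k. s k \<ominus> t k)" by simp
  have "cls (\<lambda>k. s k \<ominus> t k) \<oplus>\<^bsub>Cpl\<^esub> cls t = cls (\<lambda>k. (s k \<ominus> t k) \<oplus> t k)"
    by (rule cls_ops(3)[OF c t])
  also have "(\<lambda>k. (s k \<ominus> t k) \<oplus> t k) = s"
    using cauchy_closed[OF s] cauchy_closed[OF t] by (simp add: a_minus_def a_assoc l_neg)
  finally have "cls s = cls (\<lambda>k. s k \<ominus> t k) \<oplus>\<^bsub>Cpl\<^esub> cls t" by simp
  then show "cls s \<ominus>\<^bsub>Cpl\<^esub> cls t = cls (\<lambda>k. s k \<ominus> t k)"
    using cls_closed[OF c] cls_closed[OF t] by (simp add: a_minus_def Cpl.a_assoc Cpl.r_neg)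
qed

end

lemma (in completed_flat_algebra) cls_in_scaled_iff:
  assumes \<xi>: "cauchy \<xi>"
  shows "cls \<xi> \<in> scaled M' (ideal_power \<aa> (Suc k)) (carrier Cpl) \<longleftrightarrow> \<xi> k \<in> J k"
proof
  assume x: "cls \<xi> \<in> scaled M' (ideal_power \<aa> (Suc k)) (carrier Cpl)"
  define H where "H = {x. \<exists>s. cauchy s \<and> x = cls s \<and> s k \<in> J k}"
  have M'_smult: "e \<odot>\<^bsub>M'\<^esub> cls s = cls (\<lambda>k. f e \<otimes>\<^bsub>S\<^esub> s k)" "cauchy (\<lambda>k. f e \<otimes>\<^bsub>S\<^esub> s k)"
    if "e \<in> carrier A" "cauchy s" for e s
    using that cls_ops(4)[OF cauchy_const[of "f e"] that(2)] cauchy_mult[OF cauchy_const[of "f e"] that(2)]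
    by (simp_all add: to_completion_cls)
  have "submodule H A M'"
  proof (rule M'.submoduleI2)
    show "H \<subseteq> carrier M'" unfolding H_def using cls_closed by auto
    show "\<zero>\<^bsub>M'\<^esub> \<in> H"
      unfolding H_def using cls_ops(1) cauchy_const[of "\<zero>\<^bsub>S\<^esub>"] JD(2) by auto
  next
    fix x y assume "x \<in> H" "y \<in> H"
    then obtain s t where st: "cauchy s" "x = cls s" "s k \<in> J k" "cauchy t" "y = cls t" "t k \<in> J k"
      unfolding H_def by blast
    then show "x \<oplus>\<^bsub>M'\<^esub> y \<in> H"
      unfolding H_def using cls_ops(3)[OF st(1,4)] cauchy_add[OF st(1,4)] JD(5)[OF st(3,6)] by auto
  next
    fix e x assume e: "e \<in> carrier A" and "x \<in> H"
    then obtain s where s: "cauchy s" "x = cls s" "s k \<in> J k" unfolding H_def by blast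
    then show "e \<odot>\<^bsub>M'\<^esub> x \<in> H"
      unfolding H_def s(2) M'_smult(1)[OF e s(1)] using M'_smult(2)[OF e s(1)] JD(7)[of "f e" "s k"] e by blast
  qed
  then have "scaled M' (ideal_power \<aa> (Suc k)) (carrier Cpl) \<subseteq> H"
  proof (rule M'.scaled_least)
    fix e z assume e: "e \<in> ideal_power \<aa> (Suc k)" and "z \<in> carrier Cpl"
    then obtain s where s: "cauchy s" "z = cls s" by (metis Cpl_cases)
    have eA: "e \<in> carrier A" using ideal.Icarr[OF ideal_power_ideal[OF a] e] .
    have "e \<odot>\<^bsub>M\<^esub> s k \<in> D (Suc k)"
      using e cauchy_closed[OF s(1)] eA by (intro M.scaled_mult M.smult_closed) simp_all
    then have "f e \<otimes>\<^bsub>S\<^esub> s k \<in> J k" unfolding J_eq by simp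
    then show "e \<odot>\<^bsub>M'\<^esub> z \<in> H"
      unfolding H_def s(2) M'_smult(1)[OF eA s(1)] using M'_smult(2)[OF eA s(1)] by blast
  qed
  with x obtain s where s: "cauchy s" "cls \<xi> = cls s" "s k \<in> J k" unfolding H_def by blast
  have "\<xi> k \<ominus>\<^bsub>S\<^esub> s k \<in> J k"
    using s(2) cls_eq_iff[of \<xi> s] cauchy_closed[OF \<xi>] cauchy_closed[OF s(1)] by simp
  then show "\<xi> k \<in> J k" using J_diff_mem[of "\<xi> k" "s k" k] s(3) cauchy_closed[OF \<xi>] cauchy_closed[OF s(1)] by blast
qed (rule cls_in_scaled[OF \<xi>])

lemma scaled_image_coefficients:
  assumes "\<And>e z. e \<in> E \<Longrightarrow> z \<in> Z \<Longrightarrow> \<phi> e \<odot>\<^bsub>M\<^esub> z = e \<odot>\<^bsub>N\<^esub> z" "add M = add N" "\<zero>\<^bsub>M\<^esub> = \<zero>\<^bsub>N\<^esub>"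
  shows "scaled M (\<phi> ` E) Z = scaled N E Z"
proof (intro equalityI subsetI)
  fix x assume "x \<in> scaled M (\<phi> ` E) Z"
  then show "x \<in> scaled N E Z"
  proof (induction rule: scaled.induct)
    case zero
    show ?case unfolding assms(3) by (rule scaled.zero)
  next
    case (step e z x)
    then obtain e' where e': "e' \<in> E" "e = \<phi> e'" by blast
    then show ?case using scaled.step[OF e'(1) step(2) step.IH] assms(1)[OF e'(1) step(2)] assms(2) by simp
  qed
next
  fix x assume "x \<in> scaled N E Z"
  then show "x \<in> scaled M (\<phi> ` E) Z"
  proof (induction rule: scaled.induct)
    case zero
    show ?case unfolding assms(3)[symmetric] by (rule scaled.zero)
  next
    case (step e z x)
    then show ?case using scaled.step[OF imageI[OF step(1)] step(2) step.IH] assms(1)[OF step(1,2)] assms(2) by simp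
  qed
qed

text \<open>
  The image of \<open>\<phi>\<close> serves as the subring of coefficients: relations over it
  lift to relations over \<open>A\<close>, and \<open>\<phi>\<close> maps the solutions back.
\<close>

lemma relation_flat_restrict:
  assumes \<phi>: "ring_hom_cring A R \<phi>" and h: "ring_hom_cring R S h"
    and flat: "relation_flat A (carrier A) {} (algebra_module (h \<circ> \<phi>) S) (carrier S)"
  shows "relation_flat R (\<phi> ` carrier A) {} (algebra_module h S) (carrier S)"
  unfolding relation_flat_def
proof (intro allI impI)
  interpret \<phi>: ring_hom_cring A R \<phi> by (rule \<phi>)
  interpret h: ring_hom_cring R S h by (rule h)
  let ?M = "algebra_module h S" and ?N = "algebra_module (h \<circ> \<phi>) S"
  have hom: "ring_hom_cring A S (h \<circ> \<phi>)"
    using ring_hom_trans[OF \<phi>.homh h.homh]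
    by (simp add: ring_hom_cring_def ring_hom_cring_axioms_def \<phi>.R.is_cring h.S.is_cring)
  interpret M: module R ?M by (rule algebra_module_module[OF h])
  interpret N: module A ?N by (rule algebra_module_module[OF hom])
  interpret sA: module A "self_module A" by (rule self_module_module[OF \<phi>.R.is_cring])
  interpret sR: module R "self_module R" by (rule self_module_module[OF \<phi>.S.is_cring])
  have lc: "lincomb ?M K (\<lambda>i. \<phi> (c i)) m = lincomb ?N K c m" for K c m
    by (simp add: lincomb_def)
  fix n :: nat and r m
  assume r: "r \<in> {..<n} \<rightarrow> \<phi> ` carrier A" and m: "m \<in> {..<n} \<rightarrow> carrier S"
    and "lincomb ?M {..<n} r m \<in> scaled ?M {} (carrier S)"
  then have rel: "lincomb ?M {..<n} r m = \<zero>\<^bsub>S\<^esub>" by simp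
  have "\<forall>i<n. \<exists>a\<in>carrier A. r i = \<phi> a" using r by (auto simp: Pi_iff image_iff)
  then obtain c where c: "\<And>i. i < n \<Longrightarrow> c i \<in> carrier A" "\<And>i. i < n \<Longrightarrow> r i = \<phi> (c i)" by metis
  have "lincomb ?M {..<n} r m = lincomb ?M {..<n} (\<lambda>i. \<phi> (c i)) m"
    using c m by (intro M.lincomb_cong) auto
  then have "lincomb ?N {..<n} c m \<in> scaled ?N {} (carrier S)" using rel lc[of "{..<n}" c m] by simp
  then have "trivial_relations A (carrier A) {} ?N (carrier S) {..<n} {()} (\<lambda>_. c) m"
    using flat c(1) m unfolding relation_flat_def by blast
  then obtain p :: nat and T w where 1: "T \<in> {..<n} \<rightarrow> {..<p} \<rightarrow> carrier A" "w \<in> {..<p} \<rightarrow> carrier S"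
    "\<forall>j<p. lincomb (self_module A) {..<n} c (\<lambda>i. T i j) = \<zero>\<^bsub>A\<^esub>"
    "\<forall>i<n. m i \<ominus>\<^bsub>S\<^esub> lincomb ?N {..<p} (T i) w = \<zero>\<^bsub>S\<^esub>"
    unfolding trivial_relations_def by auto
  have TA: "T i j \<in> carrier A" if "i < n" "j < p" for i j using 1(1) that by auto
  have "lincomb (self_module R) {..<n} r (\<lambda>i. \<phi> (T i j)) = \<zero>\<^bsub>R\<^esub>" if j: "j < p" for j
  proof -
    have "lincomb (self_module R) {..<n} r (\<lambda>i. \<phi> (T i j)) = (\<Oplus>\<^bsub>R\<^esub>i\<in>{..<n}. \<phi> (c i \<otimes>\<^bsub>A\<^esub> T i j))"
      unfolding lincomb_def self_module_simps using c TA j by (intro \<phi>.S.finsum_cong') auto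
    also have "\<dots> = \<phi> (\<Oplus>\<^bsub>A\<^esub>i\<in>{..<n}. c i \<otimes>\<^bsub>A\<^esub> T i j)"
      using c TA j by (subst \<phi>.hom_finsum) (auto simp: o_def)
    also have "\<dots> = \<zero>\<^bsub>R\<^esub>" using 1(3) j by (simp add: lincomb_def)
    finally show ?thesis .
  qed
  moreover have "(\<lambda>i j. \<phi> (T i j)) \<in> {..<n} \<rightarrow> {..<p} \<rightarrow> \<phi> ` carrier A" using TA by auto
  ultimately show "trivial_relations R (\<phi> ` carrier A) {} ?M (carrier S) {..<n} {()} (\<lambda>_. r) m"
    unfolding trivial_relations_def using 1(2,4)
    by (intro exI[of _ p] exI[of _ "\<lambda>i j. \<phi> (T i j)"] exI[of _ w]) (simp add: lc)
qed

text \<open>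
  Making a relation over \<open>A\<close> trivial over \<open>B\<close> writes \<open>m\<close>
  as \<open>T w\<close>, where the columns of \<open>T\<close> satisfy the relation in
  \<open>B\<close>. These columns are in turn trivial over \<open>A\<close>, and trivial vectors
  are closed under sums.
\<close>

lemma relation_flat_trans:
  assumes f: "ring_hom_cring A B f" and g: "ring_hom_cring B C g"
    and Bf: "relation_flat A (carrier A) {} (algebra_module f B) (carrier B)"
    and Cf: "relation_flat B (carrier B) {} (algebra_module g C) (carrier C)"
  shows "relation_flat A (carrier A) {} (algebra_module (g \<circ> f) C) (carrier C)"
  unfolding relation_flat_def
proof (intro allI impI)
  interpret f: ring_hom_cring A B f by (rule f)
  interpret g: ring_hom_cring B C g by (rule g)
  let ?B = "algebra_module f B" and ?C = "algebra_module g C" and ?D = "algebra_module (g \<circ> f) C"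
  have gf: "ring_hom_cring A C (g \<circ> f)"
    using ring_hom_trans[OF f.homh g.homh]
    by (simp add: ring_hom_cring_def ring_hom_cring_axioms_def f.R.is_cring g.S.is_cring)
  interpret MB: module A ?B by (rule algebra_module_module[OF f])
  interpret MC: module B ?C by (rule algebra_module_module[OF g])
  interpret MD: module A ?D by (rule algebra_module_module[OF gf])
  interpret coA: coefficients A "carrier A" "{}" by unfold_locales auto
  interpret coB: coefficient_module A "carrier A" "{}" ?B "carrier B"
    using MB.carrier_is_submodule by (intro coA.coefficient_moduleI MB.module_axioms) simp
  interpret coD: coefficient_module A "carrier A" "{}" ?D "carrier C"
    using MD.carrier_is_submodule by (intro coA.coefficient_moduleI MD.module_axioms) simp
  fix n :: nat and r m
  assume r: "r \<in> {..<n} \<rightarrow> carrier A" and m: "m \<in> {..<n} \<rightarrow> carrier C"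
    and "lincomb ?D {..<n} r m \<in> scaled ?D {} (carrier C)"
  then have rel: "lincomb ?C {..<n} (\<lambda>i. f (r i)) m \<in> scaled ?C {} (carrier C)"
    by (simp add: lincomb_def)
  have "(\<lambda>i. f (r i)) \<in> {..<n} \<rightarrow> carrier B" using r by auto
  then have "trivial_relations B (carrier B) {} ?C (carrier C) {..<n} {()} (\<lambda>_ i. f (r i)) m"
    using Cf m rel unfolding relation_flat_def by blast
  then obtain p :: nat and T w where 1: "T \<in> {..<n} \<rightarrow> {..<p} \<rightarrow> carrier B" "w \<in> {..<p} \<rightarrow> carrier C"
    "\<forall>j<p. lincomb (self_module B) {..<n} (\<lambda>i. f (r i)) (\<lambda>i. T i j) = \<zero>\<^bsub>B\<^esub>"
    "\<forall>i<n. m i \<ominus>\<^bsub>C\<^esub> lincomb ?C {..<p} (T i) w = \<zero>\<^bsub>C\<^esub>"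
    unfolding trivial_relations_def by auto
  have TB: "T i j \<in> carrier B" if "i < n" "j < p" for i j using 1(1) that by auto
  have wC: "w j \<in> carrier C" if "j < p" for j using 1(2) that by auto
  have "trivial_relations A (carrier A) {} ?D (carrier C) {..<n} {()} (\<lambda>_. r)
     (\<lambda>i. \<Oplus>\<^bsub>?D\<^esub>j\<in>{..<p}. g (T i j) \<otimes>\<^bsub>C\<^esub> w j)"
  proof (rule coD.trivial_finsum)
    fix j assume "j \<in> {..<p}"
    then have j: "j < p" by simp
    have "lincomb ?B {..<n} r (\<lambda>i. T i j) \<in> scaled ?B {} (carrier B)"
      using 1(3) j by (simp add: lincomb_def)
    moreover have "(\<lambda>i. T i j) \<in> {..<n} \<rightarrow> carrier B" using TB j by auto
    ultimately have t: "trivial_relations A (carrier A) {} ?B (carrier B) {..<n} {()} (\<lambda>_. r) (\<lambda>i. T i j)"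
      using Bf r unfolding relation_flat_def by blast
    interpret l: linear_map A ?B ?D "\<lambda>b. g b \<otimes>\<^bsub>C\<^esub> w j"
      using wC[OF j] by (intro linear_mapI MB.module_axioms MD.module_axioms)
        (auto simp: linear_maps_def g.S.l_distr g.S.m_assoc)
    show "trivial_relations A (carrier A) {} ?D (carrier C) {..<n} {()} (\<lambda>_. r) (\<lambda>i. g (T i j) \<otimes>\<^bsub>C\<^esub> w j)"
      by (rule l.trivial_image[OF t]) (use TB wC j in auto)
    show "(\<lambda>i. g (T i j) \<otimes>\<^bsub>C\<^esub> w j) \<in> {..<n} \<rightarrow> carrier ?D" using TB wC j by auto
  qed simp
  then show "trivial_relations A (carrier A) {} ?D (carrier C) {..<n} {()} (\<lambda>_. r) m"
  proof (rule coD.trivial_cong)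
    fix i assume "i \<in> {..<n}"
    then have i: "i < n" by simp
    have c: "lincomb ?C {..<p} (T i) w \<in> carrier C" "m i \<in> carrier C"
      using MC.lincomb_closed[of "T i" "{..<p}" w] TB wC i m by auto
    have "m i = (m i \<ominus>\<^bsub>C\<^esub> lincomb ?C {..<p} (T i) w) \<oplus>\<^bsub>C\<^esub> lincomb ?C {..<p} (T i) w"
      using c by (simp add: a_minus_def g.S.a_assoc g.S.l_neg)
    then have "m i = lincomb ?C {..<p} (T i) w" using 1(4) i c by simp
    then show "m i = (\<Oplus>\<^bsub>?D\<^esub>j\<in>{..<p}. g (T i j) \<otimes>\<^bsub>C\<^esub> w j)" by (simp add: lincomb_def)
  qed
qed

lemma relation_flat_cong_scalars:
  assumes "\<And>a. a \<in> carrier R \<Longrightarrow> h a = h' a" "ring_hom_cring R S h" "ring_hom_cring R S h'"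
    and "relation_flat R (carrier R) {} (algebra_module h S) (carrier S)"
  shows "relation_flat R (carrier R) {} (algebra_module h' S) (carrier S)"
  unfolding relation_flat_def
proof (intro allI impI)
  interpret M: module R "algebra_module h S" by (rule algebra_module_module[OF assms(2)])
  interpret M': module R "algebra_module h' S" by (rule algebra_module_module[OF assms(3)])
  have lc: "lincomb (algebra_module h' S) {..<n::nat} c m = lincomb (algebra_module h S) {..<n} c m"
    if "c \<in> {..<n} \<rightarrow> carrier R" "m \<in> {..<n} \<rightarrow> carrier S" for n c m
    unfolding lincomb_def algebra_module_derived
    using that assms(1) M.smult_closed by (intro M.M.finsum_cong'[simplified]) (auto simp: Pi_iff)
  fix n :: nat and r m
  assume r: "r \<in> {..<n} \<rightarrow> carrier R" and m: "m \<in> {..<n} \<rightarrow> carrier S"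
    and rel: "lincomb (algebra_module h' S) {..<n} r m \<in> scaled (algebra_module h' S) {} (carrier S)"
  then have "trivial_relations R (carrier R) {} (algebra_module h S) (carrier S) {..<n} {()} (\<lambda>_. r) m"
    using assms(4) unfolding relation_flat_def by (simp add: lc)
  then obtain p :: nat and T w where 1: "T \<in> {..<n} \<rightarrow> {..<p} \<rightarrow> carrier R" "w \<in> {..<p} \<rightarrow> carrier S"
    "\<forall>j<p. lincomb (self_module R) {..<n} r (\<lambda>i. T i j) = \<zero>\<^bsub>R\<^esub>"
    "\<forall>i<n. m i \<ominus>\<^bsub>S\<^esub> lincomb (algebra_module h S) {..<p} (T i) w = \<zero>\<^bsub>S\<^esub>"
    unfolding trivial_relations_def by auto
  have "lincomb (algebra_module h' S) {..<p} (T i) w = lincomb (algebra_module h S) {..<p} (T i) w" if "i < n" for i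
    using 1(1,2) that by (intro lc) auto
  then show "trivial_relations R (carrier R) {} (algebra_module h' S) (carrier S) {..<n} {()} (\<lambda>_. r) m"
    unfolding trivial_relations_def using 1
    by (intro exI[of _ p] exI[of _ T] exI[of _ w]) simp
qed

text \<open>
  The structure map \<open>gf\<close> of \<open>C\<close> over \<open>A\<close> is a single map
  that agrees with the composite on \<open>A\<close>, so that the results about \<open>C\<close>
  as an \<open>A\<close>-algebra apply literally.
\<close>

locale completed_tower = B: completed_flat_algebra A B f \<aa> + C: completed_flat_algebra A C gf \<aa> +
    g: ring_hom_cring B C g
  for A (structure) and B and f and C and gf and \<aa> and g +
  assumes gf: "\<And>a. a \<in> carrier A \<Longrightarrow> gf a = g (f a)"
    and g_flat: "relation_flat B (carrier B) {} (algebra_module g C) (carrier C)"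
begin

abbreviation cm where "cm \<equiv> completion_map C C.\<bb> g"
abbreviation P where "P \<equiv> algebra_module cm C.Cpl"
abbreviation \<phi> where "\<phi> \<equiv> B.\<phi>"

lemma g_J: "x \<in> B.J k \<Longrightarrow> g x \<in> C.J k"
proof -
  have "g ` B.\<bb> \<subseteq> C.\<bb>"
  proof -
    have fa: "f ` \<aa> \<subseteq> carrier B" "gf ` \<aa> \<subseteq> carrier C"
      using ideal.Icarr[OF B.a] by auto
    interpret cb: ideal "C.\<bb>" C by (rule C.\<bb>_ideal)
    have "ideal {x \<in> carrier B. g x \<in> C.\<bb>} B"
      unfolding B.f.S.ideal_iff_submodule
      by (rule module.submoduleI2[OF B.f.S.self_is_module]) (auto simp: cb.I_l_closed)
    moreover have "f ` \<aa> \<subseteq> {x \<in> carrier B. g x \<in> C.\<bb>}"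
      using fa C.f.S.genideal_self[OF fa(2)] gf ideal.Icarr[OF B.a] by force
    ultimately have "B.\<bb> \<subseteq> {x \<in> carrier B. g x \<in> C.\<bb>}" by (rule B.f.S.genideal_minimal)
    then show ?thesis by auto
  qed
  from image_ideal_power[OF g.ring_hom_cring_axioms B.\<bb>_ideal C.\<bb>_ideal this, of "Suc k"]
  show "x \<in> B.J k \<Longrightarrow> g x \<in> C.J k" unfolding B.J_def C.J_def by blast
qed

lemma g_cauchy: "B.cauchy s \<Longrightarrow> C.cauchy (\<lambda>k. g (s k))"
  unfolding C.cauchy_def
proof (intro allI conjI)
  fix k assume s: "B.cauchy s"
  note c = B.cauchy_closed[OF s]
  show "g (s k) \<in> carrier C" using c by simp
  have "g (s (Suc k) \<ominus>\<^bsub>B\<^esub> s k) \<in> C.J k" by (rule g_J[OF B.cauchy_step[OF s]])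
  then show "g (s (Suc k)) \<ominus>\<^bsub>C\<^esub> g (s k) \<in> C.J k" using c by (simp add: a_minus_def)
qed

lemma cm_cls:
  assumes s: "B.cauchy s"
  shows "cm (B.cls s) = C.cls (\<lambda>k. g (s k))"
proof
  fix k
  note c = B.cauchy_closed[OF s]
  have "C.J k <+>\<^bsub>C\<^esub> g ` (B.J k +>\<^bsub>B\<^esub> s k) = C.J k +>\<^bsub>C\<^esub> g (s k)"
  proof (intro equalityI subsetI)
    fix y assume "y \<in> C.J k <+>\<^bsub>C\<^esub> g ` (B.J k +>\<^bsub>B\<^esub> s k)"
    then obtain u v where uv: "u \<in> C.J k" "v \<in> B.J k" "y = u \<oplus>\<^bsub>C\<^esub> g (v \<oplus>\<^bsub>B\<^esub> s k)"
      unfolding set_add_def' a_r_coset_def' by blast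
    have "y = (u \<oplus>\<^bsub>C\<^esub> g v) \<oplus>\<^bsub>C\<^esub> g (s k)"
      using uv c C.JD(3) B.JD(3) by (simp add: C.f.S.a_assoc)
    moreover have "u \<oplus>\<^bsub>C\<^esub> g v \<in> C.J k" using uv g_J C.JD(5) by blast
    ultimately show "y \<in> C.J k +>\<^bsub>C\<^esub> g (s k)" unfolding a_r_coset_def' by blast
  next
    fix y assume "y \<in> C.J k +>\<^bsub>C\<^esub> g (s k)"
    then obtain u where u: "u \<in> C.J k" "y = u \<oplus>\<^bsub>C\<^esub> g (s k)" unfolding a_r_coset_def' by blast
    have "s k = \<zero>\<^bsub>B\<^esub> \<oplus>\<^bsub>B\<^esub> s k" using c by simp
    then have "s k \<in> B.J k +>\<^bsub>B\<^esub> s k" unfolding a_r_coset_def' using B.JD(2) by blast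
    then show "y \<in> C.J k <+>\<^bsub>C\<^esub> g ` (B.J k +>\<^bsub>B\<^esub> s k)" unfolding set_add_def' using u by blast
  qed
  then show "cm (B.cls s) k = C.cls (\<lambda>k. g (s k)) k"
    unfolding completion_map_def B.cls_def C.cls_def C.J_def .
qed

lemma cm_hom: "ring_hom_cring B.Cpl C.Cpl cm"
proof -
  have "cm \<in> ring_hom B.Cpl C.Cpl"
  proof (rule ring_hom_memI)
    fix x assume "x \<in> carrier B.Cpl"
    then obtain s where s: "B.cauchy s" "x = B.cls s" by (rule B.Cpl_cases)
    then show "cm x \<in> carrier C.Cpl" by (simp add: cm_cls C.cls_closed g_cauchy)
    fix y assume "y \<in> carrier B.Cpl"
    then obtain t where t: "B.cauchy t" "y = B.cls t" by (rule B.Cpl_cases)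
    show "cm (x \<otimes>\<^bsub>B.Cpl\<^esub> y) = cm x \<otimes>\<^bsub>C.Cpl\<^esub> cm y"
      using s t by (simp add: B.cls_ops C.cls_ops cm_cls B.cauchy_mult g_cauchy B.cauchy_closed)
    show "cm (x \<oplus>\<^bsub>B.Cpl\<^esub> y) = cm x \<oplus>\<^bsub>C.Cpl\<^esub> cm y"
      using s t by (simp add: B.cls_ops C.cls_ops cm_cls B.cauchy_add g_cauchy B.cauchy_closed)
  next
    show "cm \<one>\<^bsub>B.Cpl\<^esub> = \<one>\<^bsub>C.Cpl\<^esub>" by (simp add: B.cls_ops C.cls_ops cm_cls B.cauchy_const)
  qed
  then show ?thesis
    by (simp add: ring_hom_cring_def ring_hom_cring_axioms_def B.Cpl_cring C.Cpl_cring)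
qed

lemma cm_to_completion: "b \<in> carrier B \<Longrightarrow> cm (to_completion B B.\<bb> b) = to_completion C C.\<bb> (g b)"
  by (simp add: B.to_completion_cls C.to_completion_cls cm_cls B.cauchy_const)

lemma cm_\<phi>: "a \<in> carrier A \<Longrightarrow> cm (\<phi> a) = C.\<phi> a"
  by (simp add: cm_to_completion gf)

sublocale P: module B.Cpl P by (rule algebra_module_module[OF cm_hom])

lemma A0_coefficients: "coefficients B.Cpl (\<phi> ` carrier A) {}"
proof -
  interpret \<phi>: ring_hom_cring A B.Cpl \<phi> by (rule B.\<phi>_hom)
  have img: "\<phi> a \<in> \<phi> ` carrier A" if "a \<in> carrier A" for a using that by (rule imageI)
  show ?thesis
  proof (unfold_locales)
    show "\<phi> ` carrier A \<subseteq> carrier B.Cpl" using \<phi>.hom_closed by blast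
    show "\<zero>\<^bsub>B.Cpl\<^esub> \<in> \<phi> ` carrier A" using img[OF B.zero_closed] \<phi>.hom_zero by metis
    show "\<one>\<^bsub>B.Cpl\<^esub> \<in> \<phi> ` carrier A" using img[OF B.one_closed] \<phi>.hom_one by metis
    fix x y assume "x \<in> \<phi> ` carrier A" "y \<in> \<phi> ` carrier A"
    then obtain a b where ab: "a \<in> carrier A" "b \<in> carrier A" "x = \<phi> a" "y = \<phi> b" by blast
    show "x \<oplus>\<^bsub>B.Cpl\<^esub> y \<in> \<phi> ` carrier A"
      unfolding ab(3,4) using img[OF B.a_closed[OF ab(1,2)]] \<phi>.hom_add[OF ab(1,2)] by metis
    show "x \<otimes>\<^bsub>B.Cpl\<^esub> y \<in> \<phi> ` carrier A"
      unfolding ab(3,4) using img[OF B.m_closed[OF ab(1,2)]] \<phi>.hom_mult[OF ab(1,2)] by metis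
  qed simp
qed

lemma self_flat: "relation_flat B.Cpl (\<phi> ` carrier A) {} (self_module B.Cpl) (carrier B.Cpl)"
proof -
  have "ring_hom_cring B.Cpl B.Cpl (\<lambda>x. x)"
    by (simp add: ring_hom_cring_def ring_hom_cring_axioms_def ring_hom_def B.Cpl_cring)
  moreover have "(\<lambda>x. x) \<circ> \<phi> = \<phi>" by auto
  ultimately show ?thesis
    unfolding self_module_def
    using relation_flat_restrict[OF B.\<phi>_hom, of B.Cpl "\<lambda>x. x"] B.completion_relation_flat by metis
qed

lemma P_flat: "relation_flat B.Cpl (\<phi> ` carrier A) {} P (carrier C.Cpl)"
proof (rule relation_flat_restrict[OF B.\<phi>_hom cm_hom])
  have h: "ring_hom_cring A C.Cpl (cm \<circ> \<phi>)"
    using ring_hom_trans[OF ring_hom_cring.homh[OF B.\<phi>_hom] ring_hom_cring.homh[OF cm_hom]]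
    by (simp add: ring_hom_cring_def ring_hom_cring_axioms_def B.is_cring C.Cpl_cring)
  show "relation_flat A (carrier A) {} (algebra_module (cm \<circ> \<phi>) C.Cpl) (carrier C.Cpl)"
  proof (rule relation_flat_cong_scalars[OF _ C.\<phi>_hom h C.completion_relation_flat])
    fix a assume "a \<in> carrier A"
    from cm_\<phi>[OF this] show "C.\<phi> a = (cm \<circ> \<phi>) a" by simp
  qed
qed

text \<open>
  The quotients of the completions by the extension of
  \<open>\<aa>\<^sup>k\<^sup>+\<^sup>1\<close> are the quotients of \<open>B\<close> and
  \<open>C\<close>, and flatness is stable under base change. Concretely, the
  \<open>k\<close>-th component of a relation is a relation over \<open>B\<close> modulo
  \<open>\<aa>\<^sup>k\<^sup>+\<^sup>1C\<close>, hence a genuine relation with additional terms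
  whose coefficients come from \<open>\<aa>\<^sup>k\<^sup>+\<^sup>1\<close>. Flatness of
  \<open>C\<close> over \<open>B\<close> makes it trivial. The solution is embedded by constant
  sequences; it is correct in the \<open>k\<close>-th component, so by
  \<open>cls_in_scaled\<close> the errors lie in the extension of
  \<open>\<aa>\<^sup>k\<^sup>+\<^sup>1\<close>.
\<close>

lemma P_flat_mod_power:
  "relation_flat B.Cpl (carrier B.Cpl) (\<phi> ` B.ideal_power \<aa> (Suc k)) P (carrier C.Cpl)"
  unfolding relation_flat_def
proof (intro allI impI)
  let ?a = "B.ideal_power \<aa> (Suc k)"
  let ?E = "\<phi> ` ?a"
  interpret mg: module B "algebra_module g C" by (rule algebra_module_module[OF g.ring_hom_cring_axioms])
  have aA: "x \<in> carrier A" if "x \<in> ?a" for x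
    using ideal.Icarr[OF B.ideal_power_ideal[OF B.a]] that by blast
  have scP: "scaled P ?E (carrier C.Cpl) = scaled C.M' ?a (carrier C.Cpl)"
    using aA cm_\<phi> by (intro scaled_image_coefficients) auto
  have scB: "ideal_span B.Cpl ?E = scaled B.M' ?a (carrier B.Cpl)"
    by (intro scaled_image_coefficients) auto
  fix n :: nat and r m
  assume r: "r \<in> {..<n} \<rightarrow> carrier B.Cpl" and m: "m \<in> {..<n} \<rightarrow> carrier C.Cpl"
    and rel: "lincomb P {..<n} r m \<in> scaled P ?E (carrier C.Cpl)"
  have "\<forall>i<n. \<exists>s. B.cauchy s \<and> r i = B.cls s" using r by (metis B.Cpl_cases PiE lessThan_iff)
  then obtain \<rho> where \<rho>: "\<And>i. i < n \<Longrightarrow> B.cauchy (\<rho> i)" "\<And>i. i < n \<Longrightarrow> r i = B.cls (\<rho> i)" by metis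
  have "\<forall>i<n. \<exists>s. C.cauchy s \<and> m i = C.cls s" using m by (metis C.Cpl_cases PiE lessThan_iff)
  then obtain \<mu> where \<mu>: "\<And>i. i < n \<Longrightarrow> C.cauchy (\<mu> i)" "\<And>i. i < n \<Longrightarrow> m i = C.cls (\<mu> i)" by metis
  define \<sigma> where "\<sigma> l = lincomb (algebra_module g C) {..<n} (\<lambda>i. \<rho> i l) (\<lambda>i. \<mu> i l)" for l
  have \<rho>B: "\<rho> i l \<in> carrier B" and \<mu>C: "\<mu> i l \<in> carrier C" if "i < n" for i l
    using B.cauchy_closed[OF \<rho>(1)[OF that]] C.cauchy_closed[OF \<mu>(1)[OF that]] by auto
  have prod: "C.cauchy (\<lambda>l. g (\<rho> i l) \<otimes>\<^bsub>C\<^esub> \<mu> i l)" if "i < n" for i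
    by (intro C.cauchy_mult g_cauchy \<rho>(1) \<mu>(1) that)
  have "lincomb P {..<n} r m = (\<Oplus>\<^bsub>C.Cpl\<^esub>i\<in>{..<n}. C.cls (\<lambda>l. g (\<rho> i l) \<otimes>\<^bsub>C\<^esub> \<mu> i l))"
    unfolding lincomb_def algebra_module_derived
  proof (rule abelian_monoid.finsum_cong'[OF abelian_group.axioms(1)[OF cring.axioms(1)[OF C.Cpl_cring, THEN ring.is_abelian_group]]])
    fix i assume i: "i \<in> {..<n}"
    then show "r i \<odot>\<^bsub>P\<^esub> m i = C.cls (\<lambda>l. g (\<rho> i l) \<otimes>\<^bsub>C\<^esub> \<mu> i l)"
      using \<rho> \<mu> g_cauchy[OF \<rho>(1)] by (simp add: cm_cls C.cls_ops)
  qed (use C.cls_closed[OF prod] in auto)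
  also have "\<dots> = C.cls \<sigma>"
    using C.finsum_cls[of "{..<n}" "\<lambda>i l. g (\<rho> i l) \<otimes>\<^bsub>C\<^esub> \<mu> i l"] prod by (simp add: \<sigma>_def[abs_def] lincomb_def)
  finally have x: "lincomb P {..<n} r m = C.cls \<sigma>" .
  have \<sigma>: "C.cauchy \<sigma>"
    using C.finsum_cls[of "{..<n}" "\<lambda>i l. g (\<rho> i l) \<otimes>\<^bsub>C\<^esub> \<mu> i l"] prod by (simp add: \<sigma>_def[abs_def] lincomb_def)
  have "\<sigma> k \<in> C.J k" using rel unfolding x scP C.cls_in_scaled_iff[OF \<sigma>] .
  then have "\<sigma> k \<in> scaled C.M ?a (carrier C.M)" unfolding C.J_eq .
  then obtain q :: nat and \<alpha> y where \<alpha>: "\<alpha> \<in> {..<q} \<rightarrow> ?a" and y: "y \<in> {..<q} \<rightarrow> carrier C"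
    and \<sigma>k: "\<sigma> k = lincomb C.M {..<q} \<alpha> y"
    using C.M.scaled_lincomb[OF _ B.ideal_power_sub[OF B.a] subset_refl, of "\<sigma> k" "Suc k"] by auto
  have \<alpha>A: "\<alpha> e \<in> ?a" "\<alpha> e \<in> carrier A" "f (\<alpha> e) \<in> carrier B" if "e < q" for e
    using \<alpha> aA that by auto
  \<comment> \<open>The value \<open>\<sigma> k = \<Sum> \<alpha> e y e\<close> moves to
    the other side of the equation as additional terms.\<close>
  define \<beta> where "\<beta> e = \<ominus>\<^bsub>B\<^esub> f (\<alpha> e)" for e
  have \<beta>B: "\<beta> \<in> {..<q} \<rightarrow> carrier B" using \<alpha>A by (auto simp: \<beta>_def)
  have \<rho>k: "(\<lambda>i. \<rho> i k) \<in> {..<n} \<rightarrow> carrier B" and \<mu>k: "(\<lambda>i. \<mu> i k) \<in> {..<n} \<rightarrow> carrier (algebra_module g C)"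
    and yC: "y \<in> {..<q} \<rightarrow> carrier (algebra_module g C)"
    using \<rho>B \<mu>C y by auto
  have s\<alpha>: "lincomb C.M {..<q} \<alpha> y = lincomb (algebra_module g C) {..<q} (\<lambda>e. f (\<alpha> e)) y"
    unfolding lincomb_def algebra_module_derived using \<alpha>A y gf
    by (intro C.f.S.finsum_cong') (auto simp: Pi_iff)
  have f\<alpha>: "(\<lambda>e. f (\<alpha> e)) \<in> {..<q} \<rightarrow> carrier B" using \<alpha>A by auto
  have "lincomb (algebra_module g C) {..<q} (\<lambda>e. f (\<alpha> e)) y \<oplus>\<^bsub>C\<^esub> lincomb (algebra_module g C) {..<q} \<beta> y =
        lincomb (algebra_module g C) {..<q} (\<lambda>e. f (\<alpha> e) \<oplus>\<^bsub>B\<^esub> \<beta> e) y"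
    using mg.lincomb_add_left[OF f\<alpha> \<beta>B yC] by simp
  also have "\<dots> = \<zero>\<^bsub>C\<^esub>"
    unfolding lincomb_def algebra_module_derived using \<alpha>A y
    by (intro C.f.S.add.finprod_one_eqI) (auto simp: \<beta>_def B.f.S.r_neg Pi_iff)
  finally have "lincomb (algebra_module g C) {..<n + q} (cat n (\<lambda>i. \<rho> i k) \<beta>) (cat n (\<lambda>i. \<mu> i k) y) = \<zero>\<^bsub>C\<^esub>"
    using mg.lincomb_cat[OF \<rho>k \<beta>B \<mu>k yC] \<sigma>k[unfolded s\<alpha> \<sigma>_def] by simp
  moreover have "cat n (\<lambda>i. \<rho> i k) \<beta> \<in> {..<n + q} \<rightarrow> carrier B" by (rule cat_Pi[OF \<rho>k \<beta>B])
  moreover have "cat n (\<lambda>i. \<mu> i k) y \<in> {..<n + q} \<rightarrow> carrier C" using cat_Pi[OF \<mu>k yC] by simp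
  ultimately have "trivial_relations B (carrier B) {} (algebra_module g C) (carrier C) {..<n + q} {()}
      (\<lambda>_. cat n (\<lambda>i. \<rho> i k) \<beta>) (cat n (\<lambda>i. \<mu> i k) y)"
    using g_flat unfolding relation_flat_def by simp
  then obtain p :: nat and T w where T: "T \<in> {..<n + q} \<rightarrow> {..<p} \<rightarrow> carrier B" and w: "w \<in> {..<p} \<rightarrow> carrier C"
    and col: "\<And>j. j < p \<Longrightarrow> lincomb (self_module B) {..<n + q} (cat n (\<lambda>i. \<rho> i k) \<beta>) (\<lambda>i. T i j) = \<zero>\<^bsub>B\<^esub>"
    and vec: "\<And>i. i < n + q \<Longrightarrow> cat n (\<lambda>i. \<mu> i k) y i \<ominus>\<^bsub>C\<^esub> lincomb (algebra_module g C) {..<p} (T i) w = \<zero>\<^bsub>C\<^esub>"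
    unfolding trivial_relations_def by auto
  have TB: "T i j \<in> carrier B" if "i < n + q" "j < p" for i j using T that by auto
  have wC: "w j \<in> carrier C" if "j < p" for j using w that by auto
  define T' where "T' i j = B.cls (\<lambda>_. T i j)" for i j
  define w' where "w' j = C.cls (\<lambda>_. w j)" for j
  have T': "T' \<in> {..<n} \<rightarrow> {..<p} \<rightarrow> carrier B.Cpl"
    unfolding T'_def using TB by (auto intro!: B.cls_closed B.cauchy_const)
  have w': "w' \<in> {..<p} \<rightarrow> carrier C.Cpl"
    unfolding w'_def using wC by (auto intro!: C.cls_closed C.cauchy_const)
  have "lincomb (self_module B.Cpl) {..<n} r (\<lambda>i. T' i j) \<in> ideal_span B.Cpl ?E" if j: "j < p" for j
  proof -
    have pB: "B.cauchy (\<lambda>l. \<rho> i l \<otimes>\<^bsub>B\<^esub> T i j)" if "i < n" for i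
      using TB j that by (intro B.cauchy_mult \<rho>(1) B.cauchy_const) auto
    define \<tau> where "\<tau> l = (\<Oplus>\<^bsub>B\<^esub>i\<in>{..<n}. \<rho> i l \<otimes>\<^bsub>B\<^esub> T i j)" for l
    have "lincomb (self_module B.Cpl) {..<n} r (\<lambda>i. T' i j) = (\<Oplus>\<^bsub>B.Cpl\<^esub>i\<in>{..<n}. B.cls (\<lambda>l. \<rho> i l \<otimes>\<^bsub>B\<^esub> T i j))"
      unfolding lincomb_def self_module_simps
    proof (rule P.R.finsum_cong')
      fix i assume i: "i \<in> {..<n}"
      then show "r i \<otimes>\<^bsub>B.Cpl\<^esub> T' i j = B.cls (\<lambda>l. \<rho> i l \<otimes>\<^bsub>B\<^esub> T i j)"
        using \<rho> TB j by (simp add: T'_def B.cls_ops B.cauchy_const)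
    qed (use B.cls_closed[OF pB] in auto)
    also have "\<dots> = B.cls \<tau>"
      using B.finsum_cls[of "{..<n}" "\<lambda>i l. \<rho> i l \<otimes>\<^bsub>B\<^esub> T i j"] pB by (simp add: \<tau>_def[abs_def])
    finally have e: "lincomb (self_module B.Cpl) {..<n} r (\<lambda>i. T' i j) = B.cls \<tau>" .
    have \<tau>: "B.cauchy \<tau>"
      using B.finsum_cls[of "{..<n}" "\<lambda>i l. \<rho> i l \<otimes>\<^bsub>B\<^esub> T i j"] pB by (simp add: \<tau>_def[abs_def])
    have T1: "(\<lambda>i. T i j) \<in> {..<n} \<rightarrow> carrier (self_module B)" "(\<lambda>e. T (n + e) j) \<in> {..<q} \<rightarrow> carrier (self_module B)"
      using TB j by auto
    have "(\<lambda>i. T i j) = cat n (\<lambda>i. T i j) (\<lambda>e. T (n + e) j)" by (auto simp: cat_def)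
    then have "\<tau> k \<oplus>\<^bsub>B\<^esub> lincomb (self_module B) {..<q} \<beta> (\<lambda>e. T (n + e) j) = \<zero>\<^bsub>B\<^esub>"
      using col[OF j] module.lincomb_cat[OF B.f.S.self_is_module \<rho>k \<beta>B T1] by (simp add: \<tau>_def lincomb_def)
    moreover have \<beta>J: "lincomb (self_module B) {..<q} \<beta> (\<lambda>e. T (n + e) j) \<in> B.J k"
    proof -
      have "T (n + e) j \<otimes>\<^bsub>B\<^esub> \<beta> e \<in> B.J k" if e: "e < q" for e
      proof -
        have Te: "T (n + e) j \<in> carrier B" using TB j e by simp
        have "\<alpha> e \<odot>\<^bsub>B.M\<^esub> T (n + e) j \<in> B.D (Suc k)"
          using \<alpha>A[OF e] Te by (intro B.M.scaled_mult B.M.smult_closed) simp_all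
        then have "\<ominus>\<^bsub>B\<^esub> (f (\<alpha> e) \<otimes>\<^bsub>B\<^esub> T (n + e) j) \<in> B.J k" using B.JD(4) unfolding B.J_eq by simp
        then show ?thesis using \<alpha>A[OF e] Te by (simp add: \<beta>_def B.f.S.r_minus B.f.S.l_minus B.f.S.m_comm)
      qed
      then have "lincomb (self_module B) {..<q} (\<lambda>_. \<one>\<^bsub>B\<^esub>) (\<lambda>e. T (n + e) j \<otimes>\<^bsub>B\<^esub> \<beta> e) \<in> B.J k"
        by (intro module.lincomb_in_submodule[OF B.f.S.self_is_module B.J_submodule]) auto
      moreover have "lincomb (self_module B) {..<q} (\<lambda>_. \<one>\<^bsub>B\<^esub>) (\<lambda>e. T (n + e) j \<otimes>\<^bsub>B\<^esub> \<beta> e) =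
          lincomb (self_module B) {..<q} \<beta> (\<lambda>e. T (n + e) j)"
        unfolding lincomb_def self_module_simps using \<beta>B T1(2)
        by (intro B.f.S.finsum_cong') (auto simp: Pi_iff B.f.S.m_comm)
      ultimately show ?thesis by simp
    qed
    ultimately have "\<tau> k = \<ominus>\<^bsub>B\<^esub> lincomb (self_module B) {..<q} \<beta> (\<lambda>e. T (n + e) j)"
      using B.f.S.minus_equality B.cauchy_closed[OF \<tau>] B.JD(3) by metis
    then have "\<tau> k \<in> B.J k" using B.JD(4)[OF \<beta>J] by simp
    then show ?thesis unfolding e scB by (rule B.cls_in_scaled[OF \<tau>])
  qed
  moreover have "m i \<ominus>\<^bsub>P\<^esub> lincomb P {..<p} (T' i) w' \<in> scaled P ?E (carrier C.Cpl)" if i: "i < n" for i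
  proof -
    have gTw: "g (T i j) \<in> carrier C" "w j \<in> carrier C" "T i j \<in> carrier B" if "j < p" for j
      using TB wC i that by auto
    define v where "v = (\<Oplus>\<^bsub>C\<^esub>j\<in>{..<p}. g (T i j) \<otimes>\<^bsub>C\<^esub> w j)"
    have vC: "v \<in> carrier C" unfolding v_def using gTw by (intro C.f.S.finsum_closed) auto
    have "lincomb P {..<p} (T' i) w' = (\<Oplus>\<^bsub>C.Cpl\<^esub>j\<in>{..<p}. C.cls (\<lambda>_. g (T i j) \<otimes>\<^bsub>C\<^esub> w j))"
      unfolding lincomb_def algebra_module_derived
    proof (rule abelian_monoid.finsum_cong'[OF abelian_group.axioms(1)[OF cring.axioms(1)[OF C.Cpl_cring, THEN ring.is_abelian_group]]])
      fix j assume "j \<in> {..<p}"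
      then have j: "j < p" by simp
      show "T' i j \<odot>\<^bsub>P\<^esub> w' j = C.cls (\<lambda>_. g (T i j) \<otimes>\<^bsub>C\<^esub> w j)"
        using gTw[OF j] by (simp add: T'_def w'_def cm_cls B.cauchy_const C.cauchy_const C.cls_ops)
    qed (use gTw in \<open>auto intro!: C.cls_closed C.cauchy_const\<close>)
    also have "\<dots> = C.cls (\<lambda>_. v)"
      using C.finsum_cls[of "{..<p}" "\<lambda>j _. g (T i j) \<otimes>\<^bsub>C\<^esub> w j"] gTw C.cauchy_const by (simp add: v_def)
    finally have e: "m i \<ominus>\<^bsub>P\<^esub> lincomb P {..<p} (T' i) w' = C.cls (\<lambda>l. \<mu> i l \<ominus>\<^bsub>C\<^esub> v)"
      using C.cls_minus(2)[OF \<mu>(1)[OF i] C.cauchy_const[OF vC]] \<mu>(2)[OF i] by simp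
    have "\<mu> i k \<ominus>\<^bsub>C\<^esub> v = \<zero>\<^bsub>C\<^esub>" using vec[of i] i by (simp add: v_def lincomb_def)
    then have "\<mu> i k \<ominus>\<^bsub>C\<^esub> v \<in> C.J k" using C.JD(2) by simp
    then show ?thesis
      unfolding e scP by (rule C.cls_in_scaled[OF C.cls_minus(1)[OF \<mu>(1)[OF i] C.cauchy_const[OF vC]]])
  qed
  ultimately show "trivial_relations B.Cpl (carrier B.Cpl) ?E P (carrier C.Cpl) {..<n} {()} (\<lambda>_. r) m"
    unfolding trivial_relations_def using T' w'
    by (intro exI[of _ p] exI[of _ T'] exI[of _ w']) auto
qed

text \<open>
  Finitely many torsion elements are killed by one common power of the completed ideal, hence by
  the image of a power of \<open>\<aa>\<close>, and \<open>C'\<close> is flat modulo that power.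
\<close>

theorem completion_adically_flat:
  "adically_flat TYPE('n) B.Cpl (Idl\<^bsub>B.Cpl\<^esub> (to_completion B B.\<bb> ` B.\<bb>)) P"
  unfolding adically_flat_def
proof (intro conjI allI impI)
  show "module B.Cpl P" by (rule P.module_axioms)
  let ?b = "Idl\<^bsub>B.Cpl\<^esub> (to_completion B B.\<bb> ` B.\<bb>)"
  fix N :: "(nat \<Rightarrow> 'c set, 'n) module" and i :: nat
  assume N: "torsion_module B.Cpl ?b N" and i: "0 < i"
  interpret t: ring_hom_cring B B.Cpl "to_completion B B.\<bb>" by (rule B.to_completion_hom)
  have bb: "to_completion B B.\<bb> ` B.\<bb> \<subseteq> carrier B.Cpl"
    using ideal.Icarr[OF B.\<bb>_ideal] by auto
  have b: "ideal ?b B.Cpl" by (rule P.R.genideal_ideal[OF bb])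
  have "f ` \<aa> \<subseteq> B.\<bb>" using ideal.Icarr[OF B.a] by (intro B.f.S.genideal_self) auto
  then have \<phi>a: "\<phi> ` \<aa> \<subseteq> ?b" using P.R.genideal_self[OF bb] by auto
  note co = A0_coefficients
  interpret fr: flat_resolution B.Cpl P "\<phi> ` carrier A"
    unfolding flat_resolution_def resolution_def flat_resolution_axioms_def
    using P.module_axioms co P_flat self_flat by simp
  show "carrier (Tor B.Cpl i P N) = {\<zero>\<^bsub>Tor B.Cpl i P N\<^esub>}"
  proof (rule fr.Tor_vanishes[OF _ _ i])
    show "module B.Cpl N" using N by (simp add: torsion_module_def)
    fix W assume W: "finite W" "W \<subseteq> carrier N"
    have "\<forall>y\<in>W. \<exists>j::nat. \<forall>r\<in>?b [^]\<^bsub>ideals_set B.Cpl\<^esub> j. r \<odot>\<^bsub>N\<^esub> y = \<zero>\<^bsub>N\<^esub>"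
    proof
      fix y assume "y \<in> W"
      with W(2) have "y \<in> carrier N" by (rule subsetD)
      from bspec[OF N[unfolded torsion_module_def, THEN conjunct2] this]
      show "\<exists>j::nat. \<forall>r\<in>?b [^]\<^bsub>ideals_set B.Cpl\<^esub> j. r \<odot>\<^bsub>N\<^esub> y = \<zero>\<^bsub>N\<^esub>"
        by (elim exE conjE) (rule exI, assumption)
    qed
    then obtain j :: "'n \<Rightarrow> nat" where j: "\<And>y r. y \<in> W \<Longrightarrow> r \<in> ?b [^]\<^bsub>ideals_set B.Cpl\<^esub> j y \<Longrightarrow> r \<odot>\<^bsub>N\<^esub> y = \<zero>\<^bsub>N\<^esub>"
      by metis
    \<comment> \<open>The sum of the exponents bounds each of them, and is defined also for
      empty \<open>W\<close>.\<close>
    define k where "k = (\<Sum>y\<in>W. j y)"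
    let ?E = "\<phi> ` B.ideal_power \<aa> (Suc k)"
    have "e \<odot>\<^bsub>N\<^esub> y = \<zero>\<^bsub>N\<^esub>" if e: "e \<in> ?E" and y: "y \<in> W" for e y
    proof (rule j[OF y])
      have "j y \<le> Suc k" unfolding k_def using member_le_sum[OF y, of j] W(1) by simp
      then show "e \<in> ?b [^]\<^bsub>ideals_set B.Cpl\<^esub> j y"
        using image_ideal_power[OF B.\<phi>_hom B.a b \<phi>a, of "Suc k"] P.R.ideal_power_antimono[OF b, of "j y" "Suc k"] e
        by blast
    qed
    moreover have "?E \<subseteq> \<phi> ` carrier A" using B.ideal_power_sub[OF B.a] by (rule image_mono)
    moreover have "relation_flat B.Cpl (carrier B.Cpl) ?E P (carrier P)"
      using P_flat_mod_power by simp
    ultimately show "\<exists>E\<subseteq>\<phi> ` carrier A. (\<forall>e\<in>E. \<forall>y\<in>W. e \<odot>\<^bsub>N\<^esub> y = \<zero>\<^bsub>N\<^esub>) \<and>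
        relation_flat B.Cpl (carrier B.Cpl) E P (carrier P)"
      by (intro exI[of _ ?E]) blast
  qed
qed

end

theorem corollary0p10:
  fixes A :: "('a, 'x) ring_scheme" and B :: "('b, 'y) ring_scheme" and C :: "('c, 'z) ring_scheme"
    and f :: "'a \<Rightarrow> 'b" and g :: "'b \<Rightarrow> 'c"
    and \<aa> :: "'a set" and \<bb> :: "'b set" and \<cc> :: "'c set"
    and B' :: "(nat \<Rightarrow> 'b set) ring" and C' :: "(nat \<Rightarrow> 'c set) ring"
    and \<bb>' :: "(nat \<Rightarrow> 'b set) set"
  assumes "cring A" "cring B" "cring C" "noetherian_ring A"
    and "flat_hom A B f" "flat_hom B C g"
    and "ideal \<aa> A"
    and "\<bb> = Idl\<^bsub>B\<^esub> (f ` \<aa>)" "\<cc> = Idl\<^bsub>C\<^esub> ((g \<circ> f) ` \<aa>)"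
    and "B' = adic_completion B \<bb>" "C' = adic_completion C \<cc>"
    and "\<bb>' = Idl\<^bsub>B'\<^esub> (to_completion B \<bb> ` \<bb>)"
  shows "adically_flat TYPE('n) B' \<bb>' (algebra_module (completion_map C \<cc> g) C')"
proof -
  have f: "ring_hom_cring A B f" and g: "ring_hom_cring B C g"
    and Bf: "relation_flat A (carrier A) {} (algebra_module f B) (carrier B)"
    and Cf: "relation_flat B (carrier B) {} (algebra_module g C) (carrier C)"
    using assms(5,6) relation_flat_of_flat[of A "algebra_module f B"] relation_flat_of_flat[of B "algebra_module g C"]
    by (auto simp: flat_hom_def)
  have A: "noetherian_cring A" using assms(1,4) by (simp add: noetherian_cring_def)
  have gf: "ring_hom_cring A C (g \<circ> f)"
    using ring_hom_trans[OF ring_hom_cring.homh[OF f] ring_hom_cring.homh[OF g]] assms(1,3)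
    by (simp add: ring_hom_cring_def ring_hom_cring_axioms_def)
  have "completed_flat_algebra A B f \<aa>"
    using A f assms(7) Bf by (simp add: completed_flat_algebra_def completed_flat_algebra_axioms_def)
  moreover have "completed_flat_algebra A C (g \<circ> f) \<aa>"
    using A gf assms(7) relation_flat_trans[OF f g Bf Cf]
    by (simp add: completed_flat_algebra_def completed_flat_algebra_axioms_def)
  ultimately have "completed_tower A B f C (g \<circ> f) \<aa> g"
    using g Cf by (simp add: completed_tower_def completed_tower_axioms_def)
  from completed_tower.completion_adically_flat[OF this]
  show ?thesis unfolding assms(8-12) .
qed

end
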